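(* Let $n,r,d\in\mathbb{Z}_{\geq 1}$, let $\mathbb{K}$ be an algebraically closed field of characteristic $p\geq 0$ such that $p$ does not divide $r$, and let $v_1,\ldots,v_d\in\mathbb{K}$. The degenerate cyclotomic Yokonuma-Hecke algebra $Y_{r,n}^{d}$ is split semisimple if and only if for all $\mu\in\mathcal{C}_{r,n}$ the algebra $H^{\mu}$ is split semisimple, and this happens if and only if $$n!\prod_{1\leq i<j\leq d}\ \prod_{-n<l<n}(l+v_i-v_j)\neq 0\quad\text{in }\mathbb{K}.$$
   Context: **Degenerate cyclotomic Hecke algebra.** For $m\geq 1$, $\widehat{H}_{m}$ is the associative unital $\mathbb{K}$-algebra generated by $\bar{x}_1,\ldots,\bar{x}_m,\bar{s}_1,\ldots,\bar{s}_{m-1}$ with relations $\bar{s}_i^2=1$; $\bar{s}_i\bar{s}_{i+1}\bar{s}_i=\bar{s}_{i+1}\bar{s}_i\bar{s}_{i+1}$; $\bar{s}_i\bar{s}_j=\bar{s}_j\bar{s}_i$ if $|i-j|>1$; $\bar{x}_i\bar{x}_j=\bar{x}_j\bar{x}_i$; $\bar{s}_i\bar{x}_{i+1}=\bar{x}_i\bar{s}_i+1$; $\bar{s}_i\bar{x}_j=\bar{x}_j\bar{s}_i$ if $j\neq i,i+1$. Put $H_m^d=\widehat{H}_m/\langle(\bar{x}_1-v_1)\cdots(\bar{x}_1-v_d)\rangle$ for $m\geq1$ and $H_0^d=\mathbb{K}$. **Degenerate cyclotomic Yokonuma-Hecke algebra.** $\widehat{Y}_{r,n}$ is the associative unital $\mathbb{K}$-algebra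 generated by $t_1,\ldots,t_n,f_1,\ldots,f_{n-1},x_1,\ldots,x_n$ with relations: $f_if_j=f_jf_i$ if $|i-j|\geq 2$; $f_if_{i+1}f_i=f_{i+1}f_if_{i+1}$; $t_it_j=t_jt_i$; $f_it_j=t_{s_i(j)}f_i$; $t_i^r=1$; $f_i^2=1$; $x_ix_j=x_jx_i$; $f_ix_{i+1}=x_if_i+e_i$; $f_ix_j=x_jf_i$ for $j\neq i,i+1$; $t_jx_i=x_it_j$ for all $i,j$; where $s_i=(i,i+1)$ and $e_i=\frac1r\sum_{s=0}^{r-1}t_i^st_{i+1}^{-s}$. Put $Y_{r,n}^d=\widehat{Y}_{r,n}/\langle(x_1-v_1)\cdots(x_1-v_d)\rangle$ (quotient by the two-sided ideal). **Compositions.** $\mathcal{C}_{r,n}$ is the set of $\mu=(\mu_1,\ldots,\mu_r)\in\mathbb{Z}_{\geq0}^r$ with $\sum_a\mu_a=n$, and $H^\mu=H_{\mu_1}^d\otimes\cdots\otimes H_{\mu_r}^d$ (tensor products over $\mathbb{K}$, all factors with the same parameters $v_1,\ldots,v_d$). The index $l$ runs over integers, viewed in $\mathbb{K}$. *)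

theory Defs
  imports
    "HOL-Algebra.Algebra"
    "HOL-Combinatorics.Transposition"
    "HOL-Computational_Algebra.Polynomial"
    "HOL-Library.Poly_Mapping"
    "Jordan_Normal_Form.Matrix"
begin

section \<open>Associative unital algebras over a field\<close>

text \<open>
  The record \<^typ>\<open>('k, 'a) module\<close> has all operations of a \<open>'k\<close>-algebra; the locale \<open>algebra\<close> of
  HOL-Algebra is restricted to commutative algebras.
\<close>

locale assoc_algebra = ring A
  for A :: "('k::field, 'a) module" (structure) +
  assumes smult_closed: "x \<in> carrier A \<Longrightarrow> c \<odot> x \<in> carrier A"
    and smult_l_distr: "x \<in> carrier A \<Longrightarrow> (b + c) \<odot> x = b \<odot> x \<oplus> c \<odot> x"
    and smult_r_distr:
      "x \<in> carrier A \<Longrightarrow> y \<in> carrier A \<Longrightarrow> c \<odot> (x \<oplus> y) = c \<odot> x \<oplus> c \<odot> y"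
    and smult_assoc: "x \<in> carrier A \<Longrightarrow> (b * c) \<odot> x = b \<odot> (c \<odot> x)"
    and smult_one: "x \<in> carrier A \<Longrightarrow> 1 \<odot> x = x"
    and smult_mult_l:
      "x \<in> carrier A \<Longrightarrow> y \<in> carrier A \<Longrightarrow> (c \<odot> x) \<otimes> y = c \<odot> (x \<otimes> y)"
    and smult_mult_r:
      "x \<in> carrier A \<Longrightarrow> y \<in> carrier A \<Longrightarrow> x \<otimes> (c \<odot> y) = c \<odot> (x \<otimes> y)"

definition algebra_iso ::
    "('k::field, 'a) module \<Rightarrow> ('k, 'b) module \<Rightarrow> ('a \<Rightarrow> 'b) set" where
  "algebra_iso A B =
    {h \<in> ring_iso A B. \<forall>c. \<forall>x \<in> carrier A. h (c \<odot>\<^bsub>A\<^esub> x) = c \<odot>\<^bsub>B\<^esub> h x}"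

definition product_algebra ::
    "'i set \<Rightarrow> ('i \<Rightarrow> ('k::field, 'a) module) \<Rightarrow> ('k, 'i \<Rightarrow> 'a) module" where
  "product_algebra I A = \<lparr>
    carrier = (\<Pi>\<^sub>E i\<in>I. carrier (A i)),
    monoid.mult = (\<lambda>x y. \<lambda>i\<in>I. x i \<otimes>\<^bsub>A i\<^esub> y i),
    monoid.one = (\<lambda>i\<in>I. \<one>\<^bsub>A i\<^esub>),
    ring.zero = (\<lambda>i\<in>I. \<zero>\<^bsub>A i\<^esub>),
    ring.add = (\<lambda>x y. \<lambda>i\<in>I. x i \<oplus>\<^bsub>A i\<^esub> y i),
    module.smult = (\<lambda>c x. \<lambda>i\<in>I. c \<odot>\<^bsub>A i\<^esub> x i)\<rparr>"

text \<open>Split semisimple: isomorphic to a finite direct sum of full matrix algebras over the base field.\<close>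

definition split_semisimple :: "('k::field, 'a) module \<Rightarrow> bool" where
  "split_semisimple A \<longleftrightarrow>
    (\<exists>(k::nat) (N::nat \<Rightarrow> nat). (\<forall>i<k. 0 < N i) \<and>
      algebra_iso A (product_algebra {..<k} (\<lambda>i. module_mat TYPE('k) (N i) (N i))) \<noteq> {})"

text \<open>The quotient ring \<^term>\<open>A Quot I\<close> with its scalar multiplication.\<close>

definition quotient_algebra ::
    "('k::field, 'a) module \<Rightarrow> 'a set \<Rightarrow> ('k, 'a set) module" where
  "quotient_algebra A I = \<lparr>
    carrier = carrier (A Quot I),
    monoid.mult = monoid.mult (A Quot I),
    monoid.one = monoid.one (A Quot I),
    ring.zero = ring.zero (A Quot I),
    ring.add = ring.add (A Quot I),
    module.smult = (\<lambda>c C. \<Union>x\<in>C. I +>\<^bsub>A\<^esub> (c \<odot>\<^bsub>A\<^esub> x))\<rparr>"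

text \<open>The two-sided ideal generated by the differences of a set of relations, given as pairs.\<close>

definition relation_ideal :: "('k::field, 'a) module \<Rightarrow> ('a \<times> 'a) set \<Rightarrow> 'a set" where
  "relation_ideal A R = Idl\<^bsub>A\<^esub> ((\<lambda>(a, b). a \<ominus>\<^bsub>A\<^esub> b) ` R)"

text \<open>The algebra with basis \<^term>\<open>carrier G\<close> whose product extends that of the monoid \<open>G\<close> bilinearly.\<close>

definition monoid_algebra ::
    "('g, 'b) monoid_scheme \<Rightarrow> ('k::field, 'g \<Rightarrow>\<^sub>0 'k) module" where
  "monoid_algebra G = \<lparr>
    carrier = {p. Poly_Mapping.keys p \<subseteq> carrier G},
    monoid.mult = (\<lambda>p q. \<Sum>x\<in>Poly_Mapping.keys p. \<Sum>y\<in>Poly_Mapping.keys q.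
      Poly_Mapping.single (x \<otimes>\<^bsub>G\<^esub> y) (Poly_Mapping.lookup p x * Poly_Mapping.lookup q y)),
    monoid.one = Poly_Mapping.single \<one>\<^bsub>G\<^esub> 1,
    ring.zero = 0,
    ring.add = (+),
    module.smult = (\<lambda>c. Poly_Mapping.map ((*) c))\<rparr>"


section \<open>Presentations by generators and relations\<close>

definition free_algebra :: "'g set \<Rightarrow> ('k::field, 'g list \<Rightarrow>\<^sub>0 'k) module" where
  "free_algebra S = monoid_algebra \<lparr>carrier = lists S, monoid.mult = (@), monoid.one = []\<rparr>"

definition free_gen :: "'g \<Rightarrow> ('g list \<Rightarrow>\<^sub>0 'k::field)" where
  "free_gen g = Poly_Mapping.single [g] 1"

definition presented_algebra ::
    "'g set \<Rightarrow> (('g list \<Rightarrow>\<^sub>0 'k::field) \<times> ('g list \<Rightarrow>\<^sub>0 'k)) set \<Rightarrow>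
      ('k, ('g list \<Rightarrow>\<^sub>0 'k) set) module" where
  "presented_algebra S R =
    quotient_algebra (free_algebra S) (relation_ideal (free_algebra S) R)"

definition presented_gen ::
    "'g set \<Rightarrow> (('g list \<Rightarrow>\<^sub>0 'k::field) \<times> ('g list \<Rightarrow>\<^sub>0 'k)) set \<Rightarrow>
      'g \<Rightarrow> ('g list \<Rightarrow>\<^sub>0 'k) set" where
  "presented_gen S R g = relation_ideal (free_algebra S) R +>\<^bsub>free_algebra S\<^esub> free_gen g"

text \<open>\<open>(a - v\<^sub>1) \<cdots> (a - v\<^sub>d)\<close>\<close>

definition cyclotomic_element ::
    "('k::field, 'a) module \<Rightarrow> nat \<Rightarrow> (nat \<Rightarrow> 'k) \<Rightarrow> 'a \<Rightarrow> 'a" where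
  "cyclotomic_element A d v a =
    foldr (\<lambda>i b. (a \<ominus>\<^bsub>A\<^esub> v i \<odot>\<^bsub>A\<^esub> \<one>\<^bsub>A\<^esub>) \<otimes>\<^bsub>A\<^esub> b) [1..<Suc d] \<one>\<^bsub>A\<^esub>"


section \<open>Tensor products of algebras\<close>

text \<open>
  The tensor product over the base field is the space on the basis \<open>\<Prod>\<^sub>i A\<^sub>i\<close> modulo the
  multilinearity relations, with componentwise multiplication of pure tensors. The span of these
  relations is stable under multiplication by tuples (on either side), so it equals the two-sided
  ideal that they generate in the monoid algebra of the multiplicative monoid \<open>\<Prod>\<^sub>i A\<^sub>i\<close>.
\<close>

definition multilinear_relations ::
    "'i set \<Rightarrow> ('i \<Rightarrow> ('k::field, 'a) module) \<Rightarrow>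
      ((('i \<Rightarrow> 'a) \<Rightarrow>\<^sub>0 'k) \<times> (('i \<Rightarrow> 'a) \<Rightarrow>\<^sub>0 'k)) set" where
  "multilinear_relations I A =
    {(Poly_Mapping.single (u(i := a \<oplus>\<^bsub>A i\<^esub> b)) 1,
      Poly_Mapping.single (u(i := a)) 1 + Poly_Mapping.single (u(i := b)) 1) | u i a b.
      u \<in> (\<Pi>\<^sub>E j\<in>I. carrier (A j)) \<and> i \<in> I \<and> a \<in> carrier (A i) \<and> b \<in> carrier (A i)} \<union>
    {(Poly_Mapping.single (u(i := c \<odot>\<^bsub>A i\<^esub> a)) 1, Poly_Mapping.single (u(i := a)) c) | u i a c.
      u \<in> (\<Pi>\<^sub>E j\<in>I. carrier (A j)) \<and> i \<in> I \<and> a \<in> carrier (A i)}"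

definition tensor_algebra ::
    "'i set \<Rightarrow> ('i \<Rightarrow> ('k::field, 'a) module) \<Rightarrow> ('k, (('i \<Rightarrow> 'a) \<Rightarrow>\<^sub>0 'k) set) module" where
  "tensor_algebra I A =
    quotient_algebra (monoid_algebra (product_group I A))
      (relation_ideal (monoid_algebra (product_group I A)) (multilinear_relations I A))"


section \<open>Degenerate cyclotomic Hecke algebras\<close>

datatype hecke_gen = HX nat | HS nat

definition hecke_gens :: "nat \<Rightarrow> hecke_gen set" where
  "hecke_gens m = HX ` {1..m} \<union> HS ` {1..<m}"

definition hecke_relations ::
    "('k::field, 'a) module \<Rightarrow> nat \<Rightarrow> (nat \<Rightarrow> 'a) \<Rightarrow> (nat \<Rightarrow> 'a) \<Rightarrow> ('a \<times> 'a) set" where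
  "hecke_relations A m x s =
    {(s i \<otimes> s i, \<one>) | i. i \<in> {1..<m}} \<union>
    {(s i \<otimes> s (i + 1) \<otimes> s i, s (i + 1) \<otimes> s i \<otimes> s (i + 1)) | i.
      i \<in> {1..<m} \<and> i + 1 \<in> {1..<m}} \<union>
    {(s i \<otimes> s j, s j \<otimes> s i) | i j.
      i \<in> {1..<m} \<and> j \<in> {1..<m} \<and> \<bar>int i - int j\<bar> > 1} \<union>
    {(x i \<otimes> x j, x j \<otimes> x i) | i j. i \<in> {1..m} \<and> j \<in> {1..m}} \<union>
    {(s i \<otimes> x (i + 1), x i \<otimes> s i \<oplus> \<one>) | i. i \<in> {1..<m}} \<union>
    {(s i \<otimes> x j, x j \<otimes> s i) | i j.
      i \<in> {1..<m} \<and> j \<in> {1..m} \<and> j \<noteq> i \<and> j \<noteq> i + 1}"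
  for A (structure)

definition affine_hecke_relations ::
    "nat \<Rightarrow> ((hecke_gen list \<Rightarrow>\<^sub>0 'k::field) \<times> (hecke_gen list \<Rightarrow>\<^sub>0 'k)) set" where
  "affine_hecke_relations m =
    hecke_relations (free_algebra (hecke_gens m)) m (\<lambda>i. free_gen (HX i)) (\<lambda>i. free_gen (HS i))"

definition affine_hecke :: "nat \<Rightarrow> ('k::field, (hecke_gen list \<Rightarrow>\<^sub>0 'k) set) module" where
  "affine_hecke m = presented_algebra (hecke_gens m) (affine_hecke_relations m)"

definition affine_hecke_x :: "nat \<Rightarrow> nat \<Rightarrow> (hecke_gen list \<Rightarrow>\<^sub>0 'k::field) set" where
  "affine_hecke_x m i = presented_gen (hecke_gens m) (affine_hecke_relations m) (HX i)"

text \<open>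
  For \<open>m = 0\<close> there are neither generators nor relations, so \<^term>\<open>affine_hecke 0\<close>, and hence
  \<^term>\<open>cyclotomic_hecke d v 0\<close>, is a copy of the base field.
\<close>

definition cyclotomic_hecke ::
    "nat \<Rightarrow> (nat \<Rightarrow> 'k::field) \<Rightarrow> nat \<Rightarrow> ('k, (hecke_gen list \<Rightarrow>\<^sub>0 'k) set set) module" where
  "cyclotomic_hecke d v m =
    quotient_algebra (affine_hecke m)
      (Idl\<^bsub>affine_hecke m\<^esub>
        (if m = 0 then {} else {cyclotomic_element (affine_hecke m) d v (affine_hecke_x m 1)}))"

definition compositions :: "nat \<Rightarrow> nat \<Rightarrow> nat list set" where
  "compositions r n = {\<mu>. length \<mu> = r \<and> sum_list \<mu> = n}"

definition cyclotomic_hecke_tensor ::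
    "nat \<Rightarrow> (nat \<Rightarrow> 'k::field) \<Rightarrow> nat list \<Rightarrow>
      ('k, ((nat \<Rightarrow> (hecke_gen list \<Rightarrow>\<^sub>0 'k) set set) \<Rightarrow>\<^sub>0 'k) set) module" where
  "cyclotomic_hecke_tensor d v \<mu> =
    tensor_algebra {..<length \<mu>} (\<lambda>a. cyclotomic_hecke d v (\<mu> ! a))"


section \<open>Degenerate cyclotomic Yokonuma-Hecke algebras\<close>

datatype yh_gen = YT nat | YF nat | YX nat

definition yh_gens :: "nat \<Rightarrow> yh_gen set" where
  "yh_gens n = YT ` {1..n} \<union> YF ` {1..<n} \<union> YX ` {1..n}"

text \<open>As \<open>t\<^sub>j\<close> is invertible only modulo \<open>t\<^sub>j\<^sup>r = 1\<close>, the power \<open>t\<^sub>j\<^sup>-\<^sup>k\<close> is written \<open>t\<^sub>j\<^sup>r\<^sup>-\<^sup>k\<close>.\<close>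

definition yh_e ::
    "('k::field, 'a) module \<Rightarrow> nat \<Rightarrow> (nat \<Rightarrow> 'a) \<Rightarrow> nat \<Rightarrow> 'a" where
  "yh_e A r t i =
    (1 / of_nat r) \<odot> (\<Oplus>k\<in>{..<r}. t i [^] k \<otimes> t (i + 1) [^] (r - k))"
  for A (structure)

definition yh_relations ::
    "('k::field, 'a) module \<Rightarrow> nat \<Rightarrow> nat \<Rightarrow>
      (nat \<Rightarrow> 'a) \<Rightarrow> (nat \<Rightarrow> 'a) \<Rightarrow> (nat \<Rightarrow> 'a) \<Rightarrow> ('a \<times> 'a) set" where
  "yh_relations A r n t f x =
    {(f i \<otimes> f j, f j \<otimes> f i) | i j.
      i \<in> {1..<n} \<and> j \<in> {1..<n} \<and> \<bar>int i - int j\<bar> \<ge> 2} \<union>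
    {(f i \<otimes> f (i + 1) \<otimes> f i, f (i + 1) \<otimes> f i \<otimes> f (i + 1)) | i.
      i \<in> {1..<n} \<and> i + 1 \<in> {1..<n}} \<union>
    {(t i \<otimes> t j, t j \<otimes> t i) | i j. i \<in> {1..n} \<and> j \<in> {1..n}} \<union>
    {(f i \<otimes> t j, t (Transposition.transpose i (i + 1) j) \<otimes> f i) | i j.
      i \<in> {1..<n} \<and> j \<in> {1..n}} \<union>
    {(t i [^] r, \<one>) | i. i \<in> {1..n}} \<union>
    {(f i \<otimes> f i, \<one>) | i. i \<in> {1..<n}} \<union>
    {(x i \<otimes> x j, x j \<otimes> x i) | i j. i \<in> {1..n} \<and> j \<in> {1..n}} \<union>
    {(f i \<otimes> x (i + 1), x i \<otimes> f i \<oplus> yh_e A r t i) | i. i \<in> {1..<n}} \<union>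
    {(f i \<otimes> x j, x j \<otimes> f i) | i j.
      i \<in> {1..<n} \<and> j \<in> {1..n} \<and> j \<noteq> i \<and> j \<noteq> i + 1} \<union>
    {(t j \<otimes> x i, x i \<otimes> t j) | i j. i \<in> {1..n} \<and> j \<in> {1..n}}"
  for A (structure)

definition affine_yh_relations ::
    "nat \<Rightarrow> nat \<Rightarrow> ((yh_gen list \<Rightarrow>\<^sub>0 'k::field) \<times> (yh_gen list \<Rightarrow>\<^sub>0 'k)) set" where
  "affine_yh_relations r n =
    yh_relations (free_algebra (yh_gens n)) r n
      (\<lambda>i. free_gen (YT i)) (\<lambda>i. free_gen (YF i)) (\<lambda>i. free_gen (YX i))"

definition affine_yh :: "nat \<Rightarrow> nat \<Rightarrow> ('k::field, (yh_gen list \<Rightarrow>\<^sub>0 'k) set) module" where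
  "affine_yh r n = presented_algebra (yh_gens n) (affine_yh_relations r n)"

definition affine_yh_x :: "nat \<Rightarrow> nat \<Rightarrow> nat \<Rightarrow> (yh_gen list \<Rightarrow>\<^sub>0 'k::field) set" where
  "affine_yh_x r n i = presented_gen (yh_gens n) (affine_yh_relations r n) (YX i)"

definition cyclotomic_yh ::
    "nat \<Rightarrow> nat \<Rightarrow> nat \<Rightarrow> (nat \<Rightarrow> 'k::field) \<Rightarrow>
      ('k, (yh_gen list \<Rightarrow>\<^sub>0 'k) set set) module" where
  "cyclotomic_yh r n d v =
    quotient_algebra (affine_yh r n)
      (Idl\<^bsub>affine_yh r n\<^esub> {cyclotomic_element (affine_yh r n) d v (affine_yh_x r n 1)})"


section \<open>Well-definedness\<close>

text \<open>
  The constructions yield associative unital algebras; in particular every relation lies in the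
  carrier, so that the generated ideals are genuine two-sided ideals.
\<close>

lemma monoid_algebra_simps [simp]:
  "carrier (monoid_algebra G) = {p. Poly_Mapping.keys p \<subseteq> carrier G}"
  "\<one>\<^bsub>monoid_algebra G\<^esub> = Poly_Mapping.single \<one>\<^bsub>G\<^esub> 1"
  "\<zero>\<^bsub>monoid_algebra G\<^esub> = 0"
  "add (monoid_algebra G) = (+)"
  "module.smult (monoid_algebra G) c = Poly_Mapping.map ((*) c)"
  by (simp_all add: monoid_algebra_def)

lemma monoid_algebra_mult_superset:
  assumes "finite S" "finite T" "Poly_Mapping.keys p \<subseteq> S" "Poly_Mapping.keys q \<subseteq> T"
  shows "p \<otimes>\<^bsub>monoid_algebra G\<^esub> q = (\<Sum>x\<in>S. \<Sum>y\<in>T.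
      Poly_Mapping.single (x \<otimes>\<^bsub>G\<^esub> y) (Poly_Mapping.lookup p x * Poly_Mapping.lookup q y))"
proof -
  have "p \<otimes>\<^bsub>monoid_algebra G\<^esub> q =
      (\<Sum>x\<in>Poly_Mapping.keys p. \<Sum>y\<in>T.
        Poly_Mapping.single (x \<otimes>\<^bsub>G\<^esub> y) (Poly_Mapping.lookup p x * Poly_Mapping.lookup q y))"
    unfolding monoid_algebra_def using assms
    by (simp, intro sum.cong refl sum.mono_neutral_left) (auto simp: in_keys_iff)
  also have "\<dots> = (\<Sum>x\<in>S. \<Sum>y\<in>T.
        Poly_Mapping.single (x \<otimes>\<^bsub>G\<^esub> y) (Poly_Mapping.lookup p x * Poly_Mapping.lookup q y))"
    using assms by (intro sum.mono_neutral_left) (auto simp: in_keys_iff)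
  finally show ?thesis .
qed

lemma monoid_algebra_mult_single [simp]:
  "Poly_Mapping.single x a \<otimes>\<^bsub>monoid_algebra G\<^esub> Poly_Mapping.single y b =
    Poly_Mapping.single (x \<otimes>\<^bsub>G\<^esub> y) (a * b)"
  by (subst monoid_algebra_mult_superset[of "{x}" "{y}"]) auto

lemma monoid_algebra_distrib:
  "(p + q) \<otimes>\<^bsub>monoid_algebra G\<^esub> s = p \<otimes>\<^bsub>monoid_algebra G\<^esub> s + q \<otimes>\<^bsub>monoid_algebra G\<^esub> s" (is ?l)
  "s \<otimes>\<^bsub>monoid_algebra G\<^esub> (p + q) = s \<otimes>\<^bsub>monoid_algebra G\<^esub> p + s \<otimes>\<^bsub>monoid_algebra G\<^esub> q" (is ?r)
proof -
  let ?K = "Poly_Mapping.keys p \<union> Poly_Mapping.keys q" and ?S = "Poly_Mapping.keys s"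
  have K: "Poly_Mapping.keys (p + q) \<subseteq> ?K" by (rule keys_add)
  show ?l
    using K by (simp add: monoid_algebra_mult_superset[of ?K ?S]
      lookup_add distrib_right single_add sum.distrib)
  show ?r
    using K by (simp add: monoid_algebra_mult_superset[of ?S ?K]
      lookup_add distrib_left single_add sum.distrib)
qed

lemma monoid_algebra_mult_zero:
  "0 \<otimes>\<^bsub>monoid_algebra G\<^esub> p = 0" "p \<otimes>\<^bsub>monoid_algebra G\<^esub> 0 = 0"
  by (simp_all add: monoid_algebra_def)

lemma poly_mapping_single_induct [case_names zero plus]:
  fixes p :: "'a \<Rightarrow>\<^sub>0 'b::ab_group_add"
  assumes "Q 0"
    and "\<And>x c p'. x \<in> Poly_Mapping.keys p \<Longrightarrow> Q p' \<Longrightarrow> Q (Poly_Mapping.single x c + p')"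
  shows "Q p"
proof -
  have sum: "(\<Sum>x\<in>Poly_Mapping.keys p. Poly_Mapping.single x (Poly_Mapping.lookup p x)) = p"
    by (rule poly_mapping_eqI)
       (auto simp: lookup_sum lookup_single when_def in_keys_iff sum.delta)
  have "Q (\<Sum>x\<in>K. Poly_Mapping.single x (Poly_Mapping.lookup p x))"
    if "finite K" "K \<subseteq> Poly_Mapping.keys p" for K
    using that by (induction K) (auto intro: assms)
  from this[of "Poly_Mapping.keys p"] show ?thesis
    by (simp add: sum)
qed

lemma lookup_map_mult:
  "Poly_Mapping.lookup (Poly_Mapping.map ((*) c) p) x = c * Poly_Mapping.lookup p x"
  for c :: "'k::field"
  by (simp add: Poly_Mapping.map.rep_eq when_def)

lemma smult_monoid_algebra:
  fixes p :: "'a \<Rightarrow>\<^sub>0 'k::field"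
  shows "Poly_Mapping.map ((*) c) (p + q) = Poly_Mapping.map ((*) c) p + Poly_Mapping.map ((*) c) q"
    "Poly_Mapping.map ((*) (b + c)) p = Poly_Mapping.map ((*) b) p + Poly_Mapping.map ((*) c) p"
    "Poly_Mapping.map ((*) (b * c)) p = Poly_Mapping.map ((*) b) (Poly_Mapping.map ((*) c) p)"
    "Poly_Mapping.map ((*) 1) p = p"
    "Poly_Mapping.map ((*) c) 0 = (0 :: 'a \<Rightarrow>\<^sub>0 'k)"
    "Poly_Mapping.keys (Poly_Mapping.map ((*) c) p) \<subseteq> Poly_Mapping.keys p"
  by (auto intro!: poly_mapping_eqI simp: lookup_map_mult lookup_add algebra_simps in_keys_iff)

lemma assoc_algebra_monoid_algebra:
  assumes "monoid G"
  shows "assoc_algebra (monoid_algebra G :: ('k::field, 'g \<Rightarrow>\<^sub>0 'k) module)"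
proof -
  interpret G: monoid G by fact
  let ?A = "monoid_algebra G :: ('k, 'g \<Rightarrow>\<^sub>0 'k) module"
  note d = monoid_algebra_distrib monoid_algebra_mult_zero smult_monoid_algebra
  have assoc: "p \<otimes>\<^bsub>?A\<^esub> q \<otimes>\<^bsub>?A\<^esub> s = p \<otimes>\<^bsub>?A\<^esub> (q \<otimes>\<^bsub>?A\<^esub> s)"
    if "p \<in> carrier ?A" "q \<in> carrier ?A" "s \<in> carrier ?A" for p q s
  proof (induction p rule: poly_mapping_single_induct)
    case (plus x c p')
    have "Poly_Mapping.single x c \<otimes>\<^bsub>?A\<^esub> q \<otimes>\<^bsub>?A\<^esub> s =
        Poly_Mapping.single x c \<otimes>\<^bsub>?A\<^esub> (q \<otimes>\<^bsub>?A\<^esub> s)"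
    proof (induction q rule: poly_mapping_single_induct)
      case (plus y b q')
      have "Poly_Mapping.single x c \<otimes>\<^bsub>?A\<^esub> Poly_Mapping.single y b \<otimes>\<^bsub>?A\<^esub> s =
          Poly_Mapping.single x c \<otimes>\<^bsub>?A\<^esub> (Poly_Mapping.single y b \<otimes>\<^bsub>?A\<^esub> s)"
      proof (induction s rule: poly_mapping_single_induct)
        case (plus z a s')
        then show ?case
          using \<open>x \<in> Poly_Mapping.keys p\<close> \<open>y \<in> Poly_Mapping.keys q\<close> that
          by (auto simp: d G.m_assoc mult.assoc subset_iff)
      qed (simp add: d)
      with plus.IH show ?case by (simp add: d)
    qed (simp add: d)
    with plus.IH show ?case by (simp add: d)
  qed (simp add: d)
  have l_one: "\<one>\<^bsub>?A\<^esub> \<otimes>\<^bsub>?A\<^esub> p = p" if "p \<in> carrier ?A" for p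
    by (induction p rule: poly_mapping_single_induct) (use that in \<open>auto simp: d\<close>)
  have r_one: "p \<otimes>\<^bsub>?A\<^esub> \<one>\<^bsub>?A\<^esub> = p" if "p \<in> carrier ?A" for p
    by (induction p rule: poly_mapping_single_induct) (use that in \<open>auto simp: d\<close>)
  have sl: "Poly_Mapping.map ((*) c) p \<otimes>\<^bsub>?A\<^esub> q = Poly_Mapping.map ((*) c) (p \<otimes>\<^bsub>?A\<^esub> q)" (is ?l)
    and sr: "p \<otimes>\<^bsub>?A\<^esub> Poly_Mapping.map ((*) c) q = Poly_Mapping.map ((*) c) (p \<otimes>\<^bsub>?A\<^esub> q)" (is ?r) for p q c
  proof -
    have *: "Poly_Mapping.map ((*) c) (Poly_Mapping.single x a) = Poly_Mapping.single x (c * a)" for x :: 'g and a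
      by simp
    have "Poly_Mapping.map ((*) c) (Poly_Mapping.single x a) \<otimes>\<^bsub>?A\<^esub> q =
        Poly_Mapping.map ((*) c) (Poly_Mapping.single x a \<otimes>\<^bsub>?A\<^esub> q)" for x a
      by (induction q rule: poly_mapping_single_induct) (auto simp: d mult.left_commute mult.assoc)
    then show ?l
      by (induction p rule: poly_mapping_single_induct) (auto simp: d)
    have "Poly_Mapping.single x a \<otimes>\<^bsub>?A\<^esub> Poly_Mapping.map ((*) c) q =
        Poly_Mapping.map ((*) c) (Poly_Mapping.single x a \<otimes>\<^bsub>?A\<^esub> q)" for x a
      by (induction q rule: poly_mapping_single_induct) (auto simp: d mult.left_commute mult.assoc)
    then show ?r
      by (induction p rule: poly_mapping_single_induct) (auto simp: d)
  qed
  have add_closed: "p + q \<in> carrier ?A" if "p \<in> carrier ?A" "q \<in> carrier ?A" for p q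
    using that keys_add[of p q] by auto
  have closed: "p \<otimes>\<^bsub>?A\<^esub> q \<in> carrier ?A" if "p \<in> carrier ?A" "q \<in> carrier ?A" for p q
  proof (induction p rule: poly_mapping_single_induct)
    case (plus x c p')
    have "Poly_Mapping.single x c \<otimes>\<^bsub>?A\<^esub> q \<in> carrier ?A"
    proof (induction q rule: poly_mapping_single_induct)
      case (plus y b q')
      have "Poly_Mapping.single (x \<otimes>\<^bsub>G\<^esub> y) (c * b) \<in> carrier ?A"
        using that \<open>x \<in> Poly_Mapping.keys p\<close> \<open>y \<in> Poly_Mapping.keys q\<close> by auto
      then show ?case
        unfolding d monoid_algebra_mult_single using plus.IH by (rule add_closed)
    qed (simp add: d)
    then show ?case
      unfolding d using plus.IH by (rule add_closed)
  qed (simp add: d)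
  have ring: "ring ?A"
  proof (rule ringI)
    show "abelian_group ?A"
    proof (rule abelian_groupI)
      fix p assume "p \<in> carrier ?A"
      then show "\<exists>q\<in>carrier ?A. q \<oplus>\<^bsub>?A\<^esub> p = \<zero>\<^bsub>?A\<^esub>"
        by (intro bexI[of _ "- p"]) (auto simp: in_keys_iff)
    qed (use add_closed in \<open>simp_all add: add_ac\<close>)
    show "Group.monoid ?A"
      by (rule monoidI) (use closed assoc l_one r_one in auto)
  qed (simp_all add: d)
  have smult_closed: "c \<odot>\<^bsub>?A\<^esub> p \<in> carrier ?A" if "p \<in> carrier ?A" for c p
    using that smult_monoid_algebra(6)[of c p] by auto
  show ?thesis
    by (intro assoc_algebra.intro assoc_algebra_axioms.intro ring)
       (use smult_closed in \<open>simp_all add: d sl sr\<close>)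
qed

lemma assoc_algebra_quotient_algebra:
  assumes "assoc_algebra A" "ideal I A"
  shows "assoc_algebra (quotient_algebra A I)"
proof -
  interpret A: assoc_algebra A by fact
  interpret ideal I A by fact
  have in_I: "c \<odot>\<^bsub>A\<^esub> h \<in> I" if "h \<in> I" for c h
  proof -
    have h: "h \<in> carrier A" using that by (rule a_Hcarr)
    then have "(c \<odot>\<^bsub>A\<^esub> \<one>\<^bsub>A\<^esub>) \<otimes>\<^bsub>A\<^esub> h = c \<odot>\<^bsub>A\<^esub> h"
      by (simp add: A.smult_mult_l)
    moreover have "(c \<odot>\<^bsub>A\<^esub> \<one>\<^bsub>A\<^esub>) \<otimes>\<^bsub>A\<^esub> h \<in> I"
      using that by (intro I_l_closed A.smult_closed) auto
    ultimately show ?thesis by simp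
  qed
  have smult: "(\<Union>y\<in>I +>\<^bsub>A\<^esub> x. I +>\<^bsub>A\<^esub> (c \<odot>\<^bsub>A\<^esub> y)) = I +>\<^bsub>A\<^esub> (c \<odot>\<^bsub>A\<^esub> x)"
    if x: "x \<in> carrier A" for c x
  proof -
    have "I +>\<^bsub>A\<^esub> (c \<odot>\<^bsub>A\<^esub> y) = I +>\<^bsub>A\<^esub> (c \<odot>\<^bsub>A\<^esub> x)" if y: "y \<in> I +>\<^bsub>A\<^esub> x" for y
    proof -
      obtain h where h: "h \<in> I" "y = h \<oplus>\<^bsub>A\<^esub> x"
        using y by (auto simp: a_r_coset_def')
      then have "c \<odot>\<^bsub>A\<^esub> y = c \<odot>\<^bsub>A\<^esub> h \<oplus>\<^bsub>A\<^esub> c \<odot>\<^bsub>A\<^esub> x"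
        using x by (simp add: A.smult_r_distr a_Hcarr)
      then have "c \<odot>\<^bsub>A\<^esub> y \<in> I +>\<^bsub>A\<^esub> (c \<odot>\<^bsub>A\<^esub> x)"
        using in_I[OF h(1)] by (auto simp: a_r_coset_def')
      then show ?thesis
        using x by (intro a_repr_independence'[symmetric]) (auto intro: A.smult_closed)
    qed
    moreover have "x \<in> I +>\<^bsub>A\<^esub> x"
      using x by (rule a_rcos_self)
    ultimately show ?thesis by blast
  qed
  interpret Q: ring "A Quot I" by (rule quotient_is_ring)
  have ring: "ring (quotient_algebra A I)"
    by (intro ringI abelian_groupI monoidI)
       (simp_all add: quotient_algebra_def Q.add.m_ac Q.m_assoc Q.l_distr Q.r_distr
         Q.add.l_inv_ex[simplified])
  let ?Q = "quotient_algebra A I"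
  have carr: "carrier ?Q = (\<lambda>x. I +>\<^bsub>A\<^esub> x) ` carrier A"
    by (auto simp: quotient_algebra_def FactRing_def A_RCOSETS_def')
  have ops: "c \<odot>\<^bsub>?Q\<^esub> (I +>\<^bsub>A\<^esub> x) = I +>\<^bsub>A\<^esub> (c \<odot>\<^bsub>A\<^esub> x)"
    "(I +>\<^bsub>A\<^esub> x) \<oplus>\<^bsub>?Q\<^esub> (I +>\<^bsub>A\<^esub> y) = I +>\<^bsub>A\<^esub> (x \<oplus>\<^bsub>A\<^esub> y)"
    "(I +>\<^bsub>A\<^esub> x) \<otimes>\<^bsub>?Q\<^esub> (I +>\<^bsub>A\<^esub> y) = I +>\<^bsub>A\<^esub> (x \<otimes>\<^bsub>A\<^esub> y)"
    if "x \<in> carrier A" "y \<in> carrier A" for c x y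
    using that smult
    by (simp_all add: quotient_algebra_def FactRing_def rcoset_mult_add a_rcos_sum)
  show ?thesis
    by (intro assoc_algebra.intro assoc_algebra_axioms.intro ring)
       (auto simp: carr ops A.smult_closed A.smult_l_distr A.smult_r_distr A.smult_assoc
         A.smult_one A.smult_mult_l A.smult_mult_r)
qed

lemma quotient_algebra_zero_iso:
  assumes "assoc_algebra A"
  shows "(\<lambda>x. {\<zero>\<^bsub>A\<^esub>} +>\<^bsub>A\<^esub> x) \<in> algebra_iso A (quotient_algebra A {\<zero>\<^bsub>A\<^esub>})"
proof -
  interpret A: assoc_algebra A by fact
  have [simp]: "{\<zero>\<^bsub>A\<^esub>} +>\<^bsub>A\<^esub> x = {x}" if "x \<in> carrier A" for x
    using that by (simp add: a_r_coset_def')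
  have "bij_betw (\<lambda>x. {\<zero>\<^bsub>A\<^esub>} +>\<^bsub>A\<^esub> x) (carrier A) (carrier (quotient_algebra A {\<zero>\<^bsub>A\<^esub>}))"
    by (auto simp: bij_betw_def inj_on_def quotient_algebra_def FactRing_def A_RCOSETS_def')
  then show ?thesis
    by (auto simp: algebra_iso_def ring_iso_def Ring.ring_hom_def quotient_algebra_def FactRing_def
      A_RCOSETS_def' rcoset_mult_def set_add_def' A.smult_closed)
qed

lemma algebra_iso_trans:
  "g \<in> algebra_iso A B \<Longrightarrow> h \<in> algebra_iso B C \<Longrightarrow> h \<circ> g \<in> algebra_iso A C"
  by (auto simp: algebra_iso_def ring_iso_memE(1) intro: ring_iso_set_trans)

lemma ideal_relation_ideal:
  assumes "assoc_algebra A" "R \<subseteq> carrier A \<times> carrier A"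
  shows "ideal (relation_ideal A R) A"
proof -
  interpret assoc_algebra A by fact
  show ?thesis
    unfolding relation_ideal_def using assms(2) by (intro genideal_ideal) auto
qed

lemma monoid_lists: "monoid \<lparr>carrier = lists S, monoid.mult = (@), monoid.one = []\<rparr>"
  by (rule monoidI) auto

lemma assoc_algebra_free_algebra: "assoc_algebra (free_algebra S)"
  unfolding free_algebra_def by (intro assoc_algebra_monoid_algebra monoid_lists)

lemma free_gen_closed: "g \<in> S \<Longrightarrow> free_gen g \<in> carrier (free_algebra S)"
  by (auto simp: free_gen_def free_algebra_def)

lemma monoid_product_group:
  assumes "\<And>i. i \<in> I \<Longrightarrow> monoid (G i)"
  shows "monoid (product_group I G)"
proof (rule monoidI)
  fix x y z
  assume "x \<in> carrier (product_group I G)" "y \<in> carrier (product_group I G)"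
    "z \<in> carrier (product_group I G)"
  then show "x \<otimes>\<^bsub>product_group I G\<^esub> y \<otimes>\<^bsub>product_group I G\<^esub> z =
      x \<otimes>\<^bsub>product_group I G\<^esub> (y \<otimes>\<^bsub>product_group I G\<^esub> z)"
    using monoid.m_assoc[OF assms] by (auto simp: PiE_iff intro!: restrict_ext)
next
  fix x assume x: "x \<in> carrier (product_group I G)"
  show "\<one>\<^bsub>product_group I G\<^esub> \<otimes>\<^bsub>product_group I G\<^esub> x = x"
    using x monoid.l_one[OF assms]
    by (intro extensionalityI[of _ I]) (auto simp: PiE_iff)
  show "x \<otimes>\<^bsub>product_group I G\<^esub> \<one>\<^bsub>product_group I G\<^esub> = x"
    using x monoid.r_one[OF assms]
    by (intro extensionalityI[of _ I]) (auto simp: PiE_iff)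
qed (use monoid.m_closed[OF assms] monoid.one_closed[OF assms] in \<open>auto simp: PiE_iff\<close>)

lemma assoc_algebra_tensor_algebra:
  assumes "\<And>i. i \<in> I \<Longrightarrow> assoc_algebra (A i)"
  shows "assoc_algebra (tensor_algebra I A)"
proof -
  have "monoid (A i)" if "i \<in> I" for i
    using assms[OF that] by (simp add: assoc_algebra_def ring_def)
  then have M: "assoc_algebra (monoid_algebra (product_group I A))"
    by (intro assoc_algebra_monoid_algebra monoid_product_group)
  have ac: "a \<oplus>\<^bsub>A i\<^esub> b \<in> carrier (A i)" if "i \<in> I" "a \<in> carrier (A i)" "b \<in> carrier (A i)" for i a b
    using that assms[OF that(1)] by (simp add: assoc_algebra_def ring.ring_simprules)
  have "multilinear_relations I A \<subseteq>
      carrier (monoid_algebra (product_group I A)) \<times> carrier (monoid_algebra (product_group I A))"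
    unfolding multilinear_relations_def
    using ac assoc_algebra.smult_closed[OF assms]
    by (auto simp: PiE_iff extensional_def dest!: subsetD[OF keys_add] split: if_splits)
  then show ?thesis
    unfolding tensor_algebra_def
    by (intro assoc_algebra_quotient_algebra ideal_relation_ideal M)
qed

lemma hecke_relations_closed:
  assumes "assoc_algebra A"
    and "\<And>i. i \<in> {1..m} \<Longrightarrow> x i \<in> carrier A" "\<And>i. i \<in> {1..<m} \<Longrightarrow> s i \<in> carrier A"
  shows "hecke_relations A m x s \<subseteq> carrier A \<times> carrier A"
proof -
  interpret assoc_algebra A by fact
  show ?thesis
    unfolding hecke_relations_def using assms(2,3) by auto
qed

lemma yh_relations_closed:
  assumes "assoc_algebra A"
    and "\<And>i. i \<in> {1..n} \<Longrightarrow> t i \<in> carrier A" "\<And>i. i \<in> {1..<n} \<Longrightarrow> f i \<in> carrier A"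
      "\<And>i. i \<in> {1..n} \<Longrightarrow> x i \<in> carrier A"
  shows "yh_relations A r n t f x \<subseteq> carrier A \<times> carrier A"
proof -
  interpret assoc_algebra A by fact
  have "yh_e A r t i \<in> carrier A" if "i \<in> {1..<n}" for i
    unfolding yh_e_def using that assms(2) by (intro smult_closed finsum_closed) auto
  moreover have "t (Transposition.transpose i (i + 1) j) \<in> carrier A"
    if "i \<in> {1..<n}" "j \<in> {1..n}" for i j
    using that by (intro assms) (auto simp: Transposition.transpose_def)
  ultimately show ?thesis
    unfolding yh_relations_def using assms(2-4) by auto
qed

lemma assoc_algebra_presented_algebra:
  assumes "R \<subseteq> carrier (free_algebra S) \<times> carrier (free_algebra S)"
  shows "assoc_algebra (presented_algebra S R)"
  unfolding presented_algebra_def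
  by (intro assoc_algebra_quotient_algebra ideal_relation_ideal assoc_algebra_free_algebra assms)

lemma presented_gen_closed:
  assumes "R \<subseteq> carrier (free_algebra S) \<times> carrier (free_algebra S)" "g \<in> S"
  shows "presented_gen S R g \<in> carrier (presented_algebra S R)"
  unfolding presented_gen_def presented_algebra_def quotient_algebra_def FactRing_def A_RCOSETS_def'
  using free_gen_closed[OF assms(2)] by auto

lemma cyclotomic_element_closed:
  assumes "assoc_algebra A" "a \<in> carrier A"
  shows "cyclotomic_element A d v a \<in> carrier A"
proof -
  interpret assoc_algebra A by fact
  have "foldr (\<lambda>i b. (a \<ominus>\<^bsub>A\<^esub> v i \<odot>\<^bsub>A\<^esub> \<one>\<^bsub>A\<^esub>) \<otimes>\<^bsub>A\<^esub> b) is \<one>\<^bsub>A\<^esub> \<in> carrier A" for "is"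
    by (induction "is") (auto intro!: m_closed minus_closed smult_closed assms)
  then show ?thesis unfolding cyclotomic_element_def .
qed

lemma affine_hecke_relations_closed:
  "affine_hecke_relations m \<subseteq>
    carrier (free_algebra (hecke_gens m)) \<times> carrier (free_algebra (hecke_gens m))"
  unfolding affine_hecke_relations_def
  by (intro hecke_relations_closed assoc_algebra_free_algebra free_gen_closed)
     (auto simp: hecke_gens_def)

lemma assoc_algebra_affine_hecke: "assoc_algebra (affine_hecke m)"
  unfolding affine_hecke_def
  by (intro assoc_algebra_presented_algebra affine_hecke_relations_closed)

lemma assoc_algebra_cyclotomic_hecke: "assoc_algebra (cyclotomic_hecke d v m)"
proof -
  have A: "assoc_algebra (affine_hecke m :: ('a, (hecke_gen list \<Rightarrow>\<^sub>0 'a) set) module)"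
    by (rule assoc_algebra_affine_hecke)
  then interpret assoc_algebra "affine_hecke m :: ('a, (hecke_gen list \<Rightarrow>\<^sub>0 'a) set) module" .
  have "affine_hecke_x m 1 \<in> carrier (affine_hecke m :: ('a, (hecke_gen list \<Rightarrow>\<^sub>0 'a) set) module)"
    if "m \<noteq> 0"
    unfolding affine_hecke_def affine_hecke_x_def using that
    by (intro presented_gen_closed affine_hecke_relations_closed) (auto simp: hecke_gens_def)
  then show ?thesis
    unfolding cyclotomic_hecke_def
    by (intro assoc_algebra_quotient_algebra A genideal_ideal)
       (auto intro: cyclotomic_element_closed A)
qed

lemma genideal_empty:
  assumes "ring R"
  shows "Idl\<^bsub>R\<^esub> {} = {\<zero>\<^bsub>R\<^esub>}"
proof -
  interpret ring R by fact
  have "ideal (Idl\<^bsub>R\<^esub> {}) R" by (rule genideal_ideal) simp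
  then show ?thesis
    using genideal_minimal[OF zeroideal, of "{}"] additive_subgroup.zero_closed
    by (auto simp: ideal_def)
qed

lemma cyclotomic_hecke_0_iso:
  fixes v :: "nat \<Rightarrow> 'k::field"
  defines "K \<equiv> \<lparr>carrier = UNIV, monoid.mult = (*), monoid.one = 1, ring.zero = 0, ring.add = (+),
    module.smult = (*)\<rparr> :: ('k, 'k) module"
  shows "algebra_iso K (cyclotomic_hecke d v 0) \<noteq> {}"
proof -
  let ?F = "free_algebra {} :: ('k, (hecke_gen list \<Rightarrow>\<^sub>0 'k)) module"
  let ?H = "affine_hecke 0 :: ('k, (hecke_gen list \<Rightarrow>\<^sub>0 'k) set) module"
  have F: "assoc_algebra ?F" by (rule assoc_algebra_free_algebra)
  have H: "assoc_algebra ?H" by (rule assoc_algebra_affine_hecke)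
  have carr: "carrier ?F = range (Poly_Mapping.single [])"
  proof (intro equalityI subsetI)
    fix p assume "p \<in> carrier ?F"
    then have "Poly_Mapping.keys p \<subseteq> {[]}" by (auto simp: free_algebra_def)
    then have "p = Poly_Mapping.single [] (Poly_Mapping.lookup p [])"
      by (intro poly_mapping_eqI) (auto simp: lookup_single when_def in_keys_iff)
    then show "p \<in> range (Poly_Mapping.single [])" by blast
  qed (auto simp: free_algebra_def split: if_splits)
  have 1: "Poly_Mapping.single [] \<in> algebra_iso K ?F"
    unfolding algebra_iso_def ring_iso_def
    by (auto simp: bij_betw_def carr K_def Ring.ring_hom_def)
       (auto simp: free_algebra_def single_add)
  have "?H = quotient_algebra ?F {\<zero>\<^bsub>?F\<^esub>}"
    using F by (simp add: affine_hecke_def presented_algebra_def relation_ideal_def hecke_gens_def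
      affine_hecke_relations_def hecke_relations_def genideal_empty assoc_algebra_def)
  then have 2: "(\<lambda>x. {\<zero>\<^bsub>?F\<^esub>} +>\<^bsub>?F\<^esub> x) \<in> algebra_iso ?F ?H"
    using quotient_algebra_zero_iso[OF F] by simp
  have "cyclotomic_hecke d v 0 = quotient_algebra ?H {\<zero>\<^bsub>?H\<^esub>}"
    using H by (simp add: cyclotomic_hecke_def genideal_empty assoc_algebra_def)
  then have 3: "(\<lambda>x. {\<zero>\<^bsub>?H\<^esub>} +>\<^bsub>?H\<^esub> x) \<in> algebra_iso ?H (cyclotomic_hecke d v 0)"
    using quotient_algebra_zero_iso[OF H] by simp
  show ?thesis
    using algebra_iso_trans[OF algebra_iso_trans[OF 1 2] 3] by blast
qed

lemma assoc_algebra_cyclotomic_hecke_tensor: "assoc_algebra (cyclotomic_hecke_tensor d v \<mu>)"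
  unfolding cyclotomic_hecke_tensor_def
  by (intro assoc_algebra_tensor_algebra assoc_algebra_cyclotomic_hecke)

lemma affine_yh_relations_closed:
  "affine_yh_relations r n \<subseteq>
    carrier (free_algebra (yh_gens n)) \<times> carrier (free_algebra (yh_gens n))"
  unfolding affine_yh_relations_def
  by (intro yh_relations_closed assoc_algebra_free_algebra free_gen_closed)
     (auto simp: yh_gens_def)

lemma assoc_algebra_cyclotomic_yh:
  fixes v :: "nat \<Rightarrow> 'k::field"
  assumes "n \<ge> 1"
  shows "assoc_algebra (cyclotomic_yh r n d v)"
proof -
  have A: "assoc_algebra (affine_yh r n :: ('k, (yh_gen list \<Rightarrow>\<^sub>0 'k) set) module)"
    unfolding affine_yh_def
    by (intro assoc_algebra_presented_algebra affine_yh_relations_closed)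
  then interpret assoc_algebra "affine_yh r n :: ('k, (yh_gen list \<Rightarrow>\<^sub>0 'k) set) module" .
  have "affine_yh_x r n 1 \<in> carrier (affine_yh r n :: ('k, (yh_gen list \<Rightarrow>\<^sub>0 'k) set) module)"
    unfolding affine_yh_def affine_yh_x_def using assms
    by (intro presented_gen_closed affine_yh_relations_closed) (auto simp: yh_gens_def)
  then show ?thesis
    unfolding cyclotomic_yh_def
    by (intro assoc_algebra_quotient_algebra A genideal_ideal)
       (auto intro: cyclotomic_element_closed A)
qed

end

theory Submission
  imports
    Defs
    "HOL-Library.Function_Algebras"
    "HOL-Combinatorics.Permutations"
begin

text \<open>
  If the product does not vanish, the commuting elements \<open>t\<^sub>1, \<dots>, t\<^sub>n, x\<^sub>1, \<dots>, x\<^sub>n\<close> act diagonalizably and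
  their joint weights are the paths of residues of standard multitableaux: the residues of the boxes
  that can be added to a multipartition with fewer than \<open>n\<close> boxes are pairwise distinct, so a
  weight determines its multitableau. The idempotents of the weights are primitive, two of them are
  equivalent if and only if the multitableaux have the same shape, and this yields a complete system
  of matrix units. The algebras \<open>H\<^sub>m\<^sup>d\<close> are the case \<open>r = 1\<close>, and matrix units of the factors give
  matrix units of a tensor product.

  Conversely, every element \<open>a\<close> of a quotient of a split semisimple algebra satisfies \<open>a = a b a\<close> for some
  \<open>b\<close>. If the product vanishes, there is a representation of \<open>H\<^sub>n\<^sup>d\<close> (hence, with \<open>t\<^sub>i = 1\<close>, of \<open>Y\<^sub>r\<^sub>,\<^sub>n\<^sup>d\<close>
  and of \<open>H\<^sub>n\<^sup>d \<otimes> K \<otimes> \<dots> \<otimes> K\<close>) containing a nonzero operator \<open>a\<close> whose range lies in an invariant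
  subspace that \<open>a\<close> kills: on the functions on the symmetric group if \<open>n! = 0\<close>, on a plane with \<open>x\<^sub>1\<close> not
  diagonalizable if \<open>v\<^sub>i = v\<^sub>j\<close>, and on the functions on the \<open>m\<close>-subsets of \<open>{1..n}\<close> if \<open>n! \<noteq> 0\<close> and
  \<open>v\<^sub>j = v\<^sub>i \<plusminus> m\<close> with \<open>0 < m < n\<close>.
\<close>

section \<open>Algebras on a vector space type\<close>

text \<open>The algebras are known only through generators and relations, with no basis at hand. For
  sufficiency this does no harm: spanning statements read off from the relations are enough, since a
  system of matrix units in which some vanish still splits the algebra once the zero blocks are
  dropped. The hypothesis enters only through distances between boxes. Inside one component such a
  distance is a nonzero integer bounded by \<open>n\<close>, like a hook length, and is invertible
  when \<open>n!\<close> is. Between two components it is a hook that straddles them and stays below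
  \<open>n\<close>, which is the origin of the range of \<open>l\<close>. That
  \<open>x (k + 1)\<close> is diagonalizable and that weights of length \<open>k + 1\<close> are
  standard must be proved together, by induction on \<open>k\<close>, because every step has to
  exclude the eigenvalues that come from no addable box. Necessity needs a lower bound, hence actual
  modules. All of them come from one recipe: a representation of the symmetric group with an
  operator \<open>D\<close> that commutes with the stabilizer of 1 and satisfies the single relation
  saying that \<open>x 1\<close> and \<open>x 2\<close> commute.\<close>

text \<open>
  An algebra whose carrier is a direct summand of a type: the product is defined everywhere and the
  idempotent \<open>one\<close> is the unit of the summand \<open>C\<close>.
\<close>

locale summand_algebra = vector_space scale
  for scale :: "'k::field \<Rightarrow> 'v::ab_group_add \<Rightarrow> 'v" (infixr "*s" 75) +
  fixes mul :: "'v \<Rightarrow> 'v \<Rightarrow> 'v" (infixl "\<star>" 72) and one :: 'v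
  assumes mul_distrib: "(a + b) \<star> c = a \<star> c + b \<star> c" "a \<star> (b + c) = a \<star> b + a \<star> c"
    and mul_scale: "(k *s a) \<star> b = k *s (a \<star> b)" "a \<star> (k *s b) = k *s (a \<star> b)"
    and mul_assoc: "a \<star> b \<star> c = a \<star> (b \<star> c)"
    and one_idem: "one \<star> one = one"
begin

text \<open>The corner cut out by \<open>one\<close>. Outside it the product has no unit, so
  membership in \<open>C\<close> plays the part of a carrier.\<close>

definition C :: "'v set" where "C = {u. one \<star> u = u \<and> u \<star> one = u}"

lemma mul_zero [simp]: "0 \<star> a = 0" "a \<star> 0 = 0"
  using mul_distrib(1)[of 0 0 a] mul_distrib(2)[of a 0 0]
  by (simp_all only: add_0_left add_cancel_left_left add_cancel_right_right)

lemma mul_minus: "(- a) \<star> b = - (a \<star> b)" "a \<star> (- b) = - (a \<star> b)"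
  using mul_distrib(1)[of "- a" a b] mul_distrib(2)[of a "- b" b]
  by (simp_all add: eq_neg_iff_add_eq_0)

lemma mul_diff: "(a - b) \<star> c = a \<star> c - b \<star> c" "a \<star> (b - c) = a \<star> b - a \<star> c"
  using mul_distrib(1)[of a "- b" c] mul_distrib(2)[of a b "- c"] by (simp_all add: mul_minus)

lemma mul_sum: "(\<Sum>i\<in>I. g i) \<star> a = (\<Sum>i\<in>I. g i \<star> a)" "a \<star> (\<Sum>i\<in>I. g i) = (\<Sum>i\<in>I. a \<star> g i)"
  by (induction I rule: infinite_finite_induct) (simp_all add: mul_distrib)

lemmas mul_simps = mul_distrib mul_diff mul_minus mul_scale mul_assoc scale_right_distrib
  scale_right_diff_distrib scale_left_distrib scale_left_diff_distrib scale_left_commute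

lemma C_subspace: "subspace C"
  unfolding subspace_def C_def by (auto simp: mul_simps)

lemma one_C [simp]: "one \<in> C" by (simp add: C_def one_idem)

lemma C_mul [simp]: "a \<in> C \<Longrightarrow> b \<in> C \<Longrightarrow> a \<star> b \<in> C"
  unfolding C_def by (metis (mono_tags, lifting) mem_Collect_eq mul_assoc)

lemma C_closed [simp]:
  "0 \<in> C" "a \<in> C \<Longrightarrow> k *s a \<in> C" "a \<in> C \<Longrightarrow> b \<in> C \<Longrightarrow> a + b \<in> C" "a \<in> C \<Longrightarrow> b \<in> C \<Longrightarrow> a - b \<in> C"
  using C_subspace by (auto simp: subspace_def subspace_diff)

lemma one_mul [simp]: "u \<in> C \<Longrightarrow> one \<star> u = u" "u \<in> C \<Longrightarrow> u \<star> one = u"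
  by (auto simp: C_def)

section \<open>Spans, products of linear factors and eigenvectors\<close>

lemma span_mul_left:
  assumes "m \<in> span G" "\<And>g. g \<in> G \<Longrightarrow> a \<star> g \<in> span H"
  shows "a \<star> m \<in> span H"
  using assms(1)
  by (induction rule: span_induct_alt) (auto simp: mul_simps intro: span_add span_scale assms(2) span_zero)

text \<open>The product of the factors \<open>y - c\<close> over the root list \<open>cs\<close>,
  applied to \<open>m\<close>. It is written as an operator because \<open>one\<close> is a unit
  only on \<open>C\<close>; a list of roots records multiplicities.\<close>

definition lin :: "'v \<Rightarrow> 'k list \<Rightarrow> 'v \<Rightarrow> 'v" where
  "lin y cs m = foldr (\<lambda>c m. y \<star> m - c *s m) cs m"

lemma lin_simps [simp]: "lin y [] m = m" "lin y (c # cs) m = y \<star> lin y cs m - c *s lin y cs m"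
  by (simp_all add: lin_def)

lemma lin_append: "lin y (cs @ ds) m = lin y cs (lin y ds m)"
  by (induction cs) auto

lemma lin_linear [simp]:
  "lin y cs 0 = 0" "lin y cs (m + m') = lin y cs m + lin y cs m'"
  "lin y cs (k *s m) = k *s lin y cs m"
  by (induction cs) (simp_all add: mul_simps)

lemma lin_diff [simp]: "lin y cs (m - m') = lin y cs m - lin y cs m'"
  by (induction cs) (simp_all add: mul_simps)

lemma lin_mul_commute: "y \<star> z = z \<star> y \<Longrightarrow> lin y cs (z \<star> m) = z \<star> lin y cs m"
  by (induction cs) (simp_all add: mul_diff mul_scale mul_assoc[symmetric])

lemma lin_Cons': "lin y (c # cs) m = lin y cs (y \<star> m - c *s m)"
  by (simp add: lin_mul_commute)

lemma lin_eigen: "y \<star> m = a *s m \<Longrightarrow> lin y cs m = (\<Prod>c\<leftarrow>cs. a - c) *s m"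
  by (induction cs) (auto simp: mul_simps algebra_simps)

lemma lin_in:
  assumes "subspace U" "\<And>u. u \<in> U \<Longrightarrow> y \<star> u \<in> U" "m \<in> U"
  shows "lin y cs m \<in> U"
  by (induction cs) (auto simp: assms subspace_diff subspace_scale)

text \<open>On an eigenvector each factor acts by the scalar \<open>a - c\<close>, so one of these
  scalars has to vanish.\<close>

lemma lin_eigen_zero:
  assumes "y \<star> m = a *s m" "lin y cs m = 0" "m \<noteq> 0"
  shows "a \<in> set cs"
  using assms by (auto simp: lin_eigen prod_list_zero_iff)

text \<open>On an eigenvector with eigenvalue \<open>s\<close> in \<open>S\<close> the operator
  \<open>y - c\<close> is the nonzero scalar \<open>s - c\<close>. It is therefore invertible on the
  span, and the preimage does not leave the span.\<close>

lemma lin_diff_span: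
  assumes "m \<in> span {u \<in> U. \<exists>s\<in>S. y \<star> u = s *s u}" "c \<notin> S"
  shows "\<exists>m' \<in> span {u \<in> U. \<exists>s\<in>S. y \<star> u = s *s u}. y \<star> m' - c *s m' = m"
  using assms(1)
proof (induction rule: span_induct_alt)
  case base then show ?case by (intro bexI[of _ 0]) (auto intro: span_zero)
next
  case (step k u m)
  then obtain s m' where s: "s \<in> S" "y \<star> u = s *s u" "u \<in> U"
    and m': "m' \<in> span {u \<in> U. \<exists>s\<in>S. y \<star> u = s *s u}" "y \<star> m' - c *s m' = m" by auto
  have "s - c \<noteq> 0" using s assms(2) by auto
  then have "y \<star> ((k / (s - c)) *s u + m') - c *s ((k / (s - c)) *s u + m') = k *s u + m"
    unfolding m'(2)[symmetric]
    by (simp add: mul_simps s(2)) (simp add: scale_left_diff_distrib[symmetric] field_simps diff_divide_distrib[symmetric])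
  moreover have "(k / (s - c)) *s u + m' \<in> span {u \<in> U. \<exists>s\<in>S. y \<star> u = s *s u}"
    using s m'(1) by (intro span_add span_scale) (auto intro: span_base)
  ultimately show ?case by blast
qed

text \<open>Induction on the roots: the vector \<open>y \<star> m - c *s m\<close> is killed by the
  remaining factors, hence a sum of eigenvectors for the remaining roots. Dividing it by
  \<open>y - c\<close> inside their span gives \<open>m'\<close>, and \<open>m - m'\<close> is an
  eigenvector for \<open>c\<close>.\<close>

lemma eigen_decomposition:
  assumes "subspace U" "\<And>u. u \<in> U \<Longrightarrow> y \<star> u \<in> U"
  shows "distinct cs \<Longrightarrow> m \<in> U \<Longrightarrow> lin y cs m = 0 \<Longrightarrow>
    m \<in> span {u \<in> U. \<exists>c\<in>set cs. y \<star> u = c *s u}"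
proof (induction cs arbitrary: m)
  case Nil then show ?case by (simp add: span_zero)
next
  case (Cons c cs)
  have yU: "y \<star> m - c *s m \<in> U"
    using Cons.prems assms by (simp add: subspace_diff subspace_scale)
  have "y \<star> m - c *s m \<in> span {u \<in> U. \<exists>c\<in>set cs. y \<star> u = c *s u}"
    using Cons.prems yU by (intro Cons.IH) (simp_all only: lin_Cons' distinct.simps)
  from lin_diff_span[OF this, of c] Cons.prems obtain m'
    where m': "m' \<in> span {u \<in> U. \<exists>s\<in>set cs. y \<star> u = s *s u}" "y \<star> m' - c *s m' = y \<star> m - c *s m"
    by auto
  have "m' \<in> U"
    using m'(1) span_minimal[of "{u \<in> U. \<exists>s\<in>set cs. y \<star> u = s *s u}" U] assms(1) by auto
  then have "m - m' \<in> U" using Cons.prems assms by (simp add: subspace_diff)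
  moreover have "y \<star> (m - m') = c *s (m - m')"
    using m'(2) by (simp add: mul_simps algebra_simps)
  ultimately have "m - m' \<in> span {u \<in> U. \<exists>c\<in>set (c # cs). y \<star> u = c *s u}"
    by (intro span_base) auto
  moreover have "m' \<in> span {u \<in> U. \<exists>c\<in>set (c # cs). y \<star> u = c *s u}"
    using m'(1) span_mono[of "{u \<in> U. \<exists>s\<in>set cs. y \<star> u = s *s u}" "{u \<in> U. \<exists>c\<in>set (c # cs). y \<star> u = c *s u}"]
    by auto
  ultimately show ?case using span_add[of "m - m'" _ m'] by simp
qed

text \<open>A Jordan block of size two contradicts simple roots. If \<open>u\<close> were nonzero,
  \<open>a\<close> would be a root; as \<open>u\<close> is \<open>y - a\<close> applied to
  \<open>z\<close>, the factors left after deleting that one occurrence of \<open>a\<close> still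
  kill \<open>u\<close>, so \<open>a\<close> would occur a second time.\<close>

lemma lin_distinct_square:
  assumes "distinct cs" "lin y cs z = 0" "y \<star> z - a *s z = u" "y \<star> u = a *s u"
  shows "u = 0"
proof (rule ccontr)
  assume u: "u \<noteq> 0"
  have "lin y cs (y \<star> z - a *s z) = 0"
    by (simp only: lin_diff lin_linear lin_mul_commute[OF refl] assms(2)) simp
  then have "lin y cs u = 0" using assms(3) by simp
  then have a: "a \<in> set cs" using lin_eigen_zero[OF assms(4)] u by simp
  then obtain bs ds where cs: "cs = bs @ a # ds" by (auto simp: in_set_conv_decomp)
  have "lin y (bs @ ds) (y \<star> z - a *s z) = lin y cs z"
    by (simp add: cs lin_append lin_mul_commute[OF refl])
  then have "lin y (bs @ ds) u = 0" unfolding assms(2,3) .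
  then have "a \<in> set (bs @ ds)" using lin_eigen_zero[OF assms(4) _ u] by blast
  then show False using assms(1) cs by auto
qed

end

section \<open>Addable boxes of multipartitions\<close>

text \<open>
  The component of colour \<open>\<zeta>\<close> and index \<open>j\<close> of a multipartition is given by its Maya diagram
  \<open>S \<zeta> j :: int \<Rightarrow> bool\<close>. Adding a box of diagonal \<open>l\<close>, hence of content \<open>v j + l\<close>, turns the bits
  \<open>0 1\<close> at \<open>l - 1\<close> and \<open>l\<close> into \<open>1 0\<close>.
\<close>

type_synonym 'k maya = "'k \<Rightarrow> nat \<Rightarrow> int \<Rightarrow> bool"

definition addable :: "'k maya \<Rightarrow> 'k \<Rightarrow> nat \<Rightarrow> int \<Rightarrow> bool" where
  "addable S \<zeta> j l \<longleftrightarrow> S \<zeta> j l \<and> \<not> S \<zeta> j (l - 1)"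

definition removable :: "'k maya \<Rightarrow> 'k \<Rightarrow> nat \<Rightarrow> int \<Rightarrow> bool" where
  "removable S \<zeta> j l \<longleftrightarrow> S \<zeta> j (l - 1) \<and> \<not> S \<zeta> j l"

definition add_box :: "'k maya \<Rightarrow> 'k \<Rightarrow> nat \<Rightarrow> int \<Rightarrow> 'k maya" where
  "add_box S \<zeta> j l = (\<lambda>\<zeta>' j' l'. if \<zeta>' = \<zeta> \<and> j' = j \<and> l' = l - 1 then True
    else if \<zeta>' = \<zeta> \<and> j' = j \<and> l' = l then False else S \<zeta>' j' l')"

text \<open>The first \<open>k\<close> entries of \<open>w\<close> are read along a standard
  multitableau of shape \<open>S\<close>: entry \<open>i\<close> holds the colour and the content of
  the box added at step \<open>i\<close>. Colours are field elements because they will be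
  eigenvalues of the \<open>t i\<close>.\<close>

inductive std_weight :: "(nat \<Rightarrow> 'k::field) \<Rightarrow> nat \<Rightarrow> nat \<Rightarrow> (nat \<Rightarrow> 'k \<times> 'k) \<Rightarrow> 'k maya \<Rightarrow> bool"
  for v d where
  "std_weight v d 0 w (\<lambda>_ _ l. 0 \<le> l)"
| "std_weight v d k w S \<Longrightarrow> j \<in> {1..d} \<Longrightarrow> w (Suc k) = (\<zeta>, v j + of_int l) \<Longrightarrow> addable S \<zeta> j l \<Longrightarrow>
    std_weight v d (Suc k) w (add_box S \<zeta> j l)"

inductive_cases std_weight_SucE: "std_weight v d (Suc k) w S"
inductive_cases std_weight_0E: "std_weight v d 0 w S"

definition addable_contents :: "(nat \<Rightarrow> 'k::field) \<Rightarrow> nat \<Rightarrow> 'k maya \<Rightarrow> 'k \<Rightarrow> 'k set" where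
  "addable_contents v d S \<zeta> = {v j + of_int l | j l. j \<in> {1..d} \<and> addable S \<zeta> j l}"

lemma std_weight_cong:
  assumes "std_weight v d k w S" "\<And>i. i \<in> {1..k} \<Longrightarrow> w' i = w i"
  shows "std_weight v d k w' S"
  using assms by (induction rule: std_weight.induct) (auto intro!: std_weight.intros)

text \<open>For \<open>j = j'\<close> and \<open>l < m\<close>, a 1 at \<open>l\<close> and a 0 at
  \<open>m\<close> mark a rim hook of length \<open>m - l\<close>, which has at most
  \<open>k\<close> boxes. For different components the same difference combines a row of one with a
  column of the other; these share no corner box, which explains the extra 1.\<close>

lemma std_weight_bits:
  assumes "std_weight v d k w S" "S \<zeta> j l" "\<not> S \<zeta> j' m"
  shows "m - l \<le> int k - (if j \<noteq> j' then 1 else 0)"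
  using assms
proof (induction arbitrary: j l j' m rule: std_weight.induct)
  case (2 k w S i \<zeta>' a)
  have add: "S \<zeta>' i a" "\<not> S \<zeta>' i (a - 1)" using "2.hyps" by (auto simp: addable_def)
  show ?case
  proof (cases "\<zeta> = \<zeta>'")
    case False
    then show ?thesis using "2.IH"[of j l j' m] "2.prems" by (auto simp: add_box_def)
  next
    case True
    note IH = "2.IH"[unfolded True]
    \<comment> \<open>The new 1 at \<open>a - 1\<close> and the new 0 at \<open>a\<close> are each
      one place away from an old 1 at \<open>a\<close> and an old 0 at \<open>a - 1\<close>, so the
      bound grows by at most one.\<close>
    have 1: "j = i \<and> l = a - 1 \<or> S \<zeta>' j l"
      using "2.prems"(1) by (auto simp: add_box_def True split: if_splits)
    have 2: "j' = i \<and> m = a \<or> \<not> S \<zeta>' j' m"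
      using "2.prems"(2) by (auto simp: add_box_def True split: if_splits)
    have "m - l \<le> int k - (if j \<noteq> j' then 1 else 0)" if "S \<zeta>' j l" "\<not> S \<zeta>' j' m"
      using IH[OF that] .
    moreover have "m - a \<le> int k - (if i \<noteq> j' then 1 else 0)" if "\<not> S \<zeta>' j' m"
      using IH[OF add(1) that] .
    moreover have "a - 1 - l \<le> int k - (if j \<noteq> i then 1 else 0)" if "S \<zeta>' j l"
      using IH[OF that add(2)] .
    ultimately show ?thesis using 1 2 add by (auto split: if_splits)
  qed
qed auto

section \<open>Differences of contents under the separation hypothesis\<close>

locale separated_parameters =
  fixes n d :: nat and v :: "nat \<Rightarrow> 'k::field"
  assumes fact_nonzero: "of_nat (fact n) \<noteq> (0::'k)"
    and separated: "\<lbrakk>1 \<le> i; i < j; j \<le> d; \<bar>l\<bar> < int n\<rbrakk> \<Longrightarrow> of_int l + v i - v j \<noteq> 0"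
begin

text \<open>Such an integer divides \<open>n!\<close> up to sign, so its image cannot vanish when
  that of \<open>n!\<close> does not.\<close>

lemma of_int_nonzero:
  assumes "l \<noteq> 0" "\<bar>l\<bar> \<le> int n"
  shows "of_int l \<noteq> (0::'k)"
proof
  assume 0: "of_int l = (0::'k)"
  have "nat \<bar>l\<bar> dvd fact n" using assms by (intro dvd_fact) auto
  then obtain q where "fact n = nat \<bar>l\<bar> * q" ..
  then have "of_nat (fact n) = (of_int \<bar>l\<bar> * of_nat q :: 'k)"
    by (metis abs_ge_zero nat_0_le of_int_of_nat_eq of_nat_mult)
  also have "(of_int \<bar>l\<bar> :: 'k) = 0" using 0 by (auto simp: abs_if)
  finally show False using fact_nonzero by simp
qed

lemma content_nonzero:
  assumes "i \<in> {1..d}" "j \<in> {1..d}" "i \<noteq> j \<Longrightarrow> \<bar>l\<bar> < int n" "i = j \<Longrightarrow> l \<noteq> 0 \<and> \<bar>l\<bar> \<le> int n"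
  shows "v i - v j + of_int l \<noteq> 0"
proof -
  consider "i = j" | "i < j" | "j < i" by linarith
  then show ?thesis
  proof cases
    case 1 then show ?thesis using of_int_nonzero assms(4) by simp
  next
    case 2 then show ?thesis using separated[of i j l] assms by (simp add: algebra_simps)
  next
    case 3
    then have "of_int (- l) + v j - v i \<noteq> 0" using separated[of j i "- l"] assms by simp
    then show ?thesis by (simp add: algebra_simps)
  qed
qed

text \<open>Addable boxes of one component never lie on neighbouring diagonals, and the bound on
  bits keeps \<open>l - m - c\<close> in the range controlled by the parameters. The two spare units
  in \<open>k + 2 \<le> n\<close> pay for the shift by one in \<open>addable\<close> and for
  \<open>c\<close>.\<close>

lemma addable_nonadjacent:
  assumes "std_weight v d k w S" "k + 2 \<le> n" "addable S \<zeta> i l" "addable S \<zeta> j m"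
    "i \<in> {1..d}" "j \<in> {1..d}" "(i, l) \<noteq> (j, m)" "\<bar>c\<bar> \<le> 1"
  shows "v i + of_int l \<noteq> v j + of_int m + of_int c"
proof -
  have 1: "m - 1 - l \<le> int k - (if i \<noteq> j then 1 else 0)" "l - 1 - m \<le> int k - (if j \<noteq> i then 1 else 0)"
    using std_weight_bits[OF assms(1), of \<zeta> i l j "m - 1"] std_weight_bits[OF assms(1), of \<zeta> j m i "l - 1"]
      assms(3,4) by (auto simp: addable_def)
  have "m \<noteq> l \<and> m \<noteq> l + 1 \<and> l \<noteq> m + 1" if "i = j"
    using assms that by (auto simp: addable_def)
  then have "v i - v j + of_int (l - m - c) \<noteq> 0"
    using 1 assms by (intro content_nonzero) (auto split: if_splits)
  then show ?thesis by (auto simp: algebra_simps)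
qed

text \<open>This makes the intertwiner that moves a removable box past a later one injective, since
  contents that are neither equal nor adjacent give a coefficient different from 1 and -1.\<close>

lemma addable_removable_nonadjacent:
  assumes "std_weight v d k w S" "k + 2 \<le> n" "addable S \<zeta> i l" "removable S \<zeta> j m"
    "i \<in> {1..d}" "j \<in> {1..d}" "i = j \<Longrightarrow> \<bar>l - m\<bar> > 1" "\<bar>c\<bar> \<le> 1"
  shows "v i + of_int l \<noteq> v j + of_int m + of_int c"
proof -
  have 1: "m - l \<le> int k - (if i \<noteq> j then 1 else 0)" "l - 1 - (m - 1) \<le> int k - (if j \<noteq> i then 1 else 0)"
    using std_weight_bits[OF assms(1), of \<zeta> i l j m] std_weight_bits[OF assms(1), of \<zeta> j "m - 1" i "l - 1"]
      assms(3,4) by (auto simp: addable_def removable_def)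
  have "v i - v j + of_int (l - m - c) \<noteq> 0"
    using 1 assms by (intro content_nonzero) (auto split: if_splits)
  then show ?thesis by (auto simp: algebra_simps)
qed

end

section \<open>Weights of cyclotomic Yokonuma-Hecke algebras\<close>

context summand_algebra
begin

text \<open>Products enter only as left multiplication by a generator, so inductions have a single
  product case; closure under all products is a consequence.\<close>

inductive_set gen_alg :: "'v set \<Rightarrow> 'v set" for G where
  gen_one: "one \<in> gen_alg G"
| gen_add: "a \<in> gen_alg G \<Longrightarrow> b \<in> gen_alg G \<Longrightarrow> a + b \<in> gen_alg G"
| gen_scale: "a \<in> gen_alg G \<Longrightarrow> k *s a \<in> gen_alg G"
| gen_mul: "g \<in> G \<Longrightarrow> a \<in> gen_alg G \<Longrightarrow> g \<star> a \<in> gen_alg G"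

lemma gen_alg_C: "G \<subseteq> C \<Longrightarrow> a \<in> gen_alg G \<Longrightarrow> a \<in> C"
  by (rotate_tac, induction rule: gen_alg.induct) auto

lemma gen_alg_zero: "0 \<in> gen_alg G"
  using gen_scale[OF gen_one, of 0] by simp

lemma gen_alg_subspace: "subspace (gen_alg G)"
  unfolding subspace_def by (auto intro: gen_add gen_scale gen_alg_zero)

lemma gen_alg_mono: "G \<subseteq> H \<Longrightarrow> gen_alg G \<subseteq> gen_alg H"
proof
  fix a assume "G \<subseteq> H" "a \<in> gen_alg G"
  from this(2,1) show "a \<in> gen_alg H"
    by (induction rule: gen_alg.induct) (auto intro: gen_alg.intros)
qed

lemma gen_alg_mul:
  assumes "G \<subseteq> C" "a \<in> gen_alg G" "b \<in> gen_alg G"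
  shows "a \<star> b \<in> gen_alg G"
  using assms(2) gen_alg_C[OF assms(1,3)]
  by (induction rule: gen_alg.induct) (auto simp: assms(3) mul_distrib mul_scale mul_assoc intro: gen_alg.intros)

text \<open>
  The rank two computation: with \<open>R\<close> the product of the factors \<open>Y - c\<close>, one has
  \<open>(X - a)\<^sup>2 f R(Y) z = ((X - a)\<^sup>2 - 1) R(X) m + R(a) m\<close> for \<open>z = f m\<close>.
\<close>

lemma rank_two:
  assumes U: "subspace U" "\<And>u. u \<in> U \<Longrightarrow> y \<star> u \<in> U" "z \<in> U"
    and f: "\<And>u. u \<in> U \<Longrightarrow> f \<star> (y \<star> u) = x \<star> (f \<star> u) - u" "f \<star> z = m" "x \<star> z = a *s z + m"
    and XY: "x \<star> y = y \<star> x" "y \<star> m = a *s m"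
    and R: "lin y (a # R) z = 0"
  shows "lin x ((a + 1) # (a - 1) # R) m = 0"
proof -
  let ?P = "\<lambda>u. x \<star> u - a *s u"
  have linU: "lin y cs z \<in> U" for cs by (rule lin_in[OF U])
  \<comment> \<open>\<open>x - a\<close> commutes with the factors in \<open>y\<close>, turns
    \<open>z\<close> into \<open>m\<close>, and \<open>m\<close> is an eigenvector of
    \<open>y\<close>.\<close>
  have PA: "?P (lin y cs z) = (\<Prod>c\<leftarrow>cs. a - c) *s m" for cs
  proof -
    have "?P (lin y cs z) = lin y cs (?P z)"
      using lin_mul_commute[of y x cs z] XY(1) by simp
    also have "?P z = m" using f(3) by simp
    finally show ?thesis using lin_eigen[OF XY(2)] by simp
  qed
  have main: "?P (?P (f \<star> lin y cs z)) = ?P (?P (lin x cs m)) - lin x cs m + (\<Prod>c\<leftarrow>cs. a - c) *s m" for cs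
  proof (induction cs)
    case Nil then show ?case by (simp add: f(2))
  next
    case (Cons c cs)
    let ?A = "lin y cs z" and ?B = "lin x cs m" and ?r = "\<Prod>c\<leftarrow>cs. a - c"
    have "f \<star> lin y (c # cs) z = x \<star> (f \<star> ?A) - ?A - c *s (f \<star> ?A)"
      using f(1)[OF linU] by (simp add: mul_simps)
    then have eq: "f \<star> lin y (c # cs) z = x \<star> (f \<star> ?A) - ?A - c *s (f \<star> ?A)" .
    have "?P (?P (f \<star> lin y (c # cs) z)) =
        x \<star> ?P (?P (f \<star> ?A)) - c *s ?P (?P (f \<star> ?A)) - ?P (?P ?A)"
      unfolding eq by (simp add: mul_simps algebra_simps)
    also have "\<dots> = x \<star> (?P (?P ?B) - ?B + ?r *s m) - c *s (?P (?P ?B) - ?B + ?r *s m) - ?P (?r *s m)"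
      unfolding Cons.IH PA ..
    also have "\<dots> =
      ?P (?P (lin x (c # cs) m)) - lin x (c # cs) m + (\<Prod>c\<leftarrow>c # cs. a - c) *s m"
      by (simp add: mul_simps algebra_simps)
    finally show ?case .
  qed
  \<comment> \<open>By hypothesis the product over \<open>R\<close> sends \<open>z\<close> to an
    eigenvector of \<open>y\<close> for \<open>a\<close>; there the relation between
    \<open>f\<close>, \<open>x\<close> and \<open>y\<close> says that \<open>?P\<close> undoes
    \<open>f\<close>. Comparing with \<open>main\<close>, the terms with the value of
    \<open>R\<close> at \<open>a\<close> cancel, and the square of \<open>x - a\<close> minus one
    splits into the factors for \<open>a + 1\<close> and \<open>a - 1\<close>.\<close>
  have "y \<star> lin y R z = a *s lin y R z" using R by simp
  then have "?P (f \<star> lin y R z) = lin y R z"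
    using f(1)[OF linU, of R] by (simp add: mul_simps algebra_simps)
  then have "?P (?P (f \<star> lin y R z)) = (\<Prod>c\<leftarrow>R. a - c) *s m" using PA by simp
  then have "?P (?P (lin x R m)) - lin x R m = 0" using main[of R] by simp
  then show ?thesis by (simp add: mul_simps algebra_simps)
qed

end

text \<open>The list \<open>Z\<close> stands for the \<open>r\<close>-th roots of unity, and
  \<open>r\<close> itself does not occur: \<open>e i\<close> is given only as an element generated
  by the \<open>t j\<close> with its prescribed action on joint eigenvectors of \<open>t i\<close>
  and \<open>t (i + 1)\<close>.\<close>

locale yh_algebra = summand_algebra scale mul one + separated_parameters n d v
  for scale :: "'k::field \<Rightarrow> 'v::ab_group_add \<Rightarrow> 'v" (infixr "*s" 75)
    and mul :: "'v \<Rightarrow> 'v \<Rightarrow> 'v" (infixl "\<star>" 72) and one :: 'v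
    and n d :: nat and v :: "nat \<Rightarrow> 'k" +
  fixes Z :: "'k list" and t f x e :: "nat \<Rightarrow> 'v"
  assumes t_C: "i \<in> {1..n} \<Longrightarrow> t i \<in> C" and x_C: "i \<in> {1..n} \<Longrightarrow> x i \<in> C"
    and f_C: "i \<in> {1..<n} \<Longrightarrow> f i \<in> C"
    and ff: "i \<in> {1..<n} \<Longrightarrow> f i \<star> f i = one"
    and braid: "i \<in> {1..<n} \<Longrightarrow> i + 1 \<in> {1..<n} \<Longrightarrow> f i \<star> f (i + 1) \<star> f i = f (i + 1) \<star> f i \<star> f (i + 1)"
    and f_far: "i \<in> {1..<n} \<Longrightarrow> j \<in> {1..<n} \<Longrightarrow> i + 1 < j \<Longrightarrow> f i \<star> f j = f j \<star> f i"
    and tt: "i \<in> {1..n} \<Longrightarrow> j \<in> {1..n} \<Longrightarrow> t i \<star> t j = t j \<star> t i"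
    and xx: "i \<in> {1..n} \<Longrightarrow> j \<in> {1..n} \<Longrightarrow> x i \<star> x j = x j \<star> x i"
    and tx: "i \<in> {1..n} \<Longrightarrow> j \<in> {1..n} \<Longrightarrow> t i \<star> x j = x j \<star> t i"
    and ft: "i \<in> {1..<n} \<Longrightarrow> j \<in> {1..n} \<Longrightarrow> f i \<star> t j = t (Transposition.transpose i (i + 1) j) \<star> f i"
    and fx: "i \<in> {1..<n} \<Longrightarrow> f i \<star> x (i + 1) = x i \<star> f i + e i"
    and fx': "i \<in> {1..<n} \<Longrightarrow> j \<in> {1..n} \<Longrightarrow> j \<noteq> i \<Longrightarrow> j \<noteq> i + 1 \<Longrightarrow> f i \<star> x j = x j \<star> f i"
    and e_gen: "i \<in> {1..<n} \<Longrightarrow> e i \<in> gen_alg (t ` {1..n})"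
    and e_eigen: "i \<in> {1..<n} \<Longrightarrow> m \<in> C \<Longrightarrow> z \<in> set Z \<Longrightarrow> z' \<in> set Z \<Longrightarrow>
      t i \<star> m = z *s m \<Longrightarrow> t (i + 1) \<star> m = z' *s m \<Longrightarrow> e i \<star> m = (if z = z' then m else 0)"
    and Z_distinct: "distinct Z"
    and t_lin: "i \<in> {1..n} \<Longrightarrow> m \<in> C \<Longrightarrow> lin (t i) Z m = 0"
    and x_lin: "m \<in> C \<Longrightarrow> lin (x 1) (map v [1..<Suc d]) m = 0"
    and generated: "C \<subseteq> gen_alg (t ` {1..n} \<union> f ` {1..<n} \<union> x ` {1..n})"
    and n_pos: "1 \<le> n"
begin

section \<open>Weight spaces and intertwiners\<close>

abbreviation s :: "nat \<Rightarrow> nat \<Rightarrow> nat" where "s i \<equiv> Transposition.transpose i (i + 1)"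

text \<open>Eigenspaces of left multiplication on the algebra itself. All \<open>t i\<close> are
  diagonalized from the outset but only the first \<open>k\<close> of the \<open>x i\<close>, so
  that these can be treated one at a time.\<close>

definition wt :: "nat \<Rightarrow> (nat \<Rightarrow> 'k \<times> 'k) \<Rightarrow> 'v set" where
  "wt k w = {m \<in> C. (\<forall>i\<in>{1..n}. t i \<star> m = fst (w i) *s m) \<and> (\<forall>i\<in>{1..k}. x i \<star> m = snd (w i) *s m)}"

lemma wt_C: "m \<in> wt k w \<Longrightarrow> m \<in> C" by (simp add: wt_def)

lemma wt_subspace: "subspace (wt k w)"
  unfolding subspace_def wt_def by (auto simp: mul_simps)

lemma wt_mono: "m \<in> wt k w \<Longrightarrow> j \<le> k \<Longrightarrow> m \<in> wt j w"
  unfolding wt_def by auto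

lemma wt_cong: "(\<And>i. i \<in> {1..n} \<Longrightarrow> w i = w' i) \<Longrightarrow> k \<le> n \<Longrightarrow> wt k w = wt k w'"
  unfolding wt_def by auto

lemma wt_mul_right: "m \<in> wt k w \<Longrightarrow> a \<in> C \<Longrightarrow> m \<star> a \<in> wt k w"
  unfolding wt_def by (auto simp: mul_assoc[symmetric] mul_scale)

lemma wt_x: "m \<in> wt k w \<Longrightarrow> k \<le> n \<Longrightarrow> i \<in> {1..n} \<Longrightarrow> x i \<star> m \<in> wt k w"
proof -
  assume m: "m \<in> wt k w" and k: "k \<le> n" and i: "i \<in> {1..n}"
  have "t j \<star> (x i \<star> m) = x i \<star> (t j \<star> m)" if "j \<in> {1..n}" for j
    using tx[OF that i] by (simp add: mul_assoc[symmetric])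
  moreover have "x j \<star> (x i \<star> m) = x i \<star> (x j \<star> m)" if "j \<in> {1..k}" for j
    using xx[OF _ i, of j] that k by (simp add: mul_assoc[symmetric])
  ultimately show ?thesis
    using m x_C[OF i] by (simp add: wt_def mul_scale)
qed

text \<open>A nonzero joint eigenvector has its eigenvalues in \<open>Z\<close>, where the action of
  \<open>e i\<close> is prescribed.\<close>

lemma e_wt:
  assumes "i \<in> {1..<n}" "m \<in> C" "t i \<star> m = z *s m" "t (i + 1) \<star> m = z' *s m"
  shows "e i \<star> m = (if z = z' then m else 0)"
proof (cases "m = 0")
  case False
  have "lin (t i) Z m = 0" "lin (t (i + 1)) Z m = 0" using t_lin assms by auto
  then have "z \<in> set Z" "z' \<in> set Z" using lin_eigen_zero assms False by blast+
  then show ?thesis using e_eigen assms by blast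
qed simp

lemma ff_mul: "i \<in> {1..<n} \<Longrightarrow> m \<in> C \<Longrightarrow> f i \<star> (f i \<star> m) = m"
  by (simp add: mul_assoc[symmetric] ff)

lemma f_t:
  assumes "i \<in> {1..<n}" "m \<in> wt k w" "j \<in> {1..n}"
  shows "t j \<star> (f i \<star> m) = fst (w (s i j)) *s (f i \<star> m)"
proof -
  have sj: "s i j \<in> {1..n}" using assms by (auto simp: Transposition.transpose_def)
  have "f i \<star> t (s i j) = t j \<star> f i" using ft[OF assms(1) sj] by simp
  then have "t j \<star> (f i \<star> m) = f i \<star> (t (s i j) \<star> m)" by (simp add: mul_assoc[symmetric])
  then show ?thesis using assms sj by (simp add: wt_def mul_scale)
qed

lemma e_f:
  assumes "i \<in> {1..<n}" "m \<in> wt k w"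
  shows "e i \<star> m = (if fst (w i) = fst (w (i + 1)) then m else 0)"
    "e i \<star> (f i \<star> m) = (if fst (w i) = fst (w (i + 1)) then f i \<star> m else 0)"
proof -
  show "e i \<star> m = (if fst (w i) = fst (w (i + 1)) then m else 0)"
    using assms by (intro e_wt) (auto simp: wt_def)
  have "e i \<star> (f i \<star> m) = (if fst (w (i + 1)) = fst (w i) then f i \<star> m else 0)"
    using assms f_t[OF assms, of i] f_t[OF assms, of "i + 1"] wt_C[OF assms(2)] f_C
    by (intro e_wt) (auto simp: Transposition.transpose_def)
  then show "e i \<star> (f i \<star> m) = (if fst (w i) = fst (w (i + 1)) then f i \<star> m else 0)"
    by (auto split: if_splits)
qed

lemma x_f:
  assumes "i \<in> {1..<n}" "m \<in> wt k w"
  shows "x (i + 1) \<star> (f i \<star> m) = f i \<star> (x i \<star> m) + (if fst (w i) = fst (w (i + 1)) then m else 0)"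
    "f i \<star> (x (i + 1) \<star> m) = x i \<star> (f i \<star> m) + (if fst (w i) = fst (w (i + 1)) then m else 0)"
proof -
  have m: "m \<in> C" "f i \<star> m \<in> C" "x i \<in> C" "x (i + 1) \<in> C" "f i \<in> C"
    using assms wt_C f_C x_C by auto
  have *: "f i \<star> (x (i + 1) \<star> u) = x i \<star> (f i \<star> u) + e i \<star> u" for u
    using fx[OF assms(1)] by (metis mul_assoc mul_distrib(1))
  show "f i \<star> (x (i + 1) \<star> m) = x i \<star> (f i \<star> m) + (if fst (w i) = fst (w (i + 1)) then m else 0)"
    using * e_f[OF assms] by simp
  \<comment> \<open>Conjugation by the involution \<open>f i\<close> exchanges the roles of
    \<open>x i\<close> and \<open>x (i + 1)\<close> in the commutation relation.\<close>
  have "x (i + 1) \<star> (f i \<star> m) = f i \<star> (f i \<star> (x (i + 1) \<star> (f i \<star> m)))"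
    using ff_mul[OF assms(1)] m by simp
  also have "\<dots> = f i \<star> (x i \<star> m) + f i \<star> (if fst (w i) = fst (w (i + 1)) then f i \<star> m else 0)"
    unfolding * using ff_mul[OF assms(1)] m e_f[OF assms] by (simp add: mul_distrib)
  finally show "x (i + 1) \<star> (f i \<star> m) = f i \<star> (x i \<star> m) + (if fst (w i) = fst (w (i + 1)) then m else 0)"
    using ff_mul[OF assms(1)] m by simp
qed

lemma f_x_far:
  assumes "i \<in> {1..<n}" "m \<in> wt k w" "j \<in> {1..k}" "k \<le> n" "j \<noteq> i" "j \<noteq> i + 1"
  shows "x j \<star> (f i \<star> m) = snd (w j) *s (f i \<star> m)"
proof -
  have "x j \<star> (f i \<star> m) = f i \<star> (x j \<star> m)"
    using fx'[of i j] assms by (simp add: mul_assoc[symmetric])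
  then show ?thesis using assms by (simp add: wt_def mul_scale)
qed

text \<open>For \<open>k < i\<close> the first \<open>k\<close> of the \<open>x j\<close> commute
  with \<open>f i\<close>, which merely permutes the \<open>t j\<close>; no correction term
  arises.\<close>

lemma f_low:
  assumes "i \<in> {1..<n}" "m \<in> wt k w" "k < i"
  shows "f i \<star> m \<in> wt k (w \<circ> s i)"
  using f_t[OF assms(1,2)] f_x_far[OF assms(1,2)] assms wt_C[OF assms(2)] f_C[OF assms(1)]
  by (auto simp: wt_def)

text \<open>The diagonal coefficient of \<open>f i\<close> in Young's seminormal form. For different
  colours \<open>e i\<close> acts by zero and \<open>f i\<close> is a pure permutation.\<close>

definition coef :: "(nat \<Rightarrow> 'k \<times> 'k) \<Rightarrow> nat \<Rightarrow> 'k" where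
  "coef w i = (if fst (w i) = fst (w (i + 1)) then 1 / (snd (w (i + 1)) - snd (w i)) else 0)"

text \<open>The intertwiner: subtracting the diagonal part of \<open>f i\<close> cancels the
  correction terms in its commutation with \<open>x i\<close> and \<open>x (i + 1)\<close>.\<close>

lemma f_swap:
  assumes i: "i \<in> {1..<n}" and m: "m \<in> wt k w" and k: "i + 1 \<le> k" "k \<le> n" and w: "w i \<noteq> w (i + 1)"
  shows "f i \<star> m - coef w i *s m \<in> wt k (w \<circ> s i)"
proof -
  let ?u = "f i \<star> m - coef w i *s m"
  have mC: "m \<in> C" "f i \<in> C" using wt_C m f_C i by auto
  have xm: "x j \<star> m = snd (w j) *s m" if "j \<in> {1..k}" for j using m that by (simp add: wt_def)
  have tm: "t j \<star> m = fst (w j) *s m" if "j \<in> {1..n}" for j using m that by (simp add: wt_def)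
  have "t j \<star> ?u = fst ((w \<circ> s i) j) *s ?u" if j: "j \<in> {1..n}" for j
  proof (cases "fst (w i) = fst (w (i + 1))")
    case True
    then have "fst (w (s i j)) = fst (w j)" by (auto simp: Transposition.transpose_def)
    then show ?thesis using f_t[OF i m j] tm[OF j] by (simp add: mul_simps)
  next
    case False
    then show ?thesis using f_t[OF i m j] by (simp add: coef_def)
  qed
  moreover have "x j \<star> ?u = snd ((w \<circ> s i) j) *s ?u" if j: "j \<in> {1..k}" for j
  proof -
    let ?\<delta> = "if fst (w i) = fst (w (i + 1)) then 1 else 0 :: 'k"
    have \<delta>: "(if fst (w i) = fst (w (i + 1)) then m else 0) = ?\<delta> *s m" by simp
    \<comment> \<open>The equation that determines \<open>coef\<close>. For equal colours the
      hypothesis on \<open>w\<close> makes the two contents different, so that one may divide; for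
      different colours both extra terms are zero.\<close>
    have c: "coef w i * snd (w (i + 1)) = coef w i * snd (w i) + ?\<delta>"
      using w by (auto simp: coef_def prod_eq_iff field_simps)
    have xi: "x i \<star> m = snd (w i) *s m" "x (i + 1) \<star> m = snd (w (i + 1)) *s m"
      using xm k i by auto
    consider "j = i" | "j = i + 1" | "j \<noteq> i" "j \<noteq> i + 1" by blast
    then show ?thesis
    proof cases
      case 1
      have "x i \<star> (f i \<star> m) = snd (w (i + 1)) *s (f i \<star> m) - ?\<delta> *s m"
        using x_f(2)[OF i m] xi \<delta> by (simp add: mul_scale)
      then have "x i \<star> ?u = snd (w (i + 1)) *s (f i \<star> m) - (coef w i * snd (w i) + ?\<delta>) *s m"
        using xi by (simp add: mul_simps algebra_simps)
      also have "\<dots> = snd (w (i + 1)) *s ?u"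
        unfolding c[symmetric] by (simp add: mul_simps algebra_simps)
      finally show ?thesis using 1 by simp
    next
      case 2
      have "x (i + 1) \<star> (f i \<star> m) = snd (w i) *s (f i \<star> m) + ?\<delta> *s m"
        using x_f(1)[OF i m] xi \<delta> by (simp add: mul_scale)
      then have "x (i + 1) \<star> ?u = snd (w i) *s (f i \<star> m) + ?\<delta> *s m - (coef w i * snd (w (i + 1))) *s m"
        using xi by (simp add: mul_simps)
      also have "\<dots> = snd (w i) *s ?u"
        unfolding c by (simp add: mul_simps algebra_simps)
      finally show ?thesis using 2 by simp
    next
      case 3
      then show ?thesis using f_x_far[OF i m j k(2)] xm[OF j]
        by (simp add: mul_simps)
    qed
  qed
  ultimately show ?thesis using mC by (auto simp: wt_def)
qed

text \<open>A vanishing difference would make \<open>m\<close> an eigenvector of the involution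
  \<open>f i\<close> with eigenvalue \<open>c\<close>, so \<open>c * c = 1\<close>.\<close>

lemma f_swap_nonzero:
  assumes "i \<in> {1..<n}" "m \<in> C" "m \<noteq> 0" "c \<noteq> 1" "c \<noteq> - 1"
  shows "f i \<star> m - c *s m \<noteq> 0"
proof
  assume "f i \<star> m - c *s m = 0"
  then have fm: "f i \<star> m = c *s m" by simp
  then have "m = (c * c) *s m" using ff_mul[OF assms(1,2)] by (simp add: mul_scale)
  then have "(c * c - 1) *s m = 0" by (simp only: scale_left_diff_distrib scale_one right_minus_eq)
  then have "c * c - 1 = 0" using assms(3) unfolding scale_eq_0_iff by blast
  then have "(c - 1) * (c + 1) = 0" by (simp add: algebra_simps)
  then show False using assms(4,5) by (auto simp: eq_neg_iff_add_eq_0)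
qed

text \<open>The statement proved by induction: on a weight vector whose first \<open>k\<close>
  entries come from a tableau of shape \<open>S\<close>, the next element \<open>x (Suc k)\<close>
  is annihilated by a product of distinct factors whose roots are contents of addable boxes of the
  right colour.\<close>

definition diag :: "nat \<Rightarrow> bool" where
  "diag k \<longleftrightarrow> (\<forall>w S. \<forall>m\<in>wt k w. std_weight v d k w S \<longrightarrow>
    (\<exists>cs. distinct cs \<and> set cs \<subseteq> addable_contents v d S (fst (w (Suc k))) \<and> lin (x (Suc k)) cs m = 0))"

text \<open>Each \<open>diag j\<close> forces the next entry of the weight to be the content of an
  addable box, so the tableau grows box by box.\<close>

lemma wt_std:
  assumes "\<And>j. j < k \<Longrightarrow> diag j" "k \<le> n" "m \<in> wt k w" "m \<noteq> 0"
  shows "\<exists>S. std_weight v d k w S"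
  using assms
proof (induction k)
  case 0 then show ?case by (auto intro: std_weight.intros)
next
  case (Suc k)
  have m: "m \<in> wt k w" using wt_mono[OF Suc.prems(3)] by simp
  then obtain S where S: "std_weight v d k w S" using Suc by force
  from Suc.prems(1)[of k] m S obtain cs where cs: "set cs \<subseteq> addable_contents v d S (fst (w (Suc k)))"
    "lin (x (Suc k)) cs m = 0" unfolding diag_def by blast
  have "x (Suc k) \<star> m = snd (w (Suc k)) *s m" using Suc.prems(3) by (simp add: wt_def)
  then have "snd (w (Suc k)) \<in> set cs" using lin_eigen_zero cs Suc.prems(4) by blast
  then obtain j l where "j \<in> {1..d}" "addable S (fst (w (Suc k))) j l" "snd (w (Suc k)) = v j + of_int l"
    using cs(1) by (auto simp: addable_contents_def)
  then show ?case
    using S by (metis prod.collapse std_weight.intros(2))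
qed

text \<open>If the entries \<open>i\<close> and \<open>i + 1\<close> agree,
  \<open>f i \<star> m\<close> and \<open>m\<close> form a Jordan block of size two for
  \<open>x i\<close>. But \<open>diag (i - 1)\<close> applies to \<open>f i \<star> m\<close>, which
  still has a weight for the first \<open>i - 1\<close> places, and gives \<open>x i\<close> simple
  roots there.\<close>

lemma wt_equal_zero:
  assumes dg: "\<And>j. j < i \<Longrightarrow> diag j" and i: "i \<in> {1..<n}" and m: "m \<in> wt k w"
    and k: "i + 1 \<le> k" "k \<le> n" and w: "w i = w (i + 1)"
  shows "m = 0"
proof (cases "f i \<star> m = 0")
  case True
  then show ?thesis using ff_mul[OF i wt_C[OF m]] by simp
next
  case False
  let ?z = "f i \<star> m"
  have z: "?z \<in> wt (i - 1) (w \<circ> s i)" using m k i by (intro f_low) (auto intro: wt_mono)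
  have dg': "diag j" if "j < i - 1" for j using dg[of j] that by simp
  have "\<exists>S. std_weight v d (i - 1) (w \<circ> s i) S"
    using i by (intro wt_std[OF dg' _ z False]) auto
  then obtain S where S: "std_weight v d (i - 1) (w \<circ> s i) S" by blast
  have "diag (i - 1)" using dg i by simp
  then obtain cs where cs: "distinct cs" "lin (x i) cs ?z = 0"
    using S z i unfolding diag_def by fastforce
  have xi: "x i \<star> m = snd (w i) *s m" "x (i + 1) \<star> m = snd (w i) *s m"
    using m k i w by (auto simp: wt_def)
  have "x i \<star> ?z - snd (w i) *s ?z = - m"
    using x_f(2)[OF i m] xi w by (simp add: mul_simps algebra_simps)
  then have "- m = 0" using xi by (intro lin_distinct_square[OF cs]) (auto simp: mul_minus)
  then show ?thesis by simp
qed

text \<open>Both intertwiners send \<open>m\<close> to a weight with equal neighbours, hence to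
  zero, so \<open>f i\<close> and \<open>f (i + 1)\<close> act on \<open>m\<close> by opposite
  scalars \<open>c\<close> and \<open>- c\<close>. The braid relation then says that
  \<open>c * c * c\<close> equals its own negative.\<close>

lemma wt_braid_zero:
  assumes dg: "\<And>j. j < i + 1 \<Longrightarrow> diag j" and i: "i \<in> {1..<n}" "i + 1 \<in> {1..<n}" and m: "m \<in> wt k w"
    and k: "i + 2 \<le> k" "k \<le> n"
    and w: "w i = (\<zeta>, b)" "w (i + 1) = (\<zeta>, a)" "w (i + 2) = (\<zeta>, b)" "b = a + 1 \<or> b = a - 1"
    and two: "(2::'k) \<noteq> 0"
  shows "m = 0"
proof (rule ccontr)
  assume m0: "m \<noteq> 0"
  have ab: "b \<noteq> a" using w(4) by (metis add_cancel_right_right diff_0_right right_minus_eq zero_neq_one add_diff_cancel_right' diff_add_cancel)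
  define c where "c = 1 / (a - b)"
  have cc: "c = 1 \<or> c = - 1" using w(4) by (auto simp: c_def)
  have "f i \<star> m - coef w i *s m \<in> wt k (w \<circ> s i)"
    using f_swap[OF i(1) m] k w ab by auto
  then have "f i \<star> m - coef w i *s m = 0"
    using k i w dg by (intro wt_equal_zero[of "i + 1" _ k "w \<circ> s i"]) (auto simp: Transposition.transpose_def)
  then have f1: "f i \<star> m = c *s m" using w by (simp add: coef_def c_def)
  have "f (i + 1) \<star> m - coef w (i + 1) *s m \<in> wt k (w \<circ> s (i + 1))"
    using f_swap[OF i(2) m] k w ab by auto
  then have "f (i + 1) \<star> m - coef w (i + 1) *s m = 0"
    using k i w dg by (intro wt_equal_zero[of i _ k "w \<circ> s (i + 1)"]) (auto simp: Transposition.transpose_def)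
  moreover have "coef w (i + 1) = - c" using w ab by (simp add: coef_def c_def field_simps minus_divide_right)
  ultimately have f2: "f (i + 1) \<star> m = (- c) *s m" by simp
  have "f i \<star> (f (i + 1) \<star> (f i \<star> m)) = f (i + 1) \<star> (f i \<star> (f (i + 1) \<star> m))"
    using braid[OF i] by (simp add: mul_assoc[symmetric])
  then have "(- (c * c * c)) *s m = (c * c * c) *s m"
    unfolding f1 f2 mul_scale by (simp add: f1 f2 mul_scale algebra_simps)
  then have "(c * c * c) *s m + (c * c * c) *s m = 0"
    by (simp add: neg_eq_iff_add_eq_0)
  then have "(2 * (c * c * c)) *s m = 0" by (simp only: mult_2 scale_left_distrib)
  then show False using m0 two cc by auto
qed

end

text \<open>Prepares \<open>rank_two\<close>, which expects the root \<open>a\<close> in front: it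
  is pulled forward if present and inserted if absent.\<close>

lemma (in summand_algebra) lin_remove:
  assumes "distinct cs" "lin y cs m = 0"
  shows "lin y (a # removeAll a cs) m = 0"
proof (cases "a \<in> set cs")
  case True
  then obtain bs ds where cs: "cs = bs @ a # ds" by (auto simp: in_set_conv_decomp)
  then have "removeAll a cs = bs @ ds" using assms(1) by simp
  then show ?thesis using assms(2) by (simp add: cs lin_append lin_mul_commute[OF refl])
qed (use assms in simp)

lemma not_removable_empty: "std_weight v d 0 w S \<Longrightarrow> \<not> removable S \<zeta> j l"
  by (elim std_weight_0E) (auto simp: removable_def)

context yh_algebra
begin

text \<open>Every removable box of a multipartition may be assumed to be the last one added.\<close>

lemma move_removable:
  assumes "std_weight v d k w S" "k + 1 \<le> n" "removable S \<zeta> j l" "j \<in> {1..d}"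
    "u \<in> wt K w" "u \<noteq> 0" "k \<le> K" "K \<le> n"
  shows "\<exists>w' u'. u' \<in> wt K w' \<and> u' \<noteq> 0 \<and> w' k = (\<zeta>, v j + of_int l) \<and> (\<forall>i>k. w' i = w i)"
  using assms
proof (induction k arbitrary: S)
  case 0 then show ?case using not_removable_empty by blast
next
  case (Suc k)
  from Suc.prems(1) obtain S' i a \<zeta>' where S: "S = add_box S' \<zeta>' i a" "std_weight v d k w S'"
    "i \<in> {1..d}" "w (Suc k) = (\<zeta>', v i + of_int a)" "addable S' \<zeta>' i a"
    by (elim std_weight_SucE) auto
  show ?case
  proof (cases "\<zeta>' = \<zeta> \<and> i = j \<and> a = l")
    case True
    then show ?thesis using S(4) Suc.prems by blast
  next
    case False
    \<comment> \<open>The box was removable already before the last step. The induction hypothesis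
      makes it box number \<open>k\<close>, and the intertwiner for the places \<open>k\<close> and
      \<open>k + 1\<close> exchanges it with the last box.\<close>
    have rem: "removable S' \<zeta> j l" and far: "\<zeta>' = \<zeta> \<Longrightarrow> i = j \<Longrightarrow> \<bar>a - l\<bar> > 1"
      using Suc.prems(3) False by (auto simp: S(1) add_box_def removable_def split: if_splits)
    then have "k \<noteq> 0" using S(2) not_removable_empty by metis
    have "\<exists>w' u'. u' \<in> wt K w' \<and> u' \<noteq> 0 \<and> w' k = (\<zeta>, v j + of_int l) \<and> (\<forall>i>k. w' i = w i)"
      using Suc.prems by (intro Suc.IH[OF S(2) _ rem]) auto
    then obtain w' u' where w': "u' \<in> wt K w'" "u' \<noteq> 0" "w' k = (\<zeta>, v j + of_int l)"
      "\<And>i. i > k \<Longrightarrow> w' i = w i" by blast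
    have wk: "w' (k + 1) = (\<zeta>', v i + of_int a)" using w'(4) S(4) by simp
    have k: "k \<in> {1..<n}" using Suc.prems \<open>k \<noteq> 0\<close> by auto
    have ne: "v i + of_int a \<noteq> v j + of_int l + of_int c" if "\<bar>c\<bar> \<le> 1" "\<zeta>' = \<zeta>" for c
      using S(2) Suc.prems S(3,5) rem far that
      by (intro addable_removable_nonadjacent[where S = S' and \<zeta> = \<zeta>]) auto
    have "w' k \<noteq> w' (k + 1)" using w'(3) wk ne[of 0] by auto
    then have "f k \<star> u' - coef w' k *s u' \<in> wt K (w' \<circ> s k)"
      using Suc.prems by (intro f_swap k w') auto
    moreover have "coef w' k \<noteq> 1" "coef w' k \<noteq> - 1"
      using w'(3) wk ne[of 0] ne[of 1] ne[of "- 1"]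
      by (auto simp: coef_def field_simps minus_divide_right)
    then have "f k \<star> u' - coef w' k *s u' \<noteq> 0"
      by (intro f_swap_nonzero k w' wt_C[OF w'(1)])
    moreover have "(w' \<circ> s k) (Suc k) = (\<zeta>, v j + of_int l)" using w'(3) by simp
    moreover have "(w' \<circ> s k) q = w q" if "q > Suc k" for q
      using that w'(4) by (simp add: Transposition.transpose_def)
    ultimately show ?thesis by blast
  qed
qed

text \<open>If a box of content \<open>c\<close> next to the new box cannot be added afterwards,
  then one of that content was removable before. Moving it to place \<open>k - 1\<close> produces a
  vector with entries \<open>c\<close>, \<open>c \<plusminus> 1\<close>, \<open>c\<close> at the
  places \<open>k - 1\<close>, \<open>k\<close>, \<open>k + 1\<close>, which the braid relation
  excludes.\<close>

lemma wt_not_addable_zero: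
  assumes dg: "\<And>j. j < k \<Longrightarrow> diag j" and k: "k \<in> {1..<n}" and S: "std_weight v d (k - 1) w S"
    and add: "addable S \<zeta> j l" "j \<in> {1..d}" and w: "w k = (\<zeta>, v j + of_int l)" "fst (w (k + 1)) = \<zeta>"
    and u: "u \<in> wt k w" "x (k + 1) \<star> u = c *s u"
    and c: "c = v j + of_int l + 1 \<or> c = v j + of_int l - 1"
    and na: "c \<notin> addable_contents v d (add_box S \<zeta> j l) \<zeta>"
  shows "u = 0"
proof (rule ccontr)
  assume u0: "u \<noteq> 0"
  have nq: "\<not> addable (add_box S \<zeta> j l) \<zeta> j q" if "c = v j + of_int q" for q
    using na add(2) that unfolding addable_contents_def by blast
  \<comment> \<open>Adding the box writes 1 at \<open>l - 1\<close> and 0 at \<open>l\<close>. So a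
    failure to be addable at \<open>l + 1\<close> comes from a 0 there, and at \<open>l - 1\<close>
    from a 1 at \<open>l - 2\<close>; with the old bits at \<open>l\<close> and \<open>l - 1\<close>
    this is the pattern of a removable box.\<close>
  obtain l' where l': "c = v j + of_int l'" "removable S \<zeta> j l'"
  proof (cases "c = v j + of_int l + 1")
    case True
    then have "c = v j + of_int (l + 1)" by simp
    with nq[OF this] show ?thesis
      using add by (intro that[of "l + 1"]) (auto simp: removable_def addable_def add_box_def)
  next
    case False
    then have "c = v j + of_int (l - 1)" using c by simp
    with nq[OF this] show ?thesis
      using add by (intro that[of "l - 1"]) (auto simp: removable_def addable_def add_box_def)
  qed
  define w1 where "w1 = w(k + 1 := (\<zeta>, c))"
  have u1: "u \<in> wt (k + 1) w1"
    using u w unfolding wt_def w1_def by (auto simp: le_Suc_eq)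
  have S1: "std_weight v d (k - 1) w1 S"
    by (rule std_weight_cong[OF S]) (auto simp: w1_def)
  have "\<exists>w' u'. u' \<in> wt (k + 1) w' \<and> u' \<noteq> 0 \<and> w' (k - 1) = (\<zeta>, v j + of_int l') \<and> (\<forall>i>k - 1. w' i = w1 i)"
    by (rule move_removable[OF S1 _ l'(2) add(2) u1 u0]) (use k in auto)
  then obtain w2 u2 where 2: "u2 \<in> wt (k + 1) w2" "u2 \<noteq> 0" "w2 (k - 1) = (\<zeta>, c)"
    "\<And>i. i > k - 1 \<Longrightarrow> w2 i = w1 i"
    unfolding l'(1) by blast
  have "k - 1 \<noteq> 0" using S l'(2) not_removable_empty by metis
  define i where "i = k - 1"
  have i: "k = i + 1" "i \<in> {1..<n}" using k \<open>k - 1 \<noteq> 0\<close> by (auto simp: i_def)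
  have "(2::'k) \<noteq> 0" using of_int_nonzero[of 2] k by auto
  moreover have "w2 (i + 1) = (\<zeta>, v j + of_int l)" "w2 (i + 2) = (\<zeta>, c)"
    using 2(4) w i by (auto simp: w1_def)
  moreover have "w2 i = (\<zeta>, c)" using 2(3) by (simp add: i_def)
  moreover have "diag q" if "q < i + 1" for q using dg that i by simp
  ultimately have "u2 = 0" using k i c 2(1) by (intro wt_braid_zero[of i _ "k + 1" w2 \<zeta> c]) auto
  then show False using 2(2) by simp
qed

text \<open>The empty diagram has exactly the addable diagonals \<open>l = 0\<close>, of contents
  \<open>v j\<close>, so the cyclotomic relation supplies the root list. It has no repetition by
  separation at \<open>l = 0\<close>.\<close>

lemma diag_zero: "diag 0"
  unfolding diag_def
proof (intro allI ballI impI)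
  fix w S m assume m: "m \<in> wt 0 w" and S: "std_weight v d 0 w S"
  have "v i \<noteq> v j" if "1 \<le> i" "i < j" "j \<le> d" for i j
    using separated[OF that, of 0] n_pos by auto
  then have "inj_on v {1..d}" by (intro linorder_inj_onI) auto
  then have "distinct (map v [1..<Suc d])" by (simp add: distinct_map atLeastLessThanSuc_atLeastAtMost del: upt_Suc)
  moreover have "set (map v [1..<Suc d]) \<subseteq> addable_contents v d S (fst (w (Suc 0)))"
    using S by (elim std_weight_0E) (auto simp: addable_contents_def addable_def intro!: exI[of _ "0::int"])
  moreover have "lin (x (Suc 0)) (map v [1..<Suc d]) m = 0" using x_lin wt_C[OF m] by simp
  ultimately show "\<exists>cs. distinct cs \<and> set cs \<subseteq> addable_contents v d S (fst (w (Suc 0))) \<and> lin (x (Suc 0)) cs m = 0"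
    by blast
qed

text \<open>The roots of \<open>x k\<close> on \<open>f k \<star> m\<close> are known by induction,
  and \<open>f k\<close> carries them over to \<open>x (k + 1)\<close> on \<open>m\<close>. For
  equal colours this also creates the candidates \<open>a + 1\<close> and \<open>a - 1\<close>, of
  which those without an addable box have to be discarded.\<close>

lemma diag_step:
  assumes dg: "\<And>j. j < k \<Longrightarrow> diag j" and k: "k \<in> {1..<n}"
  shows "diag k"
  unfolding diag_def
proof (intro allI ballI impI)
  fix w S m assume m: "m \<in> wt k w" and std: "std_weight v d k w S"
  obtain k' where k': "k = Suc k'" using k by (cases k) auto
  from std obtain S' j l \<zeta> where S: "S = add_box S' \<zeta> j l" "std_weight v d (k - 1) w S'"
    "j \<in> {1..d}" "w k = (\<zeta>, v j + of_int l)" "addable S' \<zeta> j l"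
    unfolding k' by (elim std_weight_SucE) auto
  define a where "a = v j + of_int l"
  let ?z = "f k \<star> m" and ?\<zeta> = "fst (w (Suc k))"
  have z: "?z \<in> wt (k - 1) (w \<circ> s k)" using k by (intro f_low wt_mono[OF m]) auto
  have "std_weight v d (k - 1) (w \<circ> s k) S'"
    by (rule std_weight_cong[OF S(2)]) (auto simp: Transposition.transpose_def)
  moreover have "diag (k - 1)" using dg k by simp
  ultimately have "\<exists>cs. distinct cs \<and> set cs \<subseteq> addable_contents v d S' (fst ((w \<circ> s k) (Suc (k - 1)))) \<and>
      lin (x (Suc (k - 1))) cs ?z = 0"
    using z unfolding diag_def by blast
  then obtain cs where cs: "distinct cs" "set cs \<subseteq> addable_contents v d S' ?\<zeta>" "lin (x k) cs ?z = 0"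
    by (auto simp: k')
  have mC: "m \<in> C" by (rule wt_C[OF m])
  show "\<exists>cs. distinct cs \<and> set cs \<subseteq> addable_contents v d S ?\<zeta> \<and> lin (x (Suc k)) cs m = 0"
  proof (cases "?\<zeta> = \<zeta>")
    case False
    have W: "lin (x (Suc k)) ds m \<in> wt k w" for ds
      using k m by (intro lin_in wt_subspace wt_x) auto
    \<comment> \<open>For different colours \<open>e k\<close> acts by zero, so \<open>f k\<close>
      translates \<open>x (k + 1)\<close> on \<open>m\<close> into \<open>x k\<close> on
      \<open>f k \<star> m\<close> without correction.\<close>
    have "f k \<star> lin (x (Suc k)) ds m = lin (x k) ds ?z" for ds
    proof (induction ds)
      case (Cons b ds)
      then show ?case
        using x_f(2)[OF k W, of ds] False S(4) by (simp add: mul_simps)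
    qed simp
    then have "f k \<star> (f k \<star> lin (x (Suc k)) cs m) = 0" using cs(3) by simp
    then have "lin (x (Suc k)) cs m = 0" using ff_mul[OF k wt_C[OF W]] by simp
    moreover have "addable_contents v d S ?\<zeta> = addable_contents v d S' ?\<zeta>"
      using False by (simp add: addable_contents_def addable_def S(1) add_box_def)
    ultimately show ?thesis using cs by auto
  next
    case True
    define R where "R = removeAll a cs"
    let ?U = "wt (k - 1) w"
    \<comment> \<open>With equal colours, exchanging the entries \<open>k\<close> and
      \<open>k + 1\<close> changes nothing that a weight vector for the first \<open>k - 1\<close>
      contents records.\<close>
    have "fst ((w \<circ> s k) i) = fst (w i)" for i
      using True S(4) by (auto simp: Transposition.transpose_def)
    moreover have "(w \<circ> s k) i = w i" if "i \<in> {1..k-1}" for i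
      using that by (auto simp: Transposition.transpose_def)
    ultimately have zU: "?z \<in> ?U" using z unfolding wt_def by auto
    have xk: "x k \<star> m = a *s m" using m S(4) k by (auto simp: wt_def a_def)
    \<comment> \<open>The root \<open>a\<close> of \<open>x k\<close> is traded for the roots
      \<open>a + 1\<close> and \<open>a - 1\<close> of \<open>x (k + 1)\<close>.\<close>
    have "lin (x (k + 1)) ((a + 1) # (a - 1) # R) m = 0"
    proof (rule rank_two[of ?U "x k" ?z "f k"])
      show "f k \<star> (x k \<star> u) = x (k + 1) \<star> (f k \<star> u) - u" if "u \<in> ?U" for u
        using x_f(1)[OF k that] True S(4) by simp
      show "x (k + 1) \<star> ?z = a *s ?z + m"
        using x_f(1)[OF k m] True S(4) xk by (simp add: mul_scale)
      show "lin (x k) (a # R) ?z = 0"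
        unfolding R_def by (rule lin_remove[OF cs(1,3)])
    qed (use k m zU xk wt_subspace wt_x xx ff_mul[OF k mC] in auto)
    then have lin: "lin (x (Suc k)) ((a + 1) # (a - 1) # R) m = 0" by simp
    have R: "\<exists>j' l'. b = v j' + of_int l' \<and> j' \<in> {1..d} \<and> addable S' \<zeta> j' l' \<and> (j, l) \<noteq> (j', l')"
      if "b \<in> set R" for b
    proof -
      have "b \<in> addable_contents v d S' \<zeta>" "b \<noteq> a" using that cs(2) True by (auto simp: R_def)
      then show ?thesis unfolding addable_contents_def a_def by blast
    qed
    have ne: "b \<noteq> a + 1 \<and> b \<noteq> a - 1" if b: "b \<in> set R" for b
    proof -
      obtain j' l' where "b = v j' + of_int l'" "j' \<in> {1..d}" "addable S' \<zeta> j' l'" "(j', l') \<noteq> (j, l)"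
        using R[OF b] by blast
      then show ?thesis
        using addable_nonadjacent[OF S(2) _ _ S(5) _ S(3), of j' l' 1]
          addable_nonadjacent[OF S(2) _ _ S(5) _ S(3), of j' l' "- 1"] k by (auto simp: a_def)
    qed
    have "(2::'k) \<noteq> 0" using of_int_nonzero[of 2] k by auto
    moreover have "(a + 1) - (a - 1) = 2" by simp
    ultimately have "a + 1 \<noteq> a - 1" by (metis right_minus_eq)
    moreover have "a + 1 \<notin> set R" "a - 1 \<notin> set R" using ne by blast+
    moreover have "distinct R" using cs(1) by (simp add: R_def distinct_removeAll)
    ultimately have dist: "distinct ((a + 1) # (a - 1) # R)" by simp
    \<comment> \<open>The full list has distinct roots, so \<open>m\<close> is a sum of
      eigenvectors. Those whose eigenvalue is filtered out are zero, and the shorter list already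
      kills \<open>m\<close>.\<close>
    define ds where "ds = filter (\<lambda>b. b \<in> addable_contents v d S \<zeta>) ((a + 1) # (a - 1) # R)"
    have set_ds: "set ds = set ((a + 1) # (a - 1) # R) \<inter> addable_contents v d S \<zeta>"
      unfolding ds_def set_filter by blast
    have RS: "b \<in> addable_contents v d S \<zeta>" if b: "b \<in> set R" for b
    proof -
      obtain j' l' where j': "b = v j' + of_int l'" "j' \<in> {1..d}" "addable S' \<zeta> j' l'" "(j', l') \<noteq> (j, l)"
        using R[OF b] by blast
      then have "addable S \<zeta> j' l'"
        using S(5) by (auto simp: S(1) addable_def add_box_def)
      then show ?thesis using j' by (auto simp: addable_contents_def)
    qed
    have "m \<in> span {u \<in> wt k w. \<exists>c\<in>set ((a + 1) # (a - 1) # R). x (Suc k) \<star> u = c *s u}"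
      using k by (intro eigen_decomposition wt_subspace wt_x dist m lin) auto
    then have "lin (x (Suc k)) ds m = 0"
    proof (induction rule: span_induct_alt)
      case (step q u m)
      then obtain c where c: "u \<in> wt k w" "c \<in> set ((a + 1) # (a - 1) # R)" "x (Suc k) \<star> u = c *s u" by blast
      have "lin (x (Suc k)) ds u = 0"
      proof (cases "c \<in> set ds")
        case True
        then show ?thesis using lin_eigen[OF c(3), of ds] by (auto simp: prod_list_zero_iff)
      next
        case False
        then have "c \<notin> addable_contents v d S \<zeta>" using c(2) set_ds by blast
        moreover from this have "c = a + 1 \<or> c = a - 1" using c(2) RS by auto
        ultimately have "u = 0"
          using wt_not_addable_zero[OF dg k S(2,5,3,4) _ c(1), of c] True c(3) S(1) by (simp add: a_def)
        then show ?thesis by simp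
      qed
      then show ?case using step by simp
    qed simp
    moreover have "distinct ds" unfolding ds_def using dist by (rule distinct_filter)
    moreover have "set ds \<subseteq> addable_contents v d S ?\<zeta>" unfolding True set_ds by blast
    ultimately show ?thesis by blast
  qed
qed

lemma diag: "k < n \<Longrightarrow> diag k"
proof (induction k rule: less_induct)
  case (less k)
  then show ?case using diag_zero diag_step[of k] by (cases "k = 0") auto
qed

end

section \<open>Matrix units from primitive idempotents\<close>

context summand_algebra
begin

lemma span_trans': "m \<in> span G \<Longrightarrow> G \<subseteq> span H \<Longrightarrow> m \<in> span H"
  using span_minimal[OF _ subspace_span] by blast

definition matrix_units :: "'i set \<Rightarrow> ('i \<Rightarrow> 'j) \<Rightarrow> ('i \<Rightarrow> 'i \<Rightarrow> 'v) \<Rightarrow> bool" where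
  "matrix_units T \<beta> E \<longleftrightarrow> finite T \<and>
    (\<forall>s\<in>T. \<forall>t\<in>T. \<beta> s = \<beta> t \<longrightarrow> E s t \<in> C) \<and>
    (\<forall>s\<in>T. \<forall>t\<in>T. \<forall>t'\<in>T. \<forall>u\<in>T. \<beta> s = \<beta> t \<longrightarrow> \<beta> t' = \<beta> u \<longrightarrow>
      E s t \<star> E t' u = (if t = t' then E s u else 0)) \<and>
    C \<subseteq> span {E s t | s t. s \<in> T \<and> t \<in> T \<and> \<beta> s = \<beta> t}"

text \<open>Equivalence of idempotents: right multiplication by \<open>a\<close> and
  \<open>b\<close> gives inverse isomorphisms between the left ideals of \<open>p\<close> and
  \<open>q\<close>.\<close>

definition linked :: "'v \<Rightarrow> 'v \<Rightarrow> bool" where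
  "linked p q \<longleftrightarrow> (\<exists>a\<in>C. \<exists>b\<in>C. p \<star> a = a \<and> a \<star> q = a \<and> q \<star> b = b \<and> b \<star> p = b \<and> b \<star> a = q \<and> a \<star> b = p)"

lemma linked_refl: "p \<in> C \<Longrightarrow> p \<star> p = p \<Longrightarrow> linked p p"
  unfolding linked_def by (intro bexI[of _ p]) auto

lemma linked_sym: "linked p q \<Longrightarrow> linked q p"
  unfolding linked_def by blast

lemma linked_trans:
  assumes "linked p q" "linked q r"
  shows "linked p r"
proof -
  obtain a b a' b' where ab: "a \<in> C" "b \<in> C" "p \<star> a = a" "b \<star> p = b" "b \<star> a = q" "a \<star> b = p"
    "q \<star> b = b" "a \<star> q = a" "q \<star> a' = a'" "b' \<star> q = b'"
    "a' \<in> C" "b' \<in> C" "a' \<star> r = a'" "r \<star> b' = b'" "b' \<star> a' = r" "a' \<star> b' = q"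
    using assms unfolding linked_def by blast
  have "p \<star> (a \<star> a') = a \<star> a'" "a \<star> a' \<star> r = a \<star> a'" "r \<star> (b' \<star> b) = b' \<star> b" "b' \<star> b \<star> p = b' \<star> b"
    using ab(3,4,13,14) by (simp_all add: mul_assoc) (simp_all add: mul_assoc[symmetric])
  moreover have "b' \<star> b \<star> (a \<star> a') = b' \<star> (b \<star> a) \<star> a'" "a \<star> a' \<star> (b' \<star> b) = a \<star> (a' \<star> b') \<star> b"
    by (simp_all add: mul_assoc)
  then have "b' \<star> b \<star> (a \<star> a') = r" "a \<star> a' \<star> (b' \<star> b) = p"
    using ab by simp_all
  ultimately show ?thesis unfolding linked_def using ab(1,2,11,12)
    by (intro bexI[of _ "a \<star> a'"] bexI[of _ "b' \<star> b"]) auto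
qed

text \<open>In each class a representative \<open>p (\<beta> t)\<close> is fixed, with linking
  elements \<open>a t\<close> and \<open>b t\<close>; the units are \<open>a s \<star> b t\<close>.
  Since the corner of the representative is one-dimensional, every
  \<open>p s \<star> c \<star> p t\<close> is a multiple of such a unit.\<close>

lemma matrix_units_of_idempotents:
  assumes T: "finite T" "\<And>t. t \<in> T \<Longrightarrow> p t \<in> C"
    and orth: "\<And>s t. s \<in> T \<Longrightarrow> t \<in> T \<Longrightarrow> p s \<star> p t = (if s = t then p t else 0)"
    and prim: "\<And>t a. t \<in> T \<Longrightarrow> a \<in> C \<Longrightarrow> p t \<star> a \<star> p t \<in> span {p t}"
    and gen: "C \<subseteq> span {p s \<star> a \<star> p t | s t a. s \<in> T \<and> t \<in> T \<and> a \<in> C \<and> linked (p s) (p t)}"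
  shows "\<exists>(\<beta> :: 'i \<Rightarrow> 'i) E. matrix_units (T :: 'i set) \<beta> E"
proof -
  define \<beta> where "\<beta> t = (SOME b. b \<in> T \<and> linked (p t) (p b))" for t
  have lrefl: "linked (p t) (p t)" if "t \<in> T" for t
    using linked_refl T(2)[OF that] orth[OF that that] by simp
  have \<beta>: "\<beta> t \<in> T \<and> linked (p t) (p (\<beta> t))" if "t \<in> T" for t
    unfolding \<beta>_def by (rule someI[of _ t]) (use that lrefl in blast)
  \<comment> \<open>Linked idempotents define the same predicate under the choice operator, so they
    select the same representative.\<close>
  have \<beta>_eq: "\<beta> s = \<beta> t" if "linked (p s) (p t)" for s t
  proof -
    have "linked (p s) (p b) = linked (p t) (p b)" for b
      using that linked_sym linked_trans by blast
    then show ?thesis unfolding \<beta>_def by (rule arg_cong[where f = Eps, OF ext, OF conj_cong[OF refl]])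
  qed
  define P where "P t a b \<longleftrightarrow> a \<in> C \<and> b \<in> C \<and> p t \<star> a = a \<and> a \<star> p (\<beta> t) = a \<and> p (\<beta> t) \<star> b = b \<and>
      b \<star> p t = b \<and> b \<star> a = p (\<beta> t) \<and> a \<star> b = p t" for t a b
  have "\<exists>a b. P t a b" if "t \<in> T" for t
    using \<beta>[OF that] unfolding linked_def P_def by blast
  then obtain a b where P: "\<And>t. t \<in> T \<Longrightarrow> P t (a t) (b t)" by metis
  have ab: "a t \<in> C \<and> b t \<in> C \<and> b t \<star> a t = p (\<beta> t) \<and> a t \<star> b t = p t"
    and bp: "b t \<star> p t = b t" "a t \<star> p (\<beta> t) = a t" "p t \<star> a t = a t" "p (\<beta> t) \<star> b t = b t"
    if "t \<in> T" for t using P[OF that] by (simp_all add: P_def)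
  let ?E = "\<lambda>s t. a s \<star> b t"
  have "matrix_units T \<beta> ?E" unfolding matrix_units_def
  proof (intro conjI ballI impI)
    fix s t t' u assume st: "s \<in> T" "t \<in> T" "t' \<in> T" "u \<in> T" "\<beta> s = \<beta> t" "\<beta> t' = \<beta> u"
    show "?E s t \<star> ?E t' u = (if t = t' then ?E s u else 0)"
    proof (cases "t = t'")
      case True
      have "a s \<star> b t \<star> (a t \<star> b u) = a s \<star> (b t \<star> a t) \<star> b u" by (simp add: mul_assoc)
      also have "\<dots> = a s \<star> b u" using ab[OF st(2)] bp[OF st(1)] st by simp
      finally show ?thesis using True by simp
    next
      case False
      have "b t \<star> a t' = (b t \<star> p t) \<star> (p t' \<star> a t')"
        using bp(1)[OF st(2)] bp(3)[OF st(3)] by simp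
      also have "\<dots> = b t \<star> (p t \<star> p t') \<star> a t'" by (simp add: mul_assoc)
      also have "\<dots> = 0" using orth[OF st(2,3)] False by simp
      finally have "a s \<star> (b t \<star> a t') \<star> b u = 0" by simp
      then show ?thesis using False by (simp add: mul_assoc)
    qed
  next
    have "{p s \<star> c \<star> p t | s t c. s \<in> T \<and> t \<in> T \<and> c \<in> C \<and> linked (p s) (p t)} \<subseteq>
        span {?E s t | s t. s \<in> T \<and> t \<in> T \<and> \<beta> s = \<beta> t}"
    proof clarify
      fix s t c assume st: "s \<in> T" "t \<in> T" "c \<in> C" "linked (p s) (p t)"
      have \<beta>st: "\<beta> s = \<beta> t" by (rule \<beta>_eq[OF st(4)])
      have "p (\<beta> s) \<star> (b s \<star> c \<star> a t) \<star> p (\<beta> s) \<in> span {p (\<beta> s)}"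
        using \<beta>[OF st(1)] ab[OF st(1)] ab[OF st(2)] st(3) by (intro prim) auto
      moreover have "p (\<beta> s) \<star> (b s \<star> c \<star> a t) \<star> p (\<beta> s) = (p (\<beta> s) \<star> b s) \<star> c \<star> (a t \<star> p (\<beta> t))"
        using \<beta>st by (simp add: mul_assoc)
      moreover have "\<dots> = b s \<star> c \<star> a t" using bp(4)[OF st(1)] bp(2)[OF st(2)] by simp
      ultimately obtain k where k: "b s \<star> c \<star> a t = k *s p (\<beta> s)"
        unfolding span_singleton by auto
      have "p s \<star> c \<star> p t = (a s \<star> b s) \<star> c \<star> (a t \<star> b t)"
        using ab[OF st(1)] ab[OF st(2)] by simp
      also have "\<dots> = a s \<star> (b s \<star> c \<star> a t) \<star> b t" by (simp add: mul_assoc)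
      also have "\<dots> = k *s ?E s t" unfolding k using bp[OF st(1)] by (simp add: mul_scale)
      finally have "p s \<star> c \<star> p t = k *s ?E s t" .
      moreover have "?E s t \<in> {?E s t | s t. s \<in> T \<and> t \<in> T \<and> \<beta> s = \<beta> t}" using st \<beta>st by blast
      ultimately show "p s \<star> c \<star> p t \<in> span {?E s t | s t. s \<in> T \<and> t \<in> T \<and> \<beta> s = \<beta> t}"
        by (simp add: span_scale span_base)
    qed
    then show "C \<subseteq> span {?E s t | s t. s \<in> T \<and> t \<in> T \<and> \<beta> s = \<beta> t}"
      using gen span_trans' by blast
  qed (use T ab in auto)
  then show ?thesis by blast
qed

end

section \<open>Decomposition of the algebra into weight spaces\<close>

context yh_algebra
begin

text \<open>All \<open>t i\<close> and \<open>x i\<close> are present from the start and only the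
  \<open>f i\<close> are adjoined one by one; \<open>alg 1\<close> will contain the weight
  components of \<open>one\<close>.\<close>

definition alg :: "nat \<Rightarrow> 'v set" where
  "alg k = gen_alg (t ` {1..n} \<union> x ` {1..n} \<union> f ` {1..<k})"

lemma alg_gens_C: "k \<le> n \<Longrightarrow> t ` {1..n} \<union> x ` {1..n} \<union> f ` {1..<k} \<subseteq> C"
  using t_C x_C f_C by auto

lemma alg_C: "k \<le> n \<Longrightarrow> alg k \<subseteq> C"
  using gen_alg_C[OF alg_gens_C] by (auto simp: alg_def)

lemma alg_mono: "j \<le> k \<Longrightarrow> alg j \<subseteq> alg k"
  unfolding alg_def by (intro gen_alg_mono) auto

lemma alg_n: "alg n = C"
proof -
  have "t ` {1..n} \<union> x ` {1..n} \<union> f ` {1..<n} = t ` {1..n} \<union> f ` {1..<n} \<union> x ` {1..n}" by blast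
  then show ?thesis using generated alg_C[of n] unfolding alg_def by auto
qed

lemma alg_subspace: "subspace (alg k)" unfolding alg_def by (rule gen_alg_subspace)

lemma alg_simps:
  "one \<in> alg k" "0 \<in> alg k" "a \<in> alg k \<Longrightarrow> b \<in> alg k \<Longrightarrow> a + b \<in> alg k"
  "a \<in> alg k \<Longrightarrow> b \<in> alg k \<Longrightarrow> a - b \<in> alg k" "a \<in> alg k \<Longrightarrow> c *s a \<in> alg k"
  using alg_subspace[of k] subspace_diff[OF alg_subspace, of a k b]
  by (auto simp: subspace_def) (auto simp: alg_def intro: gen_alg.intros)

lemma alg_mul: "k \<le> n \<Longrightarrow> a \<in> alg k \<Longrightarrow> b \<in> alg k \<Longrightarrow> a \<star> b \<in> alg k"
  unfolding alg_def by (rule gen_alg_mul[OF alg_gens_C])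

lemma alg_t: "j \<in> {1..n} \<Longrightarrow> a \<in> alg k \<Longrightarrow> t j \<star> a \<in> alg k"
  and alg_x: "j \<in> {1..n} \<Longrightarrow> a \<in> alg k \<Longrightarrow> x j \<star> a \<in> alg k"
  and alg_f: "j \<in> {1..<k} \<Longrightarrow> a \<in> alg k \<Longrightarrow> f j \<star> a \<in> alg k"
  unfolding alg_def by (auto intro!: gen_mul)

lemma gen_alg_t: "gen_alg (t ` {1..n}) \<subseteq> alg k"
  unfolding alg_def by (intro gen_alg_mono) auto

lemma alg_induct [consumes 1, case_names one add scale mul]:
  assumes "a \<in> alg k" "P one"
    and "\<And>a b. a \<in> alg k \<Longrightarrow> b \<in> alg k \<Longrightarrow> P a \<Longrightarrow> P b \<Longrightarrow> P (a + b)"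
    and "\<And>a c. a \<in> alg k \<Longrightarrow> P a \<Longrightarrow> P (c *s a)"
    and "\<And>g a. g \<in> t ` {1..n} \<union> x ` {1..n} \<union> f ` {1..<k} \<Longrightarrow> a \<in> alg k \<Longrightarrow> P a \<Longrightarrow> P (g \<star> a)"
  shows "P a"
  using assms(1) unfolding alg_def
  by (induction rule: gen_alg.induct) (use assms(2-) in \<open>simp_all add: alg_def\<close>)

text \<open>The \<open>t j\<close> commute, so each joint eigenspace of the first ones is stable
  under the next and splits further.\<close>

lemma t_decomposition:
  assumes "m \<in> alg 1" "i \<le> n"
  shows "m \<in> span {u \<in> alg 1. \<exists>z. \<forall>j\<in>{1..i}. t j \<star> u = z j *s u}"
  using assms(2)
proof (induction i)
  case 0 then show ?case using assms(1) by (auto intro: span_base)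
next
  case (Suc i)
  then have "m \<in> span {u \<in> alg 1. \<exists>z. \<forall>j\<in>{1..i}. t j \<star> u = z j *s u}" by simp
  then show ?case
  proof (rule span_trans'; clarify)
    fix u z assume u: "u \<in> alg 1" and z: "\<forall>j\<in>{1..i}. t j \<star> u = z j *s u"
    define U where "U = {u \<in> alg 1. \<forall>j\<in>{1..i}. t j \<star> u = z j *s u}"
    have "subspace U"
      using alg_subspace[of 1] by (auto simp: U_def subspace_def mul_simps)
    moreover have "t (Suc i) \<star> a \<in> U" if "a \<in> U" for a
    proof -
      have "t j \<star> (t (Suc i) \<star> a) = t (Suc i) \<star> (t j \<star> a)" if "j \<in> {1..i}" for j
        using tt[of j "Suc i"] Suc.prems that by (simp add: mul_assoc[symmetric])
      then show ?thesis using that alg_t Suc.prems by (auto simp: U_def mul_scale)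
    qed
    moreover have "lin (t (Suc i)) Z u = 0"
      using t_lin Suc.prems u alg_C[of 1] n_pos by auto
    ultimately have "u \<in> span {a \<in> U. \<exists>c\<in>set Z. t (Suc i) \<star> a = c *s a}"
      using u z Z_distinct by (intro eigen_decomposition) (auto simp: U_def)
    then show "u \<in> span {u \<in> alg 1. \<exists>z. \<forall>j\<in>{1..Suc i}. t j \<star> u = z j *s u}"
    proof (rule span_trans'; clarify)
      fix a c assume "a \<in> U" "t (Suc i) \<star> a = c *s a"
      then have "a \<in> alg 1 \<and> (\<forall>j\<in>{1..Suc i}. t j \<star> a = (z(Suc i := c)) j *s a)"
        by (auto simp: U_def le_Suc_eq)
      then show "a \<in> span {u \<in> alg 1. \<exists>z. \<forall>j\<in>{1..Suc i}. t j \<star> u = z j *s u}"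
        by (intro span_base) blast
    qed
  qed
qed

text \<open>The same refinement for the \<open>x j\<close>, except that the root list depends on the
  component already reached: its weight is standard, and \<open>diag\<close> supplies the
  roots.\<close>

lemma wt_decomposition:
  assumes "m \<in> alg 1" "k \<le> n"
  shows "m \<in> span {u \<in> alg 1. \<exists>w. u \<in> wt k w}"
  using assms(2)
proof (induction k)
  case 0
  have "m \<in> span {u \<in> alg 1. \<exists>z. \<forall>j\<in>{1..n}. t j \<star> u = z j *s u}"
    using t_decomposition[OF assms(1)] by simp
  then show ?case
  proof (rule span_trans'; clarify)
    fix u z assume u: "u \<in> alg 1" "\<forall>j\<in>{1..n}. t j \<star> u = z j *s u"
    then have "u \<in> wt 0 (\<lambda>i. (z i, 0))" using alg_C[of 1] n_pos by (auto simp: wt_def)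
    then show "u \<in> span {u \<in> alg 1. \<exists>w. u \<in> wt 0 w}" using u by (intro span_base) blast
  qed
next
  case (Suc k)
  then have "m \<in> span {u \<in> alg 1. \<exists>w. u \<in> wt k w}" by simp
  then show ?case
  proof (rule span_trans'; clarify)
    fix u w assume u: "u \<in> alg 1" "u \<in> wt k w"
    show "u \<in> span {u \<in> alg 1. \<exists>w. u \<in> wt (Suc k) w}"
    proof (cases "u = 0")
      case False
      obtain S where S: "std_weight v d k w S"
        using wt_std[OF diag _ u(2) False] Suc.prems by auto
      have "diag k" using diag Suc.prems by simp
      then obtain cs where cs: "distinct cs" "lin (x (Suc k)) cs u = 0"
        using S u(2) unfolding diag_def by blast
      have "u \<in> span {a \<in> alg 1 \<inter> wt k w. \<exists>c\<in>set cs. x (Suc k) \<star> a = c *s a}"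
        using u cs Suc.prems alg_x wt_x
        by (intro eigen_decomposition subspace_inter alg_subspace wt_subspace) auto
      then show ?thesis
      proof (rule span_trans'; clarify)
        fix a c assume a: "a \<in> alg 1" "a \<in> wt k w" "x (Suc k) \<star> a = c *s a"
        then have "a \<in> wt (Suc k) (w(Suc k := (fst (w (Suc k)), c)))"
          by (auto simp: wt_def le_Suc_eq)
        then show "a \<in> span {u \<in> alg 1. \<exists>w. u \<in> wt (Suc k) w}"
          using a by (intro span_base) blast
      qed
    qed (simp add: span_zero)
  qed
qed

text \<open>Normalizing weights outside \<open>{1..n}\<close> makes two of them differ only if some
  \<open>t i\<close> or \<open>x i\<close> tells them apart.\<close>

definition Ext :: "(nat \<Rightarrow> 'k \<times> 'k) set" where
  "Ext = {w. \<forall>i. i \<notin> {1..n} \<longrightarrow> w i = (0, 0)}"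

lemma finite_wt_sum:
  assumes "m \<in> span {u \<in> A. \<exists>w. u \<in> wt n w}" "subspace A"
  shows "\<exists>W g. finite W \<and> W \<subseteq> Ext \<and> m = (\<Sum>w\<in>W. g w) \<and> (\<forall>w\<in>W. g w \<in> A \<inter> wt n w)"
  using assms(1)
proof (induction rule: span_induct_alt)
  case base
  then show ?case by (intro exI[of _ "{}"]) auto
next
  case (step c u m)
  then obtain W g w' where W: "finite W" "W \<subseteq> Ext" "m = (\<Sum>w\<in>W. g w)" "\<And>w. w \<in> W \<Longrightarrow> g w \<in> A \<inter> wt n w"
    and u: "u \<in> A" "u \<in> wt n w'" by auto
  define w where "w = (\<lambda>i. if i \<in> {1..n} then w' i else (0, 0))"
  have w: "w \<in> Ext" "u \<in> wt n w" using u(2) wt_cong[of w' w n] by (auto simp: w_def Ext_def)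
  have cu: "c *s u \<in> A \<inter> wt n w" using u w assms(2) wt_subspace by (auto simp: subspace_def)
  \<comment> \<open>If the weight of the new term occurs already, the term is merged into the
    component that is there.\<close>
  define h where "h = (if w \<in> W then g w else 0)"
  have h: "h \<in> A \<inter> wt n w"
    using W(4) subspace_0[OF assms(2)] subspace_0[OF wt_subspace] by (auto simp: h_def)
  have "m = h + (\<Sum>w\<in>W - {w}. g w)"
    using W(1,3) by (auto simp: h_def sum.remove)
  moreover have "(\<Sum>y\<in>insert w W. (g(w := c *s u + h)) y) = c *s u + h + (\<Sum>w\<in>W - {w}. g w)"
    using W(1) by (simp add: sum.insert_remove)
  ultimately have "c *s u + m = (\<Sum>y\<in>insert w W. (g(w := c *s u + h)) y)" by simp
  moreover have "(g(w := c *s u + h)) y \<in> A \<inter> wt n y" if "y \<in> insert w W" for y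
    using that W(4) subspace_add[OF subspace_inter[OF assms(2) wt_subspace] cu h] by auto
  ultimately show ?case using W w
    by (intro exI[of _ "insert w W"] exI[of _ "g(w := c *s u + h)"]) auto
qed

lemma wt_separating:
  assumes "w \<in> Ext" "w' \<in> Ext" "w \<noteq> w'"
  shows "\<exists>y c c'. c \<noteq> c' \<and> (\<forall>u\<in>wt n w. y \<star> u = c *s u) \<and> (\<forall>u\<in>wt n w'. y \<star> u = c' *s u) \<and>
    (\<forall>z. \<forall>u\<in>wt n z. y \<star> u \<in> wt n z)"
proof -
  obtain i where wi: "w i \<noteq> w' i" using assms(3) by (auto simp: fun_eq_iff)
  then have i: "i \<in> {1..n}" "w i \<noteq> w' i" using assms(1,2) unfolding Ext_def by force+
  have scale: "c *s u \<in> wt n z" if "u \<in> wt n z" for u z c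
    using that wt_subspace by (auto simp: subspace_def)
  have xt: "x i \<star> u = snd (z i) *s u" "t i \<star> u = fst (z i) *s u" if "u \<in> wt n z" for u z
    using that i by (auto simp: wt_def)
  show ?thesis
  proof (cases "fst (w i) = fst (w' i)")
    case True
    then have "snd (w i) \<noteq> snd (w' i)" using i(2) by (auto simp: prod_eq_iff)
    then show ?thesis
      using xt scale by (intro exI[of _ "x i"] exI[of _ "snd (w i)"] exI[of _ "snd (w' i)"]) simp
  next
    case False
    then show ?thesis
      using xt scale by (intro exI[of _ "t i"] exI[of _ "fst (w i)"] exI[of _ "fst (w' i)"]) simp
  qed
qed

text \<open>Induction on \<open>W\<close>: for a generator \<open>y\<close> separating the two
  weights, \<open>y - c'\<close> removes the part of weight \<open>w'\<close> and multiplies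
  \<open>u\<close> by the nonzero scalar \<open>c - c'\<close>.\<close>

lemma wt_independent:
  assumes "finite W" "W \<subseteq> Ext" "w \<in> Ext - W" "u \<in> wt n w" "u \<in> span (\<Union>w\<in>W. wt n w)"
  shows "u = 0"
  using assms
proof (induction W arbitrary: u)
  case (insert w' W)
  have "u \<in> span (wt n w' \<union> (\<Union>w\<in>W. wt n w))" using insert.prems by simp
  then obtain u1 u2 where u: "u = u1 + u2" "u1 \<in> span (wt n w')" "u2 \<in> span (\<Union>w\<in>W. wt n w)"
    unfolding span_Un by blast
  have u1: "u1 \<in> wt n w'" using u(2) span_eq_iff[THEN iffD2, OF wt_subspace] by simp
  obtain y c c' where y: "c \<noteq> c'" "\<And>u. u \<in> wt n w \<Longrightarrow> y \<star> u = c *s u" "\<And>u. u \<in> wt n w' \<Longrightarrow> y \<star> u = c' *s u"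
    "\<And>z u. u \<in> wt n z \<Longrightarrow> y \<star> u \<in> wt n z"
  proof -
    have "w \<in> Ext" "w' \<in> Ext" "w \<noteq> w'" using insert.prems by auto
    from wt_separating[OF this] show ?thesis using that by metis
  qed
  have "y \<star> u2 \<in> span (\<Union>w\<in>W. wt n w)"
    using u(3) by (rule span_mul_left) (use y(4) in \<open>auto intro!: span_base\<close>)
  then have "y \<star> u2 - c' *s u2 \<in> span (\<Union>w\<in>W. wt n w)"
    using u(3) by (intro span_diff span_scale)
  moreover have "y \<star> u - c' *s u = y \<star> u2 - c' *s u2"
    using y(3)[OF u1] by (simp add: u(1) mul_simps)
  moreover have "y \<star> u - c' *s u = (c - c') *s u" using y(2)[OF insert.prems(3)] by (simp add: mul_simps)
  ultimately have *: "(c - c') *s u \<in> span (\<Union>w\<in>W. wt n w)" by simp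
  have "(c - c') *s u \<in> wt n w" using insert.prems(3) wt_subspace by (auto simp: subspace_def)
  then have "(c - c') *s u = 0" using insert.IH[OF _ _ _ *] insert.prems by auto
  then show ?case using y(1) by simp
qed simp

text \<open>Includes equal neighbouring entries, where there is no intertwiner but the weight space
  is zero.\<close>

lemma f_wt_split:
  assumes "i \<in> {1..<n}" "m \<in> wt n w"
  shows "\<exists>q \<in> wt n (w \<circ> s i). f i \<star> m = coef w i *s m + q"
proof (cases "w i = w (i + 1)")
  case True
  then have "m = 0" using assms by (intro wt_equal_zero[of i m n w] diag) auto
  then show ?thesis using subspace_0[OF wt_subspace] by auto
next
  case False
  then show ?thesis using assms
    by (intro bexI[of _ "f i \<star> m - coef w i *s m"] f_swap) auto
qed

text \<open>A generator of \<open>alg k\<close> preserves weights or, being some \<open>f i\<close>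
  with \<open>i < k\<close>, exchanges two entries among the first \<open>k\<close>.\<close>

lemma alg_wt:
  assumes "a \<in> alg k" "k \<le> n" "m \<in> wt n w"
  shows "a \<star> m \<in> span (\<Union>z\<in>{z. \<forall>i>k. z i = w i}. wt n z)" (is "_ \<in> span ?Y")
  using assms(1)
proof (induction rule: alg_induct)
  case one
  have "m \<in> ?Y" using assms(3) by auto
  then show ?case using wt_C[OF assms(3)] by (simp add: span_base)
next
  case (mul g a)
  have "g \<star> (a \<star> m) \<in> span ?Y"
  proof (rule span_mul_left[OF mul.IH])
    fix u assume "u \<in> ?Y"
    then obtain z where z: "\<forall>i>k. z i = w i" "u \<in> wt n z" by blast
    have Y: "u' \<in> span ?Y" if "u' \<in> wt n z" for u'
      using z that by (intro span_base) blast
    consider (t) i where "i \<in> {1..n}" "g = t i" | (x) i where "i \<in> {1..n}" "g = x i"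
      | (f) i where "i \<in> {1..<k}" "g = f i" using mul.hyps by blast
    then show "g \<star> u \<in> span ?Y"
    proof cases
      case t
      then show ?thesis using z(2) Y[OF z(2)] by (simp add: wt_def span_scale)
    next
      case x
      then show ?thesis using z(2) Y[OF z(2)] by (simp add: wt_def span_scale)
    next
      case f
      then have i: "i \<in> {1..<n}" using assms(2) by auto
      obtain q where q: "q \<in> wt n (z \<circ> s i)" "f i \<star> u = coef z i *s u + q"
        using f_wt_split[OF i z(2)] by blast
      have "(z \<circ> s i) j = w j" if "j > k" for j
        using that z(1) f(1) by (simp add: Transposition.transpose_def)
      then have "q \<in> ?Y" using q(1) by blast
      then show ?thesis unfolding f(2) q(2) using Y[OF z(2)]
        by (intro span_add span_scale span_base[of q])
    qed
  qed
  then show ?case by (simp add: mul_assoc)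
qed (auto simp: mul_distrib mul_scale intro: span_add span_scale)

subsection \<open>The filtration by the number of strands\<close>

lemma f_gen_t:
  assumes "b \<in> gen_alg (t ` {1..n})" "i \<in> {1..<n}"
  shows "\<exists>b'\<in>gen_alg (t ` {1..n}). f i \<star> b = b' \<star> f i"
  using assms(1)
proof (induction rule: gen_alg.induct)
  case gen_one
  then show ?case using f_C[OF assms(2)] by (intro bexI[of _ one] gen_alg.intros) auto
next
  case (gen_add a b)
  then obtain a' b' where "a' \<in> gen_alg (t ` {1..n})" "b' \<in> gen_alg (t ` {1..n})"
    "f i \<star> a = a' \<star> f i" "f i \<star> b = b' \<star> f i" by auto
  then show ?case by (intro bexI[of _ "a' + b'"] gen_alg.intros) (auto simp: mul_distrib)
next
  case (gen_scale a k)
  then obtain a' where "a' \<in> gen_alg (t ` {1..n})" "f i \<star> a = a' \<star> f i" by auto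
  then show ?case by (intro bexI[of _ "k *s a'"] gen_alg.intros) (auto simp: mul_scale)
next
  case (gen_mul g a)
  then obtain a' j where a: "a' \<in> gen_alg (t ` {1..n})" "f i \<star> a = a' \<star> f i" "j \<in> {1..n}" "g = t j" by auto
  have "f i \<star> (g \<star> a) = t (s i j) \<star> (f i \<star> a)"
    using ft[OF assms(2) a(3)] a(4) by (simp add: mul_assoc[symmetric])
  moreover have "s i j \<in> {1..n}" using assms(2) a(3) by (auto simp: Transposition.transpose_def)
  ultimately show ?case using a(1,2)
    by (intro bexI[of _ "t (s i j) \<star> a'"] gen_alg.intros) (auto simp: mul_assoc)
qed

lemma x_f':
  assumes "i \<in> {1..<n}"
  shows "\<exists>e'\<in>gen_alg (t ` {1..n}). x (i + 1) \<star> f i = f i \<star> x i + e'"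
proof -
  obtain e' where e': "e' \<in> gen_alg (t ` {1..n})" "f i \<star> e i = e' \<star> f i"
    using f_gen_t[OF e_gen[OF assms] assms] by blast
  have C: "f i \<in> C" "x i \<in> C" "x (i + 1) \<in> C" "e' \<in> C"
    using f_C assms x_C gen_alg_C[OF _ e'(1)] t_C by (auto simp: image_subset_iff)
  have "x (i + 1) \<star> f i = f i \<star> (f i \<star> x (i + 1)) \<star> f i"
    using C ff[OF assms] by (simp add: mul_assoc[symmetric])
  also have "\<dots> = f i \<star> x i \<star> (f i \<star> f i) + (f i \<star> e i) \<star> f i"
    unfolding fx[OF assms] by (simp add: mul_simps)
  also have "\<dots> = f i \<star> x i + e' \<star> (f i \<star> f i)"
    using C ff[OF assms] e'(2) by (simp add: mul_assoc)
  finally show ?thesis using C e'(1) ff[OF assms] by auto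
qed

text \<open>The \<open>f i\<close> in \<open>alg (k - 1)\<close> have \<open>i + 1 < k\<close> and
  commute with \<open>f k\<close>; moving \<open>x k\<close> or \<open>x (k + 1)\<close> across
  \<open>f k\<close> costs a correction free of \<open>f k\<close>.\<close>

lemma f_alg_left:
  assumes k: "k \<in> {1..<n}" and a: "a \<in> alg (k - 1)"
  shows "\<exists>a'\<in>alg (k - 1). \<exists>a''\<in>alg (k - 1). f k \<star> a = a' \<star> f k + a''"
  using a
proof (induction rule: alg_induct)
  case one
  then show ?case using f_C[OF k] alg_simps
    by (intro bexI[of _ one] bexI[of _ 0]) auto
next
  case (add a b)
  then obtain a' a'' b' b'' where "a' \<in> alg (k - 1)" "a'' \<in> alg (k - 1)" "b' \<in> alg (k - 1)" "b'' \<in> alg (k - 1)"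
    "f k \<star> a = a' \<star> f k + a''" "f k \<star> b = b' \<star> f k + b''" by blast
  then show ?case
    by (intro bexI[of _ "a' + b'"] bexI[of _ "a'' + b''"]) (auto simp: mul_distrib alg_simps)
next
  case (scale a c)
  then obtain a' a'' where "a' \<in> alg (k - 1)" "a'' \<in> alg (k - 1)" "f k \<star> a = a' \<star> f k + a''" by blast
  then show ?case
    by (intro bexI[of _ "c *s a'"] bexI[of _ "c *s a''"]) (auto simp: mul_simps alg_simps)
next
  case (mul g a)
  then obtain a' a'' where a: "a \<in> alg (k - 1)" "a' \<in> alg (k - 1)" "a'' \<in> alg (k - 1)" "f k \<star> a = a' \<star> f k + a''"
    by blast
  note am = alg_t[OF _ a(2)] alg_t[OF _ a(3)] alg_x[OF _ a(2)] alg_x[OF _ a(3)] alg_f[OF _ a(2)] alg_f[OF _ a(3)]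
  have fg: "f k \<star> (g \<star> a) = h \<star> a' \<star> f k + h \<star> a''" if "f k \<star> g = h \<star> f k" for h
  proof -
    have "f k \<star> (g \<star> a) = h \<star> (f k \<star> a)" using that by (simp add: mul_assoc[symmetric])
    then show ?thesis using a(4) by (simp add: mul_simps)
  qed
  consider (t) i where "i \<in> {1..n}" "g = t i" | (x0) "g = x k" | (x1) "g = x (k + 1)"
    | (x) i where "i \<in> {1..n}" "i \<noteq> k" "i \<noteq> k + 1" "g = x i"
    | (f) i where "i \<in> {1..<k - 1}" "g = f i" using mul.hyps by blast
  then show ?case
  proof cases
    case (t i)
    then show ?thesis using fg[of "t (s k i)"] ft[OF k t(1)] am(1,2)[of "s k i"] k
      by (intro bexI[of _ "t (s k i) \<star> a'"] bexI[of _ "t (s k i) \<star> a''"]) (auto simp: Transposition.transpose_def)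
  next
    case x0
    obtain e' where e': "e' \<in> gen_alg (t ` {1..n})" "x (k + 1) \<star> f k = f k \<star> x k + e'" using x_f'[OF k] by blast
    then have "f k \<star> g = x (k + 1) \<star> f k - e'" using x0 by simp
    then have "f k \<star> (g \<star> a) = x (k + 1) \<star> (f k \<star> a) - e' \<star> a" by (simp add: mul_assoc[symmetric] mul_diff)
    also have "\<dots> = x (k + 1) \<star> a' \<star> f k + (x (k + 1) \<star> a'' - e' \<star> a)"
      using a(4) by (simp add: mul_simps)
    finally show ?thesis
      using am(3,4)[of "k + 1"] k alg_simps(4)[OF _ alg_mul[OF _ subsetD[OF gen_alg_t e'(1)] a(1)], of "x (k + 1) \<star> a''"]
      by (intro bexI[of _ "x (k + 1) \<star> a'"] bexI[of _ "x (k + 1) \<star> a'' - e' \<star> a"]) auto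
  next
    case x1
    have "f k \<star> (g \<star> a) = x k \<star> (f k \<star> a) + e k \<star> a" using fx[OF k] x1 by (simp add: mul_assoc[symmetric] mul_distrib)
    also have "\<dots> = x k \<star> a' \<star> f k + (x k \<star> a'' + e k \<star> a)"
      using a(4) by (simp add: mul_simps)
    finally show ?thesis
      using am(3,4)[of k] k alg_simps(3)[OF _ alg_mul[OF _ subsetD[OF gen_alg_t e_gen[OF k]] a(1)], of "x k \<star> a''"]
      by (intro bexI[of _ "x k \<star> a'"] bexI[of _ "x k \<star> a'' + e k \<star> a"]) auto
  next
    case (x i)
    then show ?thesis using fg[of "x i"] fx'[OF k x(1)] am(3,4)[of i]
      by (intro bexI[of _ "x i \<star> a'"] bexI[of _ "x i \<star> a''"]) auto
  next
    case (f i)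
    then have "f k \<star> f i = f i \<star> f k" using f_far[of i k] k by (simp add: less_diff_conv)
    then show ?thesis using fg[of "f i"] f am(5,6)[of i]
      by (intro bexI[of _ "f i \<star> a'"] bexI[of _ "f i \<star> a''"]) auto
  qed
qed

lemma f_alg_right:
  assumes k: "k \<in> {1..<n}" and a: "a \<in> alg (k - 1)"
  shows "\<exists>a'\<in>alg (k - 1). \<exists>a''\<in>alg (k - 1). a \<star> f k = f k \<star> a' + a''"
  using a
proof (induction rule: alg_induct)
  case one
  then show ?case using f_C[OF k] alg_simps
    by (intro bexI[of _ one] bexI[of _ 0]) auto
next
  case (add a b)
  then obtain a' a'' b' b'' where "a' \<in> alg (k - 1)" "a'' \<in> alg (k - 1)" "b' \<in> alg (k - 1)" "b'' \<in> alg (k - 1)"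
    "a \<star> f k = f k \<star> a' + a''" "b \<star> f k = f k \<star> b' + b''" by blast
  then show ?case
    by (intro bexI[of _ "a' + b'"] bexI[of _ "a'' + b''"]) (auto simp: mul_distrib alg_simps)
next
  case (scale a c)
  then obtain a' a'' where "a' \<in> alg (k - 1)" "a'' \<in> alg (k - 1)" "a \<star> f k = f k \<star> a' + a''" by blast
  then show ?case
    by (intro bexI[of _ "c *s a'"] bexI[of _ "c *s a''"]) (auto simp: mul_simps alg_simps)
next
  case (mul g a)
  then obtain a' a'' where a: "a \<in> alg (k - 1)" "a' \<in> alg (k - 1)" "a'' \<in> alg (k - 1)" "a \<star> f k = f k \<star> a' + a''"
    by blast
  note am = alg_t[OF _ a(2)] alg_t[OF _ a(3)] alg_x[OF _ a(2)] alg_x[OF _ a(3)] alg_f[OF _ a(2)] alg_f[OF _ a(3)]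
  have gf: "g \<star> a \<star> f k = f k \<star> (h \<star> a') + (g \<star> a'' + r \<star> a')" if "g \<star> f k = f k \<star> h + r" for h r
  proof -
    have "g \<star> a \<star> f k = g \<star> (f k \<star> a' + a'')" using a(4) by (simp add: mul_assoc)
    also have "\<dots> = g \<star> f k \<star> a' + g \<star> a''" by (simp add: mul_simps)
    finally show ?thesis unfolding that by (simp add: mul_simps)
  qed
  consider (t) i where "i \<in> {1..n}" "g = t i" | (x0) "g = x k" | (x1) "g = x (k + 1)"
    | (x) i where "i \<in> {1..n}" "i \<noteq> k" "i \<noteq> k + 1" "g = x i"
    | (f) i where "i \<in> {1..<k - 1}" "g = f i" using mul.hyps by blast
  then show ?case
  proof cases
    case (t i)
    have si: "s k i \<in> {1..n}" using t k by (auto simp: Transposition.transpose_def)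
    then have "g \<star> f k = f k \<star> t (s k i) + 0" using ft[OF k si] t by simp
    from gf[OF this] show ?thesis using t si am(1,2)
      by (intro bexI[of _ "t (s k i) \<star> a'"] bexI[of _ "t i \<star> a''"]) auto
  next
    case x0
    then have "g \<star> f k = f k \<star> x (k + 1) + - e k" using fx[OF k] by simp
    from gf[OF this] have "g \<star> a \<star> f k = f k \<star> (x (k + 1) \<star> a') + (x k \<star> a'' - e k \<star> a')"
      using x0 by (simp add: mul_minus)
    then show ?thesis
      using am(3)[of "k + 1"] am(4)[of k] k
        alg_simps(4)[OF _ alg_mul[OF _ subsetD[OF gen_alg_t e_gen[OF k]] a(2)], of "x k \<star> a''"]
      by (intro bexI[of _ "x (k + 1) \<star> a'"] bexI[of _ "x k \<star> a'' - e k \<star> a'"]) auto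
  next
    case x1
    obtain e' where e': "e' \<in> gen_alg (t ` {1..n})" "x (k + 1) \<star> f k = f k \<star> x k + e'" using x_f'[OF k] by blast
    then have "g \<star> f k = f k \<star> x k + e'" using x1 by simp
    from gf[OF this] show ?thesis
      using x1 am(3)[of k] am(4)[of "k + 1"] k
        alg_simps(3)[OF _ alg_mul[OF _ subsetD[OF gen_alg_t e'(1)] a(2)], of "g \<star> a''"]
      by (intro bexI[of _ "x k \<star> a'"] bexI[of _ "g \<star> a'' + e' \<star> a'"]) auto
  next
    case (x i)
    then have "g \<star> f k = f k \<star> x i + 0" using fx'[OF k] by simp
    from gf[OF this] show ?thesis using x am(3,4)[of i]
      by (intro bexI[of _ "x i \<star> a'"] bexI[of _ "x i \<star> a''"]) auto
  next
    case (f i)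
    then have "g \<star> f k = f k \<star> f i + 0" using f_far[of i k] k by (simp add: less_diff_conv)
    from gf[OF this] show ?thesis using f am(5,6)[of i]
      by (intro bexI[of _ "f i \<star> a'"] bexI[of _ "f i \<star> a''"]) auto
  qed
qed

text \<open>Modelled on the decomposition of the symmetric group on \<open>k + 1\<close> letters
  into two double cosets of the one on \<open>k\<close> letters.\<close>

definition alg_double :: "nat \<Rightarrow> 'v set" where
  "alg_double k = span (alg k \<union> {a \<star> f k \<star> b | a b. a \<in> alg k \<and> b \<in> alg k})"

lemma alg_double_intros:
  "a \<in> alg k \<Longrightarrow> a \<in> alg_double k" "a \<in> alg k \<Longrightarrow> b \<in> alg k \<Longrightarrow> a \<star> f k \<star> b \<in> alg_double k"
  unfolding alg_double_def by (auto intro!: span_base)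

text \<open>Serves the start of the recursion, where \<open>k - 1\<close> is zero.\<close>

lemma alg_zero_one: "alg 0 = alg 1" by (simp add: alg_def)

lemma alg_double_gen:
  assumes k: "k \<in> {1..<n}" and g: "\<And>a. a \<in> alg k \<Longrightarrow> g \<star> a \<in> alg k" and a: "a \<in> alg_double k"
  shows "g \<star> a \<in> alg_double k"
  using a unfolding alg_double_def
proof (rule span_mul_left)
  fix u assume "u \<in> alg k \<union> {a \<star> f k \<star> b | a b. a \<in> alg k \<and> b \<in> alg k}"
  then consider "u \<in> alg k" | a b where "a \<in> alg k" "b \<in> alg k" "u = a \<star> f k \<star> b" by blast
  then show "g \<star> u \<in> span (alg k \<union> {a \<star> f k \<star> b | a b. a \<in> alg k \<and> b \<in> alg k})"
  proof cases
    case 2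
    then have "g \<star> u = (g \<star> a) \<star> f k \<star> b" by (simp add: mul_assoc)
    then show ?thesis using g[OF 2(1)] 2(2) by (intro span_base) blast
  qed (use g in \<open>auto intro: span_base\<close>)
qed

lemma f_alg_f_low:
  assumes k: "k \<in> {1..<n}" and a: "a \<in> alg (k - 1)" and b: "b \<in> alg k"
  shows "f k \<star> a \<star> f k \<star> b \<in> alg_double k"
proof -
  obtain a' a'' where a': "a' \<in> alg (k - 1)" "a'' \<in> alg (k - 1)" "f k \<star> a = a' \<star> f k + a''"
    using f_alg_left[OF k a] by blast
  then have a'k: "a' \<in> alg k" "a'' \<in> alg k" using alg_mono[of "k - 1" k] by auto
  have bC: "b \<in> C" using alg_C[of k] k b by auto
  have "f k \<star> a \<star> f k \<star> b = a' \<star> ((f k \<star> f k) \<star> b) + a'' \<star> f k \<star> b"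
    unfolding a'(3) by (simp add: mul_simps)
  also have "\<dots> = a' \<star> b + a'' \<star> f k \<star> b" using ff[OF k] bC by simp
  also have "\<dots> \<in> alg_double k"
    using alg_mul[OF _ a'k(1) b] alg_double_intros a'k b k
    unfolding alg_double_def by (intro span_add) auto
  finally show ?thesis .
qed

text \<open>After the inner factors have been moved outwards, the braid relation replaces two copies
  of \<open>f k\<close> by a single one.\<close>

lemma f_alg_f_high:
  assumes k: "k \<in> {1..<n}" "k - 1 \<in> {1..<n}" and a: "a \<in> alg (k - 1)" "c \<in> alg (k - 1)" and b: "b \<in> alg k"
  shows "f k \<star> (a \<star> f (k - 1) \<star> c) \<star> f k \<star> b \<in> alg_double k"
proof -
  let ?g = "f (k - 1)"
  obtain a' a'' where a': "a' \<in> alg (k - 1)" "a'' \<in> alg (k - 1)" "f k \<star> a = a' \<star> f k + a''"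
    using f_alg_left[OF k(1) a(1)] by blast
  obtain c' c'' where c': "c' \<in> alg (k - 1)" "c'' \<in> alg (k - 1)" "c \<star> f k = f k \<star> c' + c''"
    using f_alg_right[OF k(1) a(2)] by blast
  have in_k: "a' \<in> alg k" "a'' \<in> alg k" "c' \<in> alg k" "c'' \<in> alg k"
    using a' c' alg_mono[of "k - 1" k] by auto
  have g: "?g \<star> u \<in> alg k" if "u \<in> alg k" for u using alg_f[OF _ that, of "k - 1"] k by simp
  have g': "u \<star> ?g \<in> alg k" if "u \<in> alg k" for u
    using alg_mul[OF _ that g[OF alg_simps(1)]] k f_C by simp
  note m = alg_mul[of k]
  have kn: "k \<le> n" using k by simp
  have br: "f k \<star> ?g \<star> f k = ?g \<star> f k \<star> ?g" using braid[of "k - 1"] k by simp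
  have "f k \<star> (a \<star> ?g \<star> c) \<star> f k \<star> b = (f k \<star> a) \<star> ?g \<star> (c \<star> f k) \<star> b" by (simp add: mul_assoc)
  also have "\<dots> = a' \<star> (f k \<star> ?g \<star> f k) \<star> (c' \<star> b) + a' \<star> f k \<star> (?g \<star> (c'' \<star> b)) +
      (a'' \<star> ?g) \<star> f k \<star> (c' \<star> b) + a'' \<star> (?g \<star> (c'' \<star> b))"
    unfolding a'(3) c'(3) by (simp add: mul_simps)
  also have "\<dots> = (a' \<star> ?g) \<star> f k \<star> (?g \<star> (c' \<star> b)) + a' \<star> f k \<star> (?g \<star> (c'' \<star> b)) +
      (a'' \<star> ?g) \<star> f k \<star> (c' \<star> b) + a'' \<star> (?g \<star> (c'' \<star> b))"
    unfolding br by (simp add: mul_assoc)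
  also have "\<dots> \<in> alg_double k"
    unfolding alg_double_def
    by (intro span_add; fold alg_double_def)
       (intro alg_double_intros m[OF kn] in_k b g g' m[OF kn in_k(2) g])+
  finally show ?thesis .
qed

text \<open>The point is stability under left multiplication by \<open>f k\<close>, which creates
  \<open>f k \<star> a \<star> f k\<close> with \<open>a\<close> in \<open>alg k\<close>. By
  induction \<open>a\<close> contains \<open>f (k - 1)\<close> at most once: without it the two
  \<open>f k\<close> meet and cancel up to corrections, with it the braid relation applies.\<close>

lemma alg_Suc: "k \<in> {1..<n} \<Longrightarrow> alg (k + 1) \<subseteq> alg_double k"
proof (induction k rule: less_induct)
  case (less k)
  note k = less.prems
  have sub: "subspace (alg_double k)" unfolding alg_double_def by (rule subspace_span)
  have f2: "f k \<star> a \<star> f k \<star> b \<in> alg_double k" if ab: "a \<in> alg k" "b \<in> alg k" for a b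
  proof (cases "k = 1")
    case True
    then show ?thesis using f_alg_f_low[OF k] ab alg_zero_one by simp
  next
    case False
    then have k1: "k - 1 \<in> {1..<n}" using k by auto
    have "alg (k - 1 + 1) \<subseteq> alg_double (k - 1)" using k1 by (intro less.IH) auto
    then have "a \<in> span (alg (k - 1) \<union> {a \<star> f (k - 1) \<star> b | a b. a \<in> alg (k - 1) \<and> b \<in> alg (k - 1)})"
      using ab k by (auto simp: alg_double_def)
    then show ?thesis
    proof (induction rule: span_induct_alt)
      case base then show ?case using subspace_0[OF sub] by simp
    next
      case (step q u a)
      then have "f k \<star> u \<star> f k \<star> b \<in> alg_double k"
        using f_alg_f_low[OF k _ ab(2)] f_alg_f_high[OF k k1 _ _ ab(2)] by blast
      then show ?case using step.IH sub by (simp add: mul_distrib mul_scale subspace_def)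
    qed
  qed
  have fk: "f k \<star> a \<in> alg_double k" if "a \<in> alg_double k" for a
    using that unfolding alg_double_def
  proof (rule span_mul_left; fold alg_double_def)
    fix u assume "u \<in> alg k \<union> {a \<star> f k \<star> b | a b. a \<in> alg k \<and> b \<in> alg k}"
    then consider "u \<in> alg k" | a b where "a \<in> alg k" "b \<in> alg k" "u = a \<star> f k \<star> b" by blast
    then show "f k \<star> u \<in> alg_double k"
    proof cases
      case 1
      then show ?thesis using alg_double_intros(2)[OF alg_simps(1) 1] f_C[OF k] by simp
    next
      case 2
      then show ?thesis using f2[OF 2(1,2)] by (simp add: mul_assoc)
    qed
  qed
  show ?case
  proof
    fix a assume "a \<in> alg (k + 1)"
    then show "a \<in> alg_double k"
    proof (induction rule: alg_induct)
      case one then show ?case by (rule alg_double_intros(1)[OF alg_simps(1)])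
    next
      case (mul g a)
      then consider i where "i \<in> {1..n}" "g = t i" | i where "i \<in> {1..n}" "g = x i"
        | i where "i \<in> {1..<k}" "g = f i" | "g = f k"
        by (auto simp: less_Suc_eq)
      then show ?case
      proof cases
        case 1 then show ?thesis using mul alg_t by (intro alg_double_gen[OF k]) auto
      next
        case 2 then show ?thesis using mul alg_x by (intro alg_double_gen[OF k]) auto
      next
        case 3 then show ?thesis using mul alg_f by (intro alg_double_gen[OF k]) auto
      next
        case 4 then show ?thesis using fk mul by simp
      qed
    qed (use sub in \<open>auto simp: subspace_def\<close>)
  qed
qed

end

section \<open>Primitivity and equivalence of the weight idempotents\<close>

context yh_algebra
begin

lemma Ext_swap: "w \<in> Ext \<Longrightarrow> i \<in> {1..<n} \<Longrightarrow> w \<circ> s i \<in> Ext"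
  by (auto simp: Ext_def Transposition.transpose_def)

lemma alg_one_scalar:
  assumes "a \<in> alg 1" "m \<in> wt n w"
  shows "\<exists>c. a \<star> m = c *s m"
  using assms(1)
proof (induction rule: alg_induct)
  case one
  then show ?case using wt_C[OF assms(2)] by (intro exI[of _ 1]) simp
next
  case (add a b)
  then show ?case by (metis mul_distrib(1) scale_left_distrib)
next
  case (scale a c)
  then show ?case by (metis mul_scale(1) scale_scale)
next
  case (mul g a)
  then obtain c where c: "a \<star> m = c *s m" by blast
  consider i where "i \<in> {1..n}" "g = t i" | i where "i \<in> {1..n}" "g = x i" using mul.hyps by auto
  then have "\<exists>c'. g \<star> m = c' *s m" using assms(2) by cases (auto simp: wt_def)
  then obtain c' where "g \<star> m = c' *s m" by blast
  then have "g \<star> a \<star> m = (c * c') *s m" using c by (simp add: mul_assoc mul_scale)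
  then show ?case by blast
qed

text \<open>When both weights occur, the contents at \<open>i\<close> and \<open>i + 1\<close>
  belong to boxes addable to one and the same diagram with \<open>i - 1\<close> boxes. Such contents
  are never adjacent, so their difference is not 1 or -1.\<close>

lemma coef_nonunit:
  assumes i: "i \<in> {1..<n}" and p: "p \<in> wt n w" "p \<noteq> 0" and q: "q \<in> wt n (w \<circ> s i)" "q \<noteq> 0"
  shows "coef w i \<noteq> 1 \<and> coef w i \<noteq> - 1"
proof (cases "fst (w i) = fst (w (i + 1))")
  case True
  have pi: "p \<in> wt (i - 1) w" and qi: "q \<in> wt (i - 1) (w \<circ> s i)"
    using i wt_mono[OF p(1), of "i - 1"] wt_mono[OF q(1), of "i - 1"] by (simp_all add: less_imp_diff_less less_imp_le)
  have "\<exists>S. std_weight v d (i - 1) w S"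
    using i by (intro wt_std[OF diag _ pi p(2)]) auto
  then obtain S where S: "std_weight v d (i - 1) w S" by blast
  have S': "std_weight v d (i - 1) (w \<circ> s i) S"
    by (rule std_weight_cong[OF S]) (auto simp: Transposition.transpose_def)
  have dg: "diag (i - 1)" using i by (intro diag) auto
  have Suc: "Suc (i - 1) = i" using i by simp
  have add: "snd (w' i) \<in> addable_contents v d S (fst (w' i))"
    if "std_weight v d (i - 1) w' S" "m \<in> wt n w'" "m \<noteq> 0" for w' m
  proof -
    have "m \<in> wt (i - 1) w'" using i by (intro wt_mono[OF that(2)]) auto
    moreover have "\<exists>cs. distinct cs \<and> set cs \<subseteq> addable_contents v d S (fst (w' (Suc (i - 1)))) \<and>
        lin (x (Suc (i - 1))) cs m = 0"
      using dg that(1) calculation unfolding diag_def by blast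
    ultimately obtain cs where cs: "set cs \<subseteq> addable_contents v d S (fst (w' i))" "lin (x i) cs m = 0"
      unfolding Suc by blast
    have "x i \<star> m = snd (w' i) *s m" using that(2) i by (simp add: wt_def)
    then show ?thesis using lin_eigen_zero cs that(3) by blast
  qed
  obtain j l where j: "snd (w i) = v j + of_int l" "j \<in> {1..d}" "addable S (fst (w i)) j l"
    using add[OF S p] by (auto simp: addable_contents_def)
  obtain j' l' where j': "snd (w (i + 1)) = v j' + of_int l'" "j' \<in> {1..d}" "addable S (fst (w i)) j' l'"
    using add[OF S' q] True by (auto simp: addable_contents_def)
  have ne: "snd (w (i + 1)) - snd (w i) \<noteq> of_int c" if c: "\<bar>c\<bar> \<le> 1" "c \<noteq> 0" for c
  proof (cases "(j', l') = (j, l)")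
    case True
    then show ?thesis using j(1) j'(1) of_int_nonzero[of c] c i by auto
  next
    case False
    then show ?thesis
      using addable_nonadjacent[OF S _ j'(3) j(3) j'(2) j(2) False c(1)] i j(1) j'(1)
      by (auto simp: algebra_simps)
  qed
  have "1 / \<delta> \<noteq> 1 \<and> 1 / \<delta> \<noteq> - 1" if "\<delta> \<noteq> 1" "\<delta> \<noteq> - 1" for \<delta> :: 'k
    using that by (metis divide_eq_1_iff div_minus_right divide_minus_left minus_minus)
  then show ?thesis using ne[of 1] ne[of "- 1"] True by (simp add: coef_def)
qed (simp add: coef_def)

text \<open>The idempotents \<open>p w\<close> are the weight components of \<open>one\<close>. The
  shapes of the tableaux are not compared: links along single transpositions, composed by
  transitivity, already produce all pairs needed to span the algebra.\<close>

lemma yh_matrix_units: "\<exists>(T :: (nat \<Rightarrow> 'k \<times> 'k) set) (\<beta> :: _ \<Rightarrow> (nat \<Rightarrow> 'k \<times> 'k)) E. matrix_units T \<beta> E"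
proof -
  obtain W p where W: "finite W" "W \<subseteq> Ext" and one: "one = (\<Sum>w\<in>W. p w)"
    and p: "\<And>w. w \<in> W \<Longrightarrow> p w \<in> alg 1" "\<And>w. w \<in> W \<Longrightarrow> p w \<in> wt n w"
    using finite_wt_sum[OF wt_decomposition[OF alg_simps(1) order_refl] alg_subspace] by blast
  have pC: "p w \<in> C" if "w \<in> W" for w using wt_C[OF p(2)[OF that]] .
  have sum: "m = (\<Sum>w\<in>W. p w \<star> m)" if "m \<in> C" for m
    using that by (simp add: mul_sum(1)[symmetric] one[symmetric])
  \<comment> \<open>Right multiplication preserves left weights, so the product has weight
    \<open>w\<close>. As the components of \<open>one\<close> add up to \<open>one\<close>, it also
    lies in the span of other weight spaces.\<close>
  have zero: "p w \<star> m = 0" if "w \<in> W" "m \<in> wt n z" "z \<in> Ext" "z \<noteq> w" for w m z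
  proof (rule wt_independent[of "insert z (W - {w})" w])
    have "p w \<star> m = m - (\<Sum>y\<in>W - {w}. p y \<star> m)"
      using sum[OF wt_C[OF that(2)]] sum.remove[OF W(1) that(1), of "\<lambda>w. p w \<star> m"]
      by (metis add_diff_cancel_right')
    moreover have "m \<in> span (\<Union>w\<in>insert z (W - {w}). wt n w)"
      using that by (intro span_base) auto
    moreover have "p y \<star> m \<in> span (\<Union>w\<in>insert z (W - {w}). wt n w)" if y: "y \<in> W - {w}" for y
      using y wt_mul_right[OF p(2) wt_C[OF \<open>m \<in> wt n z\<close>], of y] by (intro span_base) auto
    ultimately show "p w \<star> m \<in> span (\<Union>w\<in>insert z (W - {w}). wt n w)"
      by (metis (no_types, lifting) span_diff span_sum)
  qed (use W that wt_mul_right[OF p(2) wt_C] in auto)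
  have unit: "p w \<star> m = m" if "w \<in> W" "m \<in> wt n w" for w m
  proof -
    have "m = p w \<star> m + (\<Sum>y\<in>W - {w}. p y \<star> m)"
      using sum[OF wt_C[OF that(2)]] W(1) that(1) by (simp add: sum.remove)
    moreover have "(\<Sum>y\<in>W - {w}. p y \<star> m) = 0"
      using zero[of _ m w] that W(2) by (intro sum.neutral) auto
    ultimately show ?thesis by simp
  qed
  have outside: "m = 0" if "m \<in> wt n z" "z \<in> Ext" "z \<notin> W" for m z
    using sum[OF wt_C[OF that(1)]] zero[OF _ that(1,2)] that(3) by (metis (no_types, lifting) sum.neutral)
  have zero': "p w \<star> m = 0" if w: "w \<in> W" and m: "m \<in> span (\<Union>z\<in>{z. \<forall>i>k. z i = y i}. wt n z)"
    and i: "i > k" "i \<in> {1..n}" "y i \<noteq> w i" for w m y k i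
  proof -
    have "p w \<star> m \<in> span {}"
      using m
    proof (rule span_mul_left)
      fix u assume "u \<in> (\<Union>z\<in>{z. \<forall>i>k. z i = y i}. wt n z)"
      then obtain z where z: "u \<in> wt n z" "z i = y i" using i(1) by auto
      \<comment> \<open>The weights delivered by \<open>alg_wt\<close> are arbitrary outside
        \<open>{1..n}\<close> and are brought into \<open>Ext\<close> first.\<close>
      define z' where "z' = (\<lambda>i. if i \<in> {1..n} then z i else (0, 0))"
      have "u \<in> wt n z'" using z(1) wt_cong[of z z' n] by (auto simp: z'_def)
      moreover have "z' \<in> Ext" "z' \<noteq> w" using i z(2) by (auto simp: z'_def Ext_def)
      ultimately show "p w \<star> u \<in> span {}" using zero[OF w] by simp
    qed
    then show ?thesis by simp
  qed
  \<comment> \<open>Induction along the filtration. In a term \<open>a \<star> f k \<star> b\<close>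
    the decomposition of \<open>one\<close> is inserted after \<open>f k\<close>; each summand turns
    out to see \<open>f k\<close> only through its diagonal coefficient, which leaves an element of
    \<open>alg k\<close>.\<close>
  have prim: "p w \<star> a \<star> p w \<in> span {p w}" if "k \<in> {1..n}" "w \<in> W" "a \<in> alg k" for k w a
    using that
  proof (induction k arbitrary: a w)
    case (Suc k)
    show ?case
    proof (cases "k = 0")
      case True
      then obtain c where "a \<star> p w = c *s p w" using alg_one_scalar[OF _ p(2)] Suc.prems by auto
      then have "p w \<star> a \<star> p w = c *s p w" using unit[OF Suc.prems(2) p(2)] Suc.prems(2) by (simp add: mul_assoc mul_scale)
      then show ?thesis by (simp add: span_scale span_base)
    next
      case False
      then have k: "k \<in> {1..<n}" using Suc.prems by auto
      have low: "p w \<star> a \<star> p w \<in> span {p w}" if "a \<in> alg k" for a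
        using Suc.IH[of w a] k Suc.prems that by simp
      have "a \<in> alg_double k" using alg_Suc[OF k] Suc.prems by auto
      then show ?thesis unfolding alg_double_def
      proof (induction rule: span_induct_alt)
        case (step q u a)
        have "p w \<star> u \<star> p w \<in> span {p w}"
        proof (cases "u \<in> alg k")
          case False
          then obtain a b where ab: "a \<in> alg k" "b \<in> alg k" "u = a \<star> f k \<star> b" using step.hyps by blast
          have w: "w \<in> W" by fact
          have C: "a \<in> C" "b \<in> C" using ab alg_C[of k] k by auto
          have "p w \<star> (a \<star> (f k \<star> (p z \<star> (b \<star> p w)))) \<in> span {p w}" if z: "z \<in> W" for z
          proof -
            let ?m = "p z \<star> (b \<star> p w)"
            have m: "?m \<in> wt n z" using wt_mul_right[OF p(2)[OF z]] C pC[OF w] by simp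
            show ?thesis
            proof (cases "?m = 0")
              case False
              have bw: "b \<star> p w \<in> span (\<Union>z\<in>{z. \<forall>i>k. z i = w i}. wt n z)"
                using alg_wt[OF ab(2) _ p(2)[OF w]] k by simp
              \<comment> \<open>Elements of \<open>alg k\<close> leave entry \<open>k + 1\<close>
                alone. The off-diagonal part \<open>q\<close> has there the entry
                \<open>z k\<close>, different from \<open>z (k + 1) = w (k + 1)\<close>, so it can
                never return to weight \<open>w\<close>.\<close>
              have "z (k + 1) = w (k + 1)" using zero'[OF z bw, of "k + 1"] False k by force
              moreover have "z k \<noteq> z (k + 1)"
                using wt_equal_zero[of k ?m n z] diag m k False by auto
              ultimately have sw: "(z \<circ> s k) (k + 1) \<noteq> w (k + 1)" by simp
              obtain q where q: "q \<in> wt n (z \<circ> s k)" "f k \<star> ?m = coef z k *s ?m + q"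
                using f_wt_split[OF k m] by blast
              have "a \<star> q \<in> span (\<Union>y\<in>{y. \<forall>i>k. y i = (z \<circ> s k) i}. wt n y)"
                using alg_wt[OF ab(1) _ q(1)] k by simp
              from zero'[OF w this _ _ sw] have "p w \<star> (a \<star> q) = 0" using k by simp
              then have "p w \<star> (a \<star> (f k \<star> ?m)) = coef z k *s (p w \<star> (a \<star> p z \<star> b) \<star> p w)"
                unfolding q(2) by (simp add: mul_simps)
              moreover have "p z \<in> alg k" using p(1)[OF z] alg_mono[of 1 k] k by auto
              then have "p w \<star> (a \<star> p z \<star> b) \<star> p w \<in> span {p w}"
                using alg_mul ab k by (intro low) auto
              ultimately show ?thesis by (simp add: span_scale)
            qed (simp add: span_zero)
          qed
          then have "(\<Sum>z\<in>W. p w \<star> (a \<star> (f k \<star> (p z \<star> (b \<star> p w))))) \<in> span {p w}"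
            by (rule span_sum)
          also have "(\<Sum>z\<in>W. p w \<star> (a \<star> (f k \<star> (p z \<star> (b \<star> p w))))) = p w \<star> (a \<star> (f k \<star> (b \<star> p w)))"
            using sum[of "b \<star> p w"] C pC[OF w] by (simp add: mul_sum(2)[symmetric])
          finally show ?thesis by (simp add: ab(3) mul_assoc)
        qed (rule low)
        then show ?case using step.IH by (simp add: mul_simps span_add span_scale)
      qed (simp add: span_zero)
    qed
  qed simp
  define T where "T = {w \<in> W. p w \<noteq> 0}"
  have TW: "w \<in> W" "p w \<noteq> 0" if "w \<in> T" for w using that by (auto simp: T_def)
  have orth: "p w \<star> p z = (if w = z then p z else 0)" if "w \<in> W" "z \<in> W" for w z
    using unit[OF that(1) p(2)[OF that(1)]] zero[OF that(1) p(2)[OF that(2)]] that W(2) by auto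
  \<comment> \<open>The off-diagonal part of \<open>f i\<close> on \<open>p w\<close>, if nonzero,
    links \<open>p w\<close> to the idempotent of the swapped weight.\<close>
  have link: "q = 0 \<or> (\<exists>w'\<in>T. linked (p w') (p w) \<and> p w' \<star> q = q)"
    if i: "i \<in> {1..<n}" and w: "w \<in> T" and q: "q \<in> wt n (w \<circ> s i)" "f i \<star> p w = coef w i *s p w + q" for w i q
  proof (cases "q = 0")
    case False
    let ?w = "w \<circ> s i" and ?c = "coef w i"
    have wE: "w \<in> Ext" "?w \<in> Ext" using TW[OF w] W(2) Ext_swap[OF _ i] by auto
    have w': "?w \<in> W" using outside[OF q(1) wE(2)] False by blast
    have wq: "p ?w \<star> q = q" by (rule unit[OF w' q(1)])
    then have w'T: "?w \<in> T" using w' False by (auto simp: T_def)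
    have "w i \<noteq> w (i + 1)"
      using wt_equal_zero[of i "p w" n w] diag p(2) TW[OF w] i by auto
    then have ww: "?w \<noteq> w" by (metis comp_apply Transposition.transpose_apply_first)
    have qp: "q \<star> p w = q"
    proof -
      have "q = f i \<star> p w - ?c *s p w" using q(2) by simp
      then show ?thesis using orth[of w w] TW[OF w] by (simp add: mul_simps)
    qed
    have pq: "p w \<star> q = 0" by (rule zero[OF TW(1)[OF w] q(1) wE(2) ww])
    define r where "r = p w \<star> f i \<star> p ?w"
    \<comment> \<open>The scalar by which the intertwiner followed by its reverse acts; it is
      nonzero because \<open>coef\<close> is neither 1 nor -1.\<close>
    define k where "k = 1 - ?c * ?c"
    have "?c \<noteq> 1 \<and> ?c \<noteq> - 1" using coef_nonunit[OF i p(2) _ q(1)] TW[OF w] False by blast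
    then have "(1 - ?c) * (1 + ?c) \<noteq> 0" by (auto simp: eq_neg_iff_add_eq_0 add.commute)
    then have k: "k \<noteq> 0" by (simp add: k_def algebra_simps)
    have fq: "f i \<star> q = k *s p w - ?c *s q"
    proof -
      have "q = f i \<star> p w - ?c *s p w" using q(2) by simp
      then have "f i \<star> q = f i \<star> (f i \<star> p w) - ?c *s (f i \<star> p w)" by (metis mul_diff(2) mul_scale(2))
      also have "\<dots> = p w - ?c *s (?c *s p w + q)" using ff_mul[OF i pC[OF TW(1)[OF w]]] q(2) by simp
      finally show ?thesis by (simp add: k_def mul_simps)
    qed
    have "r \<star> q = p w \<star> (f i \<star> (p ?w \<star> q))" by (simp add: r_def mul_assoc)
    also have "\<dots> = k *s p w"
      unfolding wq fq using orth[of w w] TW[OF w] pq by (simp add: mul_simps)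
    finally have rq: "r \<star> q = k *s p w" .
    \<comment> \<open>Primitivity makes \<open>q \<star> r\<close> a multiple of the other
      idempotent, and evaluating \<open>q \<star> r \<star> q\<close> in both ways identifies the
      scalar as \<open>k\<close>.\<close>
    have "p ?w \<star> (q \<star> p w \<star> f i) \<star> p ?w \<in> span {p ?w}"
      using prim[of n ?w] w' n_pos alg_n wt_C[OF q(1)] pC TW[OF w] f_C[OF i] by simp
    moreover have "p ?w \<star> (q \<star> p w \<star> f i) \<star> p ?w = (p ?w \<star> q) \<star> r" by (simp add: r_def mul_assoc)
    ultimately obtain k' where k': "q \<star> r = k' *s p ?w" unfolding wq span_singleton by auto
    have "k' *s q = q \<star> r \<star> q" unfolding k' using wq by (simp add: mul_scale)
    also have "\<dots> = k *s q" using rq qp by (simp add: mul_assoc mul_scale)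
    finally have kk: "k' = k" using False by simp
    have C: "q \<in> C" "r \<in> C" using wt_C[OF q(1)] pC w' TW[OF w] f_C[OF i] by (auto simp: r_def)
    have pr: "p w \<star> r = r" "r \<star> p ?w = r"
      unfolding r_def using orth[of w w] orth[of ?w ?w] TW[OF w] w'
      by (simp_all add: mul_assoc) (simp add: mul_assoc[symmetric])
    have "linked (p ?w) (p w)" unfolding linked_def
      using C k kk rq k' pr wq qp
      by (intro bexI[of _ q] bexI[of _ "(1 / k) *s r"]) (auto simp: mul_scale)
    then show ?thesis using w'T wq by blast
  qed simp
  \<comment> \<open>Left multiplication by a generator changes the left idempotent only along a
    link, so the span of the linked pairs contains \<open>one\<close> and is a left ideal.\<close>
  let ?B = "{p y \<star> a \<star> p z | y z a. y \<in> T \<and> z \<in> T \<and> a \<in> C \<and> linked (p y) (p z)}"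
  have "C \<subseteq> span ?B"
  proof
    fix c assume "c \<in> C"
    then have "c \<in> alg n" by (simp add: alg_n)
    then show "c \<in> span ?B"
    proof (induction rule: alg_induct)
      case one
      have "p w \<in> span ?B" if w: "w \<in> W" for w
      proof (cases "p w = 0")
        case False
        then have "w \<in> T" "linked (p w) (p w)"
          using w pC[OF w] linked_refl[of "p w"] orth[OF w w] by (auto simp: T_def)
        then have "p w \<star> p w \<star> p w \<in> ?B" using pC[OF w] by blast
        then show ?thesis using orth[OF w w] by (simp add: span_base)
      qed (simp add: span_zero)
      then show ?case unfolding \<open>one = _\<close> by (rule span_sum)
    next
      case (mul g c)
      show ?case
        using mul.IH
      proof (rule span_mul_left)
        fix u assume "u \<in> ?B"
        then obtain y z a where u: "u = p y \<star> a \<star> p z" "y \<in> T" "z \<in> T" "a \<in> C" "linked (p y) (p z)" by blast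
        then have uB: "u \<in> span ?B" by (intro span_base) blast
        note py = p(2)[OF TW(1)[OF u(2)]]
        consider (t) i where "i \<in> {1..n}" "g = t i" | (x) i where "i \<in> {1..n}" "g = x i"
          | (f) i where "i \<in> {1..<n}" "g = f i" using mul.hyps by blast
        then show "g \<star> u \<in> span ?B"
        proof cases
          case (t i)
          then have "g \<star> p y = fst (y i) *s p y" using py by (simp add: wt_def)
          then have "g \<star> u = fst (y i) *s u" unfolding u(1) by (simp add: mul_assoc[symmetric] mul_scale)
          then show ?thesis using uB by (simp add: span_scale)
        next
          case (x i)
          then have "g \<star> p y = snd (y i) *s p y" using py by (simp add: wt_def)
          then have "g \<star> u = snd (y i) *s u" unfolding u(1) by (simp add: mul_assoc[symmetric] mul_scale)
          then show ?thesis using uB by (simp add: span_scale)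
        next
          case (f i)
          obtain q where q: "q \<in> wt n (y \<circ> s i)" "f i \<star> p y = coef y i *s p y + q"
            using f_wt_split[OF f(1) py] by blast
          have "g \<star> u = (f i \<star> p y) \<star> a \<star> p z" unfolding u(1) f(2) by (simp add: mul_assoc)
          also have "\<dots> = coef y i *s u + q \<star> a \<star> p z"
            unfolding q(2) u(1) by (simp add: mul_distrib mul_scale)
          finally have gu: "g \<star> u = coef y i *s u + q \<star> a \<star> p z" .
          from link[OF f(1) u(2) q] have "q \<star> a \<star> p z \<in> span ?B"
          proof
            assume "\<exists>w'\<in>T. linked (p w') (p y) \<and> p w' \<star> q = q"
            then obtain w' where w': "w' \<in> T" "linked (p w') (p y)" "p w' \<star> q = q" by blast
            then have "q \<star> a \<star> p z = p w' \<star> (q \<star> a) \<star> p z" by (simp add: mul_assoc[symmetric])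
            moreover have "q \<star> a \<in> C" using wt_C[OF q(1)] u(4) by simp
            moreover have "linked (p w') (p z)" by (rule linked_trans[OF w'(2) u(5)])
            ultimately have "q \<star> a \<star> p z \<in> ?B" using w'(1) u(3) by blast
            then show ?thesis by (rule span_base)
          qed (simp add: span_zero)
          then show ?thesis unfolding gu using uB by (intro span_add span_scale)
        qed
      qed
    qed (auto intro: span_add span_scale)
  qed
  then have "\<exists>(\<beta> :: _ \<Rightarrow> (nat \<Rightarrow> 'k \<times> 'k)) E. matrix_units T \<beta> E"
  proof (rule matrix_units_of_idempotents[rotated -1])
    show "finite T" using W(1) by (simp add: T_def)
    show "p w \<star> a \<star> p w \<in> span {p w}" if "w \<in> T" "a \<in> C" for w a
      using prim[of n w a] that n_pos by (simp add: alg_n T_def)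
  qed (use pC orth in \<open>auto simp: T_def\<close>)
  then show ?thesis by blast
qed

end

section \<open>Linear embedding of abstract algebras\<close>

abbreviation pm_scale :: "'k::field \<Rightarrow> ('a \<Rightarrow>\<^sub>0 'k) \<Rightarrow> ('a \<Rightarrow>\<^sub>0 'k)" where
  "pm_scale c \<equiv> Poly_Mapping.map ((*) c)"

lemma vector_space_poly_mapping: "Vector_Spaces.vector_space (pm_scale :: 'k::field \<Rightarrow> ('a \<Rightarrow>\<^sub>0 'k) \<Rightarrow> _)"
  by unfold_locales (simp_all add: smult_monoid_algebra)

inductive_set alg_span :: "('k::field, 'a) module \<Rightarrow> 'a set \<Rightarrow> 'a set" for A G where
  alg_span_zero: "\<zero>\<^bsub>A\<^esub> \<in> alg_span A G"
| alg_span_step: "g \<in> G \<Longrightarrow> p \<in> alg_span A G \<Longrightarrow> c \<odot>\<^bsub>A\<^esub> g \<oplus>\<^bsub>A\<^esub> p \<in> alg_span A G"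

text \<open>A linear section \<open>emb\<close> of a linear map \<open>ret\<close> transports the
  product of \<open>A\<close>, whose carrier is only a subset of its type, to a whole vector space.
  This gives a \<open>summand_algebra\<close> whose corner is the image of
  \<open>emb\<close>.\<close>

locale embedded_algebra = assoc_algebra A + V: Vector_Spaces.vector_space sc
  for A :: "('k::field, 'a) module" (structure) and sc :: "'k \<Rightarrow> 'v::ab_group_add \<Rightarrow> 'v" +
  fixes emb :: "'a \<Rightarrow> 'v" and ret :: "'v \<Rightarrow> 'a"
  assumes ret_closed [simp]: "ret u \<in> carrier A"
    and ret_add: "ret (u + w) = ret u \<oplus> ret w"
    and ret_scale: "ret (sc c u) = c \<odot> ret u"
    and emb_add: "a \<in> carrier A \<Longrightarrow> b \<in> carrier A \<Longrightarrow> emb (a \<oplus> b) = emb a + emb b"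
    and emb_smult: "a \<in> carrier A \<Longrightarrow> emb (c \<odot> a) = sc c (emb a)"
    and ret_emb [simp]: "a \<in> carrier A \<Longrightarrow> ret (emb a) = a"
begin

declare smult_closed [simp]

definition emul :: "'v \<Rightarrow> 'v \<Rightarrow> 'v" where "emul u w = emb (ret u \<otimes> ret w)"

sublocale E: summand_algebra sc emul "emb \<one>"
  by unfold_locales
    (simp_all add: emul_def ret_add ret_scale l_distr r_distr emb_add smult_mult_l smult_mult_r emb_smult m_assoc)

lemma emb_zero [simp]: "emb \<zero> = 0"
  using emb_add[of \<zero> \<zero>] by simp

lemma ret_zero [simp]: "ret 0 = \<zero>"
  using ret_scale[of 0 "0"] ret_scale[of 0 "emb \<zero>"] by (metis V.scale_zero_right emb_zero ret_emb zero_closed)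

lemma emb_C [simp]: "a \<in> carrier A \<Longrightarrow> emb a \<in> E.C"
  by (simp add: E.C_def emul_def)

lemma emb_ret: "u \<in> E.C \<Longrightarrow> emb (ret u) = u"
  by (auto simp: E.C_def emul_def)

lemma emb_mult: "a \<in> carrier A \<Longrightarrow> b \<in> carrier A \<Longrightarrow> emb (a \<otimes> b) = emul (emb a) (emb b)"
  by (simp add: emul_def)

lemma emb_inj: "a \<in> carrier A \<Longrightarrow> b \<in> carrier A \<Longrightarrow> emb a = emb b \<longleftrightarrow> a = b"
  by (metis ret_emb)

lemma emb_minus: "a \<in> carrier A \<Longrightarrow> b \<in> carrier A \<Longrightarrow> emb (a \<ominus> b) = emb a - emb b"
proof -
  assume ab: "a \<in> carrier A" "b \<in> carrier A"
  have "emb ((a \<ominus> b) \<oplus> b) = emb (a \<ominus> b) + emb b" using ab by (intro emb_add) auto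
  moreover have "(a \<ominus> b) \<oplus> b = a" using ab by (simp add: minus_eq a_assoc l_neg)
  ultimately show ?thesis by simp
qed

lemma ret_span:
  assumes "u \<in> V.span G"
  shows "ret u \<in> alg_span A (ret ` G)"
  using assms
  by (induction rule: V.span_induct_alt) (auto simp: ret_add ret_scale intro: alg_span.intros)

lemma emb_span:
  assumes "a \<in> alg_span A G" "G \<subseteq> carrier A"
  shows "a \<in> carrier A \<and> emb a \<in> V.span (emb ` G)"
  using assms(1)
proof (induction rule: alg_span.induct)
  case alg_span_zero then show ?case by (simp add: V.span_zero)
next
  case (alg_span_step g p c)
  then have g: "g \<in> carrier A" "emb g \<in> emb ` G" using assms(2) by auto
  then have "sc c (emb g) \<in> V.span (emb ` G)" by (intro V.span_scale V.span_base)
  then show ?case using alg_span_step g(1) by (simp add: emb_add emb_smult V.span_add)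
qed

end

text \<open>\<open>A\<close> is a quotient of the space of formal combinations of its elements; a
  complement of the kernel of evaluation is a copy of \<open>A\<close>.\<close>

lemma embedding_exists:
  fixes A :: "('k::field, 'a) module"
  assumes "assoc_algebra A"
  shows "\<exists>(emb :: 'a \<Rightarrow> 'a \<Rightarrow>\<^sub>0 'k) ret. embedded_algebra A pm_scale emb ret"
proof -
  interpret A: assoc_algebra A by fact
  interpret V: Vector_Spaces.vector_space "pm_scale :: 'k \<Rightarrow> ('a \<Rightarrow>\<^sub>0 'k) \<Rightarrow> _"
    by (rule vector_space_poly_mapping)
  interpret VV: Vector_Spaces.vector_space_pair "pm_scale :: 'k \<Rightarrow> ('a \<Rightarrow>\<^sub>0 'k) \<Rightarrow> _" "pm_scale :: 'k \<Rightarrow> ('a \<Rightarrow>\<^sub>0 'k) \<Rightarrow> _"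
    by unfold_locales
  \<comment> \<open>Evaluation of a formal combination. Terms outside the carrier are ignored, so
    that the map is total and linear.\<close>
  define ret where "ret p = finsum A (\<lambda>a. Poly_Mapping.lookup p a \<odot>\<^bsub>A\<^esub> a) (Poly_Mapping.keys p \<inter> carrier A)"
    for p :: "'a \<Rightarrow>\<^sub>0 'k"
  have smult_zero: "0 \<odot>\<^bsub>A\<^esub> a = \<zero>\<^bsub>A\<^esub>" if "a \<in> carrier A" for a
  proof -
    have "0 \<odot>\<^bsub>A\<^esub> a \<oplus>\<^bsub>A\<^esub> 0 \<odot>\<^bsub>A\<^esub> a = 0 \<odot>\<^bsub>A\<^esub> a" using A.smult_l_distr[OF that, of 0 0] by simp
    then show ?thesis using A.smult_closed[OF that, of 0] by (simp add: A.add.l_cancel_one)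
  qed
  have closed: "(\<lambda>a. Poly_Mapping.lookup p a \<odot>\<^bsub>A\<^esub> a) \<in> S \<rightarrow> carrier A" if "S \<subseteq> carrier A" for S and p :: "'a \<Rightarrow>\<^sub>0 'k"
    using that by (auto intro: A.smult_closed)
  have ret_superset: "ret p = finsum A (\<lambda>a. Poly_Mapping.lookup p a \<odot>\<^bsub>A\<^esub> a) S"
    if "finite S" "Poly_Mapping.keys p \<inter> carrier A \<subseteq> S" "S \<subseteq> carrier A" for p S
    unfolding ret_def using that closed[OF that(3)]
    by (intro A.add.finprod_mono_neutral_cong_left) (auto simp: in_keys_iff smult_zero)
  have ret_closed: "ret p \<in> carrier A" for p
    unfolding ret_def by (intro A.finsum_closed closed) auto
  have ret_add: "ret (p + q) = ret p \<oplus>\<^bsub>A\<^esub> ret q" for p q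
  proof -
    let ?S = "(Poly_Mapping.keys p \<union> Poly_Mapping.keys q) \<inter> carrier A"
    have S: "finite ?S" "?S \<subseteq> carrier A" by auto
    have "ret (p + q) = finsum A (\<lambda>a. Poly_Mapping.lookup (p + q) a \<odot>\<^bsub>A\<^esub> a) ?S"
      using keys_add[of p q] by (intro ret_superset) auto
    also have "\<dots> = finsum A (\<lambda>a. Poly_Mapping.lookup p a \<odot>\<^bsub>A\<^esub> a \<oplus>\<^bsub>A\<^esub> Poly_Mapping.lookup q a \<odot>\<^bsub>A\<^esub> a) ?S"
      by (intro A.finsum_cong') (auto simp: lookup_add A.smult_l_distr intro: A.smult_closed)
    also have "\<dots> = ret p \<oplus>\<^bsub>A\<^esub> ret q"
    proof -
      have "Poly_Mapping.keys p \<inter> carrier A \<subseteq> ?S" "Poly_Mapping.keys q \<inter> carrier A \<subseteq> ?S" by auto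
      from this[THEN ret_superset[OF S(1) _ S(2)]] show ?thesis
        using closed[OF S(2)] by (subst A.finsum_addf) auto
    qed
    finally show ?thesis .
  qed
  have smult_zero': "c \<odot>\<^bsub>A\<^esub> \<zero>\<^bsub>A\<^esub> = \<zero>\<^bsub>A\<^esub>" for c
    using smult_zero[of "\<zero>\<^bsub>A\<^esub>"] A.smult_assoc[of "\<zero>\<^bsub>A\<^esub>" c 0] by simp
  have ret_single: "ret (Poly_Mapping.single a c) = (if a \<in> carrier A then c \<odot>\<^bsub>A\<^esub> a else \<zero>\<^bsub>A\<^esub>)" for a c
  proof (cases "a \<in> carrier A")
    case True
    then have "ret (Poly_Mapping.single a c) = finsum A (\<lambda>b. Poly_Mapping.lookup (Poly_Mapping.single a c) b \<odot>\<^bsub>A\<^esub> b) {a}"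
      by (intro ret_superset) (auto split: if_splits)
    then show ?thesis using True by (simp add: A.smult_closed)
  next
    case False
    then have "Poly_Mapping.keys (Poly_Mapping.single a c) \<inter> carrier A = {}" by auto
    then show ?thesis using False by (simp add: ret_def)
  qed
  have ret_zero: "ret 0 = \<zero>\<^bsub>A\<^esub>" by (simp add: ret_def)
  have ret_scale: "ret (pm_scale c p) = c \<odot>\<^bsub>A\<^esub> ret p" for c p
  proof (induction p rule: poly_mapping_single_induct)
    case (plus a k p)
    have "ret (pm_scale c (Poly_Mapping.single a k)) = c \<odot>\<^bsub>A\<^esub> ret (Poly_Mapping.single a k)"
      by (simp add: ret_single A.smult_assoc smult_zero')
    with plus show ?case
      by (simp only: smult_monoid_algebra ret_add A.smult_r_distr[OF ret_closed ret_closed])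
  qed (simp_all add: ret_zero smult_zero' smult_monoid_algebra)
  define J where "J = {p. ret p = \<zero>\<^bsub>A\<^esub>}"
  have J: "V.subspace J"
    by (auto simp: V.subspace_def J_def ret_zero ret_add ret_scale smult_zero')
  \<comment> \<open>A projection onto the kernel of evaluation. Hence \<open>p - \<rho> p\<close>
    depends only on \<open>ret p\<close>, which makes \<open>emb\<close> linear although
    \<open>Poly_Mapping.single\<close> is not.\<close>
  obtain \<rho> where \<rho>: "range \<rho> \<subseteq> J" "Vector_Spaces.linear pm_scale pm_scale \<rho>" "\<And>p. p \<in> J \<Longrightarrow> \<rho> p = p"
    using VV.linear_exists_right_inverse_on[OF V.linear_id J] by auto
  interpret \<rho>: Vector_Spaces.linear pm_scale pm_scale \<rho> by (rule \<rho>(2))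
  define emb where "emb a = Poly_Mapping.single a 1 - \<rho> (Poly_Mapping.single a 1)" for a
  have ret_diff: "ret (p - q) = ret p \<ominus>\<^bsub>A\<^esub> ret q" for p q
  proof -
    have "ret p = ret (p - q) \<oplus>\<^bsub>A\<^esub> ret q" by (simp flip: ret_add)
    then show ?thesis using ret_closed by (simp add: A.minus_eq A.a_assoc A.r_neg)
  qed
  have ker: "p = \<rho> p" if "ret p = \<zero>\<^bsub>A\<^esub>" for p using \<rho>(3)[of p] that by (simp add: J_def)
  have "ret (emb a) = a" if "a \<in> carrier A" for a
  proof -
    have "ret (\<rho> p) = \<zero>\<^bsub>A\<^esub>" for p using \<rho>(1) by (auto simp: J_def)
    then show ?thesis using that by (simp add: emb_def ret_diff ret_single A.smult_one A.minus_eq)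
  qed
  moreover have "emb (a \<oplus>\<^bsub>A\<^esub> b) = emb a + emb b" if "a \<in> carrier A" "b \<in> carrier A" for a b
  proof -
    let ?p = "Poly_Mapping.single (a \<oplus>\<^bsub>A\<^esub> b) 1 - (Poly_Mapping.single a 1 + Poly_Mapping.single b (1::'k))"
    have "ret ?p = \<zero>\<^bsub>A\<^esub>"
      using that by (simp add: ret_diff ret_add ret_single A.smult_one A.minus_eq A.r_neg)
    from ker[OF this] show ?thesis by (simp add: emb_def \<rho>.diff \<rho>.add algebra_simps)
  qed
  moreover have "emb (c \<odot>\<^bsub>A\<^esub> a) = pm_scale c (emb a)" if "a \<in> carrier A" for a c
  proof -
    let ?p = "Poly_Mapping.single (c \<odot>\<^bsub>A\<^esub> a) 1 - pm_scale c (Poly_Mapping.single a (1::'k))"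
    have "ret ?p = \<zero>\<^bsub>A\<^esub>"
      using that by (simp add: ret_diff ret_scale ret_single A.smult_one A.smult_closed A.minus_eq A.r_neg del: map_single)
    from ker[OF this] show ?thesis
      by (simp add: emb_def \<rho>.diff \<rho>.scale V.scale_right_diff_distrib algebra_simps del: map_single)
  qed
  ultimately have "embedded_algebra A pm_scale emb ret"
    using ret_closed ret_add ret_scale by unfold_locales auto
  then show ?thesis by blast
qed

section \<open>Split semisimplicity from matrix units\<close>

text \<open>No matrix unit is required to be nonzero.\<close>

definition has_matrix_units :: "('k::field, 'a) module \<Rightarrow> bool" where
  "has_matrix_units A \<longleftrightarrow> (\<exists>(N::nat) (\<beta> :: nat \<Rightarrow> nat) E.
    (\<forall>s<N. \<forall>t<N. \<beta> s = \<beta> t \<longrightarrow> E s t \<in> carrier A) \<and>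
    (\<forall>s<N. \<forall>t<N. \<forall>t'<N. \<forall>u<N. \<beta> s = \<beta> t \<longrightarrow> \<beta> t' = \<beta> u \<longrightarrow>
      E s t \<otimes>\<^bsub>A\<^esub> E t' u = (if t = t' then E s u else \<zero>\<^bsub>A\<^esub>)) \<and>
    carrier A \<subseteq> alg_span A {E s t | s t. s < N \<and> t < N \<and> \<beta> s = \<beta> t})"

lemma has_matrix_unitsI:
  fixes T :: "'i set" and \<beta> :: "'i \<Rightarrow> 'j"
  assumes "finite T" "\<And>s t. s \<in> T \<Longrightarrow> t \<in> T \<Longrightarrow> \<beta> s = \<beta> t \<Longrightarrow> E s t \<in> carrier A"
    and "\<And>s t t' u. s \<in> T \<Longrightarrow> t \<in> T \<Longrightarrow> t' \<in> T \<Longrightarrow> u \<in> T \<Longrightarrow> \<beta> s = \<beta> t \<Longrightarrow> \<beta> t' = \<beta> u \<Longrightarrow>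
      E s t \<otimes>\<^bsub>A\<^esub> E t' u = (if t = t' then E s u else \<zero>\<^bsub>A\<^esub>)"
    and "carrier A \<subseteq> alg_span A {E s t | s t. s \<in> T \<and> t \<in> T \<and> \<beta> s = \<beta> t}"
  shows "has_matrix_units A"
proof -
  obtain h where h: "bij_betw h {..<card T} T" using ex_bij_betw_nat_finite[OF assms(1)]
    by (auto simp: atLeast0LessThan)
  have hT: "h i \<in> T" if "i < card T" for i using h that by (auto simp: bij_betw_def)
  have hinj: "h i = h j \<longleftrightarrow> i = j" if "i < card T" "j < card T" for i j
    using h that by (auto simp: bij_betw_def inj_on_def)
  obtain g where g: "bij_betw g (\<beta> ` T) {..<card (\<beta> ` T)}"
    using ex_bij_betw_finite_nat[of "\<beta> ` T"] assms(1) by (auto simp: atLeast0LessThan)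
  have ginj: "g (\<beta> s) = g (\<beta> t) \<longleftrightarrow> \<beta> s = \<beta> t" if "s \<in> T" "t \<in> T" for s t
    using g that by (auto simp: bij_betw_def inj_on_def)
  have "{E s t | s t. s \<in> T \<and> t \<in> T \<and> \<beta> s = \<beta> t} =
      {E (h i) (h j) | i j. i < card T \<and> j < card T \<and> g (\<beta> (h i)) = g (\<beta> (h j))}"
  proof (intro equalityI subsetI)
    fix y assume "y \<in> {E s t | s t. s \<in> T \<and> t \<in> T \<and> \<beta> s = \<beta> t}"
    then obtain s t where st: "y = E s t" "s \<in> T" "t \<in> T" "\<beta> s = \<beta> t" by blast
    then obtain i j where "i < card T" "j < card T" "s = h i" "t = h j"
      using h unfolding bij_betw_def by (metis imageE lessThan_iff)
    then show "y \<in> {E (h i) (h j) | i j. i < card T \<and> j < card T \<and> g (\<beta> (h i)) = g (\<beta> (h j))}"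
      using st by (intro CollectI exI[of _ i] exI[of _ j]) simp
  next
    fix y assume "y \<in> {E (h i) (h j) | i j. i < card T \<and> j < card T \<and> g (\<beta> (h i)) = g (\<beta> (h j))}"
    then show "y \<in> {E s t | s t. s \<in> T \<and> t \<in> T \<and> \<beta> s = \<beta> t}" using hT ginj by blast
  qed
  then show ?thesis unfolding has_matrix_units_def using assms hT ginj hinj
    by (intro exI[of _ "card T"] exI[of _ "\<lambda>i. g (\<beta> (h i))"] exI[of _ "\<lambda>i j. E (h i) (h j)"]) simp
qed

context summand_algebra
begin

lemma block_product:
  fixes N :: nat and M M' :: "'k mat" and F :: "nat \<Rightarrow> nat \<Rightarrow> 'v"
  assumes F: "\<And>p q p' q'. p < N \<Longrightarrow> q < N \<Longrightarrow> p' < N \<Longrightarrow> q' < N \<Longrightarrow> F p q \<star> F p' q' = (if q = p' then F p q' else 0)"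
    and M: "M \<in> carrier_mat N N" "M' \<in> carrier_mat N N"
  shows "(\<Sum>p<N. \<Sum>q<N. M $$ (p, q) *s F p q) \<star> (\<Sum>p<N. \<Sum>q<N. M' $$ (p, q) *s F p q) =
    (\<Sum>p<N. \<Sum>q<N. (M * M') $$ (p, q) *s F p q)"
proof -
  have "(\<Sum>p<N. \<Sum>q<N. M $$ (p, q) *s F p q) \<star> (\<Sum>p<N. \<Sum>q<N. M' $$ (p, q) *s F p q) =
      (\<Sum>p<N. \<Sum>q<N. \<Sum>p'<N. \<Sum>q'<N. (M $$ (p, q) * M' $$ (p', q')) *s (F p q \<star> F p' q'))"
    unfolding mul_sum(1) unfolding mul_sum(2) by (simp add: mul_scale scale_sum_right mult.commute)
  also have "\<dots> = (\<Sum>p<N. \<Sum>q<N. \<Sum>q'<N. (M $$ (p, q) * M' $$ (q, q')) *s F p q')"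
  proof (rule sum.cong[OF refl], rule sum.cong[OF refl])
    fix p q assume pq: "p \<in> {..<N}" "q \<in> {..<N}"
    have "(\<Sum>p'<N. \<Sum>q'<N. (M $$ (p, q) * M' $$ (p', q')) *s (F p q \<star> F p' q')) =
        (\<Sum>p'<N. if p' = q then (\<Sum>q'<N. (M $$ (p, q) * M' $$ (q, q')) *s F p q') else 0)"
      using pq F by (intro sum.cong refl) auto
    then show "(\<Sum>p'<N. \<Sum>q'<N. (M $$ (p, q) * M' $$ (p', q')) *s (F p q \<star> F p' q')) =
        (\<Sum>q'<N. (M $$ (p, q) * M' $$ (q, q')) *s F p q')"
      using pq by simp
  qed
  also have "\<dots> = (\<Sum>p<N. \<Sum>q'<N. (M * M') $$ (p, q') *s F p q')"
  proof (rule sum.cong[OF refl])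
    fix p assume p: "p \<in> {..<N}"
    have "(\<Sum>q<N. \<Sum>q'<N. (M $$ (p, q) * M' $$ (q, q')) *s F p q') =
        (\<Sum>q'<N. (\<Sum>q<N. M $$ (p, q) * M' $$ (q, q')) *s F p q')"
      by (subst sum.swap) (simp add: scale_sum_left)
    also have "\<dots> = (\<Sum>q'<N. (M * M') $$ (p, q') *s F p q')"
      using p M by (intro sum.cong refl) (auto simp: scalar_prod_def atLeast0LessThan intro!: arg_cong2[where f = scale] sum.cong)
    finally show "(\<Sum>q<N. \<Sum>q'<N. (M $$ (p, q) * M' $$ (q, q')) *s F p q') = (\<Sum>q'<N. (M * M') $$ (p, q') *s F p q')" .
  qed
  finally show ?thesis .
qed

end

lemma product_algebra_simps:
  "carrier (product_algebra I B) = (\<Pi>\<^sub>E i\<in>I. carrier (B i))"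
  "x \<otimes>\<^bsub>product_algebra I B\<^esub> y = (\<lambda>i\<in>I. x i \<otimes>\<^bsub>B i\<^esub> y i)"
  "\<one>\<^bsub>product_algebra I B\<^esub> = (\<lambda>i\<in>I. \<one>\<^bsub>B i\<^esub>)"
  "x \<oplus>\<^bsub>product_algebra I B\<^esub> y = (\<lambda>i\<in>I. x i \<oplus>\<^bsub>B i\<^esub> y i)"
  "c \<odot>\<^bsub>product_algebra I B\<^esub> x = (\<lambda>i\<in>I. c \<odot>\<^bsub>B i\<^esub> x i)"
  by (simp_all add: product_algebra_def)

lemma module_mat_simps':
  "carrier (module_mat TYPE('k::semiring_1) m m) = carrier_mat m m"
  "x \<otimes>\<^bsub>module_mat TYPE('k) m m\<^esub> y = x * y" "\<one>\<^bsub>module_mat TYPE('k) m m\<^esub> = 1\<^sub>m m"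
  "x \<oplus>\<^bsub>module_mat TYPE('k) m m\<^esub> y = x + y" "c \<odot>\<^bsub>module_mat TYPE('k) m m\<^esub> x = c \<cdot>\<^sub>m x"
  by (simp_all add: module_mat_def)

lemma sum_delta2:
  fixes h :: "'a::comm_monoid_add"
  assumes "p < (N::nat)" "q < (M::nat)"
  shows "(\<Sum>p'<N. \<Sum>q'<M. if p' = p \<and> q' = q then h else 0) = h"
proof -
  have "(\<Sum>q'<M. if p' = p \<and> q' = q then h else 0) = (if p' = p then h else 0)" for p'
    using assms by (cases "p' = p") auto
  then show ?thesis using assms by simp
qed

text \<open>The map \<open>g\<close> sends a family of matrices to the combination of units with
  these entries; the isomorphism is its inverse. Nonvanishing of the diagonal units gives
  injectivity, the spanning hypothesis surjectivity.\<close>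

lemma (in embedded_algebra) split_semisimple_of_blocks:
  fixes k :: nat and N :: "nat \<Rightarrow> nat" and F :: "nat \<Rightarrow> nat \<Rightarrow> nat \<Rightarrow> 'v"
  assumes F_C: "\<And>i p q. i < k \<Longrightarrow> p < N i \<Longrightarrow> q < N i \<Longrightarrow> F i p q \<in> E.C"
    and F: "\<And>i j p q p' q'. i < k \<Longrightarrow> j < k \<Longrightarrow> p < N i \<Longrightarrow> q < N i \<Longrightarrow> p' < N j \<Longrightarrow> q' < N j \<Longrightarrow>
      emul (F i p q) (F j p' q') = (if i = j \<and> q = p' then F i p q' else 0)"
    and F_nz: "\<And>i p. i < k \<Longrightarrow> p < N i \<Longrightarrow> F i p p \<noteq> 0"
    and N: "\<And>i. i < k \<Longrightarrow> 0 < N i"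
    and span: "E.C \<subseteq> V.span {F i p q | i p q. i < k \<and> p < N i \<and> q < N i}"
  shows "split_semisimple A"
proof -
  let ?P = "product_algebra {..<k} (\<lambda>i. module_mat TYPE('k) (N i) (N i))"
  define b where "b i M = (\<Sum>p<N i. \<Sum>q<N i. sc (M $$ (p, q)) (F i p q))" for i M
  define g where "g x = (\<Sum>i<k. b i (x i))" for x
  have P: "x i \<in> carrier_mat (N i) (N i)" if "x \<in> carrier ?P" "i < k" for x i
    using that by (auto simp: product_algebra_simps module_mat_simps')
  have bC: "b i M \<in> E.C" if "i < k" for i M
    unfolding b_def using F_C that by (intro V.subspace_sum E.C_subspace E.C_closed) auto
  have gC: "g x \<in> E.C" for x
    unfolding g_def using bC by (intro V.subspace_sum E.C_subspace) auto
  have b_mult: "emul (b i M) (b j M') = (if i = j then b i (M * M') else 0)"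
    if "i < k" "j < k" "M \<in> carrier_mat (N i) (N i)" "M' \<in> carrier_mat (N j) (N j)" for i j M M'
  proof (cases "i = j")
    case True
    have "emul (b i M) (b i M') = b i (M * M')"
      unfolding b_def using that True F[of i i] by (intro E.block_product) auto
    then show ?thesis using True by simp
  next
    case False
    then show ?thesis using that F unfolding b_def
      by (simp add: E.mul_sum E.mul_scale)
  qed
  have closed: "x \<otimes>\<^bsub>?P\<^esub> y \<in> carrier ?P" "x \<oplus>\<^bsub>?P\<^esub> y \<in> carrier ?P" "c \<odot>\<^bsub>?P\<^esub> x \<in> carrier ?P"
    if "x \<in> carrier ?P" "y \<in> carrier ?P" for x y c
    using P[OF that(1)] P[OF that(2)]
    by (auto simp: product_algebra_simps module_mat_simps' intro!: mult_carrier_mat)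
  note one_closed' = one_closed
  have one_closed: "\<one>\<^bsub>?P\<^esub> \<in> carrier ?P" by (auto simp: product_algebra_simps module_mat_simps')
  have g_mult: "g (x \<otimes>\<^bsub>?P\<^esub> y) = emul (g x) (g y)" if "x \<in> carrier ?P" "y \<in> carrier ?P" for x y
  proof -
    have "emul (g x) (g y) = (\<Sum>i<k. \<Sum>j<k. emul (b i (x i)) (b j (y j)))"
      unfolding g_def E.mul_sum(1) unfolding E.mul_sum(2) ..
    also have "\<dots> = (\<Sum>i<k. \<Sum>j<k. if i = j then b i (x i * y i) else 0)"
      using P[OF that(1)] P[OF that(2)] b_mult by (intro sum.cong refl) auto
    also have "\<dots> = g (x \<otimes>\<^bsub>?P\<^esub> y)" by (simp add: g_def product_algebra_simps module_mat_simps')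
    finally show ?thesis by simp
  qed
  have g_add: "g (x \<oplus>\<^bsub>?P\<^esub> y) = g x + g y" if "x \<in> carrier ?P" "y \<in> carrier ?P" for x y
  proof -
    have "b i (x i + y i) = b i (x i) + b i (y i)" if "i < k" for i
      using P[OF \<open>x \<in> carrier ?P\<close> that] P[OF \<open>y \<in> carrier ?P\<close> that]
      by (simp add: b_def V.scale_left_distrib sum.distrib)
    then show ?thesis by (simp add: g_def product_algebra_simps module_mat_simps' sum.distrib)
  qed
  have g_smult: "g (c \<odot>\<^bsub>?P\<^esub> x) = sc c (g x)" if "x \<in> carrier ?P" for x c
  proof -
    have "b i (c \<cdot>\<^sub>m x i) = sc c (b i (x i))" if "i < k" for i
      using P[OF \<open>x \<in> carrier ?P\<close> that] by (simp add: b_def V.scale_sum_right)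
    then show ?thesis by (simp add: g_def product_algebra_simps module_mat_simps' V.scale_sum_right)
  qed
  \<comment> \<open>Multiplying by diagonal units on both sides isolates one entry.\<close>
  have entry: "emul (emul (F i p p) (g x)) (F i q q) = sc (x i $$ (p, q)) (F i p q)"
    if "x \<in> carrier ?P" "i < k" "p < N i" "q < N i" for x i p q
  proof -
    have "emul (emul (F i p p) (g x)) (F i q q) =
        (\<Sum>j<k. \<Sum>p'<N j. \<Sum>q'<N j. sc (x j $$ (p', q')) (emul (emul (F i p p) (F j p' q')) (F i q q)))"
      by (simp add: g_def b_def E.mul_sum E.mul_scale)
    also have "\<dots> = (\<Sum>j<k. if j = i then (\<Sum>p'<N i. \<Sum>q'<N i. if p' = p \<and> q' = q then sc (x i $$ (p, q)) (F i p q) else 0) else 0)"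
    proof (rule sum.cong[OF refl])
      fix j assume j: "j \<in> {..<k}"
      show "(\<Sum>p'<N j. \<Sum>q'<N j. sc (x j $$ (p', q')) (emul (emul (F i p p) (F j p' q')) (F i q q))) =
        (if j = i then (\<Sum>p'<N i. \<Sum>q'<N i. if p' = p \<and> q' = q then sc (x i $$ (p, q)) (F i p q) else 0) else 0)"
      proof (cases "j = i")
        case True
        have "(\<Sum>p'<N i. \<Sum>q'<N i. sc (x i $$ (p', q')) (emul (emul (F i p p) (F i p' q')) (F i q q))) =
            (\<Sum>p'<N i. \<Sum>q'<N i. if p' = p \<and> q' = q then sc (x i $$ (p, q)) (F i p q) else 0)"
          using that F by (intro sum.cong refl) auto
        then show ?thesis using True by simp
      next
        case False
        then show ?thesis using that j F by (auto intro!: sum.neutral)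
      qed
    qed
    also have "\<dots> = sc (x i $$ (p, q)) (F i p q)"
      using that by (simp add: sum_delta2)
    finally show ?thesis .
  qed
  have F_nz': "F i p q \<noteq> 0" if "i < k" "p < N i" "q < N i" for i p q
    using F[of i i p q q p] F_nz[OF that(1,2)] that by auto
  have inj: "inj_on g (carrier ?P)"
  proof (rule inj_onI)
    fix x y assume xy: "x \<in> carrier ?P" "y \<in> carrier ?P" "g x = g y"
    have "x i = y i" if i: "i < k" for i
    proof (rule eq_matI)
      fix p q assume "p < dim_row (y i)" "q < dim_col (y i)"
      then have pq: "p < N i" "q < N i" using P[OF xy(2) i] by auto
      have "sc (x i $$ (p, q)) (F i p q) = sc (y i $$ (p, q)) (F i p q)"
        using entry[OF xy(1) i pq, unfolded xy(3)] entry[OF xy(2) i pq] by (rule trans[OF sym])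
      then show "x i $$ (p, q) = y i $$ (p, q)" using F_nz'[OF i pq] by simp
    qed (use P[OF xy(1) i] P[OF xy(2) i] in auto)
    then show "x = y" using xy(1,2) by (intro extensionalityI[of _ "{..<k}"]) (auto simp: product_algebra_simps PiE_def)
  qed
  have surj: "u \<in> g ` carrier ?P" if "u \<in> E.C" for u
  proof -
    have "u \<in> V.span {F i p q | i p q. i < k \<and> p < N i \<and> q < N i}" using span that by blast
    then show ?thesis
    proof (induction rule: V.span_induct_alt)
      case base
      have "g (\<lambda>i\<in>{..<k}. 0\<^sub>m (N i) (N i)) = 0" by (simp add: g_def b_def)
      moreover have "(\<lambda>i\<in>{..<k}. 0\<^sub>m (N i) (N i)) \<in> carrier ?P" by (auto simp: product_algebra_simps module_mat_simps')
      ultimately show ?case by force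
    next
      case (step c w u)
      then obtain y where y: "y \<in> carrier ?P" "u = g y" by blast
      from step.hyps(1) obtain i p q where w: "w = F i p q" "i < k" "p < N i" "q < N i" by blast
      define M where "M = (\<lambda>j\<in>{..<k}. mat (N j) (N j) (\<lambda>a. if j = i \<and> a = (p, q) then 1 else (0::'k)))"
      have M: "M \<in> carrier ?P" by (auto simp: M_def product_algebra_simps module_mat_simps')
      have "b j (M j) = (if j = i then F i p q else 0)" if "j < k" for j
      proof (cases "j = i")
        case True
        have "b i (M i) = (\<Sum>p'<N i. \<Sum>q'<N i. if p' = p \<and> q' = q then F i p q else 0)"
          unfolding b_def using w by (intro sum.cong refl) (auto simp: M_def)
        then show ?thesis using True w by (simp add: sum_delta2)
      next
        case False
        then show ?thesis using that unfolding b_def by (auto simp: M_def intro!: sum.neutral)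
      qed
      then have "g M = F i p q" using w by (simp add: g_def)
      then have "g (c \<odot>\<^bsub>?P\<^esub> M \<oplus>\<^bsub>?P\<^esub> y) = sc c w + u"
        using g_add[OF closed(3)[OF M M] y(1)] g_smult[OF M] y(2) w(1) by simp
      from image_eqI[where f = g, OF this[symmetric] closed(2)[OF closed(3)[OF M M, of c] y(1)]] show ?case .
    qed
  qed
  \<comment> \<open>No sum over diagonal units is computed: a preimage of \<open>emb \<one>\<close>
    exists by surjectivity, and multiplying it by the unit of the product shows what that unit is
    sent to.\<close>
  have g_one: "g \<one>\<^bsub>?P\<^esub> = emb \<one>"
  proof -
    obtain x where x: "x \<in> carrier ?P" "g x = emb \<one>" using surj[of "emb \<one>"] by auto
    have "\<one>\<^bsub>?P\<^esub> \<otimes>\<^bsub>?P\<^esub> x = x"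
      using P[OF x(1)] x(1) by (intro extensionalityI[of _ "{..<k}"])
        (auto simp: product_algebra_simps module_mat_simps' PiE_def intro!: left_mult_one_mat)
    then have "emul (g \<one>\<^bsub>?P\<^esub>) (emb \<one>) = emb \<one>" using g_mult[OF one_closed x(1)] x(2) by simp
    then show ?thesis using gC by simp
  qed
  define h where "h a = the_inv_into (carrier ?P) g (emb a)" for a
  have gh: "h a \<in> carrier ?P" "g (h a) = emb a" if "a \<in> carrier A" for a
    using the_inv_into_into[OF inj surj[OF emb_C[OF that]] subset_refl] f_the_inv_into_f[OF inj surj[OF emb_C[OF that]]]
    by (simp_all add: h_def)
  have hI: "h a = x" if "a \<in> carrier A" "x \<in> carrier ?P" "g x = emb a" for a x
    using inj_onD[OF inj, of "h a" x] gh[OF that(1)] that by simp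
  have h_mult: "h (a \<otimes> c) = h a \<otimes>\<^bsub>?P\<^esub> h c" and h_add: "h (a \<oplus> c) = h a \<oplus>\<^bsub>?P\<^esub> h c"
    if "a \<in> carrier A" "c \<in> carrier A" for a c
  proof -
    note gh = gh[OF that(1)] gh[OF that(2)]
    show "h (a \<otimes> c) = h a \<otimes>\<^bsub>?P\<^esub> h c"
      using g_mult[OF gh(1,3)] gh that by (intro hI m_closed closed(1)) (simp_all add: emb_mult)
    show "h (a \<oplus> c) = h a \<oplus>\<^bsub>?P\<^esub> h c"
      using g_add[OF gh(1,3)] gh that by (intro hI a_closed closed(2)) (simp_all add: emb_add)
  qed
  have h_smult: "h (c \<odot> a) = c \<odot>\<^bsub>?P\<^esub> h a" if "a \<in> carrier A" for a c
    using g_smult[OF gh(1)[OF that]] gh[OF that] that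
    by (intro hI smult_closed closed(3)[OF gh(1)[OF that] gh(1)[OF that]]) (simp_all add: emb_smult)
  have h_one: "h \<one> = \<one>\<^bsub>?P\<^esub>" by (rule hI[OF one_closed' one_closed g_one])
  have "bij_betw h (carrier A) (carrier ?P)"
  proof (rule bij_betw_byWitness[where f' = "\<lambda>x. ret (g x)"])
    show "\<forall>a\<in>carrier A. ret (g (h a)) = a" using gh by simp
    show "\<forall>x\<in>carrier ?P. h (ret (g x)) = x" using gC by (auto intro!: hI simp: emb_ret)
  qed (use gh in auto)
  moreover have "h \<in> Ring.ring_hom A ?P"
    using gh(1) h_mult h_add h_one by (rule ring_hom_memI)
  ultimately have "h \<in> algebra_iso A ?P" unfolding algebra_iso_def ring_iso_def using h_smult by simp
  then have "algebra_iso A ?P \<noteq> {}" by blast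
  then show ?thesis unfolding split_semisimple_def using N
    by (intro exI[of _ k] exI[of _ N]) simp
qed

text \<open>The vanishing units fill whole blocks, so deleting them leaves a system of full matrix
  blocks that spans the same space.\<close>

lemma (in embedded_algebra) split_semisimple_of_units:
  assumes "has_matrix_units A"
  shows "split_semisimple A"
proof -
  obtain n :: nat and \<beta> :: "nat \<Rightarrow> nat" and E where
    EC': "\<forall>s<n. \<forall>t<n. \<beta> s = \<beta> t \<longrightarrow> E s t \<in> carrier A"
    and EE': "\<forall>s<n. \<forall>t<n. \<forall>t'<n. \<forall>u<n. \<beta> s = \<beta> t \<longrightarrow> \<beta> t' = \<beta> u \<longrightarrow>
      E s t \<otimes>\<^bsub>A\<^esub> E t' u = (if t = t' then E s u else \<zero>\<^bsub>A\<^esub>)"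
    and span: "carrier A \<subseteq> alg_span A {E s t | s t. s < n \<and> t < n \<and> \<beta> s = \<beta> t}"
    using assms unfolding has_matrix_units_def by (elim exE conjE) (rule that)
  note EC = EC'[rule_format] and EE = EE'[rule_format]
  define T where "T = {t. t < n \<and> E t t \<noteq> \<zero>\<^bsub>A\<^esub>}"
  have T_n: "T \<subseteq> {..<n}" unfolding T_def by blast
  then have T: "finite T" "\<And>t. t \<in> T \<Longrightarrow> t < n" by (blast intro: finite_subset)+
  \<comment> \<open>If one diagonal unit of a block is zero, every unit factors through it, so the
    others vanish with it.\<close>
  have T_block: "t \<in> T" if "s \<in> T" "t < n" "\<beta> s = \<beta> t" for s t
  proof (rule ccontr)
    assume "t \<notin> T"
    then have tt: "E t t = \<zero>\<^bsub>A\<^esub>" using \<open>t < n\<close> by (simp add: T_def)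
    have s: "s < n" using \<open>s \<in> T\<close> by (rule T(2))
    have E: "E s t \<otimes>\<^bsub>A\<^esub> E t t = E s t" "E s t \<otimes>\<^bsub>A\<^esub> E t s = E s s"
      using EE[OF s that(2,2,2,3) refl] EE[OF s that(2,2) s that(3) that(3)[symmetric]] by simp_all
    have C: "E s t \<in> carrier A" "E t s \<in> carrier A"
      by (rule EC[OF s that(2,3)], rule EC[OF that(2) s that(3)[symmetric]])
    have "E s t = \<zero>\<^bsub>A\<^esub>" using E(1) r_null[OF C(1)] unfolding tt by simp
    then have "E s s = \<zero>\<^bsub>A\<^esub>" using E(2) l_null[OF C(2)] by simp
    then show False using that by (simp add: T_def)
  qed
  define k where "k = card (\<beta> ` T)"
  obtain b where b: "bij_betw b {..<k} (\<beta> ` T)"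
    using ex_bij_betw_nat_finite[of "\<beta> ` T"] T(1) unfolding k_def atLeast0LessThan by blast
  define B where "B i = {t \<in> T. \<beta> t = b i}" for i
  define N where "N i = card (B i)" for i
  have "\<exists>h. bij_betw h {..<N i} (B i)" for i
    using ex_bij_betw_nat_finite[of "B i"] T(1) unfolding N_def B_def atLeast0LessThan by auto
  then obtain h where h: "\<And>i. bij_betw (h i) {..<N i} (B i)" by metis
  have hB: "h i p \<in> T" "\<beta> (h i p) = b i" "h i p < n" if "p < N i" for i p
    using bij_betwE[OF h[of i]] that T by (auto simp: B_def)
  have b_inj: "b i = b j \<longleftrightarrow> i = j" if "i < k" "j < k" for i j
    using b that by (auto simp: bij_betw_def inj_on_def)
  have h_inj: "h i p = h i q \<longleftrightarrow> p = q" if "p < N i" "q < N i" for i p q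
    using h[of i] that by (auto simp: bij_betw_def inj_on_def)
  define F where "F i p q = emb (E (h i p) (h i q))" for i p q
  show ?thesis
  proof (rule split_semisimple_of_blocks[of k N F])
    show "F i p q \<in> E.C" if "i < k" "p < N i" "q < N i" for i p q
      unfolding F_def using that hB EC by (intro emb_C) auto
    show "emul (F i p q) (F j p' q') = (if i = j \<and> q = p' then F i p q' else 0)"
      if "i < k" "j < k" "p < N i" "q < N i" "p' < N j" "q' < N j" for i j p q p' q'
    proof -
      have "emul (F i p q) (F j p' q') = emb (E (h i p) (h i q) \<otimes>\<^bsub>A\<^esub> E (h j p') (h j q'))"
        unfolding F_def using that hB EC by (intro emb_mult[symmetric]) auto
      also have "\<dots> = emb (if h i q = h j p' then E (h i p) (h j q') else \<zero>\<^bsub>A\<^esub>)"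
        using that hB by (subst EE) auto
      also have "\<dots> = (if i = j \<and> q = p' then F i p q' else 0)"
      proof (cases "i = j")
        case False
        then have "h i q \<noteq> h j p'" using hB(2)[OF that(4)] hB(2)[OF that(5)] b_inj that by metis
        then show ?thesis using False by simp
      qed (use that h_inj in \<open>auto simp: F_def\<close>)
      finally show ?thesis .
    qed
    show "F i p p \<noteq> 0" if "i < k" "p < N i" for i p
    proof -
      have "E (h i p) (h i p) \<noteq> \<zero>\<^bsub>A\<^esub>" "E (h i p) (h i p) \<in> carrier A"
        using hB[OF that(2)] EC by (auto simp: T_def)
      then show ?thesis unfolding F_def using emb_inj[of _ "\<zero>\<^bsub>A\<^esub>"] by auto
    qed
    show "0 < N i" if "i < k" for i
    proof -
      have "b i \<in> \<beta> ` T" using bij_betwE[OF b] that by auto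
      then show ?thesis using T(1) by (auto simp: N_def B_def card_gt_0_iff)
    qed
    let ?S = "{F i p q | i p q. i < k \<and> p < N i \<and> q < N i}"
    have ES: "emb (E s t) \<in> V.span ?S" if st: "s < n" "t < n" "\<beta> s = \<beta> t" for s t
    proof (cases "s \<in> T")
      case True
      then have t: "t \<in> T" using T_block st by blast
      obtain i where i: "i < k" "b i = \<beta> s" using b True unfolding bij_betw_def by (metis imageI imageE lessThan_iff)
      then have "s \<in> B i" "t \<in> B i" using True t st by (auto simp: B_def)
      then obtain p q where "p < N i" "q < N i" "h i p = s" "h i q = t"
        using h[of i] unfolding bij_betw_def by (metis imageE lessThan_iff)
      then have "emb (E s t) \<in> ?S" using i by (auto simp: F_def)
      then show ?thesis by (rule V.span_base)
    next
      case False
      then have "E s s = \<zero>\<^bsub>A\<^esub>" using st by (simp add: T_def)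
      moreover have "E s s \<otimes>\<^bsub>A\<^esub> E s t = E s t" using EE[of s s s t] st by simp
      ultimately have "E s t = \<zero>\<^bsub>A\<^esub>" using EC[OF st] by (metis l_null)
      then show ?thesis by (simp add: V.span_zero)
    qed
    show "E.C \<subseteq> V.span ?S"
    proof
      fix u assume "u \<in> E.C"
      then have u: "emb (ret u) = u" by (rule emb_ret)
      have "ret u \<in> alg_span A {E s t | s t. s < n \<and> t < n \<and> \<beta> s = \<beta> t}" using span by auto
      then have "emb (ret u) \<in> V.span (emb ` {E s t | s t. s < n \<and> t < n \<and> \<beta> s = \<beta> t})"
        using EC by (intro emb_span[THEN conjunct2]) auto
      moreover have "V.span (emb ` {E s t | s t. s < n \<and> t < n \<and> \<beta> s = \<beta> t}) \<subseteq> V.span ?S"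
        using ES by (intro V.span_minimal) auto
      ultimately show "u \<in> V.span ?S" using u by auto
    qed
  qed
qed

theorem split_semisimple_of_matrix_units:
  "assoc_algebra A \<Longrightarrow> has_matrix_units A \<Longrightarrow> split_semisimple A"
  using embedding_exists embedded_algebra.split_semisimple_of_units by blast

section \<open>Polynomials in one element and roots of unity\<close>

context summand_algebra
begin

text \<open>The bridge from the relation that \<open>t i\<close> has \<open>r\<close>-th power one,
  which concerns a polynomial, to a root list for \<open>lin\<close>.\<close>

definition papply :: "'v \<Rightarrow> 'k poly \<Rightarrow> 'v \<Rightarrow> 'v" where
  "papply y p m = (\<Sum>i\<le>degree p. coeff p i *s (((\<star>) y) ^^ i) m)"

lemma papply_bound:
  assumes "degree p \<le> N"
  shows "papply y p m = (\<Sum>i\<le>N. coeff p i *s (((\<star>) y) ^^ i) m)"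
  unfolding papply_def using assms
  by (intro sum.mono_neutral_left) (auto simp: coeff_eq_0)

lemma papply_pCons: "papply y (pCons a p) m = a *s m + y \<star> papply y p m"
proof -
  have "papply y (pCons a p) m = (\<Sum>i\<le>Suc (degree p). coeff (pCons a p) i *s (((\<star>) y) ^^ i) m)"
    by (intro papply_bound degree_pCons_le)
  also have "\<dots> = a *s m + (\<Sum>i\<le>degree p. coeff p i *s (((\<star>) y) ^^ Suc i) m)"
    by (subst sum.atMost_Suc_shift) simp
  also have "(\<Sum>i\<le>degree p. coeff p i *s (((\<star>) y) ^^ Suc i) m) = y \<star> papply y p m"
    by (simp add: papply_def mul_sum mul_scale)
  finally show ?thesis .
qed

lemma papply_smult: "papply y (smult c p) m = c *s papply y p m"
proof -
  have "papply y (smult c p) m = (\<Sum>i\<le>degree p. coeff (smult c p) i *s (((\<star>) y) ^^ i) m)"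
    by (intro papply_bound degree_smult_le)
  then show ?thesis by (simp add: papply_def scale_sum_right)
qed

lemma papply_add: "papply y (p + q) m = papply y p m + papply y q m"
proof -
  let ?N = "max (degree p) (degree q)"
  have "papply y (p + q) m = (\<Sum>i\<le>?N. coeff (p + q) i *s (((\<star>) y) ^^ i) m)"
    by (intro papply_bound degree_add_le_max)
  then show ?thesis
    by (simp add: papply_bound[of p ?N] papply_bound[of q ?N] scale_left_distrib sum.distrib)
qed

lemma papply_prod: "papply y (\<Prod>c\<leftarrow>cs. [:- c, 1:]) m = lin y cs m"
proof (induction cs)
  case Nil then show ?case by (simp add: papply_def)
next
  case (Cons c cs)
  let ?p = "\<Prod>c\<leftarrow>cs. [:- c, 1:]"
  have "papply y (\<Prod>c\<leftarrow>c # cs. [:- c, 1:]) m = papply y (smult (- c) ?p + pCons 0 ?p) m" by simp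
  also have "\<dots> = (- c) *s papply y ?p m + y \<star> papply y ?p m"
    by (simp only: papply_add papply_smult papply_pCons) simp
  finally show ?case using Cons.IH by simp
qed

lemma papply_monom: "papply y (monom c k) m = c *s (((\<star>) y) ^^ k) m"
proof -
  have "papply y (monom c k) m = (\<Sum>i\<le>k. coeff (monom c k) i *s (((\<star>) y) ^^ i) m)"
    by (intro papply_bound degree_monom_le)
  also have "\<dots> = (\<Sum>i\<le>k. if i = k then c *s (((\<star>) y) ^^ k) m else 0)"
    by (intro sum.cong) auto
  finally show ?thesis by simp
qed

end

text \<open>The derivative of the polynomial is \<open>r\<close> times a power of the variable, so
  with \<open>r\<close> invertible a double root could only be 0, which is not a root.\<close>

lemma roots_of_unity_list:
  fixes r :: nat
  assumes "1 \<le> r" "\<not> CHAR('k) dvd r"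
  obtains Z :: "'k::alg_closed_field list" where "distinct Z" "monom 1 r - 1 = (\<Prod>z\<leftarrow>Z. [:- z, 1:])"
proof -
  let ?p = "monom 1 r - 1 :: 'k poly"
  have r: "of_nat r \<noteq> (0::'k)" using assms(2) by (simp add: of_nat_eq_0_iff_char_dvd)
  have deg: "degree ?p = r"
    using assms(1) degree_add_eq_left[of "- 1" "monom 1 r :: 'k poly"] by (simp add: degree_monom_eq)
  then have p0: "?p \<noteq> 0" using assms(1) by auto
  have lc: "lead_coeff ?p = 1" using deg assms(1) by simp
  obtain A where A: "?p = (\<Prod>z\<in>#A. [:- z, 1:])"
    using alg_closed_imp_factorization[OF p0] lc by (metis smult_1_left)
  obtain Z where Z: "mset Z = A" using ex_mset by blast
  have pZ: "?p = (\<Prod>z\<leftarrow>Z. [:- z, 1:])"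
    unfolding A Z[symmetric] by (metis mset_map prod_mset_prod_list)
  have "distinct Z"
  proof (rule ccontr)
    assume "\<not> distinct Z"
    then obtain as bs cs z where "Z = as @ [z] @ bs @ [z] @ cs" using not_distinct_decomp by blast
    then have "?p = [:- z, 1:] * ([:- z, 1:] * ((\<Prod>z\<leftarrow>as. [:- z, 1:]) * (\<Prod>z\<leftarrow>bs. [:- z, 1:]) * (\<Prod>z\<leftarrow>cs. [:- z, 1:])))"
      unfolding pZ by (simp add: ac_simps del: mult_pCons_left mult_pCons_right)
    then obtain q where q: "?p = [:- z, 1:] * ([:- z, 1:] * q)" by blast
    have 1: "poly ?p z = 0" "poly (pderiv ?p) z = 0" unfolding q by (simp_all add: pderiv_mult pderiv_pCons del: mult_pCons_left mult_pCons_right)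
    have "poly (pderiv ?p) z = of_nat r * z ^ (r - 1)"
      by (simp add: pderiv_diff pderiv_monom poly_monom)
    then have "z = 0" using 1 r by auto
    then show False using 1 assms(1) by (simp add: poly_monom zero_power)
  qed
  then show ?thesis using that pZ by blast
qed

section \<open>Quotients and generators\<close>

context
  fixes A :: "('k::field, 'a) module" (structure) and I
  assumes A: "assoc_algebra A" and I: "ideal I A"
begin

interpretation A: assoc_algebra A by (rule A)
interpretation I: ideal I A by (rule I)

lemma quotient_carrier: "carrier (quotient_algebra A I) = (\<lambda>x. I +> x) ` carrier A"
  by (auto simp: quotient_algebra_def FactRing_def A_RCOSETS_def')

lemma quotient_eq: "x \<in> carrier A \<Longrightarrow> y \<in> carrier A \<Longrightarrow> I +> x = I +> y \<longleftrightarrow> x \<ominus> y \<in> I"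
  by (simp add: A.quotient_eq_iff_same_a_r_cos[OF I])

lemma ideal_smult: "h \<in> I \<Longrightarrow> c \<odot> h \<in> I"
proof -
  assume h: "h \<in> I"
  then have "(c \<odot> \<one>) \<otimes> h \<in> I" by (intro I.I_l_closed A.smult_closed) auto
  then show ?thesis using I.a_Hcarr[OF h] by (simp add: A.smult_mult_l)
qed

lemma smult_minus_distrib:
  assumes "x \<in> carrier A" "y \<in> carrier A"
  shows "c \<odot> (x \<ominus> y) = c \<odot> x \<ominus> c \<odot> y"
proof -
  have "c \<odot> (x \<ominus> y) \<oplus> c \<odot> y = c \<odot> ((x \<ominus> y) \<oplus> y)"
    using assms by (simp add: A.smult_r_distr)
  also have "(x \<ominus> y) \<oplus> y = x" using assms by (simp add: A.minus_eq A.a_assoc A.l_neg)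
  finally have "c \<odot> x = c \<odot> (x \<ominus> y) \<oplus> c \<odot> y" ..
  then show ?thesis using assms by (simp add: A.smult_closed A.minus_eq A.a_assoc A.r_neg)
qed

lemma quotient_ops:
  assumes x: "x \<in> carrier A" and y: "y \<in> carrier A"
  shows "(I +> x) \<otimes>\<^bsub>quotient_algebra A I\<^esub> (I +> y) = I +> (x \<otimes> y)"
    "(I +> x) \<oplus>\<^bsub>quotient_algebra A I\<^esub> (I +> y) = I +> (x \<oplus> y)"
    "c \<odot>\<^bsub>quotient_algebra A I\<^esub> (I +> x) = I +> (c \<odot> x)"
    "\<one>\<^bsub>quotient_algebra A I\<^esub> = I +> \<one>" "\<zero>\<^bsub>quotient_algebra A I\<^esub> = I +> \<zero>"
proof -
  show "(I +> x) \<otimes>\<^bsub>quotient_algebra A I\<^esub> (I +> y) = I +> (x \<otimes> y)"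
    "(I +> x) \<oplus>\<^bsub>quotient_algebra A I\<^esub> (I +> y) = I +> (x \<oplus> y)"
    "\<one>\<^bsub>quotient_algebra A I\<^esub> = I +> \<one>" "\<zero>\<^bsub>quotient_algebra A I\<^esub> = I +> \<zero>"
    using x y by (simp_all add: quotient_algebra_def FactRing_def I.rcoset_mult_add I.a_rcos_sum
      A.a_coset_add_zero I.a_subset)
  have "I +> (c \<odot> z) = I +> (c \<odot> x)" if "z \<in> I +> x" for z
  proof -
    have z: "z \<in> carrier A" using that x I.a_subset by (auto simp: a_r_coset_def')
    have "I +> z = I +> x" by (rule I.a_repr_independence'[OF that x, symmetric])
    then have "z \<ominus> x \<in> I" using quotient_eq[OF z x] by simp
    from ideal_smult[OF this, of c] show ?thesis
      using z x by (subst quotient_eq) (auto simp: smult_minus_distrib A.smult_closed)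
  qed
  then have "(\<Union>z\<in>I +> x. I +> (c \<odot> z)) = (\<Union>z\<in>I +> x. I +> (c \<odot> x))"
    by (rule SUP_cong[OF refl])
  moreover have "I +> x \<noteq> {}" using I.a_rcos_self[OF x] by blast
  ultimately show "c \<odot>\<^bsub>quotient_algebra A I\<^esub> (I +> x) = I +> (c \<odot> x)"
    by (simp add: quotient_algebra_def)
qed

end

text \<open>Phrased as an induction principle with left multiplication by generators, in parallel
  with \<open>gen_alg\<close>.\<close>

definition generates :: "('k::field, 'a) module \<Rightarrow> 'a set \<Rightarrow> bool" where
  "generates A G \<longleftrightarrow> (\<forall>S. S \<subseteq> carrier A \<longrightarrow> \<one>\<^bsub>A\<^esub> \<in> S \<longrightarrow> (\<forall>a\<in>S. \<forall>b\<in>S. a \<oplus>\<^bsub>A\<^esub> b \<in> S) \<longrightarrow>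
    (\<forall>a\<in>S. \<forall>c. c \<odot>\<^bsub>A\<^esub> a \<in> S) \<longrightarrow> (\<forall>g\<in>G. \<forall>a\<in>S. g \<otimes>\<^bsub>A\<^esub> a \<in> S) \<longrightarrow> S = carrier A)"

lemma generates_induct [consumes 2, case_names one add scale mul]:
  assumes "generates A G" "a \<in> carrier A" "P \<one>\<^bsub>A\<^esub> \<and> \<one>\<^bsub>A\<^esub> \<in> carrier A"
    and "\<And>a b. a \<in> carrier A \<Longrightarrow> b \<in> carrier A \<Longrightarrow> P a \<Longrightarrow> P b \<Longrightarrow> P (a \<oplus>\<^bsub>A\<^esub> b) \<and> a \<oplus>\<^bsub>A\<^esub> b \<in> carrier A"
    and "\<And>a c. a \<in> carrier A \<Longrightarrow> P a \<Longrightarrow> P (c \<odot>\<^bsub>A\<^esub> a) \<and> c \<odot>\<^bsub>A\<^esub> a \<in> carrier A"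
    and "\<And>g a. g \<in> G \<Longrightarrow> a \<in> carrier A \<Longrightarrow> P a \<Longrightarrow> P (g \<otimes>\<^bsub>A\<^esub> a) \<and> g \<otimes>\<^bsub>A\<^esub> a \<in> carrier A"
  shows "P a"
proof -
  let ?S = "{a \<in> carrier A. P a}"
  have "?S \<subseteq> carrier A" "\<one>\<^bsub>A\<^esub> \<in> ?S" "\<forall>a\<in>?S. \<forall>b\<in>?S. a \<oplus>\<^bsub>A\<^esub> b \<in> ?S" "\<forall>a\<in>?S. \<forall>c. c \<odot>\<^bsub>A\<^esub> a \<in> ?S"
    "\<forall>g\<in>G. \<forall>a\<in>?S. g \<otimes>\<^bsub>A\<^esub> a \<in> ?S" using assms(3-) by simp_all
  with assms(1)[unfolded generates_def, THEN spec, of ?S] have "?S = carrier A" by simp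
  then show ?thesis using assms(2) by blast
qed

lemma generates_quotient:
  assumes A: "assoc_algebra A" and I: "ideal I A" and G: "G \<subseteq> carrier A" "generates A G"
  shows "generates (quotient_algebra A I) ((\<lambda>x. I +>\<^bsub>A\<^esub> x) ` G)"
  unfolding generates_def
proof (intro allI impI)
  interpret A: assoc_algebra A by (rule A)
  let ?Q = "quotient_algebra A I" and ?p = "\<lambda>x. I +>\<^bsub>A\<^esub> x"
  fix S assume S: "S \<subseteq> carrier ?Q" "\<one>\<^bsub>?Q\<^esub> \<in> S" "\<forall>a\<in>S. \<forall>b\<in>S. a \<oplus>\<^bsub>?Q\<^esub> b \<in> S" "\<forall>a\<in>S. \<forall>c. c \<odot>\<^bsub>?Q\<^esub> a \<in> S"
    "\<forall>g\<in>?p ` G. \<forall>a\<in>S. g \<otimes>\<^bsub>?Q\<^esub> a \<in> S"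
  note ops = quotient_ops[OF A I]
  have "?p a \<in> S" if "a \<in> carrier A" for a
    using G(2) that
  proof (induction rule: generates_induct)
    case one then show ?case using S(2) ops(4)[OF A.one_closed A.one_closed] by simp
  next
    case (add a b) then show ?case using S(3) ops(2)[of a b, symmetric] by simp
  next
    case (scale a c) then show ?case using S(4) ops(3)[of a a c, symmetric] by (simp add: A.smult_closed)
  next
    case (mul g a) then show ?case using S(5) ops(1)[of g a, symmetric] G(1) by auto
  qed
  then show "S = carrier ?Q" using S(1) quotient_carrier[OF A I] by auto
qed

lemma generates_free_algebra: "generates (free_algebra S :: ('k::field, _) module) (free_gen ` S)"
  unfolding generates_def
proof (intro allI impI)
  let ?F = "free_algebra S :: ('k, _) module"
  fix T assume T: "T \<subseteq> carrier ?F" "\<one>\<^bsub>?F\<^esub> \<in> T" "\<forall>a\<in>T. \<forall>b\<in>T. a \<oplus>\<^bsub>?F\<^esub> b \<in> T" "\<forall>a\<in>T. \<forall>c. c \<odot>\<^bsub>?F\<^esub> a \<in> T"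
    "\<forall>g\<in>free_gen ` S. \<forall>a\<in>T. g \<otimes>\<^bsub>?F\<^esub> a \<in> T"
  have word: "Poly_Mapping.single w (1::'k) \<in> T" if "w \<in> lists S" for w
    using that
  proof (induction w)
    case Nil then show ?case using T(2) by (simp add: free_algebra_def)
  next
    case (Cons g w)
    then have "free_gen g \<otimes>\<^bsub>?F\<^esub> Poly_Mapping.single w 1 \<in> T"
      by (intro T(5)[rule_format]) simp_all
    then show ?case by (simp add: free_algebra_def free_gen_def)
  qed
  have single: "Poly_Mapping.single w c \<in> T" if "w \<in> lists S" for w c
  proof -
    have "c \<odot>\<^bsub>?F\<^esub> Poly_Mapping.single w 1 \<in> T" by (rule T(4)[rule_format, OF word[OF that]])
    then show ?thesis by (simp add: free_algebra_def)
  qed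
  have "carrier ?F \<subseteq> T"
  proof
    fix p assume "p \<in> carrier ?F"
    then have p: "Poly_Mapping.keys p \<subseteq> lists S" by (simp add: free_algebra_def)
    show "p \<in> T"
    proof (induction p rule: poly_mapping_single_induct)
      case zero
      have "0 \<odot>\<^bsub>?F\<^esub> \<one>\<^bsub>?F\<^esub> \<in> T" by (rule T(4)[rule_format, OF T(2)])
      then show ?case by (simp add: free_algebra_def)
    next
      case (plus w c p')
      have "w \<in> lists S" by (rule subsetD[OF p plus(1)])
      then have "Poly_Mapping.single w c \<oplus>\<^bsub>?F\<^esub> p' \<in> T"
        by (intro T(3)[rule_format] single plus(2))
      then show ?case by (simp add: free_algebra_def)
    qed
  qed
  then show "T = carrier ?F" by (rule subset_antisym[OF T(1)])
qed

section \<open>Matrix units of Yokonuma-Hecke and Hecke algebras\<close>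

text \<open>The scalar by which \<open>e i\<close> acts on a joint eigenvector. For
  \<open>z \<noteq> y\<close> the sum is, up to the factor \<open>y\<close>, the quotient of
  \<open>z ^ r - y ^ r = 0\<close> by \<open>z - y\<close>.\<close>

lemma sum_mixed_powers:
  fixes z y :: "'k::field"
  assumes "z ^ r = 1" "y ^ r = 1" "of_nat r \<noteq> (0::'k)" "1 \<le> r"
  shows "1 / of_nat r * (\<Sum>k<r. z ^ k * y ^ (r - k)) = (if z = y then 1 else 0)"
proof (cases "z = y")
  case True
  have "(\<Sum>k<r. z ^ k * y ^ (r - k)) = (\<Sum>k<r. 1)"
    using True assms(2) by (intro sum.cong refl) (simp flip: power_add)
  then show ?thesis using True assms(3) by simp
next
  case False
  obtain q where q: "r = Suc q" using assms(4) by (cases r) auto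
  have "(z - y) * (\<Sum>k<r. z ^ k * y ^ (q - k)) = 0"
    using diff_power_eq_sum[of z q y] assms(1,2) q by simp
  then have 0: "(\<Sum>k<r. z ^ k * y ^ (q - k)) = 0" using False by simp
  have "(\<Sum>k<r. z ^ k * y ^ (r - k)) = y * (\<Sum>k<r. z ^ k * y ^ (q - k))"
    unfolding sum_distrib_left by (intro sum.cong refl) (auto simp: q Suc_diff_le)
  then show ?thesis using 0 False by simp
qed

context embedded_algebra
begin

lemma ret_emul: "ret (emul u w) = ret u \<otimes> ret w"
  by (simp add: emul_def)

lemma emb_finsum:
  assumes "finite I" "\<And>i. i \<in> I \<Longrightarrow> g i \<in> carrier A"
  shows "emb (finsum A g I) = (\<Sum>i\<in>I. emb (g i))"
  using assms
proof (induction I rule: finite_induct)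
  case (insert i I)
  then have "finsum A g (insert i I) = g i \<oplus> finsum A g I" by (intro finsum_insert) auto
  moreover have "finsum A g I \<in> carrier A" using insert.prems by (intro finsum_closed) auto
  ultimately show ?case using insert by (simp add: emb_add)
qed simp

lemma emul_pow: "a \<in> carrier A \<Longrightarrow> m \<in> E.C \<Longrightarrow> (emul (emb a) ^^ k) m = emul (emb (a [^] k)) m"
proof (induction k)
  case (Suc k)
  have "emul (emb (a [^] Suc k)) m = emul (emb (a \<otimes> a [^] k)) m"
    using Suc.prems nat_pow_Suc2[of a k] by simp
  then show ?case using Suc by (simp add: emb_mult E.mul_assoc)
qed simp

lemma emul_pow_eigen:
  assumes "a \<in> carrier A" "m \<in> E.C" "emul (emb a) m = sc z m"
  shows "emul (emb (a [^] (k::nat))) m = sc (z ^ k) m"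
proof -
  have "(emul (emb a) ^^ k) m = sc (z ^ k) m"
    by (induction k) (simp_all add: E.mul_scale assms(3) mult.commute)
  then show ?thesis using emul_pow assms by simp
qed

lemma lin_cyclotomic:
  assumes "y \<in> carrier A" "m \<in> E.C"
  shows "E.lin (emb y) cs m = emul (emb (foldr (\<lambda>c b. (y \<ominus> c \<odot> \<one>) \<otimes> b) cs \<one>)) m"
proof (induction cs)
  case (Cons c cs)
  let ?b = "foldr (\<lambda>c b. (y \<ominus> c \<odot> \<one>) \<otimes> b) cs \<one>"
  have b: "?b \<in> carrier A" by (induction cs) (use assms in \<open>auto intro!: minus_closed\<close>)
  have "emul (emb ((y \<ominus> c \<odot> \<one>) \<otimes> ?b)) m = emul (emb y) (emul (emb ?b) m) - sc c (emul (emb \<one>) (emul (emb ?b) m))"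
    using b assms by (simp add: emb_mult emb_minus emb_smult E.mul_diff E.mul_scale E.mul_assoc)
  then show ?case using Cons.IH b assms(2) by simp
qed (use assms in simp)

lemma gen_alg_pow:
  assumes "\<And>g. g \<in> G \<Longrightarrow> g \<in> carrier A" "g \<in> G"
  shows "emb (g [^] (k::nat)) \<in> E.gen_alg (emb ` G)"
proof (induction k)
  case 0 then show ?case by (simp add: E.gen_one)
next
  case (Suc k)
  have "emb (g [^] Suc k) = emul (emb g) (emb (g [^] k))"
    using nat_pow_Suc2[of g k] assms by (simp add: emb_mult)
  then show ?case using Suc assms(2) by (simp add: E.gen_mul)
qed

lemma yh_units:
  fixes n r d :: nat and v :: "nat \<Rightarrow> 'k" and Z :: "'k list"
  assumes sep: "separated_parameters n d v" and n: "1 \<le> n" and r: "1 \<le> r" "of_nat r \<noteq> (0::'k)"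
    and Z: "distinct Z" "Polynomial.monom 1 r - 1 = (\<Prod>z\<leftarrow>Z. [:- z, 1:])"
    and t: "\<And>i. i \<in> {1..n} \<Longrightarrow> t i \<in> carrier A" and f: "\<And>i. i \<in> {1..<n} \<Longrightarrow> f i \<in> carrier A"
    and x: "\<And>i. i \<in> {1..n} \<Longrightarrow> x i \<in> carrier A"
    and rel: "\<And>a b. (a, b) \<in> yh_relations A r n t f x \<Longrightarrow> a = b"
    and cyc: "cyclotomic_element A d v (x 1) = \<zero>"
    and gen: "generates A (t ` {1..n} \<union> f ` {1..<n} \<union> x ` {1..n})"
  shows "has_matrix_units A"
proof -
  interpret S: separated_parameters n d v by (rule sep)
  have e: "yh_e A r t i \<in> carrier A" if "i \<in> {1..<n}" for i
    unfolding yh_e_def using that t by (intro smult_closed finsum_closed) auto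
  have emb_e: "emb (yh_e A r t i) = sc (1 / of_nat r) (\<Sum>k<r. emul (emb (t i [^] k)) (emb (t (i + 1) [^] (r - k))))"
    if "i \<in> {1..<n}" for i
  proof -
    have ti: "t i \<in> carrier A" "t (i + 1) \<in> carrier A" using that t by auto
    then have "finsum A (\<lambda>k. t i [^] k \<otimes> t (i + 1) [^] (r - k)) {..<r} \<in> carrier A" by (intro finsum_closed) auto
    then show ?thesis unfolding yh_e_def using ti by (simp add: emb_smult emb_finsum emb_mult)
  qed
  have Z_root: "z ^ r = 1" if "z \<in> set Z" for z
  proof -
    have "poly (\<Prod>z\<leftarrow>Z. [:- z, 1:]) z = 0"
      using split_list[OF that] by auto
    then show ?thesis unfolding Z(2)[symmetric] by (simp add: poly_monom)
  qed
  have powr: "t i [^] r = \<one>" if "i \<in> {1..n}" for i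
    by (rule rel) (use that in \<open>auto simp: yh_relations_def\<close>)
  interpret Y: yh_algebra sc emul "emb \<one>" n d v Z "\<lambda>i. emb (t i)" "\<lambda>i. emb (f i)" "\<lambda>i. emb (x i)" "\<lambda>i. emb (yh_e A r t i)"
  proof unfold_locales
    show "emb (t i) \<in> E.C" "emb (x i) \<in> E.C" if "i \<in> {1..n}" for i using t x that by auto
    show "emb (f i) \<in> E.C" if "i \<in> {1..<n}" for i using f that by auto
    show "emul (emb (f i)) (emb (f i)) = emb \<one>" if i: "i \<in> {1..<n}" for i
    proof -
      have "f i \<otimes> f i = \<one>" by (rule rel) (use i in \<open>auto simp: yh_relations_def\<close>)
      then show ?thesis using f[OF i] by (simp flip: emb_mult)
    qed
    show "emul (emul (emb (f i)) (emb (f (i + 1)))) (emb (f i)) = emul (emul (emb (f (i + 1))) (emb (f i))) (emb (f (i + 1)))"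
      if i: "i \<in> {1..<n}" "i + 1 \<in> {1..<n}" for i
    proof -
      have "f i \<otimes> f (i + 1) \<otimes> f i = f (i + 1) \<otimes> f i \<otimes> f (i + 1)"
        by (rule rel, unfold yh_relations_def, rule UnI1, rule UnI1, rule UnI1, rule UnI1, rule UnI1, rule UnI1,
          rule UnI1, rule UnI1, rule UnI2) (use i in blast)
      then show ?thesis using f[OF i(1)] f[OF i(2)] by (simp flip: emb_mult)
    qed
    show "emul (emb (f i)) (emb (f j)) = emul (emb (f j)) (emb (f i))"
      if i: "i \<in> {1..<n}" "j \<in> {1..<n}" "i + 1 < j" for i j
    proof -
      have "(f i \<otimes> f j, f j \<otimes> f i) \<in> yh_relations A r n t f x"
        unfolding yh_relations_def using i by (intro UnI1 CollectI exI[of _ i] exI[of _ j]) auto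
      from rel[OF this] show ?thesis using f[OF i(1)] f[OF i(2)] by (simp flip: emb_mult)
    qed
    show "emul (emb (t i)) (emb (t j)) = emul (emb (t j)) (emb (t i))"
      "emul (emb (x i)) (emb (x j)) = emul (emb (x j)) (emb (x i))"
      "emul (emb (t i)) (emb (x j)) = emul (emb (x j)) (emb (t i))"
      if i: "i \<in> {1..n}" "j \<in> {1..n}" for i j
    proof -
      have "t i \<otimes> t j = t j \<otimes> t i" "x i \<otimes> x j = x j \<otimes> x i" "t i \<otimes> x j = x j \<otimes> t i"
        by (rule rel; use i in \<open>auto simp: yh_relations_def\<close>)+
      then show "emul (emb (t i)) (emb (t j)) = emul (emb (t j)) (emb (t i))"
        "emul (emb (x i)) (emb (x j)) = emul (emb (x j)) (emb (x i))"
        "emul (emb (t i)) (emb (x j)) = emul (emb (x j)) (emb (t i))"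
        using i t x by (simp_all flip: emb_mult)
    qed
    show "emul (emb (f i)) (emb (t j)) = emul (emb (t (Transposition.transpose i (i + 1) j))) (emb (f i))"
      if i: "i \<in> {1..<n}" "j \<in> {1..n}" for i j
    proof -
      have "f i \<otimes> t j = t (Transposition.transpose i (i + 1) j) \<otimes> f i"
        by (rule rel) (use i in \<open>auto simp: yh_relations_def\<close>)
      moreover have "Transposition.transpose i (i + 1) j \<in> {1..n}"
        using i by (auto simp: Transposition.transpose_def)
      ultimately show ?thesis using f[OF i(1)] t[of j] t[of "Transposition.transpose i (i + 1) j"] i(2)
        by (simp flip: emb_mult)
    qed
    show "emul (emb (f i)) (emb (x (i + 1))) = emul (emb (x i)) (emb (f i)) + emb (yh_e A r t i)"
      if i: "i \<in> {1..<n}" for i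
    proof -
      have "f i \<otimes> x (i + 1) = x i \<otimes> f i \<oplus> yh_e A r t i"
        by (rule rel) (use i in \<open>auto simp: yh_relations_def\<close>)
      then show ?thesis using f[OF i] x[of i] x[of "i + 1"] e[OF i] i
        by (simp add: emb_add flip: emb_mult)
    qed
    show "emul (emb (f i)) (emb (x j)) = emul (emb (x j)) (emb (f i))"
      if i: "i \<in> {1..<n}" "j \<in> {1..n}" "j \<noteq> i" "j \<noteq> i + 1" for i j
    proof -
      have "f i \<otimes> x j = x j \<otimes> f i" by (rule rel) (use i in \<open>auto simp: yh_relations_def\<close>)
      then show ?thesis using f[OF i(1)] x[OF i(2)] by (simp flip: emb_mult)
    qed
    show "emb (yh_e A r t i) \<in> E.gen_alg ((\<lambda>i. emb (t i)) ` {1..n})" if i: "i \<in> {1..<n}" for i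
    proof -
      let ?G = "(\<lambda>i. emb (t i)) ` {1..n}"
      have G: "?G = emb ` t ` {1..n}" by auto
      have pow: "emb (t j [^] (k::nat)) \<in> E.gen_alg ?G" if "j \<in> {1..n}" for j k
        unfolding G using t that by (intro gen_alg_pow) auto
      have "emul (emb (t i [^] k)) (emb (t (i + 1) [^] (r - k))) \<in> E.gen_alg ?G" for k
        using i t by (intro E.gen_alg_mul pow) auto
      then show ?thesis unfolding emb_e[OF i]
        by (intro E.gen_scale V.subspace_sum E.gen_alg_subspace)
    qed
    show "emul (emb (yh_e A r t i)) m = (if z = z' then m else 0)"
      if i: "i \<in> {1..<n}" and m: "m \<in> E.C" and z: "z \<in> set Z" "z' \<in> set Z"
        and eig: "emul (emb (t i)) m = sc z m" "emul (emb (t (i + 1))) m = sc z' m" for i m z z'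
    proof -
      have ti: "t i \<in> carrier A" "t (i + 1) \<in> carrier A" using i t by auto
      have "emul (emb (yh_e A r t i)) m =
          sc (1 / of_nat r) (\<Sum>k<r. emul (emb (t i [^] k)) (emul (emb (t (i + 1) [^] (r - k))) m))"
        unfolding emb_e[OF i] by (simp add: E.mul_scale E.mul_sum E.mul_assoc)
      also have "\<dots> = sc (1 / of_nat r) (\<Sum>k<r. sc (z ^ k * z' ^ (r - k)) m)"
        using emul_pow_eigen[OF ti(1) m eig(1)] emul_pow_eigen[OF ti(2) m eig(2)]
        by (simp add: E.mul_scale mult.commute)
      also have "\<dots> = sc (1 / of_nat r * (\<Sum>k<r. z ^ k * z' ^ (r - k))) m"
        by (simp only: V.scale_sum_left[symmetric] V.scale_scale)
      also have "\<dots> = (if z = z' then m else 0)"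
        unfolding sum_mixed_powers[OF Z_root[OF z(1)] Z_root[OF z(2)] r(2,1)] by simp
      finally show ?thesis .
    qed
    \<comment> \<open>The factorization of the polynomial over \<open>Z\<close> turns the power
      relation of \<open>t i\<close> into a product of linear factors.\<close>
    show "E.lin (emb (t i)) Z m = 0" if i: "i \<in> {1..n}" and m: "m \<in> E.C" for i m
    proof -
      have "E.lin (emb (t i)) Z m = E.papply (emb (t i)) (Polynomial.monom 1 r - 1) m"
        unfolding Z(2) E.papply_prod ..
      also have "Polynomial.monom 1 r - (1 :: 'k poly) = Polynomial.monom 1 r + Polynomial.monom (- 1) 0"
        by (simp add: monom_0 one_pCons)
      also have "E.papply (emb (t i)) \<dots> m = emul (emb (t i [^] r)) m - m"
        using emul_pow[OF t[OF i] m] by (simp add: E.papply_add E.papply_monom)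
      finally show ?thesis using powr[OF i] m by simp
    qed
    show "E.lin (emb (x 1)) (map v [1..<Suc d]) m = 0" if m: "m \<in> E.C" for m
    proof -
      have "E.lin (emb (x 1)) (map v [1..<Suc d]) m = emul (emb (cyclotomic_element A d v (x 1))) m"
        using x[of 1] n m by (subst lin_cyclotomic) (auto simp: cyclotomic_element_def foldr_map comp_def simp del: upt_Suc)
      then show ?thesis unfolding cyc by simp
    qed
    show "E.C \<subseteq> E.gen_alg ((\<lambda>i. emb (t i)) ` {1..n} \<union> (\<lambda>i. emb (f i)) ` {1..<n} \<union> (\<lambda>i. emb (x i)) ` {1..n})"
      (is "_ \<subseteq> E.gen_alg ?G")
    proof
      fix u assume u: "u \<in> E.C"
      have "emb a \<in> E.gen_alg ?G" if "a \<in> carrier A" for a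
        using gen that
      proof (induction rule: generates_induct)
        case one then show ?case by (simp add: E.gen_one)
      next
        case (add a b) then show ?case by (simp add: emb_add E.gen_add)
      next
        case (scale a c) then show ?case by (simp add: emb_smult E.gen_scale)
      next
        case (mul g a)
        then have "g \<in> carrier A" "emb g \<in> ?G" using t f x by auto
        then show ?case using mul by (simp add: emb_mult E.gen_mul)
      qed
      from this[OF ret_closed[of u]] show "u \<in> E.gen_alg ?G" by (simp only: emb_ret[OF u])
    qed
  qed (use n Z(1) in auto)
  obtain T :: "(nat \<Rightarrow> 'k \<times> 'k) set" and \<beta> :: "(nat \<Rightarrow> 'k \<times> 'k) \<Rightarrow> (nat \<Rightarrow> 'k \<times> 'k)" and U
    where TU: "E.matrix_units T \<beta> U" using Y.yh_matrix_units by blast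
  have mult: "\<forall>s\<in>T. \<forall>t\<in>T. \<forall>t'\<in>T. \<forall>u\<in>T. \<beta> s = \<beta> t \<longrightarrow> \<beta> t' = \<beta> u \<longrightarrow>
      emul (U s t) (U t' u) = (if t = t' then U s u else 0)"
    and span: "E.C \<subseteq> V.span {U s t | s t. s \<in> T \<and> t \<in> T \<and> \<beta> s = \<beta> t}"
    by (rule TU[unfolded E.matrix_units_def, THEN conjunct2, THEN conjunct2, THEN conjunct1],
      rule TU[unfolded E.matrix_units_def, THEN conjunct2, THEN conjunct2, THEN conjunct2])
  show ?thesis
  proof (rule has_matrix_unitsI[of T \<beta> "\<lambda>s t. ret (U s t)"])
    show "finite T" using TU by (simp add: E.matrix_units_def)
    show "ret (U s t) \<otimes> ret (U t' u) = (if t = t' then ret (U s u) else \<zero>)"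
      if "s \<in> T" "t \<in> T" "t' \<in> T" "u \<in> T" "\<beta> s = \<beta> t" "\<beta> t' = \<beta> u" for s t t' u
    proof -
      have "emul (U s t) (U t' u) = (if t = t' then U s u else 0)"
        by (rule mult[rule_format, OF that])
      then show ?thesis by (simp flip: ret_emul)
    qed
    show "carrier A \<subseteq> alg_span A {ret (U s t) | s t. s \<in> T \<and> t \<in> T \<and> \<beta> s = \<beta> t}"
    proof
      fix a assume a: "a \<in> carrier A"
      have "emb a \<in> V.span {U s t | s t. s \<in> T \<and> t \<in> T \<and> \<beta> s = \<beta> t}"
        by (rule subsetD[OF span emb_C[OF a]])
      from ret_span[OF this] have "a \<in> alg_span A (ret ` {U s t | s t. s \<in> T \<and> t \<in> T \<and> \<beta> s = \<beta> t})"
        using a by simp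
      moreover have "ret ` {U s t | s t. s \<in> T \<and> t \<in> T \<and> \<beta> s = \<beta> t} =
          {ret (U s t) | s t. s \<in> T \<and> t \<in> T \<and> \<beta> s = \<beta> t}" by blast
      ultimately show "a \<in> alg_span A {ret (U s t) | s t. s \<in> T \<and> t \<in> T \<and> \<beta> s = \<beta> t}" by simp
    qed
  qed auto
qed

end

lemma yh_relations_intros:
  fixes A (structure)
  shows
    "i \<in> {1..<n} \<Longrightarrow> j \<in> {1..<n} \<Longrightarrow> \<bar>int i - int j\<bar> \<ge> 2 \<Longrightarrow> (f i \<otimes> f j, f j \<otimes> f i) \<in> yh_relations A r n t f x"
    "i \<in> {1..<n} \<Longrightarrow> i + 1 \<in> {1..<n} \<Longrightarrow> (f i \<otimes> f (i + 1) \<otimes> f i, f (i + 1) \<otimes> f i \<otimes> f (i + 1)) \<in> yh_relations A r n t f x"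
    "i \<in> {1..n} \<Longrightarrow> j \<in> {1..n} \<Longrightarrow> (t i \<otimes> t j, t j \<otimes> t i) \<in> yh_relations A r n t f x"
    "i \<in> {1..<n} \<Longrightarrow> j \<in> {1..n} \<Longrightarrow> (f i \<otimes> t j, t (Transposition.transpose i (i + 1) j) \<otimes> f i) \<in> yh_relations A r n t f x"
    "i \<in> {1..n} \<Longrightarrow> (t i [^] r, \<one>) \<in> yh_relations A r n t f x"
    "i \<in> {1..<n} \<Longrightarrow> (f i \<otimes> f i, \<one>) \<in> yh_relations A r n t f x"
    "i \<in> {1..n} \<Longrightarrow> j \<in> {1..n} \<Longrightarrow> (x i \<otimes> x j, x j \<otimes> x i) \<in> yh_relations A r n t f x"
    "i \<in> {1..<n} \<Longrightarrow> (f i \<otimes> x (i + 1), x i \<otimes> f i \<oplus> yh_e A r t i) \<in> yh_relations A r n t f x"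
    "i \<in> {1..<n} \<Longrightarrow> j \<in> {1..n} \<Longrightarrow> j \<noteq> i \<Longrightarrow> j \<noteq> i + 1 \<Longrightarrow> (f i \<otimes> x j, x j \<otimes> f i) \<in> yh_relations A r n t f x"
    "i \<in> {1..n} \<Longrightarrow> j \<in> {1..n} \<Longrightarrow> (t j \<otimes> x i, x i \<otimes> t j) \<in> yh_relations A r n t f x"
  unfolding yh_relations_def
  subgoal by (rule UnI1, rule UnI1, rule UnI1, rule UnI1, rule UnI1, rule UnI1, rule UnI1, rule UnI1, rule UnI1, blast)
  subgoal by (rule UnI1, rule UnI1, rule UnI1, rule UnI1, rule UnI1, rule UnI1, rule UnI1, rule UnI1, rule UnI2, blast)
  subgoal by (rule UnI1, rule UnI1, rule UnI1, rule UnI1, rule UnI1, rule UnI1, rule UnI1, rule UnI2, blast)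
  subgoal by (rule UnI1, rule UnI1, rule UnI1, rule UnI1, rule UnI1, rule UnI1, rule UnI2, blast)
  subgoal by (rule UnI1, rule UnI1, rule UnI1, rule UnI1, rule UnI1, rule UnI2, blast)
  subgoal by (rule UnI1, rule UnI1, rule UnI1, rule UnI1, rule UnI2, blast)
  subgoal by (rule UnI1, rule UnI1, rule UnI1, rule UnI2, blast)
  subgoal by (rule UnI1, rule UnI1, rule UnI2, blast)
  subgoal by (rule UnI1, rule UnI2, blast)
  subgoal by (rule UnI2, blast)
  done

lemma hecke_relations_intros:
  fixes A (structure)
  shows
    "i \<in> {1..<m} \<Longrightarrow> (s i \<otimes> s i, \<one>) \<in> hecke_relations A m x s"
    "i \<in> {1..<m} \<Longrightarrow> i + 1 \<in> {1..<m} \<Longrightarrow> (s i \<otimes> s (i + 1) \<otimes> s i, s (i + 1) \<otimes> s i \<otimes> s (i + 1)) \<in> hecke_relations A m x s"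
    "i \<in> {1..<m} \<Longrightarrow> j \<in> {1..<m} \<Longrightarrow> \<bar>int i - int j\<bar> > 1 \<Longrightarrow> (s i \<otimes> s j, s j \<otimes> s i) \<in> hecke_relations A m x s"
    "i \<in> {1..m} \<Longrightarrow> j \<in> {1..m} \<Longrightarrow> (x i \<otimes> x j, x j \<otimes> x i) \<in> hecke_relations A m x s"
    "i \<in> {1..<m} \<Longrightarrow> (s i \<otimes> x (i + 1), x i \<otimes> s i \<oplus> \<one>) \<in> hecke_relations A m x s"
    "i \<in> {1..<m} \<Longrightarrow> j \<in> {1..m} \<Longrightarrow> j \<noteq> i \<Longrightarrow> j \<noteq> i + 1 \<Longrightarrow> (s i \<otimes> x j, x j \<otimes> s i) \<in> hecke_relations A m x s"
  unfolding hecke_relations_def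
  subgoal by (rule UnI1, rule UnI1, rule UnI1, rule UnI1, rule UnI1, blast)
  subgoal by (rule UnI1, rule UnI1, rule UnI1, rule UnI1, rule UnI2, blast)
  subgoal by (rule UnI1, rule UnI1, rule UnI1, rule UnI2, blast)
  subgoal by (rule UnI1, rule UnI1, rule UnI2, blast)
  subgoal by (rule UnI1, rule UnI2, blast)
  subgoal by (rule UnI2, blast)
  done

section \<open>Homomorphisms and the transport of relations\<close>

definition algebra_hom :: "('k::field, 'a) module \<Rightarrow> ('k, 'b) module \<Rightarrow> ('a \<Rightarrow> 'b) set" where
  "algebra_hom A B = {h \<in> Ring.ring_hom A B. \<forall>c. \<forall>x\<in>carrier A. h (c \<odot>\<^bsub>A\<^esub> x) = c \<odot>\<^bsub>B\<^esub> h x}"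

lemma algebra_hom_comp: "g \<in> algebra_hom A B \<Longrightarrow> h \<in> algebra_hom B D \<Longrightarrow> h \<circ> g \<in> algebra_hom A D"
  by (auto simp: algebra_hom_def ring_hom_trans dest: ring_hom_closed)

lemma quotient_hom:
  assumes "assoc_algebra A" "ideal I A"
  shows "(\<lambda>x. I +>\<^bsub>A\<^esub> x) \<in> algebra_hom A (quotient_algebra A I)"
proof -
  interpret A: assoc_algebra A by fact
  note ops = quotient_ops[OF assms]
  show ?thesis unfolding algebra_hom_def
    using ops(4)[OF A.one_closed A.one_closed]
    by (auto intro!: ring_hom_memI simp: quotient_carrier[OF assms] ops(1-3))
qed

locale algebra_hom_pair = A: assoc_algebra A + B: assoc_algebra B
  for A :: "('k::field, 'a) module" and B :: "('k, 'b) module" +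
  fixes h
  assumes h: "h \<in> algebra_hom A B"
begin

lemma hom [simp]:
  "a \<in> carrier A \<Longrightarrow> h a \<in> carrier B" "h \<one>\<^bsub>A\<^esub> = \<one>\<^bsub>B\<^esub>"
  "a \<in> carrier A \<Longrightarrow> b \<in> carrier A \<Longrightarrow> h (a \<otimes>\<^bsub>A\<^esub> b) = h a \<otimes>\<^bsub>B\<^esub> h b"
  "a \<in> carrier A \<Longrightarrow> b \<in> carrier A \<Longrightarrow> h (a \<oplus>\<^bsub>A\<^esub> b) = h a \<oplus>\<^bsub>B\<^esub> h b"
  "a \<in> carrier A \<Longrightarrow> h (c \<odot>\<^bsub>A\<^esub> a) = c \<odot>\<^bsub>B\<^esub> h a"
  using h by (auto simp: algebra_hom_def ring_hom_closed ring_hom_one ring_hom_mult ring_hom_add)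

lemma hom_zero [simp]: "h \<zero>\<^bsub>A\<^esub> = \<zero>\<^bsub>B\<^esub>"
proof -
  have "h \<zero>\<^bsub>A\<^esub> \<oplus>\<^bsub>B\<^esub> h \<zero>\<^bsub>A\<^esub> = h \<zero>\<^bsub>A\<^esub>" by (simp flip: hom(4))
  then show ?thesis by (simp add: B.add.l_cancel_one)
qed

lemma hom_minus [simp]: "a \<in> carrier A \<Longrightarrow> b \<in> carrier A \<Longrightarrow> h (a \<ominus>\<^bsub>A\<^esub> b) = h a \<ominus>\<^bsub>B\<^esub> h b"
proof -
  assume ab: "a \<in> carrier A" "b \<in> carrier A"
  have "h a = h ((a \<ominus>\<^bsub>A\<^esub> b) \<oplus>\<^bsub>A\<^esub> b)" using ab by (simp add: A.minus_eq A.a_assoc A.l_neg del: hom)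
  also have "\<dots> = h (a \<ominus>\<^bsub>A\<^esub> b) \<oplus>\<^bsub>B\<^esub> h b" using ab by simp
  finally show ?thesis using ab by (simp add: B.minus_eq B.a_assoc B.r_neg)
qed

lemma hom_pow [simp]: "a \<in> carrier A \<Longrightarrow> h (a [^]\<^bsub>A\<^esub> (k::nat)) = h a [^]\<^bsub>B\<^esub> k"
  by (induction k) simp_all

lemma hom_finsum:
  assumes "finite I" "\<And>i. i \<in> I \<Longrightarrow> g i \<in> carrier A"
  shows "h (finsum A g I) = finsum B (\<lambda>i. h (g i)) I"
  using assms
proof (induction I rule: finite_induct)
  case (insert i I)
  then have "finsum A g (insert i I) = g i \<oplus>\<^bsub>A\<^esub> finsum A g I" by (intro A.finsum_insert) auto
  moreover have "finsum B (\<lambda>i. h (g i)) (insert i I) = h (g i) \<oplus>\<^bsub>B\<^esub> finsum B (\<lambda>i. h (g i)) I"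
    using insert by (intro B.finsum_insert) auto
  moreover have "finsum A g I \<in> carrier A" using insert.prems by (intro A.finsum_closed) auto
  ultimately show ?case using insert by simp
qed simp

lemma cyclotomic_element_hom:
  assumes "a \<in> carrier A"
  shows "h (cyclotomic_element A d v a) = cyclotomic_element B d v (h a)"
proof -
  have "foldr (\<lambda>i b. (a \<ominus>\<^bsub>A\<^esub> v i \<odot>\<^bsub>A\<^esub> \<one>\<^bsub>A\<^esub>) \<otimes>\<^bsub>A\<^esub> b) is \<one>\<^bsub>A\<^esub> \<in> carrier A \<and>
      h (foldr (\<lambda>i b. (a \<ominus>\<^bsub>A\<^esub> v i \<odot>\<^bsub>A\<^esub> \<one>\<^bsub>A\<^esub>) \<otimes>\<^bsub>A\<^esub> b) is \<one>\<^bsub>A\<^esub>) =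
      foldr (\<lambda>i b. (h a \<ominus>\<^bsub>B\<^esub> v i \<odot>\<^bsub>B\<^esub> \<one>\<^bsub>B\<^esub>) \<otimes>\<^bsub>B\<^esub> b) is \<one>\<^bsub>B\<^esub>" for "is"
    by (induction "is") (use assms in \<open>auto simp: A.smult_closed\<close>)
  then show ?thesis unfolding cyclotomic_element_def by blast
qed

lemma yh_e_hom:
  assumes "t i \<in> carrier A" "t (i + 1) \<in> carrier A"
  shows "h (yh_e A r t i) = yh_e B r (\<lambda>i. h (t i)) i"
proof -
  have "finsum A (\<lambda>k. t i [^]\<^bsub>A\<^esub> k \<otimes>\<^bsub>A\<^esub> t (i + 1) [^]\<^bsub>A\<^esub> (r - k)) {..<r} \<in> carrier A"
    using assms by (intro A.finsum_closed) auto
  moreover have "h (finsum A (\<lambda>k. t i [^]\<^bsub>A\<^esub> k \<otimes>\<^bsub>A\<^esub> t (i + 1) [^]\<^bsub>A\<^esub> (r - k)) {..<r}) =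
      finsum B (\<lambda>k. h (t i) [^]\<^bsub>B\<^esub> k \<otimes>\<^bsub>B\<^esub> h (t (i + 1)) [^]\<^bsub>B\<^esub> (r - k)) {..<r}"
    using assms by (subst hom_finsum) auto
  ultimately show ?thesis unfolding yh_e_def by simp
qed

text \<open>Both sides of every relation are terms in the algebra operations, so the relations among
  the images are the images of the relations in \<open>A\<close>.\<close>

lemma yh_relations_hom:
  assumes t: "\<And>i. i \<in> {1..n} \<Longrightarrow> t i \<in> carrier A" and f: "\<And>i. i \<in> {1..<n} \<Longrightarrow> f i \<in> carrier A"
    and x: "\<And>i. i \<in> {1..n} \<Longrightarrow> x i \<in> carrier A"
    and rel: "\<And>a b. (a, b) \<in> yh_relations A r n t f x \<Longrightarrow> h a = h b"
    and ab: "(a, b) \<in> yh_relations B r n (\<lambda>i. h (t i)) (\<lambda>i. h (f i)) (\<lambda>i. h (x i))"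
  shows "a = b"
proof -
  let ?s = "\<lambda>i j. Transposition.transpose i (i + 1) j"
  have sij: "?s i j \<in> {1..n}" if "i \<in> {1..<n}" "j \<in> {1..n}" for i j
    using that by (auto simp: Transposition.transpose_def)
  have yc: "yh_e A r t i \<in> carrier A" if "i \<in> {1..<n}" for i
    unfolding yh_e_def using that t by (intro A.smult_closed A.finsum_closed) auto
  have "\<exists>a' b'. (a', b') \<in> yh_relations A r n t f x \<and> a = h a' \<and> b = h b'"
    using ab unfolding yh_relations_def[of B]
  proof (elim UnE CollectE exE conjE Pair_inject)
    fix i j assume *: "i \<in> {1..<n}" "j \<in> {1..<n}" "2 \<le> \<bar>int i - int j\<bar>" "a = h (f i) \<otimes>\<^bsub>B\<^esub> h (f j)" "b = h (f j) \<otimes>\<^bsub>B\<^esub> h (f i)"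
    show ?thesis
      by (rule exI[of _ "f i \<otimes>\<^bsub>A\<^esub> f j"], rule exI[of _ "f j \<otimes>\<^bsub>A\<^esub> f i"], intro conjI yh_relations_intros(1)) (use * f in simp_all)
  next
    fix i assume *: "i \<in> {1..<n}" "i + 1 \<in> {1..<n}" "a = h (f i) \<otimes>\<^bsub>B\<^esub> h (f (i + 1)) \<otimes>\<^bsub>B\<^esub> h (f i)"
      "b = h (f (i + 1)) \<otimes>\<^bsub>B\<^esub> h (f i) \<otimes>\<^bsub>B\<^esub> h (f (i + 1))"
    show ?thesis
      by (rule exI[of _ "f i \<otimes>\<^bsub>A\<^esub> f (i + 1) \<otimes>\<^bsub>A\<^esub> f i"], rule exI[of _ "f (i + 1) \<otimes>\<^bsub>A\<^esub> f i \<otimes>\<^bsub>A\<^esub> f (i + 1)"], intro conjI yh_relations_intros(2)) (use * f[of i] f[of "i + 1"] in simp_all)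
  next
    fix i j assume *: "i \<in> {1..n}" "j \<in> {1..n}" "a = h (t i) \<otimes>\<^bsub>B\<^esub> h (t j)" "b = h (t j) \<otimes>\<^bsub>B\<^esub> h (t i)"
    show ?thesis
      by (rule exI[of _ "t i \<otimes>\<^bsub>A\<^esub> t j"], rule exI[of _ "t j \<otimes>\<^bsub>A\<^esub> t i"], intro conjI yh_relations_intros(3)) (use * t in simp_all)
  next
    fix i j assume *: "i \<in> {1..<n}" "j \<in> {1..n}" "a = h (f i) \<otimes>\<^bsub>B\<^esub> h (t j)" "b = h (t (?s i j)) \<otimes>\<^bsub>B\<^esub> h (f i)"
    show ?thesis
      by (rule exI[of _ "f i \<otimes>\<^bsub>A\<^esub> t j"], rule exI[of _ "t (?s i j) \<otimes>\<^bsub>A\<^esub> f i"], intro conjI yh_relations_intros(4)) (use * f[of i] t[of j] t[OF sij[of i j]] in simp_all)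
  next
    fix i assume *: "i \<in> {1..n}" "a = h (t i) [^]\<^bsub>B\<^esub> r" "b = \<one>\<^bsub>B\<^esub>"
    show ?thesis
      by (rule exI[of _ "t i [^]\<^bsub>A\<^esub> r"], rule exI[of _ "\<one>\<^bsub>A\<^esub>"], intro conjI yh_relations_intros(5)) (use * t in simp_all)
  next
    fix i assume *: "i \<in> {1..<n}" "a = h (f i) \<otimes>\<^bsub>B\<^esub> h (f i)" "b = \<one>\<^bsub>B\<^esub>"
    show ?thesis
      by (rule exI[of _ "f i \<otimes>\<^bsub>A\<^esub> f i"], rule exI[of _ "\<one>\<^bsub>A\<^esub>"], intro conjI yh_relations_intros(6)) (use * f in simp_all)
  next
    fix i j assume *: "i \<in> {1..n}" "j \<in> {1..n}" "a = h (x i) \<otimes>\<^bsub>B\<^esub> h (x j)" "b = h (x j) \<otimes>\<^bsub>B\<^esub> h (x i)"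
    show ?thesis
      by (rule exI[of _ "x i \<otimes>\<^bsub>A\<^esub> x j"], rule exI[of _ "x j \<otimes>\<^bsub>A\<^esub> x i"], intro conjI yh_relations_intros(7)) (use * x in simp_all)
  next
    fix i assume *: "i \<in> {1..<n}" "a = h (f i) \<otimes>\<^bsub>B\<^esub> h (x (i + 1))"
      "b = h (x i) \<otimes>\<^bsub>B\<^esub> h (f i) \<oplus>\<^bsub>B\<^esub> yh_e B r (\<lambda>i. h (t i)) i"
    have e: "h (yh_e A r t i) = yh_e B r (\<lambda>i. h (t i)) i" using * t by (intro yh_e_hom) auto
    show ?thesis
      by (rule exI[of _ "f i \<otimes>\<^bsub>A\<^esub> x (i + 1)"], rule exI[of _ "x i \<otimes>\<^bsub>A\<^esub> f i \<oplus>\<^bsub>A\<^esub> yh_e A r t i"], intro conjI yh_relations_intros(8)) (use * f[of i] x[of i] x[of "i + 1"] yc[of i] e in simp_all)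
  next
    fix i j assume *: "i \<in> {1..<n}" "j \<in> {1..n}" "j \<noteq> i" "j \<noteq> i + 1" "a = h (f i) \<otimes>\<^bsub>B\<^esub> h (x j)" "b = h (x j) \<otimes>\<^bsub>B\<^esub> h (f i)"
    show ?thesis
      by (rule exI[of _ "f i \<otimes>\<^bsub>A\<^esub> x j"], rule exI[of _ "x j \<otimes>\<^bsub>A\<^esub> f i"], intro conjI yh_relations_intros(9)) (use * f x in simp_all)
  next
    fix i j assume *: "i \<in> {1..n}" "j \<in> {1..n}" "a = h (t j) \<otimes>\<^bsub>B\<^esub> h (x i)" "b = h (x i) \<otimes>\<^bsub>B\<^esub> h (t j)"
    show ?thesis
      by (rule exI[of _ "t j \<otimes>\<^bsub>A\<^esub> x i"], rule exI[of _ "x i \<otimes>\<^bsub>A\<^esub> t j"], intro conjI yh_relations_intros(10)) (use * t x in simp_all)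
  qed
  then show ?thesis using rel by blast
qed

lemma hecke_relations_hom:
  assumes s: "\<And>i. i \<in> {1..<m} \<Longrightarrow> s i \<in> carrier A" and x: "\<And>i. i \<in> {1..m} \<Longrightarrow> x i \<in> carrier A"
    and rel: "\<And>a b. (a, b) \<in> hecke_relations A m x s \<Longrightarrow> h a = h b"
    and ab: "(a, b) \<in> hecke_relations B m (\<lambda>i. h (x i)) (\<lambda>i. h (s i))"
  shows "a = b"
proof -
  have "\<exists>a' b'. (a', b') \<in> hecke_relations A m x s \<and> a = h a' \<and> b = h b'"
    using ab unfolding hecke_relations_def[of B]
  proof (elim UnE CollectE exE conjE Pair_inject)
    fix i assume *: "i \<in> {1..<m}" "a = h (s i) \<otimes>\<^bsub>B\<^esub> h (s i)" "b = \<one>\<^bsub>B\<^esub>"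
    show ?thesis
      by (rule exI[of _ "s i \<otimes>\<^bsub>A\<^esub> s i"], rule exI[of _ "\<one>\<^bsub>A\<^esub>"], intro conjI hecke_relations_intros(1)) (use * s in simp_all)
  next
    fix i assume *: "i \<in> {1..<m}" "i + 1 \<in> {1..<m}" "a = h (s i) \<otimes>\<^bsub>B\<^esub> h (s (i + 1)) \<otimes>\<^bsub>B\<^esub> h (s i)"
      "b = h (s (i + 1)) \<otimes>\<^bsub>B\<^esub> h (s i) \<otimes>\<^bsub>B\<^esub> h (s (i + 1))"
    show ?thesis
      by (rule exI[of _ "s i \<otimes>\<^bsub>A\<^esub> s (i + 1) \<otimes>\<^bsub>A\<^esub> s i"], rule exI[of _ "s (i + 1) \<otimes>\<^bsub>A\<^esub> s i \<otimes>\<^bsub>A\<^esub> s (i + 1)"], intro conjI hecke_relations_intros(2)) (use * s[of i] s[of "i + 1"] in simp_all)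
  next
    fix i j assume *: "i \<in> {1..<m}" "j \<in> {1..<m}" "1 < \<bar>int i - int j\<bar>" "a = h (s i) \<otimes>\<^bsub>B\<^esub> h (s j)" "b = h (s j) \<otimes>\<^bsub>B\<^esub> h (s i)"
    show ?thesis
      by (rule exI[of _ "s i \<otimes>\<^bsub>A\<^esub> s j"], rule exI[of _ "s j \<otimes>\<^bsub>A\<^esub> s i"], intro conjI hecke_relations_intros(3)) (use * s in simp_all)
  next
    fix i j assume *: "i \<in> {1..m}" "j \<in> {1..m}" "a = h (x i) \<otimes>\<^bsub>B\<^esub> h (x j)" "b = h (x j) \<otimes>\<^bsub>B\<^esub> h (x i)"
    show ?thesis
      by (rule exI[of _ "x i \<otimes>\<^bsub>A\<^esub> x j"], rule exI[of _ "x j \<otimes>\<^bsub>A\<^esub> x i"], intro conjI hecke_relations_intros(4)) (use * x in simp_all)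
  next
    fix i assume *: "i \<in> {1..<m}" "a = h (s i) \<otimes>\<^bsub>B\<^esub> h (x (i + 1))" "b = h (x i) \<otimes>\<^bsub>B\<^esub> h (s i) \<oplus>\<^bsub>B\<^esub> \<one>\<^bsub>B\<^esub>"
    show ?thesis
      by (rule exI[of _ "s i \<otimes>\<^bsub>A\<^esub> x (i + 1)"], rule exI[of _ "x i \<otimes>\<^bsub>A\<^esub> s i \<oplus>\<^bsub>A\<^esub> \<one>\<^bsub>A\<^esub>"], intro conjI hecke_relations_intros(5)) (use * s[of i] x[of i] x[of "i + 1"] in simp_all)
  next
    fix i j assume *: "i \<in> {1..<m}" "j \<in> {1..m}" "j \<noteq> i" "j \<noteq> i + 1" "a = h (s i) \<otimes>\<^bsub>B\<^esub> h (x j)" "b = h (x j) \<otimes>\<^bsub>B\<^esub> h (s i)"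
    show ?thesis
      by (rule exI[of _ "s i \<otimes>\<^bsub>A\<^esub> x j"], rule exI[of _ "x j \<otimes>\<^bsub>A\<^esub> s i"], intro conjI hecke_relations_intros(6)) (use * s x in simp_all)
  qed
  then show ?thesis using rel by blast
qed

end

context
  fixes S :: "'g set" and R :: "(('g list \<Rightarrow>\<^sub>0 'k::field) \<times> ('g list \<Rightarrow>\<^sub>0 'k)) set"
  assumes R: "R \<subseteq> carrier (free_algebra S) \<times> carrier (free_algebra S)"
begin

abbreviation presented_proj :: "('g list \<Rightarrow>\<^sub>0 'k) \<Rightarrow> ('g list \<Rightarrow>\<^sub>0 'k) set" where
  "presented_proj p \<equiv> relation_ideal (free_algebra S) R +>\<^bsub>free_algebra S\<^esub> p"

lemma presented_ideal: "ideal (relation_ideal (free_algebra S) R) (free_algebra S)"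
  by (intro ideal_relation_ideal assoc_algebra_free_algebra R)

lemma presented_proj_hom: "presented_proj \<in> algebra_hom (free_algebra S) (presented_algebra S R)"
  unfolding presented_algebra_def by (rule quotient_hom[OF assoc_algebra_free_algebra presented_ideal])

lemma presented_relation:
  assumes ab: "(a, b) \<in> R"
  shows "presented_proj a = presented_proj b"
proof -
  interpret F: assoc_algebra "free_algebra S :: ('k, _) module" by (rule assoc_algebra_free_algebra)
  have c: "a \<in> carrier (free_algebra S)" "b \<in> carrier (free_algebra S)" using R ab by auto
  have "(\<lambda>(a, b). a \<ominus>\<^bsub>free_algebra S\<^esub> b) ` R \<subseteq> carrier (free_algebra S)" using R by auto
  from F.genideal_self[OF this] have "a \<ominus>\<^bsub>free_algebra S\<^esub> b \<in> relation_ideal (free_algebra S) R"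
    unfolding relation_ideal_def using ab by auto
  then show ?thesis using c by (subst quotient_eq[OF assoc_algebra_free_algebra presented_ideal]) auto
qed

lemma generates_presented: "generates (presented_algebra S R) (presented_proj ` free_gen ` S)"
  unfolding presented_algebra_def
  by (intro generates_quotient assoc_algebra_free_algebra presented_ideal generates_free_algebra)
     (auto intro: free_gen_closed)

end

text \<open>Collects what passes from the free algebra through the affine algebra \<open>B\<close>
  to the cyclotomic quotient; \<open>c\<close> will be the cyclotomic element and \<open>G\<close>
  the set of free generators.\<close>

lemma cyclotomic_quotient:
  fixes B :: "('k::field, 'b) module"
  assumes B: "assoc_algebra B" and c: "c \<in> carrier B" and F: "assoc_algebra F" and p: "p \<in> algebra_hom F B"
    and G: "G \<subseteq> carrier F" "generates B (p ` G)"
  defines "J \<equiv> Idl\<^bsub>B\<^esub> {c}"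
  defines "h \<equiv> (\<lambda>y. J +>\<^bsub>B\<^esub> y) \<circ> p"
  shows "algebra_hom_pair F (quotient_algebra B J) h" "algebra_hom_pair B (quotient_algebra B J) (\<lambda>y. J +>\<^bsub>B\<^esub> y)"
    "generates (quotient_algebra B J) (h ` G)"
    "J +>\<^bsub>B\<^esub> c = \<zero>\<^bsub>quotient_algebra B J\<^esub>"
proof -
  interpret B: assoc_algebra B by (rule B)
  have J: "ideal J B" unfolding J_def using c by (intro B.genideal_ideal) auto
  have Q: "assoc_algebra (quotient_algebra B J)" by (rule assoc_algebra_quotient_algebra[OF B J])
  note q = quotient_hom[OF B J]
  show "algebra_hom_pair F (quotient_algebra B J) h" unfolding h_def
    using F Q algebra_hom_comp[OF p q] by (simp add: algebra_hom_pair_def algebra_hom_pair_axioms_def)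
  show "algebra_hom_pair B (quotient_algebra B J) (\<lambda>y. J +>\<^bsub>B\<^esub> y)"
    using B Q q by (simp add: algebra_hom_pair_def algebra_hom_pair_axioms_def)
  have pG: "p ` G \<subseteq> carrier B" using p G(1) by (auto simp: algebra_hom_def dest: ring_hom_closed)
  show "generates (quotient_algebra B J) (h ` G)"
    using generates_quotient[OF B J pG G(2)] by (simp add: h_def image_comp)
  have "c \<in> J" unfolding J_def using c by (intro B.genideal_self') auto
  then have "J +>\<^bsub>B\<^esub> c = J +>\<^bsub>B\<^esub> \<zero>\<^bsub>B\<^esub>"
    using c by (subst quotient_eq[OF B J]) (auto simp: B.minus_eq)
  then show "J +>\<^bsub>B\<^esub> c = \<zero>\<^bsub>quotient_algebra B J\<^esub>"
    using quotient_ops(5)[OF B J c c] by simp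
qed

lemma units_of_yh_relations:
  fixes A :: "('k::alg_closed_field, 'a) module" and v :: "nat \<Rightarrow> 'k"
  assumes A: "assoc_algebra A" and sep: "separated_parameters n d v" and n: "1 \<le> n" and r: "1 \<le> r" "\<not> CHAR('k) dvd r"
    and t: "\<And>i. i \<in> {1..n} \<Longrightarrow> t i \<in> carrier A" and f: "\<And>i. i \<in> {1..<n} \<Longrightarrow> f i \<in> carrier A"
    and x: "\<And>i. i \<in> {1..n} \<Longrightarrow> x i \<in> carrier A"
    and rel: "\<And>a b. (a, b) \<in> yh_relations A r n t f x \<Longrightarrow> a = b"
    and cyc: "cyclotomic_element A d v (x 1) = \<zero>\<^bsub>A\<^esub>"
    and gen: "generates A (t ` {1..n} \<union> f ` {1..<n} \<union> x ` {1..n})"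
  shows "has_matrix_units A"
proof -
  obtain emb :: "'a \<Rightarrow> 'a \<Rightarrow>\<^sub>0 'k" and ret where e: "embedded_algebra A pm_scale emb ret"
    using embedding_exists[OF A] by blast
  obtain Z :: "'k list" where Z: "distinct Z" "Polynomial.monom 1 r - 1 = (\<Prod>z\<leftarrow>Z. [:- z, 1:])"
    by (rule roots_of_unity_list[OF r])
  have "of_nat r \<noteq> (0::'k)" using r(2) by (simp add: of_nat_eq_0_iff_char_dvd)
  from embedded_algebra.yh_units[OF e sep n r(1) this Z t f x rel cyc gen] show ?thesis by blast
qed

theorem cyclotomic_yh_units:
  fixes v :: "nat \<Rightarrow> 'k::alg_closed_field"
  assumes sep: "separated_parameters n d v" and n: "1 \<le> n" and r: "1 \<le> r" "\<not> CHAR('k) dvd r"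
  shows "has_matrix_units (cyclotomic_yh r n d v)"
proof -
  let ?F = "free_algebra (yh_gens n) :: ('k, _) module" and ?B = "affine_yh r n :: ('k, _) module"
  note R = affine_yh_relations_closed[of r n, where ?'a = 'k]
  have B: "assoc_algebra ?B" unfolding affine_yh_def by (intro assoc_algebra_presented_algebra R)
  let ?c = "cyclotomic_element ?B d v (affine_yh_x r n 1)"
  have x1: "affine_yh_x r n 1 \<in> carrier ?B"
    unfolding affine_yh_x_def affine_yh_def using n
    by (intro presented_gen_closed R) (auto simp: yh_gens_def)
  have c: "?c \<in> carrier ?B" by (rule cyclotomic_element_closed[OF B x1])
  let ?p = "\<lambda>p. relation_ideal ?F (affine_yh_relations r n) +>\<^bsub>?F\<^esub> p"
  have p: "?p \<in> algebra_hom ?F ?B" unfolding affine_yh_def by (rule presented_proj_hom[OF R])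
  have G: "free_gen ` yh_gens n \<subseteq> carrier ?F" by (auto intro: free_gen_closed)
  have gB: "generates ?B (?p ` free_gen ` yh_gens n)" unfolding affine_yh_def by (rule generates_presented[OF R])
  let ?J = "Idl\<^bsub>?B\<^esub> {?c}"
  define h where "h = (\<lambda>y. ?J +>\<^bsub>?B\<^esub> y) \<circ> ?p"
  note q = cyclotomic_quotient[OF B c assoc_algebra_free_algebra p G gB, folded h_def]
  have Q: "cyclotomic_yh r n d v = quotient_algebra ?B ?J" unfolding cyclotomic_yh_def ..
  interpret h: algebra_hom_pair ?F "cyclotomic_yh r n d v" h unfolding Q by (rule q(1))
  interpret g: algebra_hom_pair ?B "cyclotomic_yh r n d v" "\<lambda>y. ?J +>\<^bsub>?B\<^esub> y" unfolding Q by (rule q(2))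
  let ?t = "\<lambda>i. free_gen (YT i)" and ?f = "\<lambda>i. free_gen (YF i)" and ?x = "\<lambda>i. free_gen (YX i)"
  have cl: "?t i \<in> carrier ?F" "?x i \<in> carrier ?F" if "i \<in> {1..n}" for i
    using that by (auto intro!: free_gen_closed simp: yh_gens_def)
  have clf: "?f i \<in> carrier ?F" if "i \<in> {1..<n}" for i
    using that by (auto intro!: free_gen_closed simp: yh_gens_def)
  show ?thesis
  proof (rule units_of_yh_relations[OF h.B.assoc_algebra_axioms sep n r])
    show "h (?t i) \<in> carrier (cyclotomic_yh r n d v)" "h (?x i) \<in> carrier (cyclotomic_yh r n d v)" if "i \<in> {1..n}" for i
      using cl that by simp_all
    show "h (?f i) \<in> carrier (cyclotomic_yh r n d v)" if "i \<in> {1..<n}" for i using clf that by simp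
    show "a = b" if "(a, b) \<in> yh_relations (cyclotomic_yh r n d v) r n (\<lambda>i. h (?t i)) (\<lambda>i. h (?f i)) (\<lambda>i. h (?x i))" for a b
    proof (rule h.yh_relations_hom[OF cl(1) clf cl(2) _ that])
      fix a b assume "(a, b) \<in> yh_relations ?F r n ?t ?f ?x"
      then have "(a, b) \<in> affine_yh_relations r n" by (simp add: affine_yh_relations_def)
      from presented_relation[OF R this] show "h a = h b" by (simp add: h_def)
    qed
    have "h (?x 1) = ?J +>\<^bsub>?B\<^esub> affine_yh_x r n 1" by (simp add: h_def affine_yh_x_def presented_gen_def)
    then show "cyclotomic_element (cyclotomic_yh r n d v) d v (h (?x 1)) = \<zero>\<^bsub>cyclotomic_yh r n d v\<^esub>"
      using g.cyclotomic_element_hom[OF x1, of d v] q(4) by (simp add: Q)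
    have "h ` free_gen ` yh_gens n = (\<lambda>i. h (?t i)) ` {1..n} \<union> (\<lambda>i. h (?f i)) ` {1..<n} \<union> (\<lambda>i. h (?x i)) ` {1..n}"
      by (simp add: yh_gens_def image_Un image_image)
    then show "generates (cyclotomic_yh r n d v)
        ((\<lambda>i. h (?t i)) ` {1..n} \<union> (\<lambda>i. h (?f i)) ` {1..<n} \<union> (\<lambda>i. h (?x i)) ` {1..n})"
      using q(3) by (simp add: Q)
  qed
qed

text \<open>With every \<open>t i\<close> and \<open>e i\<close> equal to the unit, the relations
  involving \<open>t\<close> become trivial and the others are those of the Hecke algebra. This
  serves both directions: matrix units with \<open>r = 1\<close>, and modules of the Yokonuma-Hecke
  algebra made from Hecke modules.\<close>

lemma yh_relations_of_hecke:
  assumes A: "assoc_algebra A"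
    and s: "\<And>i. i \<in> {1..<m} \<Longrightarrow> s i \<in> carrier A" and x: "\<And>i. i \<in> {1..m} \<Longrightarrow> x i \<in> carrier A"
    and rel: "\<And>a b. (a, b) \<in> hecke_relations A m x s \<Longrightarrow> a = b"
    and e: "\<And>i. yh_e A r (\<lambda>_. \<one>\<^bsub>A\<^esub>) i = \<one>\<^bsub>A\<^esub>"
    and ab: "(a, b) \<in> yh_relations A r m (\<lambda>_. \<one>\<^bsub>A\<^esub>) s x"
  shows "a = b"
proof -
  interpret assoc_algebra A by (rule A)
  show ?thesis
    using ab unfolding yh_relations_def e
  proof (elim UnE CollectE exE conjE Pair_inject)
    fix i j assume *: "i \<in> {1..<m}" "j \<in> {1..<m}" "2 \<le> \<bar>int i - int j\<bar>" "a = s i \<otimes>\<^bsub>A\<^esub> s j" "b = s j \<otimes>\<^bsub>A\<^esub> s i"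
    then show ?thesis using rel[OF hecke_relations_intros(3)[of i m j A s x]] by simp
  next
    fix i assume *: "i \<in> {1..<m}" "i + 1 \<in> {1..<m}" "a = s i \<otimes>\<^bsub>A\<^esub> s (i + 1) \<otimes>\<^bsub>A\<^esub> s i" "b = s (i + 1) \<otimes>\<^bsub>A\<^esub> s i \<otimes>\<^bsub>A\<^esub> s (i + 1)"
    show ?thesis unfolding *(3,4) by (rule rel[OF hecke_relations_intros(2)[OF *(1,2)]])
  next
    fix i assume *: "i \<in> {1..<m}" "a = s i \<otimes>\<^bsub>A\<^esub> s i" "b = \<one>\<^bsub>A\<^esub>"
    show ?thesis unfolding *(2,3) by (rule rel[OF hecke_relations_intros(1)[OF *(1)]])
  next
    fix i j assume *: "i \<in> {1..m}" "j \<in> {1..m}" "a = x i \<otimes>\<^bsub>A\<^esub> x j" "b = x j \<otimes>\<^bsub>A\<^esub> x i"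
    show ?thesis unfolding *(3,4) by (rule rel[OF hecke_relations_intros(4)[OF *(1,2)]])
  next
    fix i assume *: "i \<in> {1..<m}" "a = s i \<otimes>\<^bsub>A\<^esub> x (i + 1)" "b = x i \<otimes>\<^bsub>A\<^esub> s i \<oplus>\<^bsub>A\<^esub> \<one>\<^bsub>A\<^esub>"
    show ?thesis unfolding *(2,3) by (rule rel[OF hecke_relations_intros(5)[OF *(1)]])
  next
    fix i j assume *: "i \<in> {1..<m}" "j \<in> {1..m}" "j \<noteq> i" "j \<noteq> i + 1" "a = s i \<otimes>\<^bsub>A\<^esub> x j" "b = x j \<otimes>\<^bsub>A\<^esub> s i"
    show ?thesis unfolding *(5,6) by (rule rel[OF hecke_relations_intros(6)[OF *(1-4)]])
  qed (use s x in simp_all)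
qed

lemma generates_mono:
  assumes "generates A G" "G \<subseteq> H"
  shows "generates A H"
  unfolding generates_def
proof (intro allI impI)
  fix S assume "S \<subseteq> carrier A" "\<one>\<^bsub>A\<^esub> \<in> S" "\<forall>a\<in>S. \<forall>b\<in>S. a \<oplus>\<^bsub>A\<^esub> b \<in> S" "\<forall>a\<in>S. \<forall>c. c \<odot>\<^bsub>A\<^esub> a \<in> S"
    "\<forall>g\<in>H. \<forall>a\<in>S. g \<otimes>\<^bsub>A\<^esub> a \<in> S"
  with assms show "S = carrier A" unfolding generates_def by (metis subsetD)
qed

theorem cyclotomic_hecke_units:
  fixes v :: "nat \<Rightarrow> 'k::alg_closed_field"
  assumes sep: "separated_parameters m d v"
  shows "has_matrix_units (cyclotomic_hecke d v m)"
proof (cases "m = 0")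
  case True
  let ?H = "cyclotomic_hecke d v m" and ?B = "affine_hecke m :: ('k, _) module"
  interpret H: assoc_algebra ?H by (rule assoc_algebra_cyclotomic_hecke)
  have B: "assoc_algebra ?B" by (rule assoc_algebra_affine_hecke)
  then interpret B: assoc_algebra ?B .
  \<comment> \<open>Without generators every element is a scalar multiple of the unit, which alone
    is a system of matrix units.\<close>
  have "generates ?B {}"
    using generates_presented[OF affine_hecke_relations_closed[of m, where ?'a = 'k]] True
    by (simp add: affine_hecke_def hecke_gens_def)
  then have "generates ?H {}"
    using generates_quotient[OF B B.genideal_ideal, of "{}" "{}"] True by (simp add: cyclotomic_hecke_def)
  then have "\<exists>c. a = c \<odot>\<^bsub>?H\<^esub> \<one>\<^bsub>?H\<^esub>" if "a \<in> carrier ?H" for a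
    using that
  proof (induction rule: generates_induct)
    case one then show ?case by (auto intro: exI[of _ 1] simp: H.smult_one)
  next
    case (add a b) then show ?case by (metis H.smult_l_distr H.one_closed H.a_closed)
  next
    case (scale a c) then show ?case by (metis H.smult_assoc H.one_closed H.smult_closed)
  qed simp
  then have "carrier ?H \<subseteq> alg_span ?H {\<one>\<^bsub>?H\<^esub>}"
    using alg_span.alg_span_step[OF singletonI alg_span.alg_span_zero] H.smult_closed[OF H.one_closed]
    by (metis H.r_zero subsetI)
  then show ?thesis unfolding has_matrix_units_def
    by (intro exI[of _ "1::nat"] exI[of _ "\<lambda>_. 0::nat"] exI[of _ "\<lambda>_ _. \<one>\<^bsub>?H\<^esub>"]) simp
next
  case False
  let ?F = "free_algebra (hecke_gens m) :: ('k, _) module" and ?B = "affine_hecke m :: ('k, _) module"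
  note R = affine_hecke_relations_closed[of m, where ?'a = 'k]
  have B: "assoc_algebra ?B" by (rule assoc_algebra_affine_hecke)
  let ?c = "cyclotomic_element ?B d v (affine_hecke_x m 1)"
  have x1: "affine_hecke_x m 1 \<in> carrier ?B"
    unfolding affine_hecke_x_def affine_hecke_def using False
    by (intro presented_gen_closed R) (auto simp: hecke_gens_def)
  have c: "?c \<in> carrier ?B" by (rule cyclotomic_element_closed[OF B x1])
  let ?p = "\<lambda>p. relation_ideal ?F (affine_hecke_relations m) +>\<^bsub>?F\<^esub> p"
  have p: "?p \<in> algebra_hom ?F ?B" unfolding affine_hecke_def by (rule presented_proj_hom[OF R])
  have G: "free_gen ` hecke_gens m \<subseteq> carrier ?F" by (auto intro: free_gen_closed)
  have gB: "generates ?B (?p ` free_gen ` hecke_gens m)" unfolding affine_hecke_def by (rule generates_presented[OF R])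
  let ?J = "Idl\<^bsub>?B\<^esub> {?c}" and ?H = "cyclotomic_hecke d v m"
  define h where "h = (\<lambda>y. ?J +>\<^bsub>?B\<^esub> y) \<circ> ?p"
  note q = cyclotomic_quotient[OF B c assoc_algebra_free_algebra p G gB, folded h_def]
  have Q: "?H = quotient_algebra ?B ?J" using False by (simp add: cyclotomic_hecke_def)
  interpret h: algebra_hom_pair ?F ?H h unfolding Q by (rule q(1))
  interpret g: algebra_hom_pair ?B ?H "\<lambda>y. ?J +>\<^bsub>?B\<^esub> y" unfolding Q by (rule q(2))
  let ?s = "\<lambda>i. free_gen (HS i)" and ?x = "\<lambda>i. free_gen (HX i)"
  have cl: "?x i \<in> carrier ?F" if "i \<in> {1..m}" for i
    using that by (auto intro!: free_gen_closed simp: hecke_gens_def)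
  have cls: "?s i \<in> carrier ?F" if "i \<in> {1..<m}" for i
    using that by (auto intro!: free_gen_closed simp: hecke_gens_def)
  have rel: "a = b" if "(a, b) \<in> hecke_relations ?H m (\<lambda>i. h (?x i)) (\<lambda>i. h (?s i))" for a b
  proof (rule h.hecke_relations_hom[OF cls cl _ that])
    fix a b assume "(a, b) \<in> hecke_relations ?F m ?x ?s"
    then have "(a, b) \<in> affine_hecke_relations m" by (simp add: affine_hecke_relations_def)
    from presented_relation[OF R this] show "h a = h b" by (simp add: h_def)
  qed
  have m: "1 \<le> m" using False by simp
  have r1: "\<not> CHAR('k) dvd 1" by simp
  show ?thesis
  \<comment> \<open>The case \<open>r = 1\<close>: each \<open>t i\<close> is the unit, and the
    average defining \<open>e i\<close> has a single term.\<close>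
  proof (rule units_of_yh_relations[OF h.B.assoc_algebra_axioms sep m order_refl r1])
    show "\<one>\<^bsub>?H\<^esub> \<in> carrier ?H" by simp
    show hx: "h (?x i) \<in> carrier ?H" if "i \<in> {1..m}" for i using cl that by simp
    show hs: "h (?s i) \<in> carrier ?H" if "i \<in> {1..<m}" for i using cls that by simp
    show "a = b" if "(a, b) \<in> yh_relations ?H 1 m (\<lambda>_. \<one>\<^bsub>?H\<^esub>) (\<lambda>i. h (?s i)) (\<lambda>i. h (?x i))" for a b
    proof (rule yh_relations_of_hecke[OF h.B.assoc_algebra_axioms hs hx rel _ that])
      show "yh_e ?H 1 (\<lambda>_. \<one>\<^bsub>?H\<^esub>) i = \<one>\<^bsub>?H\<^esub>" for i
        by (simp add: yh_e_def lessThan_Suc h.B.smult_one)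
    qed
    have "h (?x 1) = ?J +>\<^bsub>?B\<^esub> affine_hecke_x m 1" by (simp add: h_def affine_hecke_x_def presented_gen_def)
    then show "cyclotomic_element ?H d v (h (?x 1)) = \<zero>\<^bsub>?H\<^esub>"
      using g.cyclotomic_element_hom[OF x1, of d v] q(4) by (simp add: Q)
    have "h ` free_gen ` hecke_gens m = (\<lambda>i. h (?s i)) ` {1..<m} \<union> (\<lambda>i. h (?x i)) ` {1..m}"
      by (simp add: hecke_gens_def image_Un image_image Un_commute)
    then have "generates ?H ((\<lambda>i. h (?s i)) ` {1..<m} \<union> (\<lambda>i. h (?x i)) ` {1..m})"
      using q(3) by (simp add: Q)
    then show "generates ?H ((\<lambda>_. \<one>\<^bsub>?H\<^esub>) ` {1..m} \<union> (\<lambda>i. h (?s i)) ` {1..<m} \<union> (\<lambda>i. h (?x i)) ` {1..m})"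
      by (rule generates_mono) blast
  qed
qed

section \<open>Matrix units of tensor products\<close>

context assoc_algebra
begin

lemma smult_zero_left: "a \<in> carrier A \<Longrightarrow> 0 \<odot> a = \<zero>"
proof -
  assume a: "a \<in> carrier A"
  have "0 \<odot> a \<oplus> 0 \<odot> a = 0 \<odot> a" using smult_l_distr[OF a, of 0 0] by simp
  then show ?thesis using smult_closed[OF a, of 0] by (simp add: add.l_cancel_one)
qed

lemma smult_zero_right: "c \<odot> \<zero> = \<zero>"
  using smult_zero_left[of \<zero>] smult_assoc[of \<zero> c 0] by simp

lemma alg_span_closed: "a \<in> alg_span A G \<Longrightarrow> G \<subseteq> carrier A \<Longrightarrow> a \<in> carrier A"
  by (induction rule: alg_span.induct) (auto intro: smult_closed)

lemma alg_span_add: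
  assumes "a \<in> alg_span A G" "b \<in> alg_span A G" "G \<subseteq> carrier A"
  shows "a \<oplus> b \<in> alg_span A G"
  using assms(1)
proof (induction rule: alg_span.induct)
  case alg_span_zero then show ?case using assms alg_span_closed by simp
next
  case (alg_span_step g p c)
  have "c \<odot> g \<oplus> p \<oplus> b = c \<odot> g \<oplus> (p \<oplus> b)"
    using alg_span_step assms alg_span_closed by (intro a_assoc smult_closed) auto
  then show ?case using alg_span.alg_span_step[OF alg_span_step(1,3)] by simp
qed

lemma alg_span_smult:
  assumes "a \<in> alg_span A G" "G \<subseteq> carrier A"
  shows "k \<odot> a \<in> alg_span A G"
  using assms(1)
proof (induction rule: alg_span.induct)
  case alg_span_zero then show ?case by (simp add: smult_zero_right alg_span.alg_span_zero)
next
  case (alg_span_step g p c)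
  then have "g \<in> carrier A" "p \<in> carrier A" using assms(2) alg_span_closed by auto
  then have "k \<odot> (c \<odot> g \<oplus> p) = (k * c) \<odot> g \<oplus> k \<odot> p"
    by (simp add: smult_r_distr smult_closed smult_assoc)
  then show ?case using alg_span.alg_span_step[OF alg_span_step(1,3)] by simp
qed

end

locale tensor_factors =
  fixes I :: "'i set" and A :: "'i \<Rightarrow> ('k::field, 'a) module"
  assumes factor: "i \<in> I \<Longrightarrow> assoc_algebra (A i)"
begin

abbreviation tuples :: "('i \<Rightarrow> 'a) set" where "tuples \<equiv> \<Pi>\<^sub>E i\<in>I. carrier (A i)"

abbreviation M :: "('k, ('i \<Rightarrow> 'a) \<Rightarrow>\<^sub>0 'k) module" where "M \<equiv> monoid_algebra (product_group I A)"

definition J :: "(('i \<Rightarrow> 'a) \<Rightarrow>\<^sub>0 'k) set" where "J = relation_ideal M (multilinear_relations I A)"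

abbreviation Q :: "('k, (('i \<Rightarrow> 'a) \<Rightarrow>\<^sub>0 'k) set) module" where "Q \<equiv> tensor_algebra I A"

definition pure :: "('i \<Rightarrow> 'a) \<Rightarrow> (('i \<Rightarrow> 'a) \<Rightarrow>\<^sub>0 'k) set" where
  "pure u = J +>\<^bsub>M\<^esub> Poly_Mapping.single u 1"

lemma M: "assoc_algebra M"
  using factor by (intro assoc_algebra_monoid_algebra monoid_product_group) (simp add: assoc_algebra_def ring_def)

lemma tuple_upd: "u \<in> tuples \<Longrightarrow> i \<in> I \<Longrightarrow> a \<in> carrier (A i) \<Longrightarrow> u(i := a) \<in> tuples"
  by (auto simp: PiE_iff extensional_def)

lemma single_closed: "u \<in> tuples \<Longrightarrow> Poly_Mapping.single u c \<in> carrier M"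
  by (cases "c = 0") auto

lemma relations_closed: "multilinear_relations I A \<subseteq> carrier M \<times> carrier M"
proof
  fix y assume "y \<in> multilinear_relations I A"
  then consider u i a b where "y = (Poly_Mapping.single (u(i := a \<oplus>\<^bsub>A i\<^esub> b)) 1,
      Poly_Mapping.single (u(i := a)) 1 + Poly_Mapping.single (u(i := b)) 1)"
      "u \<in> tuples" "i \<in> I" "a \<in> carrier (A i)" "b \<in> carrier (A i)"
    | u i a c where "y = (Poly_Mapping.single (u(i := c \<odot>\<^bsub>A i\<^esub> a)) 1, Poly_Mapping.single (u(i := a)) c)"
      "u \<in> tuples" "i \<in> I" "a \<in> carrier (A i)"
    unfolding multilinear_relations_def by blast
  then show "y \<in> carrier M \<times> carrier M"
  proof cases
    case 1
    interpret Ai: assoc_algebra "A i" by (rule factor[OF 1(3)])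
    interpret M: assoc_algebra M by (rule M)
    have "Poly_Mapping.single (u(i := a)) 1 \<oplus>\<^bsub>M\<^esub> Poly_Mapping.single (u(i := b)) 1 \<in> carrier M"
      using 1 by (intro M.a_closed single_closed tuple_upd)
    moreover have "Poly_Mapping.single (u(i := a \<oplus>\<^bsub>A i\<^esub> b)) 1 \<in> carrier M"
      using 1 by (intro single_closed tuple_upd) auto
    ultimately show ?thesis using 1(1) by simp
  next
    case 2
    interpret Ai: assoc_algebra "A i" by (rule factor[OF 2(3)])
    have "Poly_Mapping.single (u(i := c \<odot>\<^bsub>A i\<^esub> a)) 1 \<in> carrier M" "Poly_Mapping.single (u(i := a)) c \<in> carrier M"
      using 2 by (auto intro!: single_closed tuple_upd Ai.smult_closed simp del: monoid_algebra_simps)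
    then show ?thesis using 2(1) by simp
  qed
qed

lemma J: "ideal J M"
  unfolding J_def by (intro ideal_relation_ideal M relations_closed)

lemma Q_def: "Q = quotient_algebra M J"
  by (simp add: tensor_algebra_def J_def)

lemma Q: "assoc_algebra Q"
  using factor by (rule assoc_algebra_tensor_algebra)

lemmas ops = quotient_ops[OF M J, folded Q_def]

lemma pure_closed: "u \<in> tuples \<Longrightarrow> pure u \<in> carrier Q"
  unfolding Q_def quotient_carrier[OF M J] pure_def by (intro imageI single_closed)

lemma relation:
  assumes "(a, b) \<in> multilinear_relations I A"
  shows "J +>\<^bsub>M\<^esub> a = J +>\<^bsub>M\<^esub> b"
proof -
  interpret M: assoc_algebra M by (rule M)
  have c: "a \<in> carrier M" "b \<in> carrier M" using relations_closed assms by (blast, blast)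
  have "(\<lambda>(a, b). a \<ominus>\<^bsub>M\<^esub> b) ` multilinear_relations I A \<subseteq> carrier M"
  proof clarify
    fix a b assume "(a, b) \<in> multilinear_relations I A"
    then show "a \<ominus>\<^bsub>M\<^esub> b \<in> carrier M" using relations_closed by (intro M.minus_closed) blast+
  qed
  from M.genideal_self[OF this] have "a \<ominus>\<^bsub>M\<^esub> b \<in> J" unfolding J_def relation_ideal_def using assms by force
  then show ?thesis using quotient_eq[OF M J c] by simp
qed

lemma pure_add:
  assumes "u \<in> tuples" "i \<in> I" "a \<in> carrier (A i)" "b \<in> carrier (A i)"
  shows "pure (u(i := a \<oplus>\<^bsub>A i\<^esub> b)) = pure (u(i := a)) \<oplus>\<^bsub>Q\<^esub> pure (u(i := b))"
proof -
  have "pure (u(i := a \<oplus>\<^bsub>A i\<^esub> b)) =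
      J +>\<^bsub>M\<^esub> (Poly_Mapping.single (u(i := a)) 1 + Poly_Mapping.single (u(i := b)) 1)"
    unfolding pure_def by (rule relation, unfold multilinear_relations_def, rule UnI1) (use assms in blast)
  also have "\<dots> = pure (u(i := a)) \<oplus>\<^bsub>Q\<^esub> pure (u(i := b))"
    unfolding pure_def using ops(2)[OF single_closed single_closed] tuple_upd[OF assms(1,2)] assms(3,4)
    by (simp del: monoid_algebra_simps(1))
  finally show ?thesis .
qed

lemma smult_single: "u \<in> tuples \<Longrightarrow> J +>\<^bsub>M\<^esub> Poly_Mapping.single u c = c \<odot>\<^bsub>Q\<^esub> pure u"
  unfolding pure_def using ops(3)[OF single_closed[of u 1] single_closed[of u 1], of c] by (simp del: monoid_algebra_simps(1))

lemma pure_smult: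
  assumes "u \<in> tuples" "i \<in> I" "a \<in> carrier (A i)"
  shows "pure (u(i := c \<odot>\<^bsub>A i\<^esub> a)) = c \<odot>\<^bsub>Q\<^esub> pure (u(i := a))"
proof -
  have "pure (u(i := c \<odot>\<^bsub>A i\<^esub> a)) = J +>\<^bsub>M\<^esub> Poly_Mapping.single (u(i := a)) c"
    unfolding pure_def by (rule relation, unfold multilinear_relations_def, rule UnI2) (use assms in blast)
  then show ?thesis using smult_single[OF tuple_upd[OF assms]] by simp
qed

lemma pure_zero:
  assumes "u \<in> tuples" "i \<in> I" "u i = \<zero>\<^bsub>A i\<^esub>"
  shows "pure u = \<zero>\<^bsub>Q\<^esub>"
proof -
  interpret Q: assoc_algebra Q by (rule Q)
  interpret Ai: assoc_algebra "A i" by (rule factor[OF assms(2)])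
  have "pure (u(i := 0 \<odot>\<^bsub>A i\<^esub> \<zero>\<^bsub>A i\<^esub>)) = 0 \<odot>\<^bsub>Q\<^esub> pure (u(i := \<zero>\<^bsub>A i\<^esub>))"
    using assms by (intro pure_smult) auto
  then show ?thesis using assms pure_closed[OF assms(1)]
    by (simp add: Ai.smult_zero_left Q.smult_zero_left fun_upd_idem)
qed

lemma pure_mult:
  assumes "u \<in> tuples" "w \<in> tuples"
  shows "pure u \<otimes>\<^bsub>Q\<^esub> pure w = pure (\<lambda>i\<in>I. u i \<otimes>\<^bsub>A i\<^esub> w i)"
  unfolding pure_def using ops(1)[OF single_closed[OF assms(1), of 1] single_closed[OF assms(2), of 1]]
  by (simp add: product_group_def)

text \<open>Multilinearity expands one slot of a pure tensor after another over the given spanning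
  sets.\<close>

lemma pure_span:
  assumes I: "finite I" and G: "G \<subseteq> carrier Q"
    and B: "\<And>i. i \<in> I \<Longrightarrow> B i \<subseteq> carrier (A i)" "\<And>i. i \<in> I \<Longrightarrow> carrier (A i) \<subseteq> alg_span (A i) (B i)"
    and base: "\<And>u. u \<in> tuples \<Longrightarrow> (\<And>i. i \<in> I \<Longrightarrow> u i \<in> B i) \<Longrightarrow> pure u \<in> G"
  shows "carrier Q \<subseteq> alg_span Q G"
proof -
  interpret Q: assoc_algebra Q by (rule Q)
  have base': "g \<in> alg_span Q G" if "g \<in> G" for g
    using alg_span.alg_span_step[OF that alg_span.alg_span_zero, where A = Q and c = 1] subsetD[OF G that] Q.smult_one
    by simp
  \<comment> \<open>\<open>K\<close> is the set of slots that may still hold arbitrary elements; the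
    induction empties it.\<close>
  have tuple: "pure u \<in> alg_span Q G"
    if "finite K" "K \<subseteq> I" "u \<in> tuples" "\<And>i. i \<in> I - K \<Longrightarrow> u i \<in> B i" for K u
    using that
  proof (induction K arbitrary: u rule: finite_induct)
    case empty
    then show ?case using base[of u] base' by simp
  next
    case (insert k K)
    then have k: "k \<in> I" by simp
    interpret Ak: assoc_algebra "A k" by (rule factor[OF k])
    have upd: "pure (u(k := a)) \<in> alg_span Q G" if "a \<in> alg_span (A k) (B k)" for a
      using that
    proof (induction rule: alg_span.induct)
      case alg_span_zero
      have "pure (u(k := \<zero>\<^bsub>A k\<^esub>)) = \<zero>\<^bsub>Q\<^esub>"
        using k insert.prems(2) by (intro pure_zero[of _ k] tuple_upd) auto
      show ?case unfolding \<open>pure _ = _\<close> by (rule alg_span.alg_span_zero)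
    next
      case (alg_span_step g p c)
      then have cl: "g \<in> carrier (A k)" "p \<in> carrier (A k)"
        using B(1)[OF k] Ak.alg_span_closed by auto
      have "pure (u(k := g)) \<in> alg_span Q G"
        using insert.prems alg_span_step(1) cl k by (intro insert.IH tuple_upd) auto
      moreover have "pure (u(k := c \<odot>\<^bsub>A k\<^esub> g \<oplus>\<^bsub>A k\<^esub> p)) = c \<odot>\<^bsub>Q\<^esub> pure (u(k := g)) \<oplus>\<^bsub>Q\<^esub> pure (u(k := p))"
        using insert.prems(2) k cl by (simp add: pure_add pure_smult Ak.smult_closed)
      ultimately show ?case
        using Q.alg_span_add[OF Q.alg_span_smult[OF _ G] alg_span_step(3) G] by (simp only:)
    qed
    have "u k \<in> carrier (A k)" using insert.prems(2) k by auto
    then have "pure (u(k := u k)) \<in> alg_span Q G" using B(2)[OF k] by (intro upd) auto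
    then show ?case by simp
  qed
  show ?thesis
  proof
    fix y assume "y \<in> carrier Q"
    then obtain p where p: "p \<in> carrier M" "y = J +>\<^bsub>M\<^esub> p"
      unfolding Q_def quotient_carrier[OF M J] by blast
    have keys: "Poly_Mapping.keys p \<subseteq> tuples" using p(1) by (simp add: product_group_def)
    have "p \<in> carrier M \<and> J +>\<^bsub>M\<^esub> p \<in> alg_span Q G"
    proof (induction p rule: poly_mapping_single_induct)
      case zero
      interpret M: assoc_algebra M by (rule M)
      have "J +>\<^bsub>M\<^esub> \<zero>\<^bsub>M\<^esub> = \<zero>\<^bsub>Q\<^esub>" using ops(5)[OF M.zero_closed M.zero_closed] by simp
      then show ?case using M.zero_closed alg_span.alg_span_zero[of Q G] by simp
    next
      case (plus u c p')
      interpret M: assoc_algebra M by (rule M)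
      have u: "u \<in> tuples" by (rule subsetD[OF keys plus(1)])
      have cl: "Poly_Mapping.single u c \<in> carrier M" by (rule single_closed[OF u])
      have "pure u \<in> alg_span Q G" by (rule tuple[OF I subset_refl u]) simp
      then have "J +>\<^bsub>M\<^esub> Poly_Mapping.single u c \<in> alg_span Q G"
        unfolding smult_single[OF u] by (rule Q.alg_span_smult[OF _ G])
      from Q.alg_span_add[OF this conjunct2[OF plus(2)] G]
      have "J +>\<^bsub>M\<^esub> (Poly_Mapping.single u c \<oplus>\<^bsub>M\<^esub> p') \<in> alg_span Q G"
        by (simp only: ops(2)[OF cl conjunct1[OF plus(2)]])
      moreover have "Poly_Mapping.single u c \<oplus>\<^bsub>M\<^esub> p' \<in> carrier M"
        by (rule M.a_closed[OF cl conjunct1[OF plus(2)]])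
      ultimately show ?case by (simp del: monoid_algebra_simps(1))
    qed
    then show "y \<in> alg_span Q G" using p by simp
  qed
qed

text \<open>The units are pure tensors of units of the factors, indexed by tuples, and a block is a
  tuple of blocks. One pair of different indices puts a zero into a slot, which kills the whole
  tensor.\<close>

lemma tensor_units:
  assumes I: "finite I" and units: "\<And>i. i \<in> I \<Longrightarrow> has_matrix_units (A i)"
  shows "has_matrix_units Q"
proof -
  have "\<exists>(N::nat) (\<beta> :: nat \<Rightarrow> nat) E.
    (\<forall>s<N. \<forall>t<N. \<beta> s = \<beta> t \<longrightarrow> E s t \<in> carrier (A i)) \<and>
    (\<forall>s<N. \<forall>t<N. \<forall>t'<N. \<forall>u<N. \<beta> s = \<beta> t \<longrightarrow> \<beta> t' = \<beta> u \<longrightarrow>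
      E s t \<otimes>\<^bsub>A i\<^esub> E t' u = (if t = t' then E s u else \<zero>\<^bsub>A i\<^esub>)) \<and>
    carrier (A i) \<subseteq> alg_span (A i) {E s t | s t. s < N \<and> t < N \<and> \<beta> s = \<beta> t}" (is "\<exists>N \<beta> E. ?P i N \<beta> E")
    if "i \<in> I" for i using units[OF that] unfolding has_matrix_units_def .
  note ex = this
  have "\<forall>i. \<exists>N \<beta> E. i \<in> I \<longrightarrow> ?P i N \<beta> E"
  proof
    fix i show "\<exists>N \<beta> E. i \<in> I \<longrightarrow> ?P i N \<beta> E"
    proof (cases "i \<in> I")
      case True
      from ex[OF this] show ?thesis by (elim exE) (intro exI impI, assumption)
    qed simp
  qed
  from choice[OF this] obtain N where "\<forall>i. \<exists>\<beta> E. i \<in> I \<longrightarrow> ?P i (N i) \<beta> E" by (elim exE)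
  from choice[OF this] obtain \<beta> where "\<forall>i. \<exists>E. i \<in> I \<longrightarrow> ?P i (N i) (\<beta> i) E" by (elim exE)
  from choice[OF this] obtain E where P: "\<forall>i. i \<in> I \<longrightarrow> ?P i (N i) (\<beta> i) (E i)" by (elim exE)
  have EC: "E i s t \<in> carrier (A i)" if "i \<in> I" "s < N i" "t < N i" "\<beta> i s = \<beta> i t" for i s t
    using P[rule_format, OF that(1), THEN conjunct1, rule_format, OF that(2-4)] .
  have EE: "E i s t \<otimes>\<^bsub>A i\<^esub> E i t' u = (if t = t' then E i s u else \<zero>\<^bsub>A i\<^esub>)"
    if "i \<in> I" "s < N i" "t < N i" "t' < N i" "u < N i" "\<beta> i s = \<beta> i t" "\<beta> i t' = \<beta> i u" for i s t t' u
    using P[rule_format, OF that(1), THEN conjunct2, THEN conjunct1, rule_format, OF that(2-7)] .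
  have Esp: "carrier (A i) \<subseteq> alg_span (A i) {E i s t | s t. s < N i \<and> t < N i \<and> \<beta> i s = \<beta> i t}" if "i \<in> I" for i
    using P[rule_format, OF that, THEN conjunct2, THEN conjunct2] .
  define T where "T = (\<Pi>\<^sub>E i\<in>I. {..<N i})"
  define B where "B \<tau> = (\<lambda>i\<in>I. \<beta> i (\<tau> i))" for \<tau>
  define w where "w \<sigma> \<tau> = (\<lambda>i\<in>I. E i (\<sigma> i) (\<tau> i))" for \<sigma> \<tau>
  have T: "\<tau> i < N i" if "\<tau> \<in> T" "i \<in> I" for \<tau> i using that by (auto simp: T_def)
  have B: "\<beta> i (\<sigma> i) = \<beta> i (\<tau> i)" if "B \<sigma> = B \<tau>" "i \<in> I" for \<sigma> \<tau> i
    using fun_cong[OF that(1), of i] that(2) by (simp add: B_def)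
  have w: "w \<sigma> \<tau> \<in> tuples" if "\<sigma> \<in> T" "\<tau> \<in> T" "B \<sigma> = B \<tau>" for \<sigma> \<tau>
    using EC T[OF that(1)] T[OF that(2)] B[OF that(3)] by (auto simp: w_def)
  show ?thesis
  proof (rule has_matrix_unitsI[of T B "\<lambda>\<sigma> \<tau>. pure (w \<sigma> \<tau>)"])
    show "finite T" unfolding T_def using I by (intro finite_PiE) auto
    show "pure (w \<sigma> \<tau>) \<in> carrier Q" if "\<sigma> \<in> T" "\<tau> \<in> T" "B \<sigma> = B \<tau>" for \<sigma> \<tau>
      by (rule pure_closed[OF w[OF that]])
    show "pure (w \<sigma> \<tau>) \<otimes>\<^bsub>Q\<^esub> pure (w \<tau>' \<upsilon>) = (if \<tau> = \<tau>' then pure (w \<sigma> \<upsilon>) else \<zero>\<^bsub>Q\<^esub>)"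
      if t: "\<sigma> \<in> T" "\<tau> \<in> T" "\<tau>' \<in> T" "\<upsilon> \<in> T" "B \<sigma> = B \<tau>" "B \<tau>' = B \<upsilon>" for \<sigma> \<tau> \<tau>' \<upsilon>
    proof -
      let ?u = "\<lambda>i\<in>I. w \<sigma> \<tau> i \<otimes>\<^bsub>A i\<^esub> w \<tau>' \<upsilon> i"
      have u: "?u i = (if \<tau> i = \<tau>' i then E i (\<sigma> i) (\<upsilon> i) else \<zero>\<^bsub>A i\<^esub>)" if "i \<in> I" for i
        using EE[OF that T[OF t(1) that] T[OF t(2) that] T[OF t(3) that] T[OF t(4) that] B[OF t(5) that] B[OF t(6) that]] that
        by (simp add: w_def)
      have prod: "pure (w \<sigma> \<tau>) \<otimes>\<^bsub>Q\<^esub> pure (w \<tau>' \<upsilon>) = pure ?u"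
        by (rule pure_mult[OF w[OF t(1,2,5)] w[OF t(3,4,6)]])
      show ?thesis
      proof (cases "\<tau> = \<tau>'")
        case True
        have "?u = w \<sigma> \<upsilon>" using u True by (auto simp: w_def fun_eq_iff)
        then show ?thesis using prod True by simp
      next
        case False
        then obtain i where i: "i \<in> I" "\<tau> i \<noteq> \<tau>' i"
          using t(2,3) unfolding T_def by (metis PiE_ext)
        have "?u \<in> tuples"
        proof
          fix i assume i: "i \<in> I"
          interpret Ai: assoc_algebra "A i" by (rule factor[OF i])
          show "?u i \<in> carrier (A i)" using w[OF t(1,2,5)] w[OF t(3,4,6)] i by (auto intro!: Ai.m_closed)
        qed simp
        then have "pure ?u = \<zero>\<^bsub>Q\<^esub>" using u[OF i(1)] i by (intro pure_zero[of _ i]) auto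
        then show ?thesis using prod False by simp
      qed
    qed
    show "carrier Q \<subseteq> alg_span Q {pure (w \<sigma> \<tau>) | \<sigma> \<tau>. \<sigma> \<in> T \<and> \<tau> \<in> T \<and> B \<sigma> = B \<tau>}" (is "_ \<subseteq> alg_span Q ?G")
    proof (rule pure_span[OF I, where B = "\<lambda>i. {E i s t | s t. s < N i \<and> t < N i \<and> \<beta> i s = \<beta> i t}"])
      show "?G \<subseteq> carrier Q" using pure_closed[OF w] by blast
      show "{E i s t | s t. s < N i \<and> t < N i \<and> \<beta> i s = \<beta> i t} \<subseteq> carrier (A i)" if "i \<in> I" for i
        using EC[OF that] by blast
      show "carrier (A i) \<subseteq> alg_span (A i) {E i s t | s t. s < N i \<and> t < N i \<and> \<beta> i s = \<beta> i t}" if "i \<in> I" for i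
        by (rule Esp[OF that])
      fix u assume u: "u \<in> tuples" "\<And>i. i \<in> I \<Longrightarrow> u i \<in> {E i s t | s t. s < N i \<and> t < N i \<and> \<beta> i s = \<beta> i t}"
      then have "\<forall>i. \<exists>s t. i \<in> I \<longrightarrow> u i = E i s t \<and> s < N i \<and> t < N i \<and> \<beta> i s = \<beta> i t" by blast
      from choice[OF this] obtain \<sigma> where "\<forall>i. \<exists>t. i \<in> I \<longrightarrow> u i = E i (\<sigma> i) t \<and> \<sigma> i < N i \<and> t < N i \<and> \<beta> i (\<sigma> i) = \<beta> i t"
        by (elim exE)
      from choice[OF this] obtain \<tau> where st: "\<forall>i. i \<in> I \<longrightarrow> u i = E i (\<sigma> i) (\<tau> i) \<and> \<sigma> i < N i \<and> \<tau> i < N i \<and> \<beta> i (\<sigma> i) = \<beta> i (\<tau> i)"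
        by (elim exE)
      let ?\<sigma> = "restrict \<sigma> I" and ?\<tau> = "restrict \<tau> I"
      have "u = w ?\<sigma> ?\<tau>"
        using u(1) st by (intro extensionalityI[of _ I]) (auto simp: w_def PiE_def)
      moreover have "?\<sigma> \<in> T" "?\<tau> \<in> T" "B ?\<sigma> = B ?\<tau>" using st by (auto simp: T_def B_def fun_eq_iff)
      ultimately show "pure u \<in> ?G" by blast
    qed
  qed
qed

end

theorem cyclotomic_hecke_tensor_units:
  fixes v :: "nat \<Rightarrow> 'k::alg_closed_field"
  assumes "\<And>m. m \<in> set \<mu> \<Longrightarrow> separated_parameters m d v"
  shows "has_matrix_units (cyclotomic_hecke_tensor d v \<mu>)"
proof -
  interpret tensor_factors "{..<length \<mu>}" "\<lambda>a. cyclotomic_hecke d v (\<mu> ! a)"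
    by (intro tensor_factors.intro assoc_algebra_cyclotomic_hecke)
  show ?thesis unfolding cyclotomic_hecke_tensor_def
    using assms by (intro tensor_units cyclotomic_hecke_units) auto
qed

section \<open>Representations\<close>

lemma quotient_hom_exists:
  assumes A: "assoc_algebra A" and B: "assoc_algebra B" and h: "h \<in> algebra_hom A B"
    and G: "G \<subseteq> carrier A" "\<And>g. g \<in> G \<Longrightarrow> h g = \<zero>\<^bsub>B\<^esub>"
  defines "I \<equiv> Idl\<^bsub>A\<^esub> G"
  obtains h' where "h' \<in> algebra_hom (quotient_algebra A I) B" "\<And>a. a \<in> carrier A \<Longrightarrow> h' (I +>\<^bsub>A\<^esub> a) = h a"
proof -
  interpret algebra_hom_pair A B h using A B h by (simp add: algebra_hom_pair_def algebra_hom_pair_axioms_def)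
  have I: "ideal I A" unfolding I_def by (rule A.genideal_ideal[OF G(1)])
  have "ring_hom_ring A B h" by (rule ring_hom_ringI2) (use h A.ring_axioms B.ring_axioms in \<open>auto simp: algebra_hom_def\<close>)
  then have "ideal (a_kernel A B h) A" by (rule ring_hom_ring.kernel_is_ideal)
  moreover have "G \<subseteq> a_kernel A B h" using G by (auto simp: a_kernel_def')
  ultimately have ker: "I \<subseteq> a_kernel A B h" unfolding I_def by (rule A.genideal_minimal)
  define h' where "h' C = h (SOME a. a \<in> carrier A \<and> C = I +>\<^bsub>A\<^esub> a)" for C
  have h': "h' (I +>\<^bsub>A\<^esub> a) = h a" if a: "a \<in> carrier A" for a
  proof -
    define b where "b = (SOME b. b \<in> carrier A \<and> I +>\<^bsub>A\<^esub> a = I +>\<^bsub>A\<^esub> b)"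
    have b: "b \<in> carrier A \<and> I +>\<^bsub>A\<^esub> a = I +>\<^bsub>A\<^esub> b"
      unfolding b_def by (rule someI[of _ a]) (use a in simp)
    then have "a \<ominus>\<^bsub>A\<^esub> b \<in> I" using quotient_eq[OF A I a, of b] by simp
    then have "h (a \<ominus>\<^bsub>A\<^esub> b) = \<zero>\<^bsub>B\<^esub>" using ker by (auto simp: a_kernel_def')
    then have "h a = h b" using a b by simp
    then show ?thesis by (simp add: h'_def b_def)
  qed
  note ops = quotient_ops[OF A I]
  have "h' \<in> algebra_hom (quotient_algebra A I) B"
    unfolding algebra_hom_def
  proof (intro CollectI conjI allI ballI ring_hom_memI)
    fix C D c assume "C \<in> carrier (quotient_algebra A I)"
    then obtain a where a: "a \<in> carrier A" "C = I +>\<^bsub>A\<^esub> a" unfolding quotient_carrier[OF A I] by blast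
    show "h' C \<in> carrier B" using a by (simp add: h')
    show "h' (c \<odot>\<^bsub>quotient_algebra A I\<^esub> C) = c \<odot>\<^bsub>B\<^esub> h' C"
      using a by (simp add: ops(3)[OF a(1) a(1)] h' A.smult_closed)
    assume "D \<in> carrier (quotient_algebra A I)"
    then obtain b where b: "b \<in> carrier A" "D = I +>\<^bsub>A\<^esub> b" unfolding quotient_carrier[OF A I] by blast
    show "h' (C \<otimes>\<^bsub>quotient_algebra A I\<^esub> D) = h' C \<otimes>\<^bsub>B\<^esub> h' D"
      "h' (C \<oplus>\<^bsub>quotient_algebra A I\<^esub> D) = h' C \<oplus>\<^bsub>B\<^esub> h' D"
      using a b by (simp_all add: ops(1,2)[OF a(1) b(1)] h')
  next
    show "h' \<one>\<^bsub>quotient_algebra A I\<^esub> = \<one>\<^bsub>B\<^esub>"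
      by (simp add: ops(4)[OF A.one_closed A.one_closed] h')
  qed
  then show ?thesis using h' that by blast
qed

locale linear_operators = V: Vector_Spaces.vector_space sc
  for sc :: "'k::field \<Rightarrow> 'v::ab_group_add \<Rightarrow> 'v"  (infixr "*s" 75)
begin

definition lin_op :: "('v \<Rightarrow> 'v) \<Rightarrow> bool" where
  "lin_op F \<longleftrightarrow> (\<forall>u w. F (u + w) = F u + F w) \<and> (\<forall>c u. F (c *s u) = c *s F u)"

lemma lin_op_add: "lin_op F \<Longrightarrow> F (u + w) = F u + F w"
  and lin_op_scale: "lin_op F \<Longrightarrow> F (c *s u) = c *s F u"
  by (simp_all add: lin_op_def)

lemma lin_op_zero: "lin_op F \<Longrightarrow> F 0 = 0"
  using lin_op_scale[of F 0 0] by simp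

lemma lin_op_diff: "lin_op F \<Longrightarrow> F (u - w) = F u - F w"
  using lin_op_add[of F "u - w" w] by (simp add: algebra_simps)

lemma lin_op_sum: "lin_op F \<Longrightarrow> F (sum f S) = (\<Sum>s\<in>S. F (f s))"
  by (induction S rule: infinite_finite_induct) (simp_all add: lin_op_zero lin_op_add)

lemma lin_opI: "(\<And>u w. F (u + w) = F u + F w) \<Longrightarrow> (\<And>c u. F (c *s u) = c *s F u) \<Longrightarrow> lin_op F"
  by (simp add: lin_op_def)

text \<open>A representation is a homomorphism into this algebra.\<close>

definition endo :: "('k, 'v \<Rightarrow> 'v) module" where
  "endo = \<lparr>carrier = {F. lin_op F}, monoid.mult = (\<circ>), monoid.one = id, ring.zero = (\<lambda>_. 0),
    ring.add = (\<lambda>F G u. F u + G u), module.smult = (\<lambda>c F u. c *s F u)\<rparr>"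

lemma endo_simps [simp]:
  "carrier endo = {F. lin_op F}" "F \<otimes>\<^bsub>endo\<^esub> G = F \<circ> G" "\<one>\<^bsub>endo\<^esub> = id" "\<zero>\<^bsub>endo\<^esub> = (\<lambda>_. 0)"
  "F \<oplus>\<^bsub>endo\<^esub> G = (\<lambda>u. F u + G u)" "c \<odot>\<^bsub>endo\<^esub> F = (\<lambda>u. c *s F u)"
  by (simp_all add: endo_def)

lemma assoc_algebra_endo: "assoc_algebra endo"
proof -
  have neg: "\<exists>y\<in>carrier endo. y \<oplus>\<^bsub>endo\<^esub> x = \<zero>\<^bsub>endo\<^esub>" if "x \<in> carrier endo" for x
    using that by (intro bexI[of _ "\<lambda>u. - x u"]) (auto simp: lin_op_def)
  have "abelian_group endo"
    by (rule abelian_groupI) (use neg in \<open>auto simp: lin_op_def V.scale_right_distrib fun_eq_iff algebra_simps\<close>)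
  moreover have "Group.monoid endo" by (rule monoidI) (auto simp: lin_op_def fun_eq_iff)
  ultimately have "ring endo"
    by (rule ringI) (auto simp: lin_op_def fun_eq_iff)
  then show ?thesis unfolding assoc_algebra_def assoc_algebra_axioms_def
    by (auto simp: lin_op_def fun_eq_iff V.scale_right_distrib V.scale_left_distrib mult.commute)
qed

sublocale endo: assoc_algebra endo by (rule assoc_algebra_endo)

lemma endo_minus: "lin_op F \<Longrightarrow> lin_op G \<Longrightarrow> F \<ominus>\<^bsub>endo\<^esub> G = (\<lambda>u. F u - G u)"
proof -
  assume *: "lin_op F" "lin_op G"
  then have "F \<in> carrier endo" "G \<in> carrier endo" by simp_all
  then have "(F \<ominus>\<^bsub>endo\<^esub> G) \<oplus>\<^bsub>endo\<^esub> G = F"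
    by (simp add: endo.minus_eq endo.a_assoc endo.l_neg del: endo_simps)
  then have "(F \<ominus>\<^bsub>endo\<^esub> G) u + G u = F u" for u by (simp add: fun_eq_iff)
  then show ?thesis by (auto simp: fun_eq_iff algebra_simps)
qed

lemma cyclotomic_element_endo:
  assumes "lin_op F"
  shows "cyclotomic_element endo d v F = foldr (\<lambda>i b. (\<lambda>w. F w - v i *s w) \<circ> b) [1..<Suc d] id"
proof -
  have eq: "F \<ominus>\<^bsub>endo\<^esub> v i \<odot>\<^bsub>endo\<^esub> \<one>\<^bsub>endo\<^esub> = (\<lambda>w. F w - v i *s w)" for i
    using assms endo.smult_closed[OF endo.one_closed, of "v i"] by (subst endo_minus) simp_all
  have mult: "monoid.mult endo = (\<circ>)" by (simp add: endo_def)
  show ?thesis unfolding cyclotomic_element_def eq unfolding mult endo_simps(3) ..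
qed

text \<open>All \<open>r\<close> summands are the identity, and the factor
  \<open>1 / of_nat r\<close> normalizes their sum.\<close>

lemma yh_e_endo_one:
  assumes "of_nat r \<noteq> (0::'k)"
  shows "yh_e endo r (\<lambda>_. \<one>\<^bsub>endo\<^esub>) i = id"
proof -
  have sum: "finsum endo (\<lambda>k. \<one>\<^bsub>endo\<^esub>) {..<r'} = (\<lambda>u. of_nat r' *s u)" for r' :: nat
  proof (induction r')
    case 0 then show ?case by (simp add: fun_eq_iff)
  next
    case (Suc r')
    have "finsum endo (\<lambda>k. \<one>\<^bsub>endo\<^esub>) {..<Suc r'} = \<one>\<^bsub>endo\<^esub> \<oplus>\<^bsub>endo\<^esub> finsum endo (\<lambda>k. \<one>\<^bsub>endo\<^esub>) {..<r'}"
      unfolding lessThan_Suc by (subst endo.finsum_insert) (simp_all del: endo_simps)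
    then show ?case unfolding Suc by (simp add: V.scale_left_distrib id_def)
  qed
  have "yh_e endo r (\<lambda>_. \<one>\<^bsub>endo\<^esub>) i = (1 / of_nat r) \<odot>\<^bsub>endo\<^esub> finsum endo (\<lambda>k. \<one>\<^bsub>endo\<^esub>) {..<r}"
    by (simp add: yh_e_def del: endo_simps)
  then show ?thesis unfolding sum using assms by (simp add: fun_eq_iff)
qed

definition extend :: "('g \<Rightarrow> 'v \<Rightarrow> 'v) \<Rightarrow> ('g \<Rightarrow>\<^sub>0 'k) \<Rightarrow> 'v \<Rightarrow> 'v" where
  "extend \<phi> p u = (\<Sum>w\<in>Poly_Mapping.keys p. Poly_Mapping.lookup p w *s \<phi> w u)"

lemma extend_superset:
  "finite S \<Longrightarrow> Poly_Mapping.keys p \<subseteq> S \<Longrightarrow> extend \<phi> p u = (\<Sum>w\<in>S. Poly_Mapping.lookup p w *s \<phi> w u)"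
  unfolding extend_def by (rule sum.mono_neutral_left) (auto simp: in_keys_iff)

lemma extend_single [simp]: "extend \<phi> (Poly_Mapping.single w c) u = c *s \<phi> w u"
  by (simp add: extend_def)

lemma extend_zero [simp]: "extend \<phi> 0 u = 0"
  by (simp add: extend_def)

lemma extend_add: "extend \<phi> (p + q) u = extend \<phi> p u + extend \<phi> q u"
proof -
  let ?S = "Poly_Mapping.keys p \<union> Poly_Mapping.keys q"
  have "extend \<phi> s u = (\<Sum>w\<in>?S. Poly_Mapping.lookup s w *s \<phi> w u)" if "s \<in> {p, q, p + q}" for s
    using that keys_add[of p q] by (intro extend_superset) auto
  then show ?thesis by (simp add: lookup_add V.scale_left_distrib sum.distrib)
qed

lemma extend_sum: "extend \<phi> (sum f S) u = (\<Sum>s\<in>S. extend \<phi> (f s) u)"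
  by (induction S rule: infinite_finite_induct) (simp_all add: extend_add)

lemma lookup_smult: "Poly_Mapping.lookup (Poly_Mapping.map ((*) c) p) w = c * (Poly_Mapping.lookup p w :: 'k)"
  by (simp add: Poly_Mapping.map.rep_eq when_def)

lemma extend_smult: "extend \<phi> (Poly_Mapping.map ((*) c) p) u = c *s extend \<phi> p u"
proof -
  have "extend \<phi> (Poly_Mapping.map ((*) c) p) u =
      (\<Sum>w\<in>Poly_Mapping.keys p. Poly_Mapping.lookup (Poly_Mapping.map ((*) c) p) w *s \<phi> w u)"
    by (rule extend_superset) (auto simp: in_keys_iff lookup_smult)
  then show ?thesis by (simp add: extend_def lookup_smult V.scale_sum_right)
qed

lemma lin_op_extend:
  assumes "\<And>w. w \<in> Poly_Mapping.keys p \<Longrightarrow> lin_op (\<phi> w)"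
  shows "lin_op (extend \<phi> p)"
  using assms by (intro lin_opI)
    (simp_all add: extend_def lin_op_add lin_op_scale V.scale_right_distrib sum.distrib V.scale_sum_right mult.commute)

lemma extend_hom:
  assumes G: "Group.monoid G" and lin: "\<And>w. w \<in> carrier G \<Longrightarrow> lin_op (\<phi> w)"
    and mult: "\<And>w z. w \<in> carrier G \<Longrightarrow> z \<in> carrier G \<Longrightarrow> \<phi> (w \<otimes>\<^bsub>G\<^esub> z) = \<phi> w \<circ> \<phi> z"
    and one: "\<phi> \<one>\<^bsub>G\<^esub> = id"
  shows "extend \<phi> \<in> algebra_hom (monoid_algebra G) endo"
  unfolding algebra_hom_def
proof (intro CollectI conjI allI ballI ring_hom_memI)
  fix p q :: "_ \<Rightarrow>\<^sub>0 'k" assume p: "p \<in> carrier (monoid_algebra G)"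
  then show "extend \<phi> p \<in> carrier endo" using lin by (auto intro!: lin_op_extend)
  assume q: "q \<in> carrier (monoid_algebra G)"
  show "extend \<phi> (p \<otimes>\<^bsub>monoid_algebra G\<^esub> q) = extend \<phi> p \<otimes>\<^bsub>endo\<^esub> extend \<phi> q"
  proof
    fix u
    have "extend \<phi> (p \<otimes>\<^bsub>monoid_algebra G\<^esub> q) u = (\<Sum>x\<in>Poly_Mapping.keys p. \<Sum>y\<in>Poly_Mapping.keys q.
        (Poly_Mapping.lookup p x * Poly_Mapping.lookup q y) *s \<phi> (x \<otimes>\<^bsub>G\<^esub> y) u)"
      by (simp add: monoid_algebra_def extend_sum)
    also have "\<dots> = (\<Sum>x\<in>Poly_Mapping.keys p. Poly_Mapping.lookup p x *s \<phi> x (extend \<phi> q u))"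
    proof (intro sum.cong[OF refl])
      fix x assume "x \<in> Poly_Mapping.keys p"
      then have x: "x \<in> carrier G" using p by auto
      have "Poly_Mapping.lookup p x *s \<phi> x (extend \<phi> q u) =
        (\<Sum>y\<in>Poly_Mapping.keys q. (Poly_Mapping.lookup p x * Poly_Mapping.lookup q y) *s \<phi> x (\<phi> y u))"
        unfolding extend_def using lin[OF x] by (simp add: lin_op_sum lin_op_scale V.scale_sum_right)
      also have "\<dots> = (\<Sum>y\<in>Poly_Mapping.keys q. (Poly_Mapping.lookup p x * Poly_Mapping.lookup q y) *s \<phi> (x \<otimes>\<^bsub>G\<^esub> y) u)"
        using mult[OF x] q by (intro sum.cong) auto
      finally show "(\<Sum>y\<in>Poly_Mapping.keys q. (Poly_Mapping.lookup p x * Poly_Mapping.lookup q y) *s \<phi> (x \<otimes>\<^bsub>G\<^esub> y) u) =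
        Poly_Mapping.lookup p x *s \<phi> x (extend \<phi> q u)" ..
    qed
    finally show "extend \<phi> (p \<otimes>\<^bsub>monoid_algebra G\<^esub> q) u = (extend \<phi> p \<otimes>\<^bsub>endo\<^esub> extend \<phi> q) u"
      by (simp add: extend_def[of _ p])
  qed
qed (simp_all add: fun_eq_iff extend_add extend_smult one)

lemma free_hom:
  assumes "\<And>g. g \<in> S \<Longrightarrow> lin_op (\<phi> g)"
  shows "extend (\<lambda>w. foldr (\<lambda>g F. \<phi> g \<circ> F) w id) \<in> algebra_hom (free_algebra S) endo"
    "extend (\<lambda>w. foldr (\<lambda>g F. \<phi> g \<circ> F) w id) (free_gen g) = \<phi> g"
proof -
  let ?m = "\<lambda>w. foldr (\<lambda>g F. \<phi> g \<circ> F) w id"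
  have app: "?m (w @ z) = ?m w \<circ> ?m z" for w z by (induction w) (simp_all add: o_assoc)
  have lin: "lin_op (?m w)" if "w \<in> lists S" for w
    using that by (induction w) (use assms in \<open>auto simp: lin_op_def\<close>)
  show "extend ?m \<in> algebra_hom (free_algebra S) endo"
    unfolding free_algebra_def by (rule extend_hom[OF monoid_lists]) (use app lin in auto)
  show "extend ?m (free_gen g) = \<phi> g" by (simp add: fun_eq_iff free_gen_def)
qed

lemma presented_hom:
  fixes R :: "(('g list \<Rightarrow>\<^sub>0 'k) \<times> ('g list \<Rightarrow>\<^sub>0 'k)) set"
  assumes R: "R \<subseteq> carrier (free_algebra S) \<times> carrier (free_algebra S)"
    and \<rho>: "\<rho> \<in> algebra_hom (free_algebra S) endo" and rel: "\<And>a b. (a, b) \<in> R \<Longrightarrow> \<rho> a = \<rho> b"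
  obtains h where "h \<in> algebra_hom (presented_algebra S R) endo" "\<And>g. g \<in> S \<Longrightarrow> h (presented_gen S R g) = \<rho> (free_gen g)"
proof -
  interpret algebra_hom_pair "free_algebra S" endo \<rho>
    using \<rho> assoc_algebra_free_algebra assoc_algebra_endo by (auto simp: algebra_hom_pair_def algebra_hom_pair_axioms_def)
  have "(\<lambda>(a, b). a \<ominus>\<^bsub>free_algebra S\<^esub> b) ` R \<subseteq> carrier (free_algebra S)" using R by auto
  moreover have "\<rho> y = \<zero>\<^bsub>endo\<^esub>" if "y \<in> (\<lambda>(a, b). a \<ominus>\<^bsub>free_algebra S\<^esub> b) ` R" for y
  proof -
    obtain a b where ab: "(a, b) \<in> R" "y = a \<ominus>\<^bsub>free_algebra S\<^esub> b" using \<open>y \<in> _\<close> by auto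
    then have c: "a \<in> carrier (free_algebra S)" "b \<in> carrier (free_algebra S)" using R by auto
    then have "\<rho> y = \<rho> a \<ominus>\<^bsub>endo\<^esub> \<rho> b" by (simp add: ab(2))
    then show ?thesis using rel[OF ab(1)] hom(1)[OF c(2)] by (simp add: endo_minus)
  qed
  ultimately obtain h where h: "h \<in> algebra_hom (presented_algebra S R) endo"
     "\<And>a. a \<in> carrier (free_algebra S) \<Longrightarrow> h (relation_ideal (free_algebra S) R +>\<^bsub>free_algebra S\<^esub> a) = \<rho> a"
    unfolding presented_algebra_def relation_ideal_def
    by (rule quotient_hom_exists[OF assoc_algebra_free_algebra assoc_algebra_endo \<rho>]) blast+
  have "h (presented_gen S R g) = \<rho> (free_gen g)" if "g \<in> S" for g
    unfolding presented_gen_def by (rule h(2)[OF free_gen_closed[OF that]])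
  then show ?thesis using that h(1) by blast
qed

lemma cyclotomic_hom:
  assumes A: "assoc_algebra A" and a: "a \<in> carrier A" and h: "h \<in> algebra_hom A endo"
    and cyc: "cyclotomic_element endo d v (h a) = \<zero>\<^bsub>endo\<^esub>"
  obtains h' where "h' \<in> algebra_hom (quotient_algebra A (Idl\<^bsub>A\<^esub> {cyclotomic_element A d v a})) endo"
    "\<And>b. b \<in> carrier A \<Longrightarrow> h' (Idl\<^bsub>A\<^esub> {cyclotomic_element A d v a} +>\<^bsub>A\<^esub> b) = h b"
proof -
  interpret algebra_hom_pair A endo h
    using A h assoc_algebra_endo by (auto simp: algebra_hom_pair_def algebra_hom_pair_axioms_def)
  show ?thesis
    by (rule quotient_hom_exists[OF A assoc_algebra_endo h, of "{cyclotomic_element A d v a}"])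
      (use cyclotomic_element_closed[OF A a] cyclotomic_element_hom[OF a] cyc that in auto)
qed

text \<open>The image of a representation described through the generators alone, so that an
  operator can be recognized as lying in the image without writing down a preimage.\<close>

inductive_set op_algebra :: "('v \<Rightarrow> 'v) set \<Rightarrow> ('v \<Rightarrow> 'v) set" for S where
  op_id: "id \<in> op_algebra S"
| op_gen: "F \<in> S \<Longrightarrow> F \<in> op_algebra S"
| op_comp: "F \<in> op_algebra S \<Longrightarrow> G \<in> op_algebra S \<Longrightarrow> F \<circ> G \<in> op_algebra S"
| op_add: "F \<in> op_algebra S \<Longrightarrow> G \<in> op_algebra S \<Longrightarrow> (\<lambda>u. F u + G u) \<in> op_algebra S"
| op_scale: "F \<in> op_algebra S \<Longrightarrow> (\<lambda>u. c *s F u) \<in> op_algebra S"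

lemma op_algebra_subset_image:
  assumes A: "assoc_algebra A" and h: "h \<in> algebra_hom A endo" and S: "S \<subseteq> h ` carrier A"
  shows "op_algebra S \<subseteq> h ` carrier A"
proof
  interpret algebra_hom_pair A endo h
    using A h assoc_algebra_endo by (auto simp: algebra_hom_pair_def algebra_hom_pair_axioms_def)
  fix F assume "F \<in> op_algebra S"
  then show "F \<in> h ` carrier A"
  proof induction
    case op_id show ?case by (rule image_eqI[of _ _ "\<one>\<^bsub>A\<^esub>"]) simp_all
  next
    case (op_gen F) then show ?case using S by blast
  next
    case (op_comp F G)
    then obtain a b where "a \<in> carrier A" "b \<in> carrier A" "F = h a" "G = h b" by blast
    then show ?case by (intro image_eqI[of _ _ "a \<otimes>\<^bsub>A\<^esub> b"]) simp_all
  next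
    case (op_add F G)
    then obtain a b where "a \<in> carrier A" "b \<in> carrier A" "F = h a" "G = h b" by blast
    then show ?case by (intro image_eqI[of _ _ "a \<oplus>\<^bsub>A\<^esub> b"]) simp_all
  next
    case (op_scale F c)
    then obtain a where "a \<in> carrier A" "F = h a" by blast
    then show ?case by (intro image_eqI[of _ _ "c \<odot>\<^bsub>A\<^esub> a"]) (simp_all add: A.smult_closed)
  qed
qed

lemma image_subset_op_algebra:
  assumes A: "assoc_algebra A" and h: "h \<in> algebra_hom A endo" and G: "generates A G" "G \<subseteq> carrier A"
    and S: "h ` G \<subseteq> op_algebra S"
  shows "h ` carrier A \<subseteq> op_algebra S"
proof
  interpret algebra_hom_pair A endo h
    using A h assoc_algebra_endo by (auto simp: algebra_hom_pair_def algebra_hom_pair_axioms_def)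
  fix F assume "F \<in> h ` carrier A"
  then obtain a where a: "a \<in> carrier A" "F = h a" by blast
  have "h a \<in> op_algebra S"
    using G(1) a(1)
  proof (induction rule: generates_induct)
    case one then show ?case using op_id[of S] by (simp add: id_def)
  next
    case (add a b) then show ?case using op_add[of "h a" S "h b"] by simp
  next
    case (scale a c) then show ?case using op_scale[of "h a" S c] by (simp add: A.smult_closed)
  next
    case (mul g a)
    then have "h g \<in> op_algebra S" "g \<in> carrier A" using S G(2) by auto
    then show ?case using mul op_comp[of "h g" S "h a"] by (simp add: comp_def)
  qed
  then show "F \<in> op_algebra S" using a by simp
qed

end

section \<open>Representations of the cyclotomic algebras\<close>

context algebra_hom_pair
begin

lemma hecke_relations_image:
  assumes s: "\<And>i. i \<in> {1..<m} \<Longrightarrow> s i \<in> carrier A" and x: "\<And>i. i \<in> {1..m} \<Longrightarrow> x i \<in> carrier A"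
    and ab: "(a, b) \<in> hecke_relations A m x s"
  shows "(h a, h b) \<in> hecke_relations B m (\<lambda>i. h (x i)) (\<lambda>i. h (s i))"
  using ab unfolding hecke_relations_def[of A]
proof (elim UnE CollectE exE conjE Pair_inject)
  fix i assume *: "i \<in> {1..<m}" "a = s i \<otimes>\<^bsub>A\<^esub> s i" "b = \<one>\<^bsub>A\<^esub>"
  show ?thesis using hecke_relations_intros(1)[of i m B "\<lambda>i. h (s i)"] * s by simp
next
  fix i assume *: "i \<in> {1..<m}" "i + 1 \<in> {1..<m}" "a = s i \<otimes>\<^bsub>A\<^esub> s (i + 1) \<otimes>\<^bsub>A\<^esub> s i"
    "b = s (i + 1) \<otimes>\<^bsub>A\<^esub> s i \<otimes>\<^bsub>A\<^esub> s (i + 1)"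
  show ?thesis using hecke_relations_intros(2)[of i m B "\<lambda>i. h (s i)"] * s[OF *(1)] s[OF *(2)] by simp
next
  fix i j assume *: "i \<in> {1..<m}" "j \<in> {1..<m}" "1 < \<bar>int i - int j\<bar>" "a = s i \<otimes>\<^bsub>A\<^esub> s j" "b = s j \<otimes>\<^bsub>A\<^esub> s i"
  show ?thesis using hecke_relations_intros(3)[of i m j B "\<lambda>i. h (s i)"] * s by simp
next
  fix i j assume *: "i \<in> {1..m}" "j \<in> {1..m}" "a = x i \<otimes>\<^bsub>A\<^esub> x j" "b = x j \<otimes>\<^bsub>A\<^esub> x i"
  show ?thesis using hecke_relations_intros(4)[of i m j B "\<lambda>i. h (x i)"] * x by simp
next
  fix i assume *: "i \<in> {1..<m}" "a = s i \<otimes>\<^bsub>A\<^esub> x (i + 1)" "b = x i \<otimes>\<^bsub>A\<^esub> s i \<oplus>\<^bsub>A\<^esub> \<one>\<^bsub>A\<^esub>"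
  show ?thesis
    using hecke_relations_intros(5)[of i m B "\<lambda>i. h (s i)" "\<lambda>i. h (x i)"] * s[of i] x[of i] x[of "i + 1"] by simp
next
  fix i j assume *: "i \<in> {1..<m}" "j \<in> {1..m}" "j \<noteq> i" "j \<noteq> i + 1" "a = s i \<otimes>\<^bsub>A\<^esub> x j" "b = x j \<otimes>\<^bsub>A\<^esub> s i"
  show ?thesis using hecke_relations_intros(6)[of i m j B "\<lambda>i. h (s i)" "\<lambda>i. h (x i)"] * s x by simp
qed

lemma yh_relations_image:
  assumes t: "\<And>i. i \<in> {1..n} \<Longrightarrow> t i \<in> carrier A" and f: "\<And>i. i \<in> {1..<n} \<Longrightarrow> f i \<in> carrier A"
    and x: "\<And>i. i \<in> {1..n} \<Longrightarrow> x i \<in> carrier A"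
    and ab: "(a, b) \<in> yh_relations A r n t f x"
  shows "(h a, h b) \<in> yh_relations B r n (\<lambda>i. h (t i)) (\<lambda>i. h (f i)) (\<lambda>i. h (x i))"
  using ab unfolding yh_relations_def[of A]
proof (elim UnE CollectE exE conjE Pair_inject)
  let ?t = "\<lambda>i. h (t i)" and ?f = "\<lambda>i. h (f i)" and ?x = "\<lambda>i. h (x i)"
  fix i j assume *: "i \<in> {1..<n}" "j \<in> {1..<n}" "2 \<le> \<bar>int i - int j\<bar>" "a = f i \<otimes>\<^bsub>A\<^esub> f j" "b = f j \<otimes>\<^bsub>A\<^esub> f i"
  show ?thesis using yh_relations_intros(1)[of i n j B ?f] * f by simp
next
  let ?t = "\<lambda>i. h (t i)" and ?f = "\<lambda>i. h (f i)" and ?x = "\<lambda>i. h (x i)"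
  fix i assume *: "i \<in> {1..<n}" "i + 1 \<in> {1..<n}" "a = f i \<otimes>\<^bsub>A\<^esub> f (i + 1) \<otimes>\<^bsub>A\<^esub> f i"
    "b = f (i + 1) \<otimes>\<^bsub>A\<^esub> f i \<otimes>\<^bsub>A\<^esub> f (i + 1)"
  show ?thesis using yh_relations_intros(2)[of i n B ?f] * f[OF *(1)] f[OF *(2)] by simp
next
  let ?t = "\<lambda>i. h (t i)"
  fix i j assume *: "i \<in> {1..n}" "j \<in> {1..n}" "a = t i \<otimes>\<^bsub>A\<^esub> t j" "b = t j \<otimes>\<^bsub>A\<^esub> t i"
  show ?thesis using yh_relations_intros(3)[of i n j B ?t] * t by simp
next
  let ?t = "\<lambda>i. h (t i)" and ?f = "\<lambda>i. h (f i)" and ?x = "\<lambda>i. h (x i)"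
  fix i j assume *: "i \<in> {1..<n}" "j \<in> {1..n}" "a = f i \<otimes>\<^bsub>A\<^esub> t j" "b = t (Transposition.transpose i (i + 1) j) \<otimes>\<^bsub>A\<^esub> f i"
  have "Transposition.transpose i (i + 1) j \<in> {1..n}" using * by (auto simp: Transposition.transpose_def)
  then show ?thesis using yh_relations_intros(4)[of i n j B ?f ?t] *(3,4) f[OF *(1)] t[OF *(2)] t *(1,2) by simp
next
  let ?t = "\<lambda>i. h (t i)"
  fix i assume *: "i \<in> {1..n}" "a = t i [^]\<^bsub>A\<^esub> r" "b = \<one>\<^bsub>A\<^esub>"
  show ?thesis using yh_relations_intros(5)[of i n B ?t] * t by simp
next
  let ?f = "\<lambda>i. h (f i)"
  fix i assume *: "i \<in> {1..<n}" "a = f i \<otimes>\<^bsub>A\<^esub> f i" "b = \<one>\<^bsub>A\<^esub>"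
  show ?thesis using yh_relations_intros(6)[of i n B ?f] * f by simp
next
  let ?x = "\<lambda>i. h (x i)"
  fix i j assume *: "i \<in> {1..n}" "j \<in> {1..n}" "a = x i \<otimes>\<^bsub>A\<^esub> x j" "b = x j \<otimes>\<^bsub>A\<^esub> x i"
  show ?thesis using yh_relations_intros(7)[of i n j B ?x] * x by simp
next
  let ?t = "\<lambda>i. h (t i)" and ?f = "\<lambda>i. h (f i)" and ?x = "\<lambda>i. h (x i)"
  fix i assume *: "i \<in> {1..<n}" "a = f i \<otimes>\<^bsub>A\<^esub> x (i + 1)" "b = x i \<otimes>\<^bsub>A\<^esub> f i \<oplus>\<^bsub>A\<^esub> yh_e A r t i"
  have "yh_e A r t i \<in> carrier A"
    unfolding yh_e_def using * t by (intro A.smult_closed A.finsum_closed) auto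
  moreover have "h (yh_e A r t i) = yh_e B r ?t i" using * t by (intro yh_e_hom) auto
  ultimately show ?thesis
    using yh_relations_intros(8)[of i n B ?f ?x r ?t] * f[of i] x[of i] x[of "i + 1"] by simp
next
  let ?t = "\<lambda>i. h (t i)" and ?f = "\<lambda>i. h (f i)" and ?x = "\<lambda>i. h (x i)"
  fix i j assume *: "i \<in> {1..<n}" "j \<in> {1..n}" "j \<noteq> i" "j \<noteq> i + 1" "a = f i \<otimes>\<^bsub>A\<^esub> x j" "b = x j \<otimes>\<^bsub>A\<^esub> f i"
  show ?thesis using yh_relations_intros(9)[of i n j B ?f ?x] * f x by simp
next
  let ?t = "\<lambda>i. h (t i)" and ?f = "\<lambda>i. h (f i)" and ?x = "\<lambda>i. h (x i)"
  fix i j assume *: "i \<in> {1..n}" "j \<in> {1..n}" "a = t j \<otimes>\<^bsub>A\<^esub> x i" "b = x i \<otimes>\<^bsub>A\<^esub> t j"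
  show ?thesis using yh_relations_intros(10)[of i n j B ?t ?x] * t x by simp
qed

end

context linear_operators
begin

definition hecke_ops :: "nat \<Rightarrow> nat \<Rightarrow> (nat \<Rightarrow> 'k) \<Rightarrow> (nat \<Rightarrow> 'v \<Rightarrow> 'v) \<Rightarrow> (nat \<Rightarrow> 'v \<Rightarrow> 'v) \<Rightarrow> bool" where
  "hecke_ops n d v x s \<longleftrightarrow> (\<forall>i\<in>{1..n}. lin_op (x i)) \<and> (\<forall>i\<in>{1..<n}. lin_op (s i)) \<and>
    (\<forall>(a, b)\<in>hecke_relations endo n x s. a = b) \<and> cyclotomic_element endo d v (x 1) = \<zero>\<^bsub>endo\<^esub>"


lemma algebra_hom_pair_endo: "assoc_algebra A \<Longrightarrow> h \<in> algebra_hom A endo \<Longrightarrow> algebra_hom_pair A endo h"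
  using assoc_algebra_endo by (simp add: algebra_hom_pair_def algebra_hom_pair_axioms_def)

text \<open>Shared by the two presentations: operators for the generators extend to the free
  algebra, factor through the relations, and finally through the cyclotomic relation imposed on the
  generator \<open>y\<close>.\<close>

lemma presented_cyclotomic_representation:
  fixes R :: "(('g list \<Rightarrow>\<^sub>0 'k) \<times> ('g list \<Rightarrow>\<^sub>0 'k)) set" and v :: "nat \<Rightarrow> 'k"
  assumes R: "R \<subseteq> carrier (free_algebra S) \<times> carrier (free_algebra S)"
    and lin: "\<And>g. g \<in> S \<Longrightarrow> lin_op (\<phi> g)"
    and rel: "\<And>\<rho> a b. algebra_hom_pair (free_algebra S) endo \<rho> \<Longrightarrow> (\<And>g. \<rho> (free_gen g) = \<phi> g) \<Longrightarrow>
      (a, b) \<in> R \<Longrightarrow> \<rho> a = \<rho> b"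
    and y: "y \<in> S" "cyclotomic_element endo d v (\<phi> y) = \<zero>\<^bsub>endo\<^esub>"
  defines "B \<equiv> presented_algebra S R"
  defines "Q \<equiv> quotient_algebra B (Idl\<^bsub>B\<^esub> {cyclotomic_element B d v (presented_gen S R y)})"
  obtains h where "h \<in> algebra_hom Q endo" "h ` carrier Q = op_algebra (\<phi> ` S)"
proof -
  have F: "assoc_algebra (free_algebra S :: ('k, _) module)" by (rule assoc_algebra_free_algebra)
  have B: "assoc_algebra B" unfolding B_def by (intro assoc_algebra_presented_algebra R)
  interpret B: assoc_algebra B by (rule B)
  define \<rho> where "\<rho> = extend (\<lambda>w. foldr (\<lambda>g F. \<phi> g \<circ> F) w id)"
  have \<rho>: "\<rho> \<in> algebra_hom (free_algebra S) endo" unfolding \<rho>_def by (rule free_hom(1)[OF lin])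
  have \<rho>g: "\<rho> (free_gen g) = \<phi> g" for g unfolding \<rho>_def by (rule free_hom(2)[OF lin])
  have "\<rho> a = \<rho> b" if "(a, b) \<in> R" for a b by (rule rel[OF algebra_hom_pair_endo[OF F \<rho>] \<rho>g that])
  then obtain h1 where h1: "h1 \<in> algebra_hom B endo" "\<And>g. g \<in> S \<Longrightarrow> h1 (presented_gen S R g) = \<phi> g"
    unfolding B_def \<rho>g[symmetric] by (rule presented_hom[OF R \<rho>]) blast+
  have pc: "presented_gen S R ` S \<subseteq> carrier B" unfolding B_def by (auto intro!: presented_gen_closed R)
  then have yc: "presented_gen S R y \<in> carrier B" using y(1) by blast
  define J where "J = Idl\<^bsub>B\<^esub> {cyclotomic_element B d v (presented_gen S R y)}"
  have J: "ideal J B" unfolding J_def using cyclotomic_element_closed[OF B yc] by (intro B.genideal_ideal) auto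
  have QJ: "Q = quotient_algebra B J" unfolding Q_def J_def ..
  have Q: "assoc_algebra Q" unfolding QJ by (rule assoc_algebra_quotient_algebra[OF B J])
  have "cyclotomic_element endo d v (h1 (presented_gen S R y)) = \<zero>\<^bsub>endo\<^esub>" using y h1(2) by simp
  then obtain h where h: "h \<in> algebra_hom Q endo" "\<And>b. b \<in> carrier B \<Longrightarrow> h (J +>\<^bsub>B\<^esub> b) = h1 b"
    unfolding QJ J_def by (rule cyclotomic_hom[OF B yc h1(1)]) blast+
  let ?G = "(\<lambda>b. J +>\<^bsub>B\<^esub> b) ` presented_gen S R ` S"
  have "generates B (presented_gen S R ` S)"
    using generates_presented[OF R] unfolding B_def presented_gen_def image_image .
  then have gen: "generates Q ?G" unfolding QJ by (rule generates_quotient[OF B J pc])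
  have GQ: "?G \<subseteq> carrier Q" unfolding QJ quotient_carrier[OF B J] using pc by (intro image_mono)
  have hG: "h ` ?G = \<phi> ` S" unfolding image_image by (intro image_cong refl) (use h(2) h1(2) pc in auto)
  have "h ` carrier Q \<subseteq> op_algebra (\<phi> ` S)"
    by (rule image_subset_op_algebra[OF Q h(1) gen GQ], unfold hG) (blast intro: op_gen)
  moreover have "op_algebra (\<phi> ` S) \<subseteq> h ` carrier Q"
    using GQ hG by (intro op_algebra_subset_image[OF Q h(1)]) blast
  ultimately show ?thesis using that h(1) by blast
qed

lemma op_algebra_mono:
  assumes "S \<subseteq> op_algebra S'"
  shows "op_algebra S \<subseteq> op_algebra S'"
proof
  fix F assume "F \<in> op_algebra S"
  then show "F \<in> op_algebra S'" by induction (use assms in \<open>blast intro: op_id op_comp op_add op_scale\<close>)+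
qed

text \<open>Every \<open>t i\<close> acts as the identity, and then so does every
  \<open>e i\<close>.\<close>

lemma yh_representation:
  assumes ops: "hecke_ops n d v x s" and n: "1 \<le> n" and r: "of_nat r \<noteq> (0::'k)"
  obtains h where "h \<in> algebra_hom (cyclotomic_yh r n d v) endo"
    "h ` carrier (cyclotomic_yh r n d v) = op_algebra (x ` {1..n} \<union> s ` {1..<n})"
proof -
  define \<phi> where "\<phi> g = (case g of YT i \<Rightarrow> id | YF i \<Rightarrow> s i | YX i \<Rightarrow> x i)" for g
  note R = affine_yh_relations_closed[of r n, where ?'a = 'k]
  obtain h where h: "h \<in> algebra_hom (cyclotomic_yh r n d v) endo"
    "h ` carrier (cyclotomic_yh r n d v) = op_algebra (\<phi> ` yh_gens n)"
    unfolding cyclotomic_yh_def affine_yh_def affine_yh_x_def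
  proof (rule presented_cyclotomic_representation[OF R])
    show "lin_op (\<phi> g)" if "g \<in> yh_gens n" for g
      using that ops by (auto simp: \<phi>_def yh_gens_def hecke_ops_def lin_op_def)
    show "YX 1 \<in> yh_gens n" using n by (simp add: yh_gens_def)
    show "cyclotomic_element endo d v (\<phi> (YX 1)) = \<zero>\<^bsub>endo\<^esub>" using ops by (simp add: hecke_ops_def \<phi>_def)
    fix \<rho> and a b :: "yh_gen list \<Rightarrow>\<^sub>0 'k"
    assume "algebra_hom_pair (free_algebra (yh_gens n)) endo \<rho>" and \<rho>g: "\<And>g. \<rho> (free_gen g) = \<phi> g"
      and ab: "(a, b) \<in> affine_yh_relations r n"
    then interpret \<rho>: algebra_hom_pair "free_algebra (yh_gens n)" endo \<rho> by blast
    have "(\<rho> a, \<rho> b) \<in> yh_relations endo r n (\<lambda>i. \<rho> (free_gen (YT i))) (\<lambda>i. \<rho> (free_gen (YF i))) (\<lambda>i. \<rho> (free_gen (YX i)))"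
      using ab unfolding affine_yh_relations_def
      by (intro \<rho>.yh_relations_image) (auto intro!: free_gen_closed simp: yh_gens_def)
    then have *: "(\<rho> a, \<rho> b) \<in> yh_relations endo r n (\<lambda>_. \<one>\<^bsub>endo\<^esub>) s x" by (simp add: \<rho>g \<phi>_def)
    show "\<rho> a = \<rho> b"
      by (rule yh_relations_of_hecke[OF assoc_algebra_endo _ _ _ _ *])
        (use ops yh_e_endo_one[OF r] in \<open>auto simp: hecke_ops_def\<close>)
  qed blast
  have "op_algebra (\<phi> ` yh_gens n) = op_algebra (x ` {1..n} \<union> s ` {1..<n})"
    by (intro equalityI op_algebra_mono) (force simp: \<phi>_def yh_gens_def intro: op_id op_gen)+
  then show ?thesis using h that by simp
qed

lemma hecke_representation:
  assumes ops: "hecke_ops n d v x s" and n: "1 \<le> n"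
  obtains h where "h \<in> algebra_hom (cyclotomic_hecke d v n) endo"
    "h ` carrier (cyclotomic_hecke d v n) = op_algebra (x ` {1..n} \<union> s ` {1..<n})"
proof -
  define \<phi> where "\<phi> g = (case g of HS i \<Rightarrow> s i | HX i \<Rightarrow> x i)" for g
  note R = affine_hecke_relations_closed[of n, where ?'a = 'k]
  have H: "cyclotomic_hecke d v n = quotient_algebra (presented_algebra (hecke_gens n) (affine_hecke_relations n))
    (Idl\<^bsub>presented_algebra (hecke_gens n) (affine_hecke_relations n)\<^esub>
      {cyclotomic_element (presented_algebra (hecke_gens n) (affine_hecke_relations n)) d v
        (presented_gen (hecke_gens n) (affine_hecke_relations n) (HX 1))})"
    using n by (simp add: cyclotomic_hecke_def affine_hecke_def affine_hecke_x_def)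
  obtain h where h: "h \<in> algebra_hom (cyclotomic_hecke d v n) endo"
    "h ` carrier (cyclotomic_hecke d v n) = op_algebra (\<phi> ` hecke_gens n)"
    unfolding H
  proof (rule presented_cyclotomic_representation[OF R])
    show "lin_op (\<phi> g)" if "g \<in> hecke_gens n" for g
      using that ops by (auto simp: \<phi>_def hecke_gens_def hecke_ops_def)
    show "HX 1 \<in> hecke_gens n" using n by (simp add: hecke_gens_def)
    show "cyclotomic_element endo d v (\<phi> (HX 1)) = \<zero>\<^bsub>endo\<^esub>" using ops by (simp add: hecke_ops_def \<phi>_def)
    fix \<rho> and a b :: "hecke_gen list \<Rightarrow>\<^sub>0 'k"
    assume "algebra_hom_pair (free_algebra (hecke_gens n)) endo \<rho>" and \<rho>g: "\<And>g. \<rho> (free_gen g) = \<phi> g"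
      and ab: "(a, b) \<in> affine_hecke_relations n"
    then interpret \<rho>: algebra_hom_pair "free_algebra (hecke_gens n)" endo \<rho> by blast
    have "(\<rho> a, \<rho> b) \<in> hecke_relations endo n (\<lambda>i. \<rho> (free_gen (HX i))) (\<lambda>i. \<rho> (free_gen (HS i)))"
      using ab unfolding affine_hecke_relations_def
      by (intro \<rho>.hecke_relations_image) (auto intro!: free_gen_closed simp: hecke_gens_def)
    then have *: "(\<rho> a, \<rho> b) \<in> hecke_relations endo n x s" by (simp add: \<rho>g \<phi>_def)
    have "\<forall>(a, b)\<in>hecke_relations endo n x s. a = b" using ops unfolding hecke_ops_def by (elim conjE)
    from bspec[OF this *] show "\<rho> a = \<rho> b" by (simp only: prod.case)
  qed blast
  have "\<phi> ` hecke_gens n = x ` {1..n} \<union> s ` {1..<n}"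
    by (simp add: hecke_gens_def image_Un image_image \<phi>_def)
  then show ?thesis using h that by simp
qed

text \<open>Since \<open>H\<^sub>0 = K\<close> acts on everything by scalars, a representation of \<open>H\<^sub>n\<close> extends to \<open>H\<^sub>n \<otimes> H\<^sub>0 \<otimes> \<dots> \<otimes> H\<^sub>0\<close>.\<close>

lemma hecke_tensor_representation:
  fixes k :: nat
  assumes ops: "hecke_ops n d v x s" and n: "1 \<le> n"
  defines "Q \<equiv> cyclotomic_hecke_tensor d v (n # replicate k 0)"
  obtains h where "h \<in> algebra_hom Q endo" "h ` carrier Q = op_algebra (x ` {1..n} \<union> s ` {1..<n})"
proof -
  let ?S = "x ` {1..n} \<union> s ` {1..<n}"
  define I where "I = {..<Suc k}"
  define A where "A a = cyclotomic_hecke d v ((n # replicate k 0) ! a)" for a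
  have A0: "A 0 = cyclotomic_hecke d v n" by (simp add: A_def)
  have A': "A a = cyclotomic_hecke d v 0" if "a \<in> I - {0}" for a
    using that by (cases a) (auto simp: A_def I_def)
  interpret tf: tensor_factors I A
    by (rule tensor_factors.intro) (simp only: A_def assoc_algebra_cyclotomic_hecke)
  have Q: "Q = tf.Q" by (simp add: Q_def cyclotomic_hecke_tensor_def I_def A_def[abs_def])
  obtain h0 where h0: "h0 \<in> algebra_hom (A 0) endo" "h0 ` carrier (A 0) = op_algebra ?S"
    using hecke_representation[OF ops n] unfolding A0 by blast
  have I0: "0 \<in> I" by (simp add: I_def)
  interpret h0: algebra_hom_pair "A 0" endo h0 by (rule algebra_hom_pair_endo[OF tf.factor[OF I0] h0(1)])
  obtain \<iota> where \<iota>: "\<iota> \<in> algebra_iso \<lparr>carrier = UNIV, monoid.mult = (*), monoid.one = 1, ring.zero = 0, ring.add = (+),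
      module.smult = (*)\<rparr> (cyclotomic_hecke d v 0)"
    using cyclotomic_hecke_0_iso[of d v] by blast
  define \<kappa> where "\<kappa> = inv_into UNIV \<iota>"
  have \<kappa>: "\<kappa> (\<iota> c) = c" for c
    using \<iota> by (simp add: \<kappa>_def algebra_iso_def ring_iso_def bij_betw_def)
  have \<iota>_hom: "\<iota> (b * c) = \<iota> b \<otimes>\<^bsub>cyclotomic_hecke d v 0\<^esub> \<iota> c" "\<iota> (b + c) = \<iota> b \<oplus>\<^bsub>cyclotomic_hecke d v 0\<^esub> \<iota> c"
    "\<iota> 1 = \<one>\<^bsub>cyclotomic_hecke d v 0\<^esub>" "\<iota> (b * c) = b \<odot>\<^bsub>cyclotomic_hecke d v 0\<^esub> \<iota> c" for b c
    using \<iota> by (auto simp: algebra_iso_def ring_iso_def Ring.ring_hom_def)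
  have "range \<iota> = carrier (cyclotomic_hecke d v 0)"
    using \<iota> by (simp add: algebra_iso_def ring_iso_def bij_betw_def)
  then have \<iota>_surj: "\<exists>b. a = \<iota> b" if "a \<in> carrier (cyclotomic_hecke d v 0)" for a
    using that by blast
  have \<kappa>_mult: "\<kappa> (a \<otimes>\<^bsub>cyclotomic_hecke d v 0\<^esub> b) = \<kappa> a * \<kappa> b" and \<kappa>_add: "\<kappa> (a \<oplus>\<^bsub>cyclotomic_hecke d v 0\<^esub> b) = \<kappa> a + \<kappa> b"
    if "a \<in> carrier (cyclotomic_hecke d v 0)" "b \<in> carrier (cyclotomic_hecke d v 0)" for a b
    using \<iota>_surj[OF that(1)] \<iota>_surj[OF that(2)] by (auto simp: \<kappa> simp flip: \<iota>_hom(1,2))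
  have \<kappa>_smult: "\<kappa> (c \<odot>\<^bsub>cyclotomic_hecke d v 0\<^esub> a) = c * \<kappa> a" if "a \<in> carrier (cyclotomic_hecke d v 0)" for c a
    using \<iota>_surj[OF that] by (auto simp: \<kappa> simp flip: \<iota>_hom(4))
  have \<kappa>_one: "\<kappa> \<one>\<^bsub>cyclotomic_hecke d v 0\<^esub> = 1" by (simp add: \<kappa> flip: \<iota>_hom(3))
  \<comment> \<open>Slot 0 acts through \<open>h0\<close>; each other slot holds a copy of a scalar,
    which \<open>\<kappa>\<close> reads off, and the scalars are multiplied together.\<close>
  define \<chi> where "\<chi> u = (\<Prod>a\<in>I - {0}. \<kappa> (u a))" for u
  define \<phi> where "\<phi> u = (\<lambda>w. \<chi> u *s h0 (u 0) w)" for u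
  have c0: "u 0 \<in> carrier (A 0)" if "u \<in> tf.tuples" for u using that I0 by auto
  have c': "u a \<in> carrier (cyclotomic_hecke d v 0)" if "u \<in> tf.tuples" "a \<in> I - {0}" for u a
    using PiE_mem[OF that(1), of a] A'[OF that(2)] that(2) by simp
  have lin: "lin_op (\<phi> u)" if "u \<in> tf.tuples" for u
    using endo.smult_closed[of "h0 (u 0)" "\<chi> u"] h0.hom(1)[OF c0[OF that]] by (simp add: \<phi>_def)
  have "extend \<phi> \<in> algebra_hom tf.M endo"
  proof (rule extend_hom)
    show "Group.monoid (product_group I A)" using tf.factor
      by (intro monoid_product_group) (simp add: assoc_algebra_def ring_def)
    show "lin_op (\<phi> u)" if "u \<in> carrier (product_group I A)" for u
      using lin that by (simp add: product_group_def)
    show "\<phi> (u \<otimes>\<^bsub>product_group I A\<^esub> w) = \<phi> u \<circ> \<phi> w"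
      if "u \<in> carrier (product_group I A)" "w \<in> carrier (product_group I A)" for u w
    proof -
      have uw: "u \<in> tf.tuples" "w \<in> tf.tuples" using that by (simp_all add: product_group_def)
      have "\<chi> (u \<otimes>\<^bsub>product_group I A\<^esub> w) = \<chi> u * \<chi> w"
        unfolding \<chi>_def prod.distrib[symmetric]
        using c'[OF uw(1)] c'[OF uw(2)] by (intro prod.cong) (auto simp: product_group_def A' \<kappa>_mult)
      moreover have "h0 ((u \<otimes>\<^bsub>product_group I A\<^esub> w) 0) = h0 (u 0) \<circ> h0 (w 0)"
        using I0 h0.hom(3)[OF c0[OF uw(1)] c0[OF uw(2)]] by (simp add: product_group_def)
      ultimately show ?thesis
        using h0.hom(1)[OF c0[OF uw(1)]] by (simp add: \<phi>_def fun_eq_iff lin_op_scale)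
    qed
    have "\<chi> \<one>\<^bsub>product_group I A\<^esub> = 1"
      unfolding \<chi>_def by (intro prod.neutral) (auto simp: product_group_def A' \<kappa>_one)
    then show "\<phi> \<one>\<^bsub>product_group I A\<^esub> = id"
      using I0 h0.hom(2) by (simp add: \<phi>_def product_group_def fun_eq_iff)
  qed
  note ext = this
  interpret e: algebra_hom_pair tf.M endo "extend \<phi>" by (rule algebra_hom_pair_endo[OF tf.M ext])
  have upd0: "\<chi> (u(0 := a)) = \<chi> u" for u a
    unfolding \<chi>_def by (intro prod.cong) auto
  have upd: "\<chi> (u(i := a)) = \<kappa> a * (\<Prod>j\<in>I - {0} - {i}. \<kappa> (u j))" if "i \<in> I - {0}" for u i a
  proof -
    have "\<chi> (u(i := a)) = \<kappa> ((u(i := a)) i) * (\<Prod>j\<in>I - {0} - {i}. \<kappa> ((u(i := a)) j))"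
      unfolding \<chi>_def using that by (intro prod.remove) (auto simp: I_def)
    also have "(\<Prod>j\<in>I - {0} - {i}. \<kappa> ((u(i := a)) j)) = (\<Prod>j\<in>I - {0} - {i}. \<kappa> (u j))"
      by (intro prod.cong) auto
    finally show ?thesis by (simp only: fun_upd_same)
  qed
  have rel: "extend \<phi> p = extend \<phi> q" if pq: "(p, q) \<in> multilinear_relations I A" for p q
    using pq unfolding multilinear_relations_def
  proof (elim UnE CollectE exE conjE Pair_inject)
    fix u i a b
    assume *: "p = Poly_Mapping.single (u(i := a \<oplus>\<^bsub>A i\<^esub> b)) 1"
      "q = Poly_Mapping.single (u(i := a)) 1 + Poly_Mapping.single (u(i := b)) 1"
      "u \<in> tf.tuples" "i \<in> I" "a \<in> carrier (A i)" "b \<in> carrier (A i)"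
    show ?thesis
    proof (cases "i = 0")
      case True
      then show ?thesis using * h0.hom(4)[of a b]
        by (simp add: fun_eq_iff extend_add \<phi>_def upd0 V.scale_right_distrib)
    next
      case False
      then have i: "i \<in> I - {0}" using * by simp
      then show ?thesis using *(1,2,5,6) False unfolding A'[OF i]
        by (simp add: fun_eq_iff extend_add \<phi>_def upd[OF i] \<kappa>_add V.scale_left_distrib distrib_right)
    qed
  next
    fix u i a c
    assume *: "p = Poly_Mapping.single (u(i := c \<odot>\<^bsub>A i\<^esub> a)) 1" "q = Poly_Mapping.single (u(i := a)) c"
      "u \<in> tf.tuples" "i \<in> I" "a \<in> carrier (A i)"
    show ?thesis
    proof (cases "i = 0")
      case True
      then show ?thesis using * h0.hom(5)[of a c]
        by (simp add: fun_eq_iff \<phi>_def upd0 mult.commute)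
    next
      case False
      then have i: "i \<in> I - {0}" using * by simp
      then show ?thesis using *(1,2,5) False unfolding A'[OF i]
        by (simp add: fun_eq_iff \<phi>_def upd[OF i] \<kappa>_smult mult_ac)
    qed
  qed
  let ?R = "(\<lambda>(a, b). a \<ominus>\<^bsub>tf.M\<^esub> b) ` multilinear_relations I A"
  have RM: "?R \<subseteq> carrier tf.M"
  proof clarify
    fix a b assume "(a, b) \<in> multilinear_relations I A"
    then show "a \<ominus>\<^bsub>tf.M\<^esub> b \<in> carrier tf.M" using tf.relations_closed by (intro e.A.minus_closed) blast+
  qed
  have R0: "extend \<phi> y = \<zero>\<^bsub>endo\<^esub>" if y: "y \<in> ?R" for y
  proof -
    obtain a b where ab: "(a, b) \<in> multilinear_relations I A" "y = a \<ominus>\<^bsub>tf.M\<^esub> b" using y by auto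
    then have c: "a \<in> carrier tf.M" "b \<in> carrier tf.M" using tf.relations_closed by (blast, blast)
    have "extend \<phi> y = extend \<phi> a \<ominus>\<^bsub>endo\<^esub> extend \<phi> b" unfolding ab(2) by (rule e.hom_minus[OF c])
    then show ?thesis using rel[OF ab(1)] e.hom(1)[OF c(2)] by (simp add: endo_minus)
  qed
  have J: "tf.J = Idl\<^bsub>tf.M\<^esub> ?R" by (simp add: tf.J_def relation_ideal_def)
  obtain h where h: "h \<in> algebra_hom tf.Q endo" "\<And>p. p \<in> carrier tf.M \<Longrightarrow> h (tf.J +>\<^bsub>tf.M\<^esub> p) = extend \<phi> p"
    unfolding tf.Q_def J by (rule quotient_hom_exists[OF tf.M assoc_algebra_endo ext RM R0]) blast+
  have "h ` carrier tf.Q \<subseteq> op_algebra ?S"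
  proof
    fix F assume "F \<in> h ` carrier tf.Q"
    then obtain D where D: "F = h D" "D \<in> carrier tf.Q" by (rule imageE)
    then obtain p where p: "p \<in> carrier tf.M" "D = tf.J +>\<^bsub>tf.M\<^esub> p"
      unfolding tf.Q_def quotient_carrier[OF tf.M tf.J] by (elim imageE) (rule that)
    have F: "F = extend \<phi> p" unfolding D(1) p(2) by (rule h(2)[OF p(1)])
    have keys: "Poly_Mapping.keys p \<subseteq> tf.tuples" using p(1) by (simp add: product_group_def)
    have zero: "(\<lambda>_. 0) \<in> op_algebra ?S" using op_scale[OF op_id, of 0 ?S] by simp
    have "(\<lambda>w. \<Sum>u\<in>K. Poly_Mapping.lookup p u *s \<phi> u w) \<in> op_algebra ?S" if "finite K" "K \<subseteq> tf.tuples" for K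
      using that
    proof (induction K rule: finite_induct)
      case empty then show ?case using zero by simp
    next
      case (insert u K)
      then have "u \<in> tf.tuples" by simp
      then have "h0 (u 0) \<in> op_algebra ?S" unfolding h0(2)[symmetric] by (intro imageI c0)
      from op_add[OF op_scale[OF op_scale[OF this, of "\<chi> u"], of "Poly_Mapping.lookup p u"]] insert
      show ?case by (simp add: \<phi>_def)
    qed
    from this[OF finite_keys keys] show "F \<in> op_algebra ?S"
      unfolding F extend_def[abs_def] .
  qed
  moreover have "op_algebra ?S \<subseteq> h ` carrier tf.Q"
  proof
    fix F assume "F \<in> op_algebra ?S"
    then have "F \<in> h0 ` carrier (A 0)" by (simp only: h0(2))
    then obtain a where a: "a \<in> carrier (A 0)" "F = h0 a" by (elim imageE) (rule that)
    \<comment> \<open>The pure tensor with \<open>a\<close> in slot 0 and units elsewhere acts as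
      \<open>h0 a\<close>.\<close>
    define u where "u = (\<lambda>i\<in>I. \<one>\<^bsub>A i\<^esub>)(0 := a)"
    have "(\<lambda>i\<in>I. \<one>\<^bsub>A i\<^esub>) \<in> tf.tuples"
      using tf.factor by (auto simp: assoc_algebra_def intro!: ring.ring_simprules)
    then have u: "u \<in> tf.tuples" unfolding u_def using I0 a(1) by (intro tf.tuple_upd)
    have "\<chi> u = 1" unfolding u_def upd0 unfolding \<chi>_def by (intro prod.neutral) (auto simp: A' \<kappa>_one)
    then have "\<phi> u = F" by (simp add: \<phi>_def a(2) u_def)
    then have "h (tf.pure u) = F"
      unfolding tf.pure_def using h(2)[OF tf.single_closed[OF u, of 1]] by (simp add: fun_eq_iff)
    then show "F \<in> h ` carrier tf.Q" using imageI[OF tf.pure_closed[OF u], of h] by (simp only:)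
  qed
  ultimately have "h ` carrier tf.Q = op_algebra ?S" by (rule equalityI)
  with h(1) show ?thesis unfolding Q[symmetric] by (rule that)
qed

end

section \<open>Von Neumann regularity of split semisimple algebras\<close>

definition fun_scale :: "'k::field \<Rightarrow> ('i \<Rightarrow> 'k) \<Rightarrow> 'i \<Rightarrow> 'k" where
  "fun_scale c g = (\<lambda>i. c * g i)"

lemma fun_scale_apply [simp]: "fun_scale c g i = c * g i"
  by (simp add: fun_scale_def)

lemma vector_space_fun: "Vector_Spaces.vector_space (fun_scale :: 'k::field \<Rightarrow> ('i \<Rightarrow> 'k) \<Rightarrow> _)"
  by unfold_locales (auto simp: fun_eq_iff algebra_simps)

lemma sum_fun_apply: "(sum f S :: 'i \<Rightarrow> 'k::comm_monoid_add) i = (\<Sum>s\<in>S. f s i)"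
  by (induction S rule: infinite_finite_induct) auto

text \<open>A linear map \<open>f\<close> has a linear \<open>g\<close> with
  \<open>f (g u) = u\<close> on its range, so \<open>f \<circ> g \<circ> f = f\<close>;
  \<open>b\<close> is the matrix of \<open>g\<close>.\<close>

lemma matrix_regular:
  fixes a :: "'k::field mat"
  assumes a: "a \<in> carrier_mat m m"
  obtains b where "b \<in> carrier_mat m m" "a * b * a = a"
proof -
  interpret vp: vector_space_pair "fun_scale :: 'k \<Rightarrow> (nat \<Rightarrow> 'k) \<Rightarrow> _" "fun_scale :: 'k \<Rightarrow> (nat \<Rightarrow> 'k) \<Rightarrow> _"
    by (intro vector_space_pair.intro vector_space_fun)
  define f where "f g i = (if i < m then \<Sum>j<m. a $$ (i, j) * g j else 0)" for g i
  have f: "Vector_Spaces.linear fun_scale fun_scale f"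
    unfolding Vector_Spaces.linear_iff using vector_space_fun
    by (auto simp: f_def fun_eq_iff algebra_simps sum.distrib sum_distrib_left)
  obtain g where g: "Vector_Spaces.linear fun_scale fun_scale g" "\<forall>u\<in>range f. f (g u) = u"
    using vp.linear_exists_right_inverse_on[OF f vp.vs1.subspace_UNIV] by auto
  define e :: "nat \<Rightarrow> nat \<Rightarrow> 'k" where "e j = (\<lambda>i. if i = j then 1 else 0)" for j
  \<comment> \<open>Vectors are functions on all naturals. As \<open>f\<close> reads only the first
    \<open>m\<close> entries, cutting \<open>g\<close> down to a square matrix changes
    nothing.\<close>
  define b where "b = Matrix.mat m m (\<lambda>(i, j). g (e j) i)"
  have b: "b \<in> carrier_mat m m" by (simp add: b_def)
  have fe: "f (e j) = (\<Sum>l<m. fun_scale (a $$ (l, j)) (e l))" if "j < m" for j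
    using that by (auto simp: fun_eq_iff f_def e_def sum_fun_apply if_distrib[of "(*) _"] cong: if_cong)
  interpret g: Vector_Spaces.linear "fun_scale :: 'k \<Rightarrow> (nat \<Rightarrow> 'k) \<Rightarrow> _" "fun_scale :: 'k \<Rightarrow> (nat \<Rightarrow> 'k) \<Rightarrow> _" g
    by (rule g(1))
  have "(a * b * a) $$ (i, j) = a $$ (i, j)" if ij: "i < m" "j < m" for i j
  proof -
    have gfe: "g (f (e j)) l = (\<Sum>q<m. b $$ (l, q) * a $$ (q, j))" if "l < m" for l
      unfolding fe[OF ij(2)] g.sum g.scale sum_fun_apply
      using that by (intro sum.cong) (auto simp: b_def mult.commute)
    have "(a * b * a) $$ (i, j) = (a * (b * a)) $$ (i, j)" using a b by (simp add: assoc_mult_mat[of _ m m _ m _ m])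
    also have "\<dots> = (\<Sum>l<m. a $$ (i, l) * (b * a) $$ (l, j))"
      using a b ij by (auto simp: scalar_prod_def lessThan_atLeast0 intro!: sum.cong)
    also have "\<dots> = (\<Sum>l<m. a $$ (i, l) * g (f (e j)) l)"
      using a b ij gfe by (intro sum.cong refl) (auto simp: scalar_prod_def lessThan_atLeast0)
    also have "\<dots> = f (g (f (e j))) i" using ij by (simp add: f_def)
    also have "\<dots> = f (e j) i" using g(2) by simp
    also have "\<dots> = a $$ (i, j)"
      unfolding fe[OF ij(2)] using ij by (simp add: sum_fun_apply e_def if_distrib[of "(*) _"] cong: if_cong)
    finally show ?thesis .
  qed
  then have "a * b * a = a" using a b by (intro eq_matI) auto
  with b show ?thesis by (rule that)
qed

lemma split_semisimple_regular:
  fixes A :: "('k::field, 'a) module" (structure)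
  assumes A: "assoc_algebra A" and ss: "split_semisimple A" and a: "a \<in> carrier A"
  obtains b where "b \<in> carrier A" "a \<otimes>\<^bsub>A\<^esub> b \<otimes>\<^bsub>A\<^esub> a = a"
proof -
  interpret assoc_algebra A by (rule A)
  obtain k :: nat and N h where h: "h \<in> algebra_iso A (product_algebra {..<k} (\<lambda>i. module_mat TYPE('k) (N i) (N i)))"
    using ss unfolding split_semisimple_def ex_in_conv[symmetric] by (elim exE conjE) (rule that)
  let ?P = "product_algebra {..<k} (\<lambda>i. module_mat TYPE('k) (N i) (N i))"
  have hom: "h \<in> Ring.ring_hom A ?P" and bij: "bij_betw h (carrier A) (carrier ?P)"
    using h by (simp_all add: algebra_iso_def ring_iso_def)
  have ha: "h a \<in> (\<Pi>\<^sub>E i\<in>{..<k}. carrier_mat (N i) (N i))"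
    using ring_hom_closed[OF hom a] by (simp add: product_algebra_simps module_mat_simps')
  define b where "b i = (SOME b. b \<in> carrier_mat (N i) (N i) \<and> h a i * b * h a i = h a i)" for i
  have b: "b i \<in> carrier_mat (N i) (N i) \<and> h a i * b i * h a i = h a i" if "i < k" for i
  proof -
    have "h a i \<in> carrier_mat (N i) (N i)" using PiE_mem[OF ha, of i] that by simp
    then obtain b' where "b' \<in> carrier_mat (N i) (N i)" "h a i * b' * h a i = h a i" by (rule matrix_regular)
    then have "\<exists>b. b \<in> carrier_mat (N i) (N i) \<and> h a i * b * h a i = h a i" by (intro exI[of _ b'] conjI)
    then show ?thesis unfolding b_def by (rule someI_ex)
  qed
  have "(\<lambda>i\<in>{..<k}. b i) \<in> carrier ?P" using b by (simp add: product_algebra_simps module_mat_simps')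
  then have "(\<lambda>i\<in>{..<k}. b i) \<in> h ` carrier A" by (simp only: bij_betw_imp_surj_on[OF bij])
  then obtain c where c: "c \<in> carrier A" "h c = (\<lambda>i\<in>{..<k}. b i)" by (elim imageE) (rule that, simp_all only:)
  have "h (a \<otimes> c \<otimes> a) = h a \<otimes>\<^bsub>?P\<^esub> h c \<otimes>\<^bsub>?P\<^esub> h a"
    using a c(1) by (simp add: ring_hom_mult[OF hom])
  also have "\<dots> = (\<lambda>i\<in>{..<k}. h a i)"
    using b by (auto simp: c(2) product_algebra_simps module_mat_simps' intro!: restrict_ext)
  also have "\<dots> = h a" using ha by (auto simp: PiE_def extensional_restrict)
  finally have "a \<otimes> c \<otimes> a = a"
    by (rule inj_onD[OF bij_betw_imp_inj_on[OF bij]]) (use a c(1) in simp_all)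
  with c(1) show ?thesis by (rule that)
qed

section \<open>The obstruction to regularity and the cyclotomic relation\<close>

context linear_operators
begin

text \<open>If \<open>F\<close> is the image of \<open>a\<close> with \<open>a = a b a\<close>, then
  \<open>F\<close> equals \<open>F\<close> after \<open>h b\<close> after \<open>F\<close>. The
  inner \<open>F\<close> lands in \<open>U\<close>, the operator \<open>h b\<close> stays there, and
  the outer \<open>F\<close> kills \<open>U\<close>.\<close>

lemma obstruction:
  assumes A: "assoc_algebra A" and ss: "split_semisimple A"
    and hom: "h \<in> algebra_hom A endo" "h ` carrier A = op_algebra S"
    and F: "F \<in> op_algebra S" "\<And>u. F u \<in> U" "\<And>u. u \<in> U \<Longrightarrow> F u = 0"
    and U: "\<And>u w. u \<in> U \<Longrightarrow> w \<in> U \<Longrightarrow> u + w \<in> U" "\<And>c u. u \<in> U \<Longrightarrow> c *s u \<in> U"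
      "\<And>G u. G \<in> S \<Longrightarrow> u \<in> U \<Longrightarrow> G u \<in> U"
  shows "F u = 0"
proof -
  interpret h: algebra_hom_pair A endo h by (rule algebra_hom_pair_endo[OF A hom(1)])
  have "F \<in> h ` carrier A" using F(1) by (simp only: hom(2))
  then obtain a where a: "a \<in> carrier A" "F = h a" by (elim imageE) (rule that)
  obtain b where b: "b \<in> carrier A" "a \<otimes>\<^bsub>A\<^esub> b \<otimes>\<^bsub>A\<^esub> a = a"
    by (rule split_semisimple_regular[OF A ss a(1)])
  have "G w \<in> U" if "G \<in> op_algebra S" "w \<in> U" for G w
    using that by (induction arbitrary: w) (auto intro: U)
  moreover have "h b \<in> op_algebra S" unfolding hom(2)[symmetric] using b(1) by (rule imageI)
  ultimately have "F (h b (F u)) = 0" using F by blast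
  moreover have "h (a \<otimes>\<^bsub>A\<^esub> b \<otimes>\<^bsub>A\<^esub> a) u = F (h b (F u))" using a b(1) by simp
  ultimately show ?thesis using b(2) a(2) by simp
qed

text \<open>One factor with root \<open>v i\<close>, or two with roots \<open>v i\<close> and
  \<open>v j\<close>, already make the product vanish; the remaining factors are carried
  along.\<close>

lemma cyclotomic_vanishing:
  assumes F: "lin_op F" and i: "1 \<le> i" "i \<le> d"
    and van: "(\<forall>w. F w = v i *s w) \<or>
      (\<exists>j. i < j \<and> j \<le> d \<and> (\<forall>w. F (F w - v j *s w) = v i *s (F w - v j *s w)))"
  shows "cyclotomic_element endo d v F = \<zero>\<^bsub>endo\<^esub>"
proof -
  define f where "f is = foldr (\<lambda>i b. (\<lambda>w. F w - v i *s w) \<circ> b) is id" for "is"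
  have fNil: "f [] w = w" and fCons: "f (j # is) w = F (f is w) - v j *s f is w" for j "is" w
    by (simp_all add: f_def)
  have lin: "lin_op (f is)" for "is"
    by (induction "is") (auto simp: lin_op_def fNil fCons lin_op_add[OF F] lin_op_scale[OF F]
        V.scale_right_distrib V.scale_right_diff_distrib mult.commute)
  have comm: "f is (F w) = F (f is w)" for "is" w
    by (induction "is") (simp_all add: fNil fCons lin_op_diff[OF F] lin_op_scale[OF F])
  have zero: "f is w = 0" if "i \<in> set is" "F w = v i *s w" for "is" w
    using that
  proof (induction "is")
    case (Cons j "is")
    then have "F (f is w) = v i *s f is w"
      by (simp flip: comm add: lin_op_scale[OF lin])
    then show ?case using Cons by (cases "j = i") (auto simp: fCons lin_op_zero[OF F])
  qed simp
  have app: "f (xs @ ys) w = f xs (f ys w)" for xs ys w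
    by (induction xs) (simp_all add: fNil fCons)
  have "f [1..<Suc d] w = 0" for w
    using van
  proof (elim disjE exE conjE)
    assume "\<forall>w. F w = v i *s w"
    then show ?thesis using i by (intro zero) auto
  next
    fix j assume j: "i < j" "j \<le> d" and *: "\<forall>w. F (F w - v j *s w) = v i *s (F w - v j *s w)"
    \<comment> \<open>The factor for \<open>j\<close> produces an eigenvector for
      \<open>v i\<close>, and the factor for \<open>i\<close> stands further left because
      \<open>i < j\<close>.\<close>
    have "[1..<Suc d] = [1..<j] @ j # [Suc j..<Suc d]"
      using j i upt_add_eq_append[of 1 j "Suc d - j"] by (simp add: upt_conv_Cons)
    then have "f [1..<Suc d] w = f [1..<j] (f (j # [Suc j..<Suc d]) w)" by (simp only: app)
    also have "\<dots> = 0" using j i by (intro zero) (auto simp: fCons *)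
    finally show ?thesis .
  qed
  then show ?thesis unfolding cyclotomic_element_endo[OF F] f_def[symmetric] by auto
qed

end

text \<open>The recipe for modules: \<open>T\<close> is an action by pullback, so the order of
  composition is reversed, \<open>\<alpha> + D\<close> is meant to be \<open>x 1\<close>, and
  \<open>D_comm\<close> is the commutation of \<open>x 1\<close> with
  \<open>x 2 = s 1 \<circ> x 1 \<circ> s 1 + s 1\<close>.\<close>

locale hecke_module = linear_operators sc for sc :: "'k::field \<Rightarrow> 'v::ab_group_add \<Rightarrow> 'v"  (infixr "*s" 75) +
  fixes n :: nat and \<alpha> :: 'k and T :: "(nat \<Rightarrow> nat) \<Rightarrow> 'v \<Rightarrow> 'v" and D :: "'v \<Rightarrow> 'v"
  assumes T_lin: "lin_op (T p)" and D_lin: "lin_op D"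
    and T_id: "T id u = u" and T_comp: "T p (T q u) = T (q \<circ> p) u"
    and D_T: "p permutes {1..n} \<Longrightarrow> p 1 = 1 \<Longrightarrow> D (T p u) = T p (D u)"
    and D_comm: "2 \<le> n \<Longrightarrow> \<tau> = Transposition.transpose 1 2 \<Longrightarrow>
      D (T \<tau> (D (T \<tau> u))) + D (T \<tau> u) = T \<tau> (D (T \<tau> (D u))) + T \<tau> (D u)"
begin

abbreviation tr :: "nat \<Rightarrow> nat \<Rightarrow> nat \<Rightarrow> nat" where "tr \<equiv> Transposition.transpose"

definition Dk :: "nat \<Rightarrow> 'v \<Rightarrow> 'v" where "Dk k u = T (tr 1 k) (D (T (tr 1 k) u))"
text \<open>The Jucys-Murphy element of the symmetric group.\<close>

definition JM :: "nat \<Rightarrow> 'v \<Rightarrow> 'v" where "JM k u = (\<Sum>j\<in>{1..<k}. T (tr j k) u)"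
text \<open>Forced by iterating \<open>x (i + 1) = s i \<circ> x i \<circ> s i + s i\<close> from
  \<open>x 1\<close>: conjugation carries \<open>D\<close> to \<open>Dk k\<close>, and the added
  transpositions accumulate to \<open>JM k\<close>.\<close>

definition x :: "nat \<Rightarrow> 'v \<Rightarrow> 'v" where "x k u = \<alpha> *s u + Dk k u + JM k u"
definition s :: "nat \<Rightarrow> 'v \<Rightarrow> 'v" where "s i = T (tr i (i + 1))"

lemma T_comp_eq: "q \<circ> p = p' \<circ> q' \<Longrightarrow> T p (T q u) = T q' (T p' u)"
  by (simp add: T_comp)

lemma T_tr_tr: "T (tr j k) (T (tr j k) u) = u"
  by (simp add: T_comp transpose_comp_involutory T_id)

lemma T_inverse: "p permutes P \<Longrightarrow> T p (T (inv_into UNIV p) u) = u"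
  by (simp add: T_comp permutes_inv_o T_id)

lemma lin_Dk: "lin_op (Dk k)" and lin_JM: "lin_op (JM k)"
  using T_lin D_lin by (simp_all add: lin_op_def Dk_def[abs_def] JM_def[abs_def] sum.distrib V.scale_sum_right)

lemma lin_x: "lin_op (x k)"
  using lin_Dk[of k] lin_JM[of k] by (auto simp: lin_op_def x_def V.scale_right_distrib algebra_simps)

lemma tr_permutes: "i \<in> {1..n} \<Longrightarrow> j \<in> {1..n} \<Longrightarrow> tr i j permutes {1..n}"
  by (rule permutes_swap_id)

lemma T_conj: "inj p \<Longrightarrow> T p (T (tr (p a) (p b)) u) = T (tr a b) (T p u)"
  by (rule T_comp_eq) (auto simp: fun_eq_iff Transposition.transpose_def inj_eq)

lemma Dk_T:
  assumes p: "p permutes {1..n}" and k: "k \<in> {1..n}"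
  shows "T p (Dk (p k) u) = Dk k (T p u)"
proof -
  \<comment> \<open>This permutation fixes 1, so \<open>D\<close> commutes with
    \<open>T q\<close>.\<close>
  define q where "q = tr 1 (p k) \<circ> p \<circ> tr 1 k"
  have pk: "p k \<in> {1..n}" using permutes_in_image[OF p] k by (simp only:)
  then have q: "q permutes {1..n}" unfolding q_def using p k
    by (intro permutes_compose tr_permutes) auto
  have q1: "q 1 = 1" by (simp add: q_def)
  have "T p (Dk (p k) u) = T (tr 1 k) (T q (D (T (tr 1 (p k)) u)))"
    unfolding Dk_def by (rule T_comp_eq) (simp add: q_def fun_eq_iff)
  also have "T q (D (T (tr 1 (p k)) u)) = D (T q (T (tr 1 (p k)) u))" by (simp add: D_T[OF q q1])
  also have "T q (T (tr 1 (p k)) u) = T (tr 1 k) (T p u)"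
    by (rule T_comp_eq) (simp add: q_def fun_eq_iff)
  finally show ?thesis by (simp add: Dk_def)
qed

lemma Dk_T_fix: "p permutes {1..n} \<Longrightarrow> k \<in> {1..n} \<Longrightarrow> p k = k \<Longrightarrow> T p (Dk k u) = Dk k (T p u)"
  using Dk_T[of p k u] by simp

lemma JM_T:
  assumes p: "inj p" "bij_betw p {1..<k} {1..<k}" "p k = k"
  shows "T p (JM k u) = JM k (T p u)"
proof -
  have "T p (JM k u) = (\<Sum>j\<in>{1..<k}. T p (T (tr j k) u))" unfolding JM_def by (rule lin_op_sum[OF T_lin])
  also have "\<dots> = (\<Sum>j\<in>{1..<k}. T p (T (tr (p j) k) u))"
    by (rule sum.reindex_bij_betw[OF p(2), symmetric])
  also have "\<dots> = JM k (T p u)" unfolding JM_def using T_conj[OF p(1), of _ k] p(3) by simp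
  finally show ?thesis .
qed

text \<open>The relation \<open>D_comm\<close> transported from the places 1 and 2 to the places
  \<open>i\<close> and \<open>k\<close>.\<close>

lemma Dk_comm:
  assumes "i \<in> {1..n}" "k \<in> {1..n}" "i \<noteq> k"
  shows "Dk i (Dk k u) + Dk i (T (tr i k) u) = Dk k (Dk i u) + T (tr i k) (Dk i u)"
proof -
  have n: "2 \<le> n" using assms by auto
  \<comment> \<open>\<open>p\<close> moves \<open>i\<close> to 1 by a transposition and then the
    resulting place \<open>k'\<close> of \<open>k\<close> to 2.\<close>
  define k' where "k' = tr 1 i k"
  define p where "p = tr 2 k' \<circ> tr 1 i"
  have k': "k' \<in> {1..n}" "k' \<noteq> 1" using assms by (auto simp: k'_def Transposition.transpose_def)
  have p: "p permutes {1..n}" unfolding p_def using assms k' n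
    by (intro permutes_compose tr_permutes) auto
  have pi: "p i = 1" using k' by (simp add: p_def)
  have pk: "p k = 2" by (simp add: p_def k'_def[symmetric] del: One_nat_def)
  define w where "w = T (inv_into UNIV p) u"
  have w: "T p w = u" unfolding w_def by (rule T_inverse[OF p])
  have D1: "D y = Dk 1 y" for y by (simp add: Dk_def T_id)
  have Di: "T p (Dk 1 y) = Dk i (T p y)" and Dk: "T p (Dk 2 y) = Dk k (T p y)" for y
    using Dk_T[OF p assms(1), of y] Dk_T[OF p assms(2), of y] by (simp_all add: pi pk)
  have tr: "T p (T (tr 1 2) y) = T (tr i k) (T p y)" for y
    using T_conj[OF permutes_inj[OF p], of i k y] by (simp add: pi pk)
  have "Dk 1 (Dk 2 w) + Dk 1 (T (tr 1 2) w) = Dk 2 (Dk 1 w) + T (tr 1 2) (Dk 1 w)"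
    using D_comm[OF n refl, of w] unfolding D1[symmetric] by (simp add: Dk_def)
  then have "T p (Dk 1 (Dk 2 w) + Dk 1 (T (tr 1 2) w)) = T p (Dk 2 (Dk 1 w) + T (tr 1 2) (Dk 1 w))" by simp
  then show ?thesis by (simp add: lin_op_add[OF T_lin] Di Dk tr w del: One_nat_def)
qed

text \<open>For \<open>i < k\<close> the transpositions in \<open>JM i\<close> preserve
  \<open>{1..<k}\<close> and fix \<open>k\<close>, so \<open>JM i\<close> commutes with
  \<open>JM k\<close> and \<open>Dk k\<close>. The only interaction is between \<open>Dk i\<close>
  and the summand \<open>(i k)\<close> of \<open>JM k\<close>.\<close>

lemma x_comm_less:
  assumes "i \<in> {1..n}" "k \<in> {1..n}" "i < k"
  shows "x i (x k u) = x k (x i u)"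
proof -
  have JJ: "JM i (JM k u) = JM k (JM i u)"
  proof -
    have "T (tr j i) (JM k u) = JM k (T (tr j i) u)" if "j \<in> {1..<i}" for j
    proof (rule JM_T)
      show "bij_betw (tr j i) {1..<k} {1..<k}"
        using that assms by (intro permutes_imp_bij permutes_swap_id) auto
    qed (use that assms in \<open>auto simp: Transposition.transpose_def\<close>)
    then show ?thesis unfolding JM_def[of i] lin_op_sum[OF lin_JM] by (intro sum.cong) auto
  qed
  have JD: "JM i (Dk k u) = Dk k (JM i u)"
  proof -
    have "T (tr j i) (Dk k u) = Dk k (T (tr j i) u)" if "j \<in> {1..<i}" for j
      using that assms by (intro Dk_T_fix tr_permutes) (auto simp: Transposition.transpose_def)
    then show ?thesis unfolding JM_def[of i] lin_op_sum[OF lin_Dk] by (intro sum.cong) auto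
  qed
  have DJ: "Dk i (Dk k u) + Dk i (JM k u) = Dk k (Dk i u) + JM k (Dk i u)"
  proof -
    \<comment> \<open>The other summands fix \<open>i\<close> and commute with \<open>Dk i\<close>;
      the exceptional one is handled by \<open>Dk_comm\<close>.\<close>
    have JM: "JM k y = T (tr i k) y + (\<Sum>j\<in>{1..<k} - {i}. T (tr j k) y)" for y
      unfolding JM_def using assms by (intro sum.remove) auto
    have "Dk i (\<Sum>j\<in>{1..<k} - {i}. T (tr j k) u) = (\<Sum>j\<in>{1..<k} - {i}. T (tr j k) (Dk i u))"
      unfolding lin_op_sum[OF lin_Dk]
    proof (intro sum.cong refl)
      fix j assume "j \<in> {1..<k} - {i}"
      then show "Dk i (T (tr j k) u) = T (tr j k) (Dk i u)"
        using assms by (intro Dk_T_fix[symmetric] tr_permutes) (auto simp: Transposition.transpose_def)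
    qed
    then show ?thesis using Dk_comm[of i k u] assms
      unfolding JM lin_op_add[OF lin_Dk] add.assoc[symmetric] by simp
  qed
  have e: "x a (x b u) = \<alpha> *s (\<alpha> *s u) + (\<alpha> *s Dk a u + \<alpha> *s JM a u + \<alpha> *s Dk b u + \<alpha> *s JM b u) +
      (Dk a (Dk b u) + Dk a (JM b u)) + JM a (Dk b u) + JM a (JM b u)" for a b
    by (simp only: x_def lin_op_add[OF lin_Dk] lin_op_add[OF lin_JM] lin_op_scale[OF lin_Dk] lin_op_scale[OF lin_JM]
        V.scale_right_distrib add_ac)
  have "p + (a + b + c + d) + (q1 + q2) + r + t = p + (c + d + a + b) + (q3 + r') + q4 + t'"
    if "q1 + q2 = q3 + q4" "r = r'" "t = t'" for p a b c d q1 q2 q3 q4 r r' t t' :: 'v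
    unfolding that by (simp add: add_ac)
  from this[OF DJ JD JJ] show ?thesis unfolding e .
qed

lemma x_comm: "i \<in> {1..n} \<Longrightarrow> k \<in> {1..n} \<Longrightarrow> x i (x k u) = x k (x i u)"
  using x_comm_less[of i k u] x_comm_less[of k i u] by (cases i k rule: linorder_cases) auto

lemma s_x:
  assumes i: "i \<in> {1..<n}"
  shows "s i (x (i + 1) u) = x i (s i u) + u"
proof -
  let ?\<tau> = "tr i (i + 1)"
  have D: "T ?\<tau> (Dk (i + 1) u) = Dk i (T ?\<tau> u)"
  proof -
    have "?\<tau> permutes {1..n}" using i by (intro tr_permutes) auto
    from Dk_T[OF this, of i u] show ?thesis using i by simp
  qed
  \<comment> \<open>The summand \<open>j = i\<close> is \<open>s i\<close> itself, and after
    multiplication by \<open>s i\<close> it becomes the extra term \<open>u\<close>.\<close>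
  have "JM (i + 1) u = T ?\<tau> u + (\<Sum>j\<in>{1..<i}. T (tr j (i + 1)) u)"
    using i by (simp add: JM_def atLeastLessThanSuc add.commute)
  moreover have "T ?\<tau> (T (tr j (i + 1)) u) = T (tr j i) (T ?\<tau> u)" if "j \<in> {1..<i}" for j
    using that T_conj[of ?\<tau> j i u] by (simp add: Transposition.transpose_def)
  ultimately have "T ?\<tau> (JM (i + 1) u) = u + JM i (T ?\<tau> u)"
    by (simp add: lin_op_add[OF T_lin] T_tr_tr lin_op_sum[OF T_lin] JM_def)
  then show ?thesis using D by (simp add: s_def x_def lin_op_add[OF T_lin] lin_op_scale[OF T_lin] add_ac)
qed

lemma s_x_far:
  assumes i: "i \<in> {1..<n}" and j: "j \<in> {1..n}" "j \<noteq> i" "j \<noteq> i + 1"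
  shows "s i (x j u) = x j (s i u)"
proof -
  let ?\<tau> = "tr i (i + 1)"
  have fix_j: "?\<tau> j = j" using j by (simp add: Transposition.transpose_def)
  have "T ?\<tau> (Dk j u) = Dk j (T ?\<tau> u)" using i j fix_j by (intro Dk_T_fix tr_permutes) auto
  moreover have "T ?\<tau> (JM j u) = JM j (T ?\<tau> u)"
  proof (rule JM_T)
    show "bij_betw ?\<tau> {1..<j} {1..<j}"
    proof (cases "j < i")
      case True
      have "bij_betw id {1..<j} {1..<j} \<longleftrightarrow> bij_betw ?\<tau> {1..<j} {1..<j}"
        using True by (intro bij_betw_cong) (auto simp: Transposition.transpose_def)
      then show ?thesis by simp
    next
      case False
      then show ?thesis using i j by (intro permutes_imp_bij permutes_swap_id) auto
    qed
  qed (use fix_j in auto)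
  ultimately show ?thesis by (simp add: s_def x_def lin_op_add[OF T_lin] lin_op_scale[OF T_lin])
qed

lemma hecke_ops:
  assumes "cyclotomic_element endo d v (\<lambda>u. \<alpha> *s u + D u) = \<zero>\<^bsub>endo\<^esub>"
  shows "hecke_ops n d v x s"
proof -
  have rel: "a = b" if ab: "(a, b) \<in> hecke_relations endo n x s" for a b
    using ab unfolding hecke_relations_def
  proof (elim UnE CollectE exE conjE Pair_inject)
    fix i assume y: "a = s i \<otimes>\<^bsub>endo\<^esub> s i" "b = \<one>\<^bsub>endo\<^esub>"
    show ?thesis unfolding y by (simp add: fun_eq_iff s_def T_tr_tr)
  next
    fix i assume y: "a = s i \<otimes>\<^bsub>endo\<^esub> s (i + 1) \<otimes>\<^bsub>endo\<^esub> s i" "b = s (i + 1) \<otimes>\<^bsub>endo\<^esub> s i \<otimes>\<^bsub>endo\<^esub> s (i + 1)"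
    have eq: "tr i (i + 1) \<circ> (tr (i + 1) (i + 2) \<circ> tr i (i + 1)) = tr (i + 1) (i + 2) \<circ> (tr i (i + 1) \<circ> tr (i + 1) (i + 2))"
      by (auto simp: fun_eq_iff Transposition.transpose_def)
    show ?thesis unfolding y by (rule ext) (use eq in \<open>simp add: s_def T_comp comp_assoc\<close>)
  next
    fix i j assume y: "a = s i \<otimes>\<^bsub>endo\<^esub> s j" "b = s j \<otimes>\<^bsub>endo\<^esub> s i" and "1 < \<bar>int i - int j\<bar>"
    then have eq: "tr i (i + 1) \<circ> tr j (j + 1) = tr j (j + 1) \<circ> tr i (i + 1)"
      by (auto simp: fun_eq_iff Transposition.transpose_def)
    show ?thesis unfolding y by (rule ext) (use eq in \<open>simp add: s_def T_comp\<close>)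
  next
    fix i j assume y: "a = x i \<otimes>\<^bsub>endo\<^esub> x j" "b = x j \<otimes>\<^bsub>endo\<^esub> x i" and ij: "i \<in> {1..n}" "j \<in> {1..n}"
    show ?thesis unfolding y using x_comm[OF ij] by (simp add: fun_eq_iff)
  next
    fix i assume y: "a = s i \<otimes>\<^bsub>endo\<^esub> x (i + 1)" "b = x i \<otimes>\<^bsub>endo\<^esub> s i \<oplus>\<^bsub>endo\<^esub> \<one>\<^bsub>endo\<^esub>" and i: "i \<in> {1..<n}"
    show ?thesis unfolding y using s_x[OF i] by (simp add: fun_eq_iff)
  next
    fix i j assume y: "a = s i \<otimes>\<^bsub>endo\<^esub> x j" "b = x j \<otimes>\<^bsub>endo\<^esub> s i" and ij: "i \<in> {1..<n}" "j \<in> {1..n}" "j \<noteq> i" "j \<noteq> i + 1"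
    show ?thesis unfolding y using s_x_far[OF ij] by (simp add: fun_eq_iff)
  qed
  have "x 1 = (\<lambda>u. \<alpha> *s u + D u)" by (simp add: fun_eq_iff x_def Dk_def JM_def T_id)
  then have cyc: "cyclotomic_element endo d v (x 1) = \<zero>\<^bsub>endo\<^esub>" using assms by (simp only:)
  have rels: "\<forall>(a, b)\<in>hecke_relations endo n x s. a = b" by (clarify, rule rel)
  have lin_s: "lin_op (s i)" for i unfolding s_def by (rule T_lin)
  show ?thesis unfolding hecke_ops_def
    by (intro conjI; (rule cyc | rule rels | rule ballI, (rule lin_x | rule lin_s)))
qed

section \<open>Operators in the image and invariant vectors\<close>

abbreviation gens :: "('v \<Rightarrow> 'v) set" where "gens \<equiv> x ` {1..n} \<union> s ` {1..<n}"

lemma T_op_algebra: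
  assumes "p permutes {1..n}"
  shows "T p \<in> op_algebra gens"
proof -
  have less: "T (tr i j) \<in> op_algebra gens" if "1 \<le> i" "Suc i \<le> j" "j \<le> n" for i j
    using that(2,3)
  proof (induction j rule: dec_induct)
    case base
    have "T (tr i (Suc i)) = s i" by (simp add: s_def)
    moreover have "s i \<in> gens" using base that(1) by auto
    ultimately show ?case by (simp only: op_gen)
  next
    case (step j)
    have "tr i (Suc j) = tr j (Suc j) \<circ> (tr i j \<circ> tr j (Suc j))"
      using step by (auto simp: fun_eq_iff Transposition.transpose_def)
    then have "T (tr i (Suc j)) u = (s j \<circ> (T (tr i j) \<circ> s j)) u" for u
      by (simp add: s_def T_comp comp_assoc)
    then have "T (tr i (Suc j)) = s j \<circ> (T (tr i j) \<circ> s j)" by (rule ext)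
    moreover have "s j \<in> gens" using step that(1) by auto
    moreover have "T (tr i j) \<in> op_algebra gens" using step by simp
    ultimately show ?case by (simp only: op_gen op_comp)
  qed
  have tr: "T (tr i j) \<in> op_algebra gens" if "i \<in> {1..n}" "j \<in> {1..n}" "i \<noteq> j" for i j
    using less[of i j] less[of j i] that by (cases i j rule: linorder_cases) (auto simp: transpose_commute)
  show ?thesis
    using assms finite_atLeastAtMost
  proof (induction rule: permutes_induct)
    case id
    have "T id = id" by (simp add: fun_eq_iff T_id)
    then show ?case by (simp only: op_id)
  next
    case (swap a b p)
    have "T (tr a b \<circ> p) = T p \<circ> T (tr a b)" by (simp add: fun_eq_iff T_comp)
    then show ?case using op_comp[OF swap(5) tr[OF swap(1-3)]] by (simp only:)
  qed
qed

lemma sum_op_algebra: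
  assumes "finite K" "\<And>k. k \<in> K \<Longrightarrow> F k \<in> op_algebra S"
  shows "(\<lambda>u. \<Sum>k\<in>K. F k u) \<in> op_algebra S"
  using assms
proof (induction K rule: finite_induct)
  case empty
  show ?case using op_scale[OF op_id, of 0 S] by simp
next
  case (insert k K)
  then show ?case using op_add[of "F k" S "\<lambda>u. \<Sum>k\<in>K. F k u"] by simp
qed

lemma D_op_algebra: "1 \<le> n \<Longrightarrow> D \<in> op_algebra gens"
proof -
  assume "1 \<le> n"
  then have "x 1 \<in> gens" by auto
  from op_add[OF op_gen[OF this] op_scale[OF op_id, of "- \<alpha>"]]
  show ?thesis by (simp add: x_def Dk_def JM_def T_id algebra_simps)
qed

definition sym :: "'v \<Rightarrow> 'v" where "sym u = (\<Sum>p | p permutes {1..n}. T p u)"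

lemma sym_op_algebra: "sym \<in> op_algebra gens"
  unfolding sym_def[abs_def] 
  by (rule sum_op_algebra[OF finite_permutations[OF finite_atLeastAtMost]], elim CollectE, rule T_op_algebra)

lemma T_sym:
  assumes q: "q permutes {1..n}"
  shows "T q (sym u) = sym u"
proof -
  have "T q (sym u) = (\<Sum>p | p permutes {1..n}. T (p \<circ> q) u)"
    unfolding sym_def lin_op_sum[OF T_lin] T_comp ..
  also have "\<dots> = sym u"
    unfolding sym_def using sum_permutations_compose_right[OF q, of "\<lambda>p. T p u"] by simp
  finally show ?thesis .
qed

text \<open>The stable subspace for all three obstructions: on it each \<open>s i\<close> is the
  identity and \<open>x k\<close> is the scalar \<open>\<alpha> + k - 1\<close>.\<close>

definition invariants :: "'v set" where
  "invariants = {u. (\<forall>p. p permutes {1..n} \<longrightarrow> T p u = u) \<and> D u = 0}"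

lemma sym_invariant: "u \<in> invariants \<Longrightarrow> sym u = of_nat (fact n) *s u"
  by (simp add: sym_def invariants_def V.sum_constant_scale card_permutations)

lemma invariants_closed: "u \<in> invariants \<Longrightarrow> w \<in> invariants \<Longrightarrow> u + w \<in> invariants"
  "u \<in> invariants \<Longrightarrow> c *s u \<in> invariants"
  by (simp_all add: invariants_def lin_op_add[OF T_lin] lin_op_add[OF D_lin] lin_op_scale[OF T_lin] lin_op_scale[OF D_lin])

lemma gens_invariants:
  assumes "F \<in> gens" "u \<in> invariants"
  shows "F u \<in> invariants"
proof -
  have T: "T p u = u" if "p permutes {1..n}" for p using assms(2) that by (simp add: invariants_def)
  from assms(1) consider k where "k \<in> {1..n}" "F = x k" | i where "i \<in> {1..<n}" "F = s i" by blast
  then show ?thesis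
  proof cases
    case 1
    have "Dk k u = 0"
      using 1 assms(2) T[OF tr_permutes, of 1 k] by (simp add: Dk_def invariants_def lin_op_zero[OF T_lin])
    moreover have "JM k u = (\<Sum>j\<in>{1..<k}. u)"
      unfolding JM_def using 1 by (intro sum.cong refl T tr_permutes) auto
    ultimately have "F u = (\<alpha> + of_nat (card {1..<k})) *s u"
      unfolding 1(2) x_def by (simp only: V.sum_constant_scale V.scale_left_distrib add_0_right)
    then show ?thesis using invariants_closed(2)[OF assms(2)] by simp
  next
    case 2
    then have "F u = u" unfolding 2(2) s_def by (intro T tr_permutes) auto
    then show ?thesis using assms(2) by simp
  qed
qed

lemma not_split_semisimple:
  assumes n: "1 \<le> n" and cyc: "cyclotomic_element endo d v (\<lambda>u. \<alpha> *s u + D u) = \<zero>\<^bsub>endo\<^esub>"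
    and F: "F \<in> op_algebra gens" "\<And>u. F u \<in> U" "\<And>u. u \<in> U \<Longrightarrow> F u = 0" "F u0 \<noteq> 0"
    and U: "U = invariants"
  shows "of_nat r \<noteq> (0::'k) \<Longrightarrow> \<not> split_semisimple (cyclotomic_yh r n d v)"
    "\<not> split_semisimple (cyclotomic_hecke_tensor d v (n # replicate k 0))"
proof -
  note ops = hecke_ops[OF cyc]
  show "\<not> split_semisimple (cyclotomic_yh r n d v)" if r: "of_nat r \<noteq> (0::'k)"
  proof
    assume ss: "split_semisimple (cyclotomic_yh r n d v)"
    obtain h where h: "h \<in> algebra_hom (cyclotomic_yh r n d v) endo" "h ` carrier (cyclotomic_yh r n d v) = op_algebra gens"
      by (rule yh_representation[OF ops n r])
    from obstruction[OF assoc_algebra_cyclotomic_yh[OF n] ss h F(1-3)] F(4) invariants_closed gens_invariants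
    show False unfolding U by blast
  qed
  show "\<not> split_semisimple (cyclotomic_hecke_tensor d v (n # replicate k 0))"
  proof
    let ?H = "cyclotomic_hecke_tensor d v (n # replicate k 0)"
    assume ss: "split_semisimple ?H"
    obtain h where h: "h \<in> algebra_hom ?H endo" "h ` carrier ?H = op_algebra gens"
      by (rule hecke_tensor_representation[OF ops n])
    from obstruction[OF assoc_algebra_cyclotomic_hecke_tensor ss h F(1-3)] F(4) invariants_closed gens_invariants
    show False unfolding U by blast
  qed
qed

end

section \<open>Necessity\<close>

lemma linear_operators_fun: "linear_operators (fun_scale :: 'k::field \<Rightarrow> ('i \<Rightarrow> 'k) \<Rightarrow> _)"
  by (intro linear_operators.intro vector_space_fun)

text \<open>Pulling functions back along a left action reverses composition, as
  \<open>hecke_module\<close> expects.\<close>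

lemma hecke_module_of_action:
  fixes act :: "(nat \<Rightarrow> nat) \<Rightarrow> 'i \<Rightarrow> 'i" and D :: "('i \<Rightarrow> 'k::field) \<Rightarrow> 'i \<Rightarrow> 'k"
  defines "T \<equiv> \<lambda>p g y. g (act p y)"
  assumes act: "\<And>y. act id y = y" "\<And>p q y. act (p \<circ> q) y = act p (act q y)"
    and D: "\<And>g h. D (g + h) = D g + D h" "\<And>c g. D (fun_scale c g) = fun_scale c (D g)"
    and D_T: "\<And>p g. p permutes {1..n} \<Longrightarrow> p 1 = 1 \<Longrightarrow> D (T p g) = T p (D g)"
    and D_comm: "\<And>\<tau> g. 2 \<le> n \<Longrightarrow> \<tau> = Transposition.transpose 1 2 \<Longrightarrow>
      D (T \<tau> (D (T \<tau> g))) + D (T \<tau> g) = T \<tau> (D (T \<tau> (D g))) + T \<tau> (D g)"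
  shows "hecke_module fun_scale n T D"
proof -
  interpret linear_operators "fun_scale :: 'k \<Rightarrow> ('i \<Rightarrow> 'k) \<Rightarrow> _" by (rule linear_operators_fun)
  show ?thesis
  proof (intro hecke_module.intro hecke_module_axioms.intro linear_operators_fun)
    show "lin_op (T p)" for p by (intro lin_opI) (auto simp: T_def fun_eq_iff)
    show "lin_op D" by (intro lin_opI D)
    show "T id u = u" for u by (simp add: T_def act(1))
    show "T p (T q u) = T (q \<circ> p) u" for p q u by (simp add: T_def act(2))
  qed (fact D_T D_comm)+
qed

text \<open>Of all compositions only \<open>(n, 0, ..., 0)\<close> is used, with \<open>k\<close>
  zeros; its tensor product has the nonsplit factor and copies of the field.\<close>

definition obstructed :: "nat \<Rightarrow> nat \<Rightarrow> (nat \<Rightarrow> 'k::field) \<Rightarrow> bool" where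
  "obstructed n d v \<longleftrightarrow> (\<forall>r. of_nat r \<noteq> (0::'k) \<longrightarrow> \<not> split_semisimple (cyclotomic_yh r n d v)) \<and>
    (\<forall>k. \<not> split_semisimple (cyclotomic_hecke_tensor d v (n # replicate k 0)))"

lemma (in hecke_module) obstructedI:
  assumes "1 \<le> n" "cyclotomic_element endo d v (\<lambda>u. \<alpha> *s u + D u) = \<zero>\<^bsub>endo\<^esub>"
    and "F \<in> op_algebra gens" "\<And>u. F u \<in> invariants" "\<And>u. u \<in> invariants \<Longrightarrow> F u = 0" "F u0 \<noteq> 0"
  shows "obstructed n d v"
  unfolding obstructed_def using not_split_semisimple[OF assms(1,2,3,4,5,6) refl] by blast

text \<open>With \<open>D = 0\<close> the symmetrizer maps into the invariants and acts on them by
  \<open>n! = 0\<close>.\<close>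

lemma obstructed_fact:
  fixes v :: "nat \<Rightarrow> 'k::field"
  assumes n: "1 \<le> n" and d: "1 \<le> d" and fact: "of_nat (fact n) = (0::'k)"
  shows "obstructed n d v"
proof -
  \<comment> \<open>\<open>T\<close> has to be defined for every self-map of the naturals, so
    functions on all such maps replace functions on the group.\<close>
  define T :: "(nat \<Rightarrow> nat) \<Rightarrow> ((nat \<Rightarrow> nat) \<Rightarrow> 'k) \<Rightarrow> _" where "T = (\<lambda>p g w. g (p \<circ> w))"
  have "hecke_module fun_scale n T (\<lambda>_. 0)"
    unfolding T_def by (rule hecke_module_of_action) (auto simp: fun_eq_iff)
  then interpret hecke_module fun_scale n "v 1" T "\<lambda>_. 0" .
  define g :: "(nat \<Rightarrow> nat) \<Rightarrow> 'k" where "g = (\<lambda>w. if w = id then 1 else 0)"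
  show ?thesis
  proof (rule obstructedI[OF n _ sym_op_algebra])
    show "cyclotomic_element endo d v (\<lambda>u. fun_scale (v 1) u + 0) = \<zero>\<^bsub>endo\<^esub>"
      using d by (intro cyclotomic_vanishing[of _ 1]) (auto intro!: lin_opI simp: fun_eq_iff algebra_simps)
    show "sym u \<in> invariants" for u by (simp add: invariants_def T_sym)
    show "sym u = 0" if "u \<in> invariants" for u
      unfolding sym_invariant[OF that] fact by (simp add: fun_eq_iff)
    have "sym g id = (\<Sum>p | p permutes {1..n}. T p g id)" by (simp only: sym_def sum_fun_apply)
    also have "\<dots> = (\<Sum>p | p permutes {1..n}. if p = id then 1 else 0)" by (simp add: T_def g_def)
    also have "\<dots> = 1" by (subst sum.delta) (auto simp: finite_permutations permutes_id)
    finally have "sym g id \<noteq> 0 id" by simp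
    then show "sym g \<noteq> 0" by metis
  qed
qed

text \<open>The group acts trivially on a plane and \<open>D\<close> is nilpotent, so
  \<open>x 1\<close> is a Jordan block for the repeated parameter.\<close>

lemma obstructed_equal:
  fixes v :: "nat \<Rightarrow> 'k::field"
  assumes n: "1 \<le> n" and ij: "1 \<le> i" "i < j" "j \<le> d" and eq: "v i = v j"
  shows "obstructed n d v"
proof -
  define D :: "(bool \<Rightarrow> 'k) \<Rightarrow> bool \<Rightarrow> 'k" where "D g = (\<lambda>b. if b then g False else 0)" for g
  have "hecke_module fun_scale n (\<lambda>p g y. g y) D"
    by (rule hecke_module_of_action) (auto simp: fun_eq_iff D_def)
  then interpret hecke_module fun_scale n "v i" "\<lambda>p g y. g y" D .
  have DD: "D (D u) = 0" for u by (auto simp: D_def fun_eq_iff)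
  show ?thesis
  proof (rule obstructedI[OF n _ D_op_algebra[OF n]])
    show "cyclotomic_element endo d v (\<lambda>u. fun_scale (v i) u + D u) = \<zero>\<^bsub>endo\<^esub>"
      using ij by (intro cyclotomic_vanishing[of _ i] disjI2 exI[of _ j])
        (auto intro!: lin_opI simp: fun_eq_iff algebra_simps D_def eq)
    show "D u \<in> invariants" for u by (simp add: invariants_def DD)
    show "D u = 0" if "u \<in> invariants" for u using that by (simp add: invariants_def)
    show "D (\<lambda>_. 1) \<noteq> 0" by (auto simp: D_def fun_eq_iff)
  qed
qed

text \<open>
  A block of the Hecke algebra that is not semisimple is visible on the functions on the \<open>m\<close>-subsets of
  \<open>{1..n}\<close>, on which \<open>x\<^sub>1\<close> acts with the two eigenvalues \<open>\<alpha>\<close> and \<open>\<alpha> + m\<close>.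
\<close>

context
  fixes n m :: nat
  notes One_nat_def [simp del]
begin

definition subsets :: "nat set set" where "subsets = {I. I \<subseteq> {1..n} \<and> card I = m}"

text \<open>Up to sign, the difference between the sum of all exchanges of an element of
  \<open>I\<close> for 1 and its value \<open>m\<close> on constant functions. Setting it to zero on
  sets containing 1 gives it the eigenvalues 0 and \<open>m\<close>.\<close>

definition subset_op :: "(nat set \<Rightarrow> 'k::field) \<Rightarrow> nat set \<Rightarrow> 'k" where
  "subset_op g I = (if I \<in> subsets \<and> 1 \<notin> I then of_nat m * g I - (\<Sum>i\<in>I. g (insert 1 (I - {i}))) else 0)"

lemma subset_op_add: "subset_op (g + h) = subset_op g + subset_op h"
  by (auto simp: fun_eq_iff subset_op_def algebra_simps sum.distrib)

lemma subset_op_scale: "subset_op (fun_scale c g) = fun_scale c (subset_op g)"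
  by (auto simp: fun_eq_iff subset_op_def algebra_simps sum_distrib_left)

text \<open>The sets in the sum contain 1, where the values of \<open>subset_op g\<close> are
  zero.\<close>

lemma subset_op_square: "subset_op (subset_op g) = fun_scale (of_nat m) (subset_op g)"
  by (auto simp: fun_eq_iff subset_op_def)

lemma image_subsets: "p permutes {1..n} \<Longrightarrow> p ` I \<in> subsets \<longleftrightarrow> I \<in> subsets"
proof -
  assume p: "p permutes {1..n}"
  have "p ` I \<subseteq> {1..n} \<longleftrightarrow> I \<subseteq> {1..n}" using permutes_in_image[OF p] by (auto simp del: atLeastAtMost_iff)
  moreover have "card (p ` I) = card I" by (rule card_image[OF permutes_inj_on[OF p]])
  ultimately show ?thesis by (simp add: subsets_def)
qed

lemma sum_exchange_image:
  assumes "inj p"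
  shows "(\<Sum>i\<in>p ` I. h (insert (p a) (p ` I - {i}))) = (\<Sum>i\<in>I. h (p ` insert a (I - {i})))"
proof -
  have "(\<Sum>i\<in>p ` I. h (insert (p a) (p ` I - {i}))) = (\<Sum>i\<in>I. h (insert (p a) (p ` I - {p i})))"
    by (subst sum.reindex) (auto intro: inj_on_subset[OF assms])
  also have "\<dots> = (\<Sum>i\<in>I. h (p ` insert a (I - {i})))"
    by (simp add: image_set_diff[OF assms])
  finally show ?thesis .
qed

lemma subset_op_image:
  assumes p: "p permutes {1..n}" "p 1 = 1"
  shows "subset_op (\<lambda>I. g (p ` I)) = (\<lambda>I. subset_op g (p ` I))"
proof
  fix I
  have "1 \<in> p ` I \<longleftrightarrow> 1 \<in> I" using permutes_inj[OF p(1)] p(2) by (metis inj_image_mem_iff)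
  then show "subset_op (\<lambda>I. g (p ` I)) I = subset_op g (p ` I)"
    using sum_exchange_image[OF permutes_inj[OF p(1)], of g 1 I]
    by (simp add: subset_op_def image_subsets[OF p(1)] p(2))
qed

text \<open>In a second exchange the element \<open>k\<close> removed may be the \<open>a\<close>
  just inserted, which leaves a single exchange of \<open>i\<close> for \<open>b\<close>.\<close>

lemma sum_exchange_twice:
  assumes "finite I" "a \<notin> I" "a \<noteq> b"
  shows "(\<Sum>k\<in>insert a (I - {i}). h (insert b (insert a (I - {i}) - {k}))) =
    h (insert b (I - {i})) + (\<Sum>k\<in>I - {i}. h (insert a (insert b (I - {i} - {k}))))"
proof -
  have "insert a (I - {i}) - {a} = I - {i}" using assms by auto
  moreover have "(\<Sum>k\<in>I - {i}. h (insert b (insert a (I - {i}) - {k}))) =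
      (\<Sum>k\<in>I - {i}. h (insert a (insert b (I - {i} - {k}))))"
    using assms by (intro sum.cong refl arg_cong[of _ _ h]) auto
  ultimately show ?thesis using assms by (subst sum.insert) auto
qed

lemma insert_subsets:
  assumes "I \<in> subsets" "i \<in> I" "a \<notin> I" "a \<in> {1..n}"
  shows "insert a (I - {i}) \<in> subsets"
proof -
  have "finite I" using assms(1) by (auto simp: subsets_def intro: finite_subset)
  then have "card (insert a (I - {i})) = card I"
    using card_Suc_Diff1[OF _ assms(2)] assms(3) by (subst card_insert_disjoint) auto
  then show ?thesis using assms by (auto simp: subsets_def)
qed

text \<open>Conjugation by the transposition turns \<open>subset_op\<close> into \<open>E\<close>,
  the same operator with 2 in place of 1. The identity is checked according to which of 1 and 2
  belong to the set.\<close>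

lemma subset_op_comm:
  fixes g :: "nat set \<Rightarrow> 'k::field"
  assumes n: "2 \<le> n"
  defines "T \<equiv> \<lambda>(g :: nat set \<Rightarrow> 'k) I. g (Transposition.transpose 1 2 ` I)"
  shows "subset_op (T (subset_op (T g))) + subset_op (T g) = T (subset_op (T (subset_op g))) + T (subset_op g)"
proof
  let ?\<tau> = "Transposition.transpose 1 2 :: nat \<Rightarrow> nat"
  define E where "E h = T (subset_op (T h))" for h
  have T: "T h K = h (?\<tau> ` K)" for h K by (simp add: T_def)
  have \<tau>: "?\<tau> permutes {1..n}" using n by (intro permutes_swap_id) auto
  have inj: "inj ?\<tau>" by (rule permutes_inj[OF \<tau>])
  have \<tau>\<tau>: "?\<tau> ` ?\<tau> ` I = I" for I by (simp add: image_comp transpose_comp_involutory)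
  have mem: "1 \<in> ?\<tau> ` I \<longleftrightarrow> 2 \<in> I" "2 \<in> ?\<tau> ` I \<longleftrightarrow> 1 \<in> I" for I
    using inj_image_mem_iff[OF inj, of 2 I] inj_image_mem_iff[OF inj, of 1 I] by simp_all
  have E: "E h I = (if I \<in> subsets \<and> 2 \<notin> I then of_nat m * h I - (\<Sum>i\<in>I. h (insert 2 (I - {i}))) else 0)" for h I
  proof -
    have "(\<Sum>i\<in>?\<tau> ` I. T h (insert 1 (?\<tau> ` I - {i}))) = (\<Sum>i\<in>I. h (insert 2 (I - {i})))"
      using sum_exchange_image[OF inj, of "T h" 2 I] by (simp add: T \<tau>\<tau> del: image_insert)
    then show ?thesis by (simp add: E_def T[of "subset_op _"] subset_op_def mem image_subsets[OF \<tau>] T[of h "?\<tau> ` I"] \<tau>\<tau>)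
  qed
  fix I
  have "subset_op (E g) I + subset_op (T g) I = E (subset_op g) I + subset_op g (?\<tau> ` I)"
  proof (cases "I \<in> subsets")
    case False
    then show ?thesis by (simp add: subset_op_def E image_subsets[OF \<tau>])
  next
    case I: True
    then have fin: "finite I" by (auto simp: subsets_def intro: finite_subset)
    have swap: "?\<tau> ` I = insert b (I - {a})" if "a \<in> I" "b \<notin> I" "(a, b) = (1, 2) \<or> (a, b) = (2, 1)" for a b
      using that by (auto simp: Transposition.transpose_def image_iff split: if_splits)
    consider "1 \<in> I" "2 \<in> I" | "1 \<in> I" "2 \<notin> I" | "1 \<notin> I" "2 \<in> I" | "1 \<notin> I" "2 \<notin> I" by blast
    then show ?thesis
    proof cases
      case 1
      then show ?thesis by (simp add: subset_op_def E mem)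
    next
      case 2
      \<comment> \<open>Only the exchange that removes 1 survives, since \<open>subset_op g\<close>
        vanishes on sets containing 1; it cancels against the transposed term.\<close>
      have "(\<Sum>i\<in>I. subset_op g (insert 2 (I - {i}))) = subset_op g (insert 2 (I - {1}))"
        using 2 fin by (subst sum.remove[of _ 1]) (auto intro!: sum.neutral simp: subset_op_def)
      then have "E (subset_op g) I = - subset_op g (?\<tau> ` I)"
        using 2 I swap[of 1 2] by (simp add: E subset_op_def[of g I])
      then show ?thesis using 2 by (simp add: subset_op_def[of _ I])
    next
      case 3
      have "(\<Sum>i\<in>I. E g (insert 1 (I - {i}))) = E g (insert 1 (I - {2}))"
        using 3 fin by (subst sum.remove[of _ 2]) (auto intro!: sum.neutral simp: E)
      also have "insert 1 (I - {2}) = ?\<tau> ` I" using 3 swap[of 2 1] by simp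
      also have "E g (?\<tau> ` I) = subset_op (T g) I" by (simp only: E_def T \<tau>\<tau>)
      finally have "subset_op (E g) I = - subset_op (T g) I"
        using 3 I by (simp add: subset_op_def[of "E g"] E[of g I])
      then show ?thesis using 3 by (simp add: E[of _ I] subset_op_def[of g "?\<tau> ` I"] mem)
    next
      case 4
      have I': "?\<tau> ` I = I" using 4 by (force simp: Transposition.transpose_def image_iff)
      define S where "S a = (\<Sum>i\<in>I. g (insert a (I - {i})))" for a
      \<comment> \<open>The sum over double exchanges, symmetric in 1 and 2. Either side of the
        identity comes to \<open>m * m * g I - m * S 1 - m * S 2 + S2 + m * g I\<close>.\<close>
      define S2 where "S2 = (\<Sum>i\<in>I. \<Sum>k\<in>I - {i}. g (insert 1 (insert 2 (I - {i} - {k}))))"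
      have Eg: "E g I = of_nat m * g I - S 2" and Dg: "subset_op g I = of_nat m * g I - S 1"
        using 4 I by (simp_all add: E subset_op_def S_def)
      have "subset_op (T g) I = of_nat m * g I - (\<Sum>i\<in>I. T g (insert 1 (I - {i})))"
        using 4 I by (simp add: subset_op_def T_def I')
      also have "(\<Sum>i\<in>I. T g (insert 1 (I - {i}))) = S 2"
        unfolding S_def T_def using sum_exchange_image[OF inj, of g 1 I] by (simp add: I' del: image_insert)
      finally have DT: "subset_op (T g) I = of_nat m * g I - S 2" .
      have "(\<Sum>i\<in>I. E g (insert 1 (I - {i}))) = (\<Sum>i\<in>I. of_nat m * g (insert 1 (I - {i})) -
          (g (insert 2 (I - {i})) + (\<Sum>k\<in>I - {i}. g (insert 1 (insert 2 (I - {i} - {k}))))))"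
      proof (intro sum.cong refl)
        fix i assume "i \<in> I"
        then have "insert 1 (I - {i}) \<in> subsets" using 4 I n by (intro insert_subsets) auto
        then show "E g (insert 1 (I - {i})) = of_nat m * g (insert 1 (I - {i})) -
          (g (insert 2 (I - {i})) + (\<Sum>k\<in>I - {i}. g (insert 1 (insert 2 (I - {i} - {k})))))"
          using 4 sum_exchange_twice[OF fin, of 1 2 g i] by (simp add: E)
      qed
      also have "\<dots> = of_nat m * S 1 - (S 2 + S2)"
        by (simp add: sum_subtractf sum.distrib S_def S2_def sum_distrib_left)
      finally have 1: "subset_op (E g) I = of_nat m * E g I - (of_nat m * S 1 - (S 2 + S2))"
        using 4 I by (simp add: subset_op_def[of "E g"])
      have "(\<Sum>i\<in>I. subset_op g (insert 2 (I - {i}))) = (\<Sum>i\<in>I. of_nat m * g (insert 2 (I - {i})) -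
          (g (insert 1 (I - {i})) + (\<Sum>k\<in>I - {i}. g (insert 2 (insert 1 (I - {i} - {k}))))))"
      proof (intro sum.cong refl)
        fix i assume "i \<in> I"
        then have "insert 2 (I - {i}) \<in> subsets" using 4 I n by (intro insert_subsets) auto
        then show "subset_op g (insert 2 (I - {i})) = of_nat m * g (insert 2 (I - {i})) -
          (g (insert 1 (I - {i})) + (\<Sum>k\<in>I - {i}. g (insert 2 (insert 1 (I - {i} - {k})))))"
          using 4 sum_exchange_twice[OF fin, of 2 1 g i] by (simp add: subset_op_def)
      qed
      also have "\<dots> = of_nat m * S 2 - (S 1 + S2)"
        by (simp add: sum_subtractf sum.distrib S_def S2_def sum_distrib_left insert_commute[of 2 1])
      finally have 2: "E (subset_op g) I = of_nat m * subset_op g I - (of_nat m * S 2 - (S 1 + S2))"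
        using 4 I by (simp add: E[of "subset_op g"])
      show ?thesis unfolding 1 2 I' DT Eg Dg by (simp add: algebra_simps)
    qed
  qed
  then show "(subset_op (T (subset_op (T g))) + subset_op (T g)) I = (T (subset_op (T (subset_op g))) + T (subset_op g)) I"
    by (simp add: E_def) (simp add: T_def)
qed

text \<open>The operator is \<open>sym \<circ> subset_op\<close>. As \<open>subset_op\<close>
  vanishes on functions fixed by the group, the operator maps into the invariants and kills
  them.\<close>

lemma obstructed_shift:
  fixes v :: "nat \<Rightarrow> 'k::field" and \<alpha> :: 'k
  assumes m: "0 < m" "m < n" and ij: "1 \<le> i" "i < j" "j \<le> d" and fact: "of_nat (fact n) \<noteq> (0::'k)"
    and eq: "v i = \<alpha> \<and> v j = \<alpha> + of_nat m \<or> v i = \<alpha> + of_nat m \<and> v j = \<alpha>"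
  shows "obstructed n d v"
proof -
  define T :: "(nat \<Rightarrow> nat) \<Rightarrow> (nat set \<Rightarrow> 'k) \<Rightarrow> _" where "T = (\<lambda>p g I. g (p ` I))"
  let ?D = "subset_op :: (nat set \<Rightarrow> 'k) \<Rightarrow> _"
  have "hecke_module fun_scale n T ?D"
    unfolding T_def
  proof (rule hecke_module_of_action)
    fix \<tau> :: "nat \<Rightarrow> nat" and g :: "nat set \<Rightarrow> 'k" assume "2 \<le> n" "\<tau> = Transposition.transpose 1 2"
    then show "?D (\<lambda>y. ?D (\<lambda>y. g (\<tau> ` y)) (\<tau> ` y)) + ?D (\<lambda>y. g (\<tau> ` y)) =
        (\<lambda>y. ?D (\<lambda>y. ?D g (\<tau> ` y)) (\<tau> ` y)) + (\<lambda>y. ?D g (\<tau> ` y))"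
      using subset_op_comm[of g] by simp
  qed (simp_all add: subset_op_add subset_op_scale subset_op_image image_comp)
  then interpret hecke_module fun_scale n \<alpha> T ?D .
  \<comment> \<open>A function fixed by the group is constant under exchanges, and the
    \<open>m\<close> terms of the sum cancel \<open>m * w I\<close>.\<close>
  have D_invariant: "?D w = 0" if w: "\<And>p. p permutes {1..n} \<Longrightarrow> T p w = w" for w
  proof
    fix I
    have "w (insert 1 (I - {i})) = w I" if "I \<in> subsets" "1 \<notin> I" "i \<in> I" for i
    proof -
      have "insert 1 (I - {i}) = tr 1 i ` I"
        using that by (auto simp: Transposition.transpose_def image_iff split: if_splits)
      moreover have "tr 1 i permutes {1..n}" using that m by (intro tr_permutes) (auto simp: subsets_def)
      ultimately show ?thesis using w[of "tr 1 i"] by (metis T_def)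
    qed
    then have "(\<Sum>i\<in>I. w (insert 1 (I - {i}))) = of_nat m * w I" if "I \<in> subsets" "1 \<notin> I"
      using that by (simp add: subsets_def)
    then show "?D w I = 0 I" by (simp add: subset_op_def)
  qed
  \<comment> \<open>An \<open>m\<close>-subset avoiding 1, which exists because
    \<open>m < n\<close>; its indicator function is an eigenvector of \<open>subset_op\<close> for
    \<open>m\<close>.\<close>
  define J where "J = {2..m + 1}"
  have J: "J \<in> subsets" "1 \<notin> J" using m by (auto simp: J_def subsets_def)
  define g :: "nat set \<Rightarrow> 'k" where "g = (\<lambda>I. if I = J then 1 else 0)"
  have Dg: "?D g = fun_scale (of_nat m) g"
  proof
    fix I
    have "g (insert 1 (I - {i})) = 0" for i using J(2) by (auto simp: g_def)
    then show "?D g I = fun_scale (of_nat m) g I" using J by (auto simp: subset_op_def g_def)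
  qed
  have "of_nat m \<noteq> (0::'k)"
  proof -
    have "m dvd fact n" using m by (intro dvd_fact) auto
    then obtain q where "fact n = m * q" by (rule dvdE)
    then show ?thesis using fact by (metis mult_zero_left of_nat_mult)
  qed
  have fin: "finite subsets" by (rule finite_subset[of _ "Pow {1..n}"]) (auto simp: subsets_def)
  \<comment> \<open>Summing over all subsets detects that \<open>sym g\<close> is nonzero: every
    permutation contributes 1, and the total is \<open>n!\<close>.\<close>
  have "(\<Sum>I\<in>subsets. sym g I) = (\<Sum>p | p permutes {1..n}. \<Sum>I\<in>subsets. g (p ` I))"
    unfolding sym_def sum_fun_apply by (subst sum.swap) (simp add: T_def)
  also have "\<dots> = (\<Sum>p | p permutes {1..n}. 1)"
  proof (intro sum.cong refl)
    fix p assume "p \<in> {p. p permutes {1..n}}"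
    then have p: "p permutes {1..n}" by simp
    have "bij_betw ((`) p) subsets subsets"
      by (rule bij_betw_byWitness[of _ "(`) (inv_into UNIV p)"])
        (auto simp: image_comp permutes_inv_o[OF p] image_subsets[OF p] image_subsets[OF permutes_inv[OF p]])
    then have "(\<Sum>I\<in>subsets. g (p ` I)) = (\<Sum>I\<in>subsets. g I)" by (rule sum.reindex_bij_betw)
    also have "\<dots> = 1" using J(1) fin by (simp add: g_def)
    finally show "(\<Sum>I\<in>subsets. g (p ` I)) = 1" .
  qed
  also have "\<dots> = of_nat (fact n)" by (simp add: card_permutations)
  finally have "sym g \<noteq> 0" using fact by auto
  show ?thesis
  proof (rule obstructedI)
    show "1 \<le> n" using m by simp
    show "cyclotomic_element endo d v (\<lambda>u. fun_scale \<alpha> u + ?D u) = \<zero>\<^bsub>endo\<^esub>"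
    proof (rule cyclotomic_vanishing)
      show "lin_op (\<lambda>u. fun_scale \<alpha> u + ?D u)"
        by (intro lin_opI) (auto simp: subset_op_add subset_op_scale fun_eq_iff algebra_simps)
      \<comment> \<open>\<open>subset_op\<close> satisfies \<open>D (D - m) = 0\<close>, so the
        factors for \<open>\<alpha>\<close> and \<open>\<alpha> + m\<close> annihilate, in either
        order.\<close>
      have "fun_scale \<alpha> (fun_scale \<alpha> w + ?D w - fun_scale (v j) w) + ?D (fun_scale \<alpha> w + ?D w - fun_scale (v j) w) =
          fun_scale (v i) (fun_scale \<alpha> w + ?D w - fun_scale (v j) w)" for w
        unfolding lin_op_diff[OF D_lin] lin_op_add[OF D_lin] lin_op_scale[OF D_lin] subset_op_square
        using eq by (auto simp: fun_eq_iff algebra_simps)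
      then show "(\<forall>w. fun_scale \<alpha> w + ?D w = fun_scale (v i) w) \<or> (\<exists>j. i < j \<and> j \<le> d \<and>
          (\<forall>w. fun_scale \<alpha> (fun_scale \<alpha> w + ?D w - fun_scale (v j) w) + ?D (fun_scale \<alpha> w + ?D w - fun_scale (v j) w) =
          fun_scale (v i) (fun_scale \<alpha> w + ?D w - fun_scale (v j) w)))"
        using ij by blast
    qed (use ij in auto)
    show "sym \<circ> ?D \<in> op_algebra gens" using m by (intro op_comp sym_op_algebra D_op_algebra) auto
    show "(sym \<circ> ?D) u \<in> invariants" for u
      using D_invariant[of "sym (?D u)"] T_sym by (simp add: invariants_def)
    show "(sym \<circ> ?D) u = 0" if "u \<in> invariants" for u
      using that by (simp add: invariants_def sym_def lin_op_zero[OF T_lin])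
    have "sym (?D g) = fun_scale (of_nat m) (sym g)"
      unfolding Dg by (simp add: sym_def lin_op_scale[OF T_lin] V.scale_sum_right)
    then show "(sym \<circ> ?D) g \<noteq> 0" using \<open>sym g \<noteq> 0\<close> \<open>of_nat m \<noteq> 0\<close> by (simp add: V.scale_eq_0_iff)
  qed
qed

end

section \<open>From the parameter condition to the equivalences\<close>

lemma obstructed_if_not_separated:
  fixes v :: "nat \<Rightarrow> 'k::alg_closed_field"
  assumes n: "1 \<le> n" and d: "1 \<le> d" and ns: "\<not> separated_parameters n d v"
  shows "obstructed n d v"
proof (cases "of_nat (fact n) = (0::'k)")
  case True
  then show ?thesis by (rule obstructed_fact[OF n d])
next
  case False
  then obtain i j l where ij: "1 \<le> i" "i < j" "j \<le> d" and l: "\<bar>l\<bar> < int n" "of_int l + v i - v j = 0"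
    using ns unfolding separated_parameters_def by blast
  define m where "m = nat \<bar>l\<bar>"
  \<comment> \<open>\<open>\<alpha>\<close> must be the parameter from which the other arises by
    adding the positive integer \<open>m\<close>, so the sign of \<open>l\<close> decides between
    \<open>v i\<close> and \<open>v j\<close>.\<close>
  consider "l = 0" | "l = int m" "0 < m" | "l = - int m" "0 < m" unfolding m_def by linarith
  then show ?thesis
  proof cases
    case 1
    then show ?thesis using l by (intro obstructed_equal[OF n ij]) simp
  next
    case 2
    then show ?thesis using l False
      by (intro obstructed_shift[of m n i j d v "v i"] ij) (auto simp: algebra_simps)
  next
    case 3
    then show ?thesis using l False
      by (intro obstructed_shift[of m n i j d v "v j"] ij) (auto simp: algebra_simps)
  qed
qed

lemma separated_parameters_iff:
  fixes v :: "nat \<Rightarrow> 'k::alg_closed_field"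
  shows "separated_parameters n d v \<longleftrightarrow>
    of_nat (fact n) * (\<Prod>(i, j) \<in> {(i, j). 1 \<le> i \<and> i < j \<and> j \<le> d}.
        \<Prod>l \<in> {- int n <..< int n}. of_int l + v i - v j) \<noteq> 0"
proof -
  have "{(i, j). 1 \<le> i \<and> i < j \<and> j \<le> d} \<subseteq> {..d} \<times> {..d}" by auto
  then have "finite {(i, j). 1 \<le> i \<and> i < j \<and> j \<le> d}" by (rule finite_subset) simp
  then have "(\<Prod>(i, j) \<in> {(i, j). 1 \<le> i \<and> i < j \<and> j \<le> d}. \<Prod>l \<in> {- int n <..< int n}. of_int l + v i - v j) \<noteq> 0 \<longleftrightarrow>
    (\<forall>i j l. 1 \<le> i \<longrightarrow> i < j \<longrightarrow> j \<le> d \<longrightarrow> - int n < l \<and> l < int n \<longrightarrow> of_int l + v i - v j \<noteq> 0)"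
    by (auto simp: prod_zero_iff)
  then show ?thesis unfolding separated_parameters_def mult_eq_0_iff de_Morgan_disj by (auto simp: abs_less_iff)
qed

text \<open>Lets the condition for \<open>n\<close> serve every factor of a tensor product, as parts
  of a composition are at most \<open>n\<close>: \<open>m!\<close> divides \<open>n!\<close>, and
  the range of \<open>l\<close> shrinks.\<close>

lemma separated_parameters_mono:
  assumes "separated_parameters n d v" "m \<le> n"
  shows "separated_parameters m d v"
proof -
  have "fact m dvd (fact n :: nat)" using assms(2) by (rule fact_dvd)
  then obtain q :: nat where "fact n = fact m * q" by (rule dvdE)
  then have "of_nat (fact n) = of_nat (fact m) * (of_nat q :: 'a)" by (metis of_nat_mult)
  then show ?thesis using assms unfolding separated_parameters_def by force
qed

theorem mainTheorem4:
  fixes n r d :: nat and v :: "nat \<Rightarrow> 'k::alg_closed_field"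
  assumes "n \<ge> 1" and "r \<ge> 1" and "d \<ge> 1"
    and "\<not> CHAR('k) dvd r"
  shows "(split_semisimple (cyclotomic_yh r n d v) \<longleftrightarrow>
      (\<forall>\<mu> \<in> compositions r n. split_semisimple (cyclotomic_hecke_tensor d v \<mu>))) \<and>
    ((\<forall>\<mu> \<in> compositions r n. split_semisimple (cyclotomic_hecke_tensor d v \<mu>)) \<longleftrightarrow>
      of_nat (fact n) * (\<Prod>(i, j) \<in> {(i, j). 1 \<le> i \<and> i < j \<and> j \<le> d}.
        \<Prod>l \<in> {- int n <..< int n}. of_int l + v i - v j) \<noteq> 0)"
proof -
  have yh: "split_semisimple (cyclotomic_yh r n d v)" if "separated_parameters n d v"
    using assoc_algebra_cyclotomic_yh[OF assms(1)] cyclotomic_yh_units[OF that assms(1,2,4)]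
    by (rule split_semisimple_of_matrix_units)
  have tensor: "split_semisimple (cyclotomic_hecke_tensor d v \<mu>)"
    if sep: "separated_parameters n d v" and \<mu>: "\<mu> \<in> compositions r n" for \<mu>
  proof (rule split_semisimple_of_matrix_units[OF assoc_algebra_cyclotomic_hecke_tensor])
    have "separated_parameters m d v" if "m \<in> set \<mu>" for m
      using \<mu> member_le_sum_list[OF that] by (intro separated_parameters_mono[OF sep]) (simp add: compositions_def)
    then show "has_matrix_units (cyclotomic_hecke_tensor d v \<mu>)" by (rule cyclotomic_hecke_tensor_units)
  qed
  have r: "of_nat r \<noteq> (0::'k)" using assms(4) by (simp add: of_nat_eq_0_iff_char_dvd)
  have \<mu>: "n # replicate (r - 1) 0 \<in> compositions r n"
    using assms(2) by (simp add: compositions_def sum_list_replicate)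
  have necessary: "\<not> split_semisimple (cyclotomic_yh r n d v) \<and>
      (\<exists>\<mu> \<in> compositions r n. \<not> split_semisimple (cyclotomic_hecke_tensor d v \<mu>))"
    if "\<not> separated_parameters n d v"
    using obstructed_if_not_separated[OF assms(1,3) that] r unfolding obstructed_def
    by (intro conjI bexI[OF _ \<mu>]) simp_all
  show ?thesis
    unfolding separated_parameters_iff[symmetric] using yh tensor necessary by blast
qed

end
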